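(* Let $p\ge 1$ and $G=SO(2p)$. For $0\le q\le p-1$ define $\mu_{p-q}\in\Omega^{p+q}(NG(p-q))$ by $$\mu_{p-q}=\sum_{\sigma\in\mathfrak S_{p-q}}\ \sum_{\tau\in\mathfrak S_{2p}}\ \sum_{W} T^{\tau,\sigma}_{p,q}(W)\,(W_1)_{\tau(1)\tau(2)}\wedge (W_2)_{\tau(3)\tau(4)}\wedge\cdots\wedge (W_p)_{\tau(2p-1)\tau(2p)},$$ where, for given $\sigma$, the inner sum runs over all words $W=(W_1,\dots,W_p)$ obtained from the word $\varphi_{\sigma(1)}\varphi_{\sigma(2)}\cdots\varphi_{\sigma(p-q)}$ by inserting $q$ letters of the form $R_{ij}$ ($1\le i<j\le p-q+1$) in arbitrary places between consecutive letters or at the ends, repetitions of $R_{ij}$ and several insertions at the same place being allowed (that is: one chooses the set $S\subset\{1,\dots,p\}$ of the $q$ positions carrying $R$'s and a pair $(i_s,j_s)$ for each $s\in S$; the remaining positions carry $\varphi_{\sigma(1)},\dots,\varphi_{\sigma(p-q)}$ in this order). Here $$T^{\tau,\sigma}_{p,q}(W)=\mathrm{sgn}(\tau)\,\mathrm{sgn}(\sigma)\,\frac{(-1)^{p+\frac{(p-q)(p-q-1)}{2}}}{2^{2p}\pi^p\,p!}\left(\int_{\Delta^{p-q}}\prod_{i<j}(t_{i-1}t_{j-1})^{r_{ij}}\,dt_1\wedge\cdots\wedge dt_{p-q}\right),$$ with $r_{ij}$ the number of times $R_{ij}$ occurs in $W$. Then $\mu_1+\mu_2+\cdots+\mu_p$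 is a cocycle in the total complex $\Omega^{2p}(NG)$ which represents the Euler class of $ESO(2p)\to BSO(2p)$, its component in $\Omega^{p+q}(NG(p-q))$ being $\mu_{p-q}$ for $0\le q\le p-1$.
   Context: Simplicial manifolds. For a Lie group $G$, $NG(q)=G^q\ni(h_1,\dots,h_q)$ with face operators $\varepsilon_0(h_1,\dots,h_q)=(h_2,\dots,h_q)$, $\varepsilon_i(h_1,\dots,h_q)=(h_1,\dots,h_ih_{i+1},\dots,h_q)$ for $1\le i\le q-1$, $\varepsilon_q(h_1,\dots,h_q)=(h_1,\dots,h_{q-1})$. $N\bar G(q)=G^{q+1}\ni(g_0,\dots,g_q)$, with $\varepsilon_i$ deleting $g_i$, and $\gamma:N\bar G\to NG$, $\gamma(g_0,\dots,g_q)=(g_0g_1^{-1},\dots,g_{q-1}g_q^{-1})$, is a simplicial principal $G$-bundle whose fat realization is the universal bundle $EG\to BG$. Double complex. $\Omega^{r,s}(NG)=\Omega^s(NG(r))$ with $d'=\sum_{i=0}^{r+1}(-1)^i\varepsilon_i^*$ and $d''=(-1)^r\times$ exterior differential; $\Omega^*(NG)$ denotes the total complex with differential $d'+d''$, and $H(\Omega^*(NG))\cong H^*(BG)$ (real coefficients). Euler class. Let $G=SO(2p)$. On $\Delta^r\times N\bar G(r)$, with barycentric coordinates $(t_0,\dots,t_r)$ on the simplex $\Delta^r$, put $\theta=t_0\theta_0+\cdots+t_r\theta_r$, where $\theta_i=g_i^{-1}dg_i$, and $\Omega=d\theta+\frac12[\theta,\theta]=d\theta+\theta\wedge\theta$.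 Let $$\mathrm{Pf}(A,\dots,A)=\frac1{2^{2p}\pi^pp!}\sum_{\tau\in\mathfrak S_{2p}}\mathrm{sgn}(\tau)\,a_{\tau(1)\tau(2)}\cdots a_{\tau(2p-1)\tau(2p)},\qquad A=(a_{ij})\in\mathfrak{so}(2p).$$ The forms $\mathrm{Pf}(\Omega)$ are basic and descend to $\Delta^r\times NG(r)$; $I_\Delta(\mathrm{Pf}(\Omega))\in\Omega^{2p}(NG)$ denotes the cocycle whose component on $NG(r)$ is $\int_{\Delta^r}\mathrm{Pf}(\Omega)$ (fibre integration: $\int_{\Delta^r}f\,dt_1\wedge\cdots\wedge dt_r\wedge\omega=(\int_{\Delta^r} f\,dt_1\cdots dt_r)\,\omega$, and terms of lower degree in the $dt_i$ integrate to $0$). A cocycle in $\Omega^{2p}(NG)$ represents the Euler class of $ESO(2p)\to BSO(2p)$ if its class equals $[I_\Delta(\mathrm{Pf}(\Omega))]$, the image of $\mathrm{Pf}$ under the Chern–Weil homomorphism. Notation in the claim. On $NG(p-q)$, for $1\le s\le p-q$, $$\varphi_s=h_1\cdots h_{s-1}\,dh_s\,h_s^{-1}\cdots h_1^{-1},$$ a matrix of $1$-forms, and $$R_{ij}=(\varphi_i+\varphi_{i+1}+\cdots+\varphi_{j-1})^2\qquad(1\le i<j\le p-q+1),$$ a matrix of $2$-forms, where powers are matrix products with entries multiplied by the wedge product. $(M)_{ab}$ denotes the $(a,b)$ entry of $M$. $\mathfrak S_n$ is the symmetric group. *)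

theory Defs
  imports
    "HOL-Analysis.Analysis"
    "HOL-Library.Function_Algebras"
    "HOL-Combinatorics.Permutations"
    "HOL-Homology.Simplices"
begin

section \<open>Differential forms on subsets of real topological vector spaces\<close>

text \<open>Tuples of varying length are functions on \<^typ>\<open>nat\<close> that vanish outside the relevant
  finite index set. All manifolds below (with corners, because of the simplex) are subsets of
  spaces of such functions, with pointwise operations and the product topology. They lie in
  finite-dimensional coordinate subspaces, on which this is the usual structure.\<close>

instantiation "fun" :: (type, real_vector) real_vector
begin

definition scaleR_fun :: "real \<Rightarrow> ('a \<Rightarrow> 'b) \<Rightarrow> 'a \<Rightarrow> 'b" where
  "scaleR_fun c f = (\<lambda>x. c *\<^sub>R f x)"

instance
  by standard (auto simp: scaleR_fun_def fun_eq_iff scaleR_add_right scaleR_add_left)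

end

text \<open>A form \<open>\<omega>\<close> of degree \<open>s\<close> is evaluated as \<open>\<omega> x v\<close> at a point \<open>x\<close> on tangent vectors
  \<open>v 0, \<dots>, v (s - 1)\<close>; the further entries of \<open>v\<close> are irrelevant. A matrix of forms is a
  matrix-valued form.\<close>

type_synonym 'a form = "'a \<Rightarrow> (nat \<Rightarrow> 'a) \<Rightarrow> real"
type_synonym ('a, 'n) mat_form = "'a \<Rightarrow> (nat \<Rightarrow> 'a) \<Rightarrow> real^'n^'n"

text \<open>The one-sided velocities at a point of a manifold with corners form a cone that spans the
  tangent space; without boundary they already are the tangent space.\<close>

definition tangent_space :: "'a::{real_vector,t2_space} set \<Rightarrow> 'a \<Rightarrow> 'a set" where
  "tangent_space M x = span {v. \<exists>c :: real \<Rightarrow> 'a. c 0 = x \<and> (\<forall>\<^sub>F s in at_right 0. c s \<in> M) \<and>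
     ((\<lambda>s. (c s - x) /\<^sub>R s) \<longlongrightarrow> v) (at_right 0)}"

definition dir_deriv :: "('a::real_vector \<Rightarrow> real) \<Rightarrow> 'a \<Rightarrow> 'a \<Rightarrow> real" where
  "dir_deriv f v x = deriv (\<lambda>s. f (x + s *\<^sub>R v)) 0"

primrec Ck_on :: "nat \<Rightarrow> 'a::{real_vector,t2_space} set \<Rightarrow> ('a \<Rightarrow> real) \<Rightarrow> bool" where
  "Ck_on 0 U f \<longleftrightarrow> continuous_on U f"
| "Ck_on (Suc k) U f \<longleftrightarrow> continuous_on U f \<and>
     (\<forall>v. (\<forall>x\<in>U. (\<lambda>s. f (x + s *\<^sub>R v)) field_differentiable (at 0)) \<and> Ck_on k U (dir_deriv f v))"

definition smooth_on :: "'a::{real_vector,t2_space} set \<Rightarrow> ('a \<Rightarrow> real) \<Rightarrow> bool" where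
  "smooth_on U f \<longleftrightarrow> (\<forall>k. Ck_on k U f)"

definition alternating :: "nat \<Rightarrow> ((nat \<Rightarrow> 'a::real_vector) \<Rightarrow> real) \<Rightarrow> bool" where
  "alternating s a \<longleftrightarrow>
     (\<forall>v w. (\<forall>i<s. v i = w i) \<longrightarrow> a v = a w) \<and>
     (\<forall>v. \<forall>i<s. linear (\<lambda>u. a (v(i := u)))) \<and>
     (\<forall>v. \<forall>i<s. \<forall>j<s. i \<noteq> j \<and> v i = v j \<longrightarrow> a v = 0)"

definition form_eq :: "'a::{real_vector,t2_space} set \<Rightarrow> nat \<Rightarrow> 'a form \<Rightarrow> 'a form \<Rightarrow> bool" where
  "form_eq M s \<alpha> \<beta> \<longleftrightarrow>
     (\<forall>x\<in>M. \<forall>v. (\<forall>i<s. v i \<in> tangent_space M x) \<longrightarrow> \<alpha> x v = \<beta> x v)"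

text \<open>\<open>\<eta>\<close> is a smooth form on the open subset \<open>U\<close> of the ambient space that restricts to \<open>\<omega>\<close>
  on \<open>M \<inter> U\<close>.\<close>

definition extends_on ::
    "'a::{real_vector,t2_space} set \<Rightarrow> nat \<Rightarrow> 'a form \<Rightarrow> 'a set \<Rightarrow> 'a form \<Rightarrow> bool" where
  "extends_on M s \<omega> U \<eta> \<longleftrightarrow> open U \<and> (\<forall>y\<in>U. alternating s (\<eta> y)) \<and>
     (\<forall>v. smooth_on U (\<lambda>y. \<eta> y v)) \<and>
     (\<forall>y\<in>M \<inter> U. \<forall>v. (\<forall>i<s. v i \<in> tangent_space M y) \<longrightarrow> \<eta> y v = \<omega> y v)"

text \<open>A function represents an element of \<open>\<Omega>\<^sup>s(M)\<close> if it is a smooth form; two functions represent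
  the same element if they are related by \<^const>\<open>form_eq\<close>.\<close>

definition smooth_form :: "'a::{real_vector,t2_space} set \<Rightarrow> nat \<Rightarrow> 'a form \<Rightarrow> bool" where
  "smooth_form M s \<omega> \<longleftrightarrow> (\<forall>x\<in>M. \<exists>U \<eta>. x \<in> U \<and> extends_on M s \<omega> U \<eta>)"

definition flat_ext_deriv :: "nat \<Rightarrow> 'a::real_vector form \<Rightarrow> 'a form" where
  "flat_ext_deriv s \<eta> x v =
     (\<Sum>i\<le>s. (-1) ^ i * dir_deriv (\<lambda>y. \<eta> y (\<lambda>j. if j < i then v j else v (Suc j))) (v i) x)"

text \<open>The value on tangent vectors does not depend on the local extension; on other vectors it
  is meaningless.\<close>

definition ext_deriv :: "'a::{real_vector,t2_space} set \<Rightarrow> nat \<Rightarrow> 'a form \<Rightarrow> 'a form" where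
  "ext_deriv M s \<omega> x v =
     (THE c. \<exists>U \<eta>. x \<in> U \<and> extends_on M s \<omega> U \<eta> \<and> c = flat_ext_deriv s \<eta> x v)"

definition wedge :: "nat \<Rightarrow> nat \<Rightarrow> 'a form \<Rightarrow> 'a form \<Rightarrow> 'a form" where
  "wedge k l \<alpha> \<beta> x v =
     (\<Sum>\<pi> | \<pi> permutes {..<k + l}. of_int (sign \<pi>) * \<alpha> x (\<lambda>i. v (\<pi> i)) * \<beta> x (\<lambda>i. v (\<pi> (k + i))))
       / (fact k * fact l)"

text \<open>Wedge product of a list of forms, each paired with its degree.\<close>

primrec wedge_list :: "(nat \<times> 'a form) list \<Rightarrow> 'a form" where
  "wedge_list [] = (\<lambda>x v. 1)"
| "wedge_list (a # as) = wedge (fst a) (sum_list (map fst as)) (snd a) (wedge_list as)"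

text \<open>The differential of \<open>f\<close> is computed along lines in the ambient space, on a neighbourhood
  of the manifold in which the given formula for \<open>f\<close> makes sense.\<close>

definition pushforward ::
    "('a::real_vector \<Rightarrow> 'b::{real_vector,t2_space}) \<Rightarrow> 'a \<Rightarrow> 'a \<Rightarrow> 'b" where
  "pushforward f x v = Lim (at (0::real)) (\<lambda>s. (f (x + s *\<^sub>R v) - f x) /\<^sub>R s)"

definition pullback ::
    "('a::real_vector \<Rightarrow> 'b::{real_vector,t2_space}) \<Rightarrow> 'b form \<Rightarrow> 'a form" where
  "pullback f \<omega> x v = \<omega> (f x) (\<lambda>i. pushforward f x (v i))"

definition entry :: "('a, 'n::finite) mat_form \<Rightarrow> 'n \<Rightarrow> 'n \<Rightarrow> 'a form" where
  "entry A a b x v = A x v $ a $ b"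

definition mat_wedge ::
    "nat \<Rightarrow> nat \<Rightarrow> ('a, 'n::finite) mat_form \<Rightarrow> ('a, 'n) mat_form \<Rightarrow> ('a, 'n) mat_form" where
  "mat_wedge k l A B x v =
     (\<chi> a b. \<Sum>c\<in>UNIV. wedge k l (entry A a c) (entry B c b) x v)"

definition mat_ext_deriv ::
    "'a::{real_vector,t2_space} set \<Rightarrow> nat \<Rightarrow> ('a, 'n::finite) mat_form \<Rightarrow> ('a, 'n) mat_form" where
  "mat_ext_deriv M s A x v = (\<chi> a b. ext_deriv M s (entry A a b) x v)"


section \<open>The simplicial manifolds and the double complex for the special orthogonal group\<close>

type_synonym 'n tuple = "nat \<Rightarrow> real^'n^'n"

definition SO :: "(real^'n^'n) set" where
  "SO = {A. rotation_matrix A}"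

text \<open>\<open>NG r\<close> has coordinates indexed by \<open>1, \<dots>, r\<close>. The total space of the universal
  bundle in simplicial degree \<open>r\<close>, \<open>NGbar r\<close>, has coordinates indexed by \<open>0, \<dots>, r\<close>.\<close>

definition NG :: "nat \<Rightarrow> 'n::finite tuple set" where
  "NG r = {h. \<forall>j. if j \<in> {1..r} then h j \<in> SO else h j = 0}"

definition NGbar :: "nat \<Rightarrow> 'n::finite tuple set" where
  "NGbar r = {g. \<forall>j. if j \<le> r then g j \<in> SO else g j = 0}"

text \<open>The map \<open>\<epsilon>\<^sub>i : NG(q) \<rightarrow> NG(q - 1)\<close>. The extreme cases \<open>i = 0\<close> and \<open>i = q\<close>, in which no
  product occurs, are covered because \<open>j\<close> ranges over \<open>1, \<dots>, q - 1\<close>.\<close>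

definition face :: "nat \<Rightarrow> nat \<Rightarrow> 'n::finite tuple \<Rightarrow> 'n tuple" where
  "face q i h = (\<lambda>j. if j \<in> {1..<q} then
       (if j < i then h j else if j = i then h j ** h (Suc j) else h (Suc j)) else 0)"

definition gamma :: "nat \<Rightarrow> 'n::finite tuple \<Rightarrow> 'n tuple" where
  "gamma r g = (\<lambda>j. if j \<in> {1..r} then g (j - 1) ** matrix_inv (g j) else 0)"

text \<open>A cochain of total degree \<open>n\<close> is a family whose member \<open>c r\<close>, for \<open>r \<le> n\<close>, lies in
  \<open>\<Omega>\<^bsup>n-r\<^esup>(NG(r))\<close>; members with \<open>r > n\<close> are irrelevant.\<close>

type_synonym 'n cochain = "nat \<Rightarrow> 'n tuple form"

definition total_cochain :: "nat \<Rightarrow> 'n::finite cochain \<Rightarrow> bool" where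
  "total_cochain n c \<longleftrightarrow> (\<forall>r\<le>n. smooth_form (NG r) (n - r) (c r))"

definition d' :: "nat \<Rightarrow> 'n::finite tuple form \<Rightarrow> 'n tuple form" where
  "d' r \<omega> = (\<Sum>i\<le>r + 1. (-1) ^ i *\<^sub>R pullback (face (r + 1) i) \<omega>)"

definition d'' :: "nat \<Rightarrow> nat \<Rightarrow> 'n::finite tuple form \<Rightarrow> 'n tuple form" where
  "d'' r s \<omega> = (-1) ^ r *\<^sub>R ext_deriv (NG r) s \<omega>"

definition total_d :: "nat \<Rightarrow> 'n::finite cochain \<Rightarrow> 'n cochain" where
  "total_d n c r = (if 1 \<le> r then d' (r - 1) (c (r - 1)) else 0) +
     (if r \<le> n then d'' r (n - r) (c r) else 0)"

definition total_cocycle :: "nat \<Rightarrow> 'n::finite cochain \<Rightarrow> bool" where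
  "total_cocycle n c \<longleftrightarrow> total_cochain n c \<and>
     (\<forall>r\<le>n + 1. form_eq (NG r) (n + 1 - r) (total_d n c r) 0)"

text \<open>Equality of classes in degree \<open>n \<ge> 1\<close>.\<close>

definition same_class :: "nat \<Rightarrow> 'n::finite cochain \<Rightarrow> 'n cochain \<Rightarrow> bool" where
  "same_class n c c' \<longleftrightarrow> total_cocycle n c \<and> total_cocycle n c' \<and>
     (\<exists>\<eta>. total_cochain (n - 1) \<eta> \<and>
       (\<forall>r\<le>n. form_eq (NG r) (n - r) (c r - c' r) (total_d (n - 1) \<eta> r)))"

text \<open>A form on \<open>NG(r)\<close>, regarded as an element of the sum over all components.\<close>

definition in_component :: "nat \<Rightarrow> 'n::finite tuple form \<Rightarrow> 'n cochain" where
  "in_component r \<omega> = (\<lambda>r'. if r' = r then \<omega> else 0)"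


section \<open>Integration over the simplex\<close>

definition simplex_chart :: "nat \<Rightarrow> (nat \<Rightarrow> real) \<Rightarrow> nat \<Rightarrow> real" where
  "simplex_chart r u =
     (\<lambda>i. if i = 0 then 1 - (\<Sum>j=1..r. u j) else if i \<le> r then u i else 0)"

text \<open>The integral of \<open>f dt\<^sub>1 \<and> \<dots> \<and> dt\<^sub>r\<close> over \<open>\<Delta>\<^sup>r\<close>, where \<open>f\<close> is a function of the barycentric
  coordinates \<open>t\<^sub>0, \<dots>, t\<^sub>r\<close>.\<close>

definition simplex_integral :: "nat \<Rightarrow> ((nat \<Rightarrow> real) \<Rightarrow> real) \<Rightarrow> real" where
  "simplex_integral r f =
     (LINT u:{u. simplex_chart r u \<in> standard_simplex r}|Pi\<^sub>M {1..r} (\<lambda>_. lborel).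
        f (simplex_chart r u))"

text \<open>The vector field \<open>\<partial>/\<partial>t\<^sub>j\<close> for the coordinates \<open>t\<^sub>1, \<dots>, t\<^sub>r\<close> on \<open>\<Delta>\<^sup>r\<close>.\<close>

definition simplex_vec :: "nat \<Rightarrow> nat \<Rightarrow> real" where
  "simplex_vec j = (\<lambda>i. if i = j then 1 else if i = 0 then -1 else 0)"

text \<open>Evaluating the first \<open>r\<close> arguments at \<open>\<partial>/\<partial>t\<^sub>1, \<dots>, \<partial>/\<partial>t\<^sub>r\<close> sends
  \<open>f dt\<^sub>1 \<and> \<dots> \<and> dt\<^sub>r \<and> \<omega>\<close> to \<open>f \<omega>\<close> and kills the terms of lower degree in the \<open>dt\<^sub>i\<close>.\<close>

definition fibre_integral ::
    "nat \<Rightarrow> ((nat \<Rightarrow> real) \<times> 'n::finite tuple) form \<Rightarrow> 'n tuple form" where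
  "fibre_integral r \<beta> h w = simplex_integral r (\<lambda>t.
     \<beta> (t, h) (\<lambda>i. if i < r then (simplex_vec (Suc i), 0) else (0, w (i - r))))"


section \<open>The Euler class\<close>

definition theta_vertex :: "nat \<Rightarrow> ((nat \<Rightarrow> real) \<times> 'n::finite tuple, 'n) mat_form" where
  "theta_vertex i x v = matrix_inv (snd x i) ** snd (v 0) i"

definition theta :: "nat \<Rightarrow> ((nat \<Rightarrow> real) \<times> 'n::finite tuple, 'n) mat_form" where
  "theta r x v = (\<Sum>i\<le>r. fst x i *\<^sub>R theta_vertex i x v)"

definition curvature :: "nat \<Rightarrow> ((nat \<Rightarrow> real) \<times> 'n::finite tuple, 'n) mat_form" where
  "curvature r =
     mat_ext_deriv (standard_simplex r \<times> NGbar r) 1 (theta r) + mat_wedge 1 1 (theta r) (theta r)"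

text \<open>\<open>Pf(A, \<dots>, A)\<close> for a matrix \<open>A\<close> of 2-forms. The bijection \<open>e\<close> from \<open>{1, \<dots>, 2p}\<close> to the
  index type numbers the rows and columns.\<close>

definition pf_form :: "nat \<Rightarrow> (nat \<Rightarrow> 'n::finite) \<Rightarrow> ('a, 'n) mat_form \<Rightarrow> 'a form" where
  "pf_form p e A = (1 / (2 ^ (2 * p) * pi ^ p * fact p)) *\<^sub>R
     (\<Sum>\<tau> | \<tau> permutes {1..2 * p}. of_int (sign \<tau>) *\<^sub>R
        wedge_list (map (\<lambda>k. (2, entry A (e (\<tau> (2 * k - 1))) (e (\<tau> (2 * k))))) [1..<p + 1]))"

text \<open>The form on \<open>\<Delta>\<^sup>r \<times> NG(r)\<close> whose pullback is \<open>Pf(\<Omega>)\<close>. As \<open>\<gamma>\<close> is a surjective submersion,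
  it is unique up to \<^const>\<open>form_eq\<close>.\<close>

definition descended_pf ::
    "nat \<Rightarrow> (nat \<Rightarrow> 'n::finite) \<Rightarrow> nat \<Rightarrow> ((nat \<Rightarrow> real) \<times> 'n tuple) form" where
  "descended_pf p e r = (SOME \<beta>. smooth_form (standard_simplex r \<times> NG r) (2 * p) \<beta> \<and>
     form_eq (standard_simplex r \<times> NGbar r) (2 * p)
       (pullback (\<lambda>(t, g). (t, gamma r g)) \<beta>) (pf_form p e (curvature r)))"

definition euler_cocycle :: "nat \<Rightarrow> (nat \<Rightarrow> 'n::finite) \<Rightarrow> 'n cochain" where
  "euler_cocycle p e r = fibre_integral r (descended_pf p e r)"

definition represents_euler_class :: "nat \<Rightarrow> (nat \<Rightarrow> 'n::finite) \<Rightarrow> 'n cochain \<Rightarrow> bool" where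
  "represents_euler_class p e c \<longleftrightarrow> same_class (2 * p) c (euler_cocycle p e)"


section \<open>The explicit cochain\<close>

primrec hprod :: "'n::finite tuple \<Rightarrow> nat \<Rightarrow> real^'n^'n" where
  "hprod h 0 = mat 1"
| "hprod h (Suc k) = hprod h k ** h (Suc k)"

primrec hprod_inv :: "'n::finite tuple \<Rightarrow> nat \<Rightarrow> real^'n^'n" where
  "hprod_inv h 0 = mat 1"
| "hprod_inv h (Suc k) = matrix_inv (h (Suc k)) ** hprod_inv h k"

definition phi :: "nat \<Rightarrow> ('n::finite tuple, 'n) mat_form" where
  "phi s h v = hprod h (s - 1) ** v 0 s ** hprod_inv h s"

definition R_form :: "nat \<Rightarrow> nat \<Rightarrow> ('n::finite tuple, 'n) mat_form" where
  "R_form i j = mat_wedge 1 1 (\<Sum>s=i..<j. phi s) (\<Sum>s=i..<j. phi s)"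

datatype letter = Phi nat | R nat nat

primrec letter_degree :: "letter \<Rightarrow> nat" where
  "letter_degree (Phi s) = 1"
| "letter_degree (R i j) = 2"

primrec letter_form :: "letter \<Rightarrow> ('n::finite tuple, 'n) mat_form" where
  "letter_form (Phi s) = phi s"
| "letter_form (R i j) = R_form i j"

definition R_indices :: "nat \<Rightarrow> nat \<Rightarrow> (nat \<times> nat) set" where
  "R_indices p q = {(i, j). 1 \<le> i \<and> i < j \<and> j \<le> p - q + 1}"

definition words :: "nat \<Rightarrow> nat \<Rightarrow> (nat \<Rightarrow> nat) \<Rightarrow> letter list set" where
  "words p q \<sigma> =
     (\<Union>Rs \<in> {Rs. length Rs = q \<and> set Rs \<subseteq> (\<lambda>(i, j). R i j) ` R_indices p q}.
        shuffles (map (\<lambda>s. Phi (\<sigma> s)) [1..<p - q + 1]) Rs)"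

definition T_coeff ::
    "nat \<Rightarrow> nat \<Rightarrow> (nat \<Rightarrow> nat) \<Rightarrow> (nat \<Rightarrow> nat) \<Rightarrow> letter list \<Rightarrow> real" where
  "T_coeff p q \<tau> \<sigma> W = of_int (sign \<tau>) * of_int (sign \<sigma>) *
     ((-1) ^ (p + (p - q) * (p - q - 1) div 2) / (2 ^ (2 * p) * pi ^ p * fact p)) *
     simplex_integral (p - q)
       (\<lambda>t. \<Prod>(i, j)\<in>R_indices p q. (t (i - 1) * t (j - 1)) ^ count_list W (R i j))"

text \<open>\<open>mu p e q\<close> is the form \<open>\<mu>\<^bsub>p-q\<^esub>\<close> on \<open>NG(p - q)\<close>; the letter \<open>W\<^sub>k\<close> is \<open>W ! (k - 1)\<close>.\<close>

definition mu :: "nat \<Rightarrow> (nat \<Rightarrow> 'n::finite) \<Rightarrow> nat \<Rightarrow> 'n tuple form" where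
  "mu p e q =
     (\<Sum>\<sigma> | \<sigma> permutes {1..p - q}. \<Sum>\<tau> | \<tau> permutes {1..2 * p}. \<Sum>W\<in>words p q \<sigma>.
        T_coeff p q \<tau> \<sigma> W *\<^sub>R
        wedge_list (map (\<lambda>k. (letter_degree (W ! (k - 1)),
            entry (letter_form (W ! (k - 1))) (e (\<tau> (2 * k - 1))) (e (\<tau> (2 * k))))) [1..<p + 1]))"

end

theory Submission
  imports Defs
begin

text \<open>A form of degree \<open>k\<close> is encoded by an element of an exterior algebra over the reals: its value on
  \<open>v 0, \<dots>, v (k - 1)\<close> is the coefficient of \<open>\<xi>\<^sub>0 \<and> \<dots> \<and> \<xi>\<^bsub>k-1\<^esub>\<close>, a 1-form \<open>l\<close>
  being sent to \<open>\<Sum>\<^sub>j l (v j) \<xi>\<^sub>j\<close>; wedge products become products.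
  With \<open>k\<^sub>i = h\<^sub>1 \<cdots> h\<^sub>i\<close> and \<open>\<psi>\<^sub>i = dk\<^sub>i k\<^sub>i\<^sup>-\<^sup>1 = \<phi>\<^sub>1 + \<dots> + \<phi>\<^sub>i\<close>, the curvature is conjugate, by \<open>g\<^sub>0\<close>, to
  \<open>-\<Sum> dt\<^sub>i \<psi>\<^sub>i - \<Sum>\<^bsub>i<j\<^esub> t\<^sub>i t\<^sub>j (\<psi>\<^sub>i - \<psi>\<^sub>j)\<^sup>2\<close>, an expression in \<open>h\<close> alone.
  Expanding its Pfaffian into words and integrating over the simplex gives \<open>\<mu>\<close>: each word
  carries a product of the forms \<open>dt\<^sub>s + \<dots> + dt\<^sub>r\<close>, which is \<open>\<plusminus>dt\<^sub>1 \<and> \<dots> \<and> dt\<^sub>r\<close> or \<open>0\<close>.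
  The cocycle condition is Stokes' theorem on the simplex for the closed polynomial form so obtained.
  The exterior derivative on a submanifold does not depend on the extension because its tangent
  vectors extend to affine vector fields tangent to it.\<close>

section \<open>The exterior algebra on countably many generators\<close>

text \<open>\<open>descended_pf\<close> is picked by \<open>SOME\<close> and, like
  \<open>ext_deriv\<close>, is determined on tangent vectors only. The proof therefore works with
  one polynomial form on the ambient space, \<open>pf_base\<close>, in which inverses are written as
  transposes. It restricts to the descended form, is its own global extension, and its integral over
  the simplex is a finite sum of Dirichlet integrals. The price is that the Maurer-Cartan and
  Bianchi identities hold only at points of SO and on vectors tangent to it. The cochain of the
  claim and the chosen one both agree with the fibre integral of \<open>pf_base\<close> on tangent
  vectors, so they differ by the coboundary of 0. The forms \<open>\<theta>_i\<close> reach the base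
  through conjugation by \<open>g_0\<close> and a shift by \<open>\<theta>_0\<close>: the Pfaffian
  does not change under conjugation, as det \<open>g_0\<close> = 1, and the curvature of a convex
  combination does not change under a shift common to all vertices. In the coefficient,
  \<open>(-1)^p\<close> is the sign carried by the p curvature letters, and
  \<open>(-1)^(r(r-1)/2)\<close> with r = p - q comes from moving the r forms in the
  \<open>dt_i\<close> in front of the r factors \<open>\<phi>_s\<close>.\<close>

definition sg :: "nat set \<Rightarrow> nat set \<Rightarrow> real" where
  "sg A B = (-1) ^ card {(a, b). a \<in> A \<and> b \<in> B \<and> b < a}"

lemma sg_finite: "finite A \<Longrightarrow> finite B \<Longrightarrow> finite {(a, b). a \<in> A \<and> b \<in> B \<and> b < (a::nat)}"
  by (rule finite_subset[of _ "A \<times> B"]) auto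

lemma sg_Un_left:
  assumes "finite A" "finite B" "finite C" "A \<inter> B = {}"
  shows "sg (A \<union> B) C = sg A C * sg B C"
proof -
  have "{(a, b). a \<in> A \<union> B \<and> b \<in> C \<and> b < a} =
      {(a, b). a \<in> A \<and> b \<in> C \<and> b < a} \<union> {(a, b). a \<in> B \<and> b \<in> C \<and> b < a}" by auto
  then have "card {(a, b). a \<in> A \<union> B \<and> b \<in> C \<and> b < a} =
      card {(a, b). a \<in> A \<and> b \<in> C \<and> b < a} + card {(a, b). a \<in> B \<and> b \<in> C \<and> b < a}"
    using assms by (simp only:) (rule card_Un_disjoint, auto intro: sg_finite)
  then show ?thesis by (simp add: sg_def power_add)
qed

text \<open>Each pair from \<open>A\<close> and \<open>B\<close> is an inversion in exactly one of
  the two orders, since the sets are disjoint.\<close>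

lemma sg_swap:
  assumes "finite A" "finite B" "A \<inter> B = {}"
  shows "sg B A = (-1) ^ (card A * card B) * sg A B"
proof -
  let ?X = "{(a, b). a \<in> A \<and> b \<in> B \<and> b < a}" and ?Y = "{(b, a). b \<in> B \<and> a \<in> A \<and> a < b}"
  have "A \<times> B = ?X \<union> prod.swap ` ?Y" using assms(3) by (force simp: image_iff)
  then have "card (A \<times> B) = card (?X \<union> prod.swap ` ?Y)" by simp
  also have "\<dots> = card ?X + card (prod.swap ` ?Y)"
    by (rule card_Un_disjoint) (use assms in \<open>auto intro: sg_finite\<close>)
  also have "card (prod.swap ` ?Y) = card ?Y" by (rule card_image) (auto simp: inj_on_def)
  finally have "card A * card B = card ?X + card ?Y" by (simp add: card_cartesian_product)
  then show ?thesis by (simp add: sg_def power_add)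
qed

lemma sg_Un_right:
  assumes "finite A" "finite B" "finite C" "A \<inter> B = {}"
  shows "sg C (A \<union> B) = sg C A * sg C B"
proof -
  have "{(a, b). a \<in> C \<and> b \<in> A \<union> B \<and> b < a} =
      {(a, b). a \<in> C \<and> b \<in> A \<and> b < a} \<union> {(a, b). a \<in> C \<and> b \<in> B \<and> b < a}" by auto
  then have "card {(a, b). a \<in> C \<and> b \<in> A \<union> B \<and> b < a} =
      card {(a, b). a \<in> C \<and> b \<in> A \<and> b < a} + card {(a, b). a \<in> C \<and> b \<in> B \<and> b < a}"
    using assms by (simp only:) (rule card_Un_disjoint, auto intro: sg_finite)
  then show ?thesis by (simp add: sg_def power_add)
qed

lemma sg_empty [simp]: "sg {} A = 1" "sg A {} = 1"
  by (simp_all add: sg_def)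

lemma sg_ordered: "(\<And>a b. a \<in> A \<Longrightarrow> b \<in> B \<Longrightarrow> a \<le> b) \<Longrightarrow> sg A B = 1"
proof -
  assume "\<And>a b. a \<in> A \<Longrightarrow> b \<in> B \<Longrightarrow> a \<le> b"
  then have "{(a, b). a \<in> A \<and> b \<in> B \<and> b < a} = {}" by (auto simp: not_less[symmetric])
  then show ?thesis by (simp only: sg_def card.empty power_0)
qed

lemma sg_image:
  assumes "strict_mono f"
  shows "sg (f ` A) (f ` B) = sg A B"
proof -
  have "{(a, b). a \<in> f ` A \<and> b \<in> f ` B \<and> b < a} =
      map_prod f f ` {(a, b). a \<in> A \<and> b \<in> B \<and> b < a}"
    using assms by (force simp: strict_mono_less)
  moreover have "inj_on (map_prod f f) X" for X
    using strict_mono_eq[OF assms] by (auto simp: inj_on_def)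
  ultimately show ?thesis by (simp add: sg_def card_image)
qed

text \<open>The product below is the exterior algebra on generators indexed by \<^typ>\<open>nat\<close>, with
  infinite sums of monomials allowed.\<close>

typedef grass = "{f :: nat set \<Rightarrow> real. \<forall>S. infinite S \<longrightarrow> f S = 0}" morphisms gc Abs_grass
  by (rule exI[of _ "\<lambda>_. 0"]) auto

setup_lifting type_definition_grass

lemma gc_infinite [simp]: "infinite S \<Longrightarrow> gc a S = 0"
  using gc by blast

lemma grass_eqI: "(\<And>S. finite S \<Longrightarrow> gc a S = gc b S) \<Longrightarrow> a = b"
  by (metis gc_infinite gc_inject ext)

instantiation grass :: real_algebra_1
begin

lift_definition zero_grass :: grass is "\<lambda>_. 0" by simp
lift_definition one_grass :: grass is "\<lambda>S. of_bool (S = {})" by auto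
lift_definition plus_grass :: "grass \<Rightarrow> grass \<Rightarrow> grass" is "\<lambda>a b S. a S + b S" by simp
lift_definition minus_grass :: "grass \<Rightarrow> grass \<Rightarrow> grass" is "\<lambda>a b S. a S - b S" by simp
lift_definition uminus_grass :: "grass \<Rightarrow> grass" is "\<lambda>a S. - a S" by simp
lift_definition scaleR_grass :: "real \<Rightarrow> grass \<Rightarrow> grass" is "\<lambda>r a S. r * a S" by simp
text \<open>The sign is that of sorting the monomial of \<open>A\<close> followed by the monomial of
  \<open>S - A\<close>. For infinite \<open>S\<close> the sum over \<open>Pow S\<close> is 0 by
  convention, which keeps the product in the type.\<close>

lift_definition times_grass :: "grass \<Rightarrow> grass \<Rightarrow> grass" is
  "\<lambda>a b S. \<Sum>A\<in>Pow S. sg A (S - A) * a A * b (S - A)" by simp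

instance
proof
  fix a b c :: grass and r s :: real
  show "a + b + c = a + (b + c)" "a + b = b + a" "0 + a = a" "- a + a = 0" "a - b = a + - b"
    by (transfer, simp add: fun_eq_iff)+
  show "r *\<^sub>R (a + b) = r *\<^sub>R a + r *\<^sub>R b" "(r + s) *\<^sub>R a = r *\<^sub>R a + s *\<^sub>R a"
    "r *\<^sub>R s *\<^sub>R a = (r * s) *\<^sub>R a" "1 *\<^sub>R a = a"
    by (transfer, simp add: fun_eq_iff algebra_simps)+
  show "r *\<^sub>R a * b = r *\<^sub>R (a * b)" "a * r *\<^sub>R b = r *\<^sub>R (a * b)"
    by (transfer, simp add: fun_eq_iff sum_distrib_left algebra_simps)+
  show "(a + b) * c = a * c + b * c" "a * (b + c) = a * b + a * c"
    by (transfer, simp add: fun_eq_iff algebra_simps sum.distrib)+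
  show "(0::grass) \<noteq> 1" by transfer (auto simp: fun_eq_iff)
  show "1 * a = a"
  proof (transfer, rule ext)
    fix a :: "nat set \<Rightarrow> real" and S :: "nat set" assume a: "\<forall>S. infinite S \<longrightarrow> a S = 0"
    show "(\<Sum>A\<in>Pow S. sg A (S - A) * of_bool (A = {}) * a (S - A)) = a S"
    proof (cases "finite S")
      case True
      have "(\<Sum>A\<in>Pow S. sg A (S - A) * of_bool (A = {}) * a (S - A)) =
          (\<Sum>A\<in>Pow S. if A = {} then a S else 0)" by (rule sum.cong) auto
      then show ?thesis using True by (simp add: sum.delta)
    qed (use a in auto)
  qed
  show "a * 1 = a"
  proof (transfer, rule ext)
    fix a :: "nat set \<Rightarrow> real" and S :: "nat set" assume a: "\<forall>S. infinite S \<longrightarrow> a S = 0"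
    show "(\<Sum>A\<in>Pow S. sg A (S - A) * a A * of_bool (S - A = {})) = a S"
    proof (cases "finite S")
      case True
      have "(\<Sum>A\<in>Pow S. sg A (S - A) * a A * of_bool (S - A = {})) =
          (\<Sum>A\<in>Pow S. if A = S then a S else 0)" by (rule sum.cong) auto
      then show ?thesis using True by (simp add: sum.delta)
    qed (use a in auto)
  qed
  show "a * b * c = a * (b * c)"
  proof (transfer, rule ext)
    fix a b c :: "nat set \<Rightarrow> real" and S :: "nat set"
    show "(\<Sum>A\<in>Pow S. sg A (S - A) * (\<Sum>B\<in>Pow A. sg B (A - B) * a B * b (A - B)) * c (S - A)) =
       (\<Sum>A\<in>Pow S. sg A (S - A) * a A * (\<Sum>B\<in>Pow (S - A). sg B (S - A - B) * b B * c (S - A - B)))"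
      (is "?l = ?r")
    proof (cases "finite S")
      case True
      have fin: "finite (Pow X)" if "X \<subseteq> S" for X using that True by (simp add: finite_subset)
      have "?l = (\<Sum>(A, B)\<in>Sigma (Pow S) Pow.
          sg A (S - A) * (sg B (A - B) * a B * b (A - B)) * c (S - A))"
        using fin by (subst sum.Sigma[symmetric])
          (auto simp: sum_distrib_left sum_distrib_right intro!: sum.cong)
      also have "\<dots> = (\<Sum>(B, C)\<in>Sigma (Pow S) (\<lambda>B. Pow (S - B)).
          sg B (S - B) * a B * (sg C (S - B - C) * b C * c (S - B - C)))"
      \<comment> \<open>Both sides run over the ordered splittings of \<open>S\<close> into three
        blocks: on the left \<open>B\<close>, \<open>A - B\<close>, \<open>S - A\<close>, on the
        right \<open>B\<close>, \<open>C\<close>, \<open>S - B - C\<close>.\<close>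
      proof (rule sum.reindex_bij_witness[where i = "\<lambda>(B, C). (B \<union> C, B)" and j = "\<lambda>(A, B). (B, A - B)"],
          goal_cases)
        case (5 x)
        then obtain A B where x: "x = (A, B)" "A \<subseteq> S" "B \<subseteq> A" by auto
        have f: "finite B" "finite (A - B)" "finite (S - A)"
          using x True by (auto intro: finite_subset)
        have "S - B = (A - B) \<union> (S - A)" "A = B \<union> (A - B)" using x by auto
        then have "sg B (S - B) = sg B (A - B) * sg B (S - A)"
            "sg A (S - A) = sg B (S - A) * sg (A - B) (S - A)"
          using sg_Un_right[of "A - B" "S - A" B] sg_Un_left[of B "A - B" "S - A"] f by auto
        moreover have "S - B - (A - B) = S - A" using x by auto
        ultimately show ?case by (simp add: x(1))
      qed auto
      also have "\<dots> = ?r"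
        using fin by (subst sum.Sigma[symmetric])
          (auto simp: sum_distrib_left sum_distrib_right intro!: sum.cong)
      finally show ?thesis .
    qed simp
  qed
qed

end

section \<open>Coefficients, parity and graded commutativity\<close>

lemma gc_simps [simp]:
  "gc 0 S = 0" "gc (a + b) S = gc a S + gc b S" "gc (a - b) S = gc a S - gc b S"
  "gc (- a) S = - gc a S" "gc (r *\<^sub>R a) S = r * gc a S"
  by (transfer, simp)+

lemma gc_one: "gc 1 S = of_bool (S = {})" by transfer simp

lemma gc_mult: "gc (a * b) S = (\<Sum>A\<in>Pow S. sg A (S - A) * gc a A * gc b (S - A))"
  by transfer simp

lemma gc_sum [simp]: "gc (sum f I) S = (\<Sum>i\<in>I. gc (f i) S)"
  by (induction I rule: infinite_finite_induct) auto

text \<open>The grading automorphism. The equations \<open>par a = a\<close> and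
  \<open>par a = - a\<close> serve throughout as the definitions of even and odd elements.\<close>

lift_definition par :: "grass \<Rightarrow> grass" is "\<lambda>a S. (-1) ^ card S * a S" by simp

lemma gc_par: "gc (par a) S = (-1) ^ card S * gc a S" by transfer simp

lemma par_simps [simp]:
  "par 0 = 0" "par 1 = 1" "par (a + b) = par a + par b" "par (a - b) = par a - par b"
  "par (- a) = - par a" "par (r *\<^sub>R a) = r *\<^sub>R par a" "par (par a) = a"
  by (rule grass_eqI, auto simp: gc_par gc_one algebra_simps power_mult_distrib[symmetric])+

lemma par_of_real [simp]: "par (of_real r) = of_real r"
  by (simp add: of_real_def)

lemma par_sum [simp]: "par (sum f I) = (\<Sum>i\<in>I. par (f i))"
  by (induction I rule: infinite_finite_induct) auto

lemma par_mult [simp]: "par (a * b) = par a * par b"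
proof (rule grass_eqI)
  fix S :: "nat set" assume "finite S"
  then have "card S = card A + card (S - A)" if "A \<subseteq> S" for A
    using that by (metis card_Diff_subset card_mono finite_subset le_add_diff_inverse)
  then show "gc (par (a * b)) S = gc (par a * par b) S"
    by (auto simp: gc_par gc_mult sum_distrib_left power_add algebra_simps intro!: sum.cong)
qed

text \<open>An odd element that passes a monomial of degree l picks up \<open>(-1)^l\<close>, which
  is what \<open>par\<close> does to that monomial.\<close>

lemma odd_commute:
  assumes "par a = - a" shows "a * b = par b * a"
proof (rule grass_eqI)
  fix S :: "nat set" assume S: "finite S"
  have a: "even (card A) \<Longrightarrow> gc a A = 0" for A
    using arg_cong[OF assms, of "\<lambda>x. gc x A"] by (simp add: gc_par)
  have "gc (a * b) S = (\<Sum>A\<in>Pow S. sg (S - A) A * gc a (S - A) * gc b A)"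
    unfolding gc_mult
    by (rule sum.reindex_bij_witness[where i = "\<lambda>A. S - A" and j = "\<lambda>A. S - A"])
      (auto simp: double_diff)
  also have "\<dots> = gc (par b * a) S"
    unfolding gc_mult
  proof (rule sum.cong[OF refl])
    fix A assume "A \<in> Pow S"
    then have "sg (S - A) A = (-1) ^ (card A * card (S - A)) * sg A (S - A)"
      using S by (intro sg_swap) (auto intro: finite_subset)
    then show "sg (S - A) A * gc a (S - A) * gc b A = sg A (S - A) * gc (par b) A * gc a (S - A)"
      by (cases "even (card (S - A))"; cases "even (card A)") (auto simp: a gc_par)
  qed
  finally show "gc (a * b) S = gc (par b * a) S" .
qed

lemma even_commute:
  assumes "par a = a" shows "a * b = b * a"
proof (rule grass_eqI)
  fix S :: "nat set" assume S: "finite S"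
  have a: "odd (card A) \<Longrightarrow> gc a A = 0" for A
    using arg_cong[OF assms, of "\<lambda>x. gc x A"] by (simp add: gc_par)
  have "gc (a * b) S = (\<Sum>A\<in>Pow S. sg (S - A) A * gc a (S - A) * gc b A)"
    unfolding gc_mult
    by (rule sum.reindex_bij_witness[where i = "\<lambda>A. S - A" and j = "\<lambda>A. S - A"])
      (auto simp: double_diff)
  also have "\<dots> = gc (b * a) S"
    unfolding gc_mult
  proof (rule sum.cong[OF refl])
    fix A assume "A \<in> Pow S"
    then have "sg (S - A) A = (-1) ^ (card A * card (S - A)) * sg A (S - A)"
      using S by (intro sg_swap) (auto intro: finite_subset)
    then show "sg (S - A) A * gc a (S - A) * gc b A = sg A (S - A) * gc b A * gc a (S - A)"
      by (cases "even (card (S - A))"; cases "even (card A)") (auto simp: a)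
  qed
  finally show "gc (a * b) S = gc (b * a) S" .
qed

text \<open>The linear combination of generators with coefficients \<open>c\<close>, of which
  infinitely many may be nonzero: a form is applied to an infinite sequence of vectors, and only the
  first few entries matter.\<close>

lift_definition lin :: "(nat \<Rightarrow> real) \<Rightarrow> grass" is
  "\<lambda>c S. if card S = 1 then c (the_elem S) else 0" by auto

lemma gc_lin: "gc (lin c) S = (if card S = 1 then c (the_elem S) else 0)" by transfer simp

lemma gc_lin_singleton [simp]: "gc (lin c) {j} = c j" by (simp add: gc_lin)

lemma par_lin [simp]: "par (lin c) = - lin c"
  by (rule grass_eqI) (auto simp: gc_par gc_lin)

lemma lin_add: "lin (\<lambda>j. c j + d j) = lin c + lin d"
  by (rule grass_eqI) (auto simp: gc_lin)

lemma lin_scale: "lin (\<lambda>j. r * c j) = r *\<^sub>R lin c"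
  by (rule grass_eqI) (auto simp: gc_lin)

lemma lin_uminus: "lin (\<lambda>j. - c j) = - lin c"
  by (rule grass_eqI) (auto simp: gc_lin)

lemma lin_zero [simp]: "lin (\<lambda>j. 0) = 0"
  by (rule grass_eqI) (auto simp: gc_lin)

lemma lin_sum: "lin (\<lambda>j. \<Sum>i\<in>I. c i j) = (\<Sum>i\<in>I. lin (c i))"
  by (induction I rule: infinite_finite_induct) (auto simp: lin_add)

definition xi :: "nat \<Rightarrow> grass" where "xi j = lin (\<lambda>i. of_bool (i = j))"

lemma par_xi [simp]: "par (xi j) = - xi j" by (simp add: xi_def)

lemma gc_xi: "gc (xi j) S = of_bool (S = {j})"
  by (auto simp: xi_def gc_lin card_1_singleton_iff)

lemma gc_xi_mult:
  "gc (xi j * a) S = (if finite S \<and> j \<in> S then (-1) ^ card {s \<in> S. s < j} * gc a (S - {j}) else 0)"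
proof (cases "finite S")
  case True
  have "gc (xi j * a) S = (\<Sum>A\<in>Pow S. if A = {j} then sg {j} (S - {j}) * gc a (S - {j}) else 0)"
    unfolding gc_mult by (rule sum.cong) (auto simp: gc_xi)
  also have "\<dots> = (if j \<in> S then sg {j} (S - {j}) * gc a (S - {j}) else 0)"
    using True by (subst sum.delta) auto
  also have "sg {j} (S - {j}) = (-1) ^ card {s \<in> S. s < j}"
  proof -
    have "{(a, b). a \<in> {j} \<and> b \<in> S - {j} \<and> b < a} = Pair j ` {s \<in> S. s < j}" by auto
    then show ?thesis by (simp add: sg_def card_image inj_on_def)
  qed
  finally show ?thesis using True by simp
qed simp

text \<open>\<open>odot D\<close> is the formal sum of the \<open>\<xi>\<^sub>j D\<^sub>j\<close>; with \<open>D\<^sub>j\<close> the derivative along the \<open>j\<close>-th tangent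
  vector it becomes the exterior differential.\<close>

lift_definition odot :: "(nat \<Rightarrow> grass) \<Rightarrow> grass" is
  "\<lambda>D S. if finite S then \<Sum>j\<in>S. gc (xi j * D j) S else 0" by simp

lemma gc_odot: "gc (odot D) S = (\<Sum>j\<in>S. gc (xi j * D j) S)"
  by transfer (auto simp: sum.infinite)

lemma gc_odot_superset:
  assumes "finite T" "S \<subseteq> T" shows "gc (odot D) S = (\<Sum>j\<in>T. gc (xi j * D j) S)"
  unfolding gc_odot by (rule sum.mono_neutral_left) (use assms in \<open>auto simp: gc_xi_mult\<close>)

lemma odot_simps [simp]:
  "odot (\<lambda>j. 0) = 0" "odot (\<lambda>j. D j + E j) = odot D + odot E"
  "odot (\<lambda>j. - D j) = - odot D" "odot (\<lambda>j. r *\<^sub>R D j) = r *\<^sub>R odot D"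
  by (rule grass_eqI, auto simp: gc_odot sum.distrib algebra_simps sum_distrib_left sum_negf)+

lemma odot_lin: "odot (\<lambda>j. c j *\<^sub>R 1) = lin c"
proof (rule grass_eqI)
  fix S :: "nat set" assume "finite S"
  then show "gc (odot (\<lambda>j. c j *\<^sub>R 1)) S = gc (lin c) S"
    by (auto simp: gc_odot gc_xi gc_lin card_1_singleton_iff intro!: sum.neutral)
qed

lemma odot_mult_right: "odot (\<lambda>j. D j * G) = odot D * G"
proof (rule grass_eqI)
  fix S :: "nat set" assume S: "finite S"
  have "gc (odot D * G) S = (\<Sum>A\<in>Pow S. \<Sum>j\<in>S. sg A (S - A) * gc (xi j * D j) A * gc G (S - A))"
    unfolding gc_mult[of "odot D" G] using S
    by (auto simp: gc_odot_superset[OF S] sum_distrib_left sum_distrib_right intro!: sum.cong)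
  also have "\<dots> = (\<Sum>j\<in>S. gc (xi j * D j * G) S)"
    by (subst sum.swap) (simp add: gc_mult[of _ G])
  finally show "gc (odot (\<lambda>j. D j * G)) S = gc (odot D * G) S"
    by (simp add: gc_odot mult.assoc)
qed

text \<open>Each \<open>xi j\<close> has to pass \<open>F\<close>. This is the source of the sign in
  the graded Leibniz rule for \<open>hasd\<close>.\<close>

lemma odot_mult_left: "odot (\<lambda>j. F * D j) = par F * odot D"
proof (rule grass_eqI)
  fix S :: "nat set" assume S: "finite S"
  have x: "xi j * (F * D j) = par F * (xi j * D j)" for j
    by (metis mult.assoc odd_commute par_xi)
  have "gc (par F * odot D) S = (\<Sum>A\<in>Pow S. \<Sum>j\<in>S. sg A (S - A) * gc (par F) A * gc (xi j * D j) (S - A))"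
    unfolding gc_mult[of "par F" "odot D"] using S
    by (auto simp: gc_odot_superset[OF S] sum_distrib_left sum_distrib_right intro!: sum.cong)
  also have "\<dots> = (\<Sum>j\<in>S. gc (par F * (xi j * D j)) S)"
    by (subst sum.swap) (simp add: gc_mult[of "par F"])
  finally show "gc (odot (\<lambda>j. F * D j)) S = gc (par F * odot D) S"
    by (simp add: gc_odot x)
qed

text \<open>These are the signs of the exterior derivative: the generator \<open>j\<close> is moved
  to the front past the \<open>j\<close> smaller ones, which leaves the coefficient in which the
  place \<open>j\<close> is omitted.\<close>

lemma gc_odot_lessThan:
  "gc (odot D) {..<n} = (\<Sum>j<n. (-1) ^ j * gc (D j) ({..<n} - {j}))"
proof -
  have "card {s \<in> {..<n}. s < j} = j" if "j < n" for j
  proof -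
    have "{s \<in> {..<n}. s < j} = {..<j}" using that by auto
    then show ?thesis by simp
  qed
  then show ?thesis by (simp add: gc_odot gc_xi_mult)
qed

text \<open>For strictly increasing \<open>f\<close> this is the algebra homomorphism that sends the
  generator \<open>f j\<close> to the generator \<open>j\<close> and all generators outside the
  range of \<open>f\<close> to 0. It models the passage from the vectors \<open>v\<close> to the
  selection \<open>v (f j)\<close>.\<close>

definition rel :: "(nat \<Rightarrow> nat) \<Rightarrow> grass \<Rightarrow> grass" where
  "rel f a = Abs_grass (\<lambda>S. if finite S then gc a (f ` S) else 0)"

lemma gc_rel: "gc (rel f a) S = (if finite S then gc a (f ` S) else 0)"
  unfolding rel_def by (subst Abs_grass_inverse) auto

lemma rel_simps [simp]:
  "rel f 0 = 0" "rel f 1 = 1" "rel f (a + b) = rel f a + rel f b" "rel f (r *\<^sub>R a) = r *\<^sub>R rel f a"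
  by (rule grass_eqI, auto simp: gc_rel gc_one)+

lemma rel_mult:
  assumes "strict_mono f" shows "rel f (a * b) = rel f a * rel f b"
proof (rule grass_eqI)
  fix S :: "nat set" assume S: "finite S"
  have inj: "inj f" by (rule strict_mono_imp_inj_on[OF assms])
  have "gc (rel f (a * b)) S = (\<Sum>A\<in>Pow (f ` S). sg A (f ` S - A) * gc a A * gc b (f ` S - A))"
    using S by (simp add: gc_rel gc_mult)
  also have "Pow (f ` S) = image f ` Pow S" by (auto simp: subset_image_iff)
  also have "(\<Sum>A\<in>image f ` Pow S. sg A (f ` S - A) * gc a A * gc b (f ` S - A)) =
      (\<Sum>A\<in>Pow S. sg (f ` A) (f ` S - f ` A) * gc a (f ` A) * gc b (f ` S - f ` A))"
    by (subst sum.reindex) (use inj in \<open>auto simp: inj_on_def inj_image_eq_iff\<close>)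
  also have "\<dots> = gc (rel f a * rel f b) S"
    unfolding gc_mult using S
    by (intro sum.cong refl)
      (auto simp: image_set_diff[OF inj, symmetric] sg_image[OF assms] gc_rel intro: finite_subset)
  finally show "gc (rel f (a * b)) S = gc (rel f a * rel f b) S" .
qed

lemma rel_lin: "strict_mono f \<Longrightarrow> rel f (lin c) = lin (\<lambda>j. c (f j))"
proof (rule grass_eqI)
  fix S assume f: "strict_mono f" and S: "finite (S :: nat set)"
  have "card (f ` S) = card S" by (rule card_image) (metis f strict_mono_imp_inj_on inj_on_subset subset_UNIV)
  then show "gc (rel f (lin c)) S = gc (lin (\<lambda>j. c (f j))) S"
    using S by (auto simp: gc_rel gc_lin card_1_singleton_iff)
qed

section \<open>Supports and degrees of elements\<close>

definition suppin :: "nat set \<Rightarrow> grass \<Rightarrow> bool" where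
  "suppin X a \<longleftrightarrow> (\<forall>S. \<not> S \<subseteq> X \<longrightarrow> gc a S = 0)"

lemma suppin_mult: "suppin X a \<Longrightarrow> suppin X b \<Longrightarrow> suppin X (a * b)"
  unfolding suppin_def gc_mult
proof (intro allI impI sum.neutral ballI)
  fix S A assume h: "\<forall>S. \<not> S \<subseteq> X \<longrightarrow> gc a S = 0" "\<forall>S. \<not> S \<subseteq> X \<longrightarrow> gc b S = 0" "\<not> S \<subseteq> X" "A \<in> Pow S"
  then have "\<not> A \<subseteq> X \<or> \<not> S - A \<subseteq> X" by blast
  then have "gc a A = 0 \<or> gc b (S - A) = 0" using h by metis
  then show "sg A (S - A) * gc a A * gc b (S - A) = 0" by auto
qed

lemma suppin_simps [simp]: "suppin X 0" "suppin X 1" "suppin X a \<Longrightarrow> suppin X b \<Longrightarrow> suppin X (a + b)"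
  "suppin X a \<Longrightarrow> suppin X (- a)" "suppin X a \<Longrightarrow> suppin X (r *\<^sub>R a)"
  by (auto simp: suppin_def gc_one)

lemma suppin_sum: "(\<And>i. i \<in> I \<Longrightarrow> suppin X (f i)) \<Longrightarrow> suppin X (sum f I)"
  by (induction I rule: infinite_finite_induct) auto

lemma suppin_prod_list: "(\<And>a. a \<in> set as \<Longrightarrow> suppin X a) \<Longrightarrow> suppin X (prod_list as)"
  by (induction as) (auto intro: suppin_mult)

lemma suppin_lin: "(\<And>j. j \<notin> X \<Longrightarrow> c j = 0) \<Longrightarrow> suppin X (lin c)"
  by (force simp: suppin_def gc_lin card_1_singleton_iff)

text \<open>Among all splittings only \<open>A = {..<r}\<close> respects both supports, and its sign
  is 1 because the blocks are already in order. It is used to separate the simplex directions from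
  the group directions.\<close>

lemma gc_mult_split:
  assumes "suppin {..<r} a" "suppin {r..} b" "r \<le> n"
  shows "gc (a * b) {..<n} = gc a {..<r} * gc b {r..<n}"
proof -
  have "gc (a * b) {..<n} = (\<Sum>A\<in>Pow {..<n}. if A = {..<r} then gc a {..<r} * gc b {r..<n} else 0)"
    unfolding gc_mult
  proof (rule sum.cong[OF refl])
    fix A assume A: "A \<in> Pow {..<n}"
    consider "A = {..<r}" | "\<not> A \<subseteq> {..<r}" | "A \<subseteq> {..<r}" "A \<noteq> {..<r}" by blast
    then show "sg A ({..<n} - A) * gc a A * gc b ({..<n} - A) =
        (if A = {..<r} then gc a {..<r} * gc b {r..<n} else 0)"
    proof cases
      case 1
      moreover have "{..<n} - {..<r} = {r..<n}" by auto
      moreover have "sg {..<r} {r..<n} = 1" by (rule sg_ordered) auto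
      ultimately show ?thesis by simp
    next
      case 2 then show ?thesis using assms by (auto simp: suppin_def)
    next
      case 3
      then obtain i where "i < r" "i \<notin> A" by auto
      then have "i \<in> {..<n} - A" "i \<notin> {r..}" using assms(3) by auto
      then have "\<not> {..<n} - A \<subseteq> {r..}" by blast
      then show ?thesis using assms(2) 3 by (auto simp: suppin_def)
    qed
  qed
  also have "\<dots> = gc a {..<r} * gc b {r..<n}" by (subst sum.delta) (use assms(3) in auto)
  finally show ?thesis .
qed

definition homog :: "nat \<Rightarrow> grass \<Rightarrow> bool" where
  "homog k a \<longleftrightarrow> (\<forall>S. card S \<noteq> k \<longrightarrow> gc a S = 0)"

lemma homog_mult: "homog k a \<Longrightarrow> homog l b \<Longrightarrow> homog (k + l) (a * b)"
  unfolding homog_def gc_mult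
proof (intro allI impI sum.neutral ballI)
  fix S A :: "nat set" assume h: "\<forall>S. card S \<noteq> k \<longrightarrow> gc a S = 0" "\<forall>S. card S \<noteq> l \<longrightarrow> gc b S = 0"
    "card S \<noteq> k + l" "A \<in> Pow S"
  show "sg A (S - A) * gc a A * gc b (S - A) = 0"
  proof (cases "finite S")
    case True
    then have "card S = card A + card (S - A)"
      using h(4) by (metis PowD card_Diff_subset card_mono finite_subset le_add_diff_inverse)
    then have "card A \<noteq> k \<or> card (S - A) \<noteq> l" using h(3) by auto
    then show ?thesis using h by auto
  next
    case False
    then have "infinite A \<or> infinite (S - A)" by (metis finite_Diff2)
    then show ?thesis using gc_infinite[of A a] gc_infinite[of "S - A" b] by (metis mult_eq_0_iff)
  qed
qed

lemma homog_lin [simp]: "homog 1 (lin c)" by (auto simp: homog_def gc_lin)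

lemma homog_one [simp]: "homog 0 1" by (auto simp: homog_def gc_one)

lemma homog_prod_lin: "homog (length cs) (prod_list (map lin cs))"
proof (induction cs)
  case (Cons c cs)
  then show ?case using homog_mult[OF homog_lin[of c], of "length cs"] by simp
qed simp

section \<open>Forms as top coefficients\<close>

lemma prod_list_sum_distrib:
  fixes F :: "'k \<Rightarrow> 'c \<Rightarrow> 'a::semiring_1"
  assumes "distinct ks"
  shows "prod_list (map (\<lambda>k. \<Sum>c\<in>C k. F k c) ks) =
    (\<Sum>f\<in>Pi\<^sub>E (set ks) C. prod_list (map (\<lambda>k. F k (f k)) ks))"
  using assms
proof (induction ks)
  case (Cons k ks)
  have "(\<Sum>f\<in>Pi\<^sub>E (set (k # ks)) C. prod_list (map (\<lambda>k. F k (f k)) (k # ks))) =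
      (\<Sum>(c, g)\<in>C k \<times> Pi\<^sub>E (set ks) C. F k c * prod_list (map (\<lambda>k. F k (g k)) ks))"
    unfolding list.set(2) PiE_insert_eq
  proof (subst sum.reindex, goal_cases)
    case 1
    show ?case using Cons.prems by (intro inj_combinator) auto
  next
    case 2
    have m: "prod_list (map (\<lambda>l. F l (if l = k then c else g l)) ks) =
        prod_list (map (\<lambda>l. F l (g l)) ks)" for g c
      using Cons.prems by (intro arg_cong[of _ _ prod_list] map_cong) auto
    show ?case by (intro sum.cong refl) (auto simp: m)
  qed
  then show ?case
    using Cons by (simp add: sum_product sum.cartesian_product)
qed simp

lemma prod_list_scaleR:
  fixes F :: "'k \<Rightarrow> 'a::real_algebra_1"
  assumes "distinct ks"
  shows "prod_list (map (\<lambda>k. r k *\<^sub>R F k) ks) = (\<Prod>k\<in>set ks. r k) *\<^sub>R prod_list (map F ks)"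
  using assms by (induction ks) auto

lemma prod_list_transpose_adjacent:
  fixes g :: "nat \<Rightarrow> 'a::ring_1"
  assumes "Suc k < n" "g k * g (Suc k) = - (g (Suc k) * g k)"
  shows "prod_list (map (g \<circ> Transposition.transpose k (Suc k)) [0..<n]) = - prod_list (map g [0..<n])"
proof -
  have "[0..<n] = [0..<k] @ [k..<n]"
    using upt_add_eq_append[of 0 k "n - k"] assms by simp
  also have "[k..<n] = k # Suc k # [Suc (Suc k)..<n]"
    using assms by (simp add: upt_conv_Cons)
  finally have l: "[0..<n] = [0..<k] @ k # Suc k # [Suc (Suc k)..<n]" .
  have 1: "map (g \<circ> Transposition.transpose k (Suc k)) [0..<k] = map g [0..<k]"
    by (auto simp: Transposition.transpose_def)
  have 2: "map (g \<circ> Transposition.transpose k (Suc k)) [Suc (Suc k)..<n] = map g [Suc (Suc k)..<n]"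
    by (auto simp: Transposition.transpose_def)
  have 3: "g (Suc k) * (g k * z) = - (g k * (g (Suc k) * z))" for z
    by (metis assms(2) minus_minus mult.assoc mult_minus_left)
  show ?thesis
    unfolding l map_append list.map 1 2 by (simp add: 3)
qed

text \<open>The transposition of i and j + 1 is the conjugate of that of i and j by the adjacent
  transposition of j and j + 1. The three factors contribute three sign changes, hence one.\<close>

lemma prod_list_transpose:
  fixes g :: "nat \<Rightarrow> 'a::ring_1"
  assumes "i < j" "j < n" "\<And>a b. a < n \<Longrightarrow> b < n \<Longrightarrow> a \<noteq> b \<Longrightarrow> g a * g b = - (g b * g a)"
  shows "prod_list (map (g \<circ> Transposition.transpose i j) [0..<n]) = - prod_list (map g [0..<n])"
  using assms
proof (induction j arbitrary: g)
  case (Suc j)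
  show ?case
  proof (cases "i = j")
    case True
    show ?thesis unfolding True by (rule prod_list_transpose_adjacent) (use True Suc.prems(1,2) Suc.prems(3)[of j "Suc j"] in auto)
  next
    case False
    let ?s = "Transposition.transpose j (Suc j)"
    have ss: "?s x < n \<longleftrightarrow> x < n" for x using Suc.prems(1,2) by (auto simp: Transposition.transpose_def)
    have ac: "(g \<circ> ?s) a * (g \<circ> ?s) b = - ((g \<circ> ?s) b * (g \<circ> ?s) a)"
      if "a < n" "b < n" "a \<noteq> b" for a b
      using that Suc.prems(3)[of "?s a" "?s b"] ss by (metis o_apply transpose_involutory)
    have ac': "(g \<circ> ?s \<circ> Transposition.transpose i j) a * (g \<circ> ?s \<circ> Transposition.transpose i j) b =
        - ((g \<circ> ?s \<circ> Transposition.transpose i j) b * (g \<circ> ?s \<circ> Transposition.transpose i j) a)"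
      if "a < n" "b < n" "a \<noteq> b" for a b
    proof -
      have "Transposition.transpose i j x < n" if "x < n" for x using that Suc.prems(1,2) by (auto simp: Transposition.transpose_def)
      then show ?thesis using ac[of "Transposition.transpose i j a" "Transposition.transpose i j b"] that
        by (metis o_apply transpose_involutory)
    qed
    have "Transposition.transpose i (Suc j) = ?s \<circ> Transposition.transpose i j \<circ> ?s"
      using False Suc.prems(1,2) by (auto simp: fun_eq_iff Transposition.transpose_def)
    then have "prod_list (map (g \<circ> Transposition.transpose i (Suc j)) [0..<n]) =
        prod_list (map ((g \<circ> ?s \<circ> Transposition.transpose i j) \<circ> ?s) [0..<n])" by (simp add: o_assoc)
    also have "\<dots> = - prod_list (map (g \<circ> ?s \<circ> Transposition.transpose i j) [0..<n])"
      using Suc.prems(1,2) by (intro prod_list_transpose_adjacent ac') auto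
    also have "prod_list (map (g \<circ> ?s \<circ> Transposition.transpose i j) [0..<n]) =
        - prod_list (map (g \<circ> ?s) [0..<n])"
      by (rule Suc.IH[OF _ _ ac]) (use False Suc.prems(1,2) in auto)
    also have "prod_list (map (g \<circ> ?s) [0..<n]) = - prod_list (map g [0..<n])"
      by (rule prod_list_transpose_adjacent) (use Suc.prems(2) Suc.prems(3)[of j "Suc j"] in auto)
    finally show ?thesis by simp
  qed
qed simp

lemma prod_list_permute:
  fixes g :: "nat \<Rightarrow> 'a::real_algebra_1"
  assumes "\<pi> permutes {..<n}" "\<And>a b. a < n \<Longrightarrow> b < n \<Longrightarrow> a \<noteq> b \<Longrightarrow> g a * g b = - (g b * g a)"
  shows "prod_list (map (g \<circ> \<pi>) [0..<n]) = of_int (sign \<pi>) *\<^sub>R prod_list (map g [0..<n])"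
  using finite_lessThan[of n] assms(1)
proof (induction \<pi> rule: permutes_rev_induct)
  case (swap a b p)
  have ac: "(g \<circ> p) a * (g \<circ> p) b = - ((g \<circ> p) b * (g \<circ> p) a)" if "a < n" "b < n" "a \<noteq> b" for a b
  proof -
    have "p a \<noteq> p b" using swap that by (simp add: permutes_inj inj_eq)
    moreover have "p a < n" "p b < n"
      using that permutes_in_image[OF \<open>p permutes {..<n}\<close>] by auto
    ultimately show ?thesis using assms(2)[of "p a" "p b"] by simp
  qed
  have "prod_list (map ((g \<circ> p) \<circ> Transposition.transpose a b) [0..<n]) = - prod_list (map (g \<circ> p) [0..<n])"
  proof (cases "a < b")
    case True then show ?thesis using swap(1-3) by (intro prod_list_transpose ac) auto
  next
    case False
    then have "b < a" using swap by auto
    then show ?thesis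
      using swap(1-3) by (subst transpose_commute) (intro prod_list_transpose ac, auto)
  qed
  moreover have "sign (p \<circ> Transposition.transpose a b) = - sign p"
    using swap(3) permutes_imp_permutation[OF finite_lessThan \<open>p permutes {..<n}\<close>]
    by (subst sign_compose) (auto simp: sign_swap_id permutation_swap_id)
  ultimately show ?case by (simp only: o_assoc of_int_minus scaleR_minus_left swap)
qed simp

text \<open>The k x k determinant as a Leibniz sum, for a size \<open>k\<close> that is a number and
  not a type.\<close>

definition detsum :: "nat \<Rightarrow> (nat \<Rightarrow> nat \<Rightarrow> real) \<Rightarrow> real" where
  "detsum k c = (\<Sum>\<pi> | \<pi> permutes {..<k}. of_int (sign \<pi>) * (\<Prod>m<k. c m (\<pi> m)))"

lemma xi_anticommute: "xi a * xi b = - (xi b * xi a)"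
  using odd_commute[of "xi a" "xi b"] by simp

lemma gc_prod_xi: "gc (prod_list (map xi [0..<k])) {..<k} = 1"
proof (induction k)
  case (Suc k)
  have "gc (prod_list (map xi [0..<k]) * xi k) {..<Suc k} =
      gc (prod_list (map xi [0..<k])) {..<k} * gc (xi k) {k..<Suc k}"
    by (rule gc_mult_split) (auto intro!: suppin_prod_list suppin_lin simp: xi_def)
  then show ?case using Suc by (simp add: gc_xi)
qed (simp add: gc_one)

lemma gc_prod_cong:
  assumes "\<And>x S. x \<in> set xs \<Longrightarrow> S \<subseteq> X \<Longrightarrow> gc (f x) S = gc (g x) S" "S \<subseteq> X"
  shows "gc (prod_list (map f xs)) S = gc (prod_list (map g xs)) S"
  using assms
proof (induction xs arbitrary: S)
  case (Cons x xs)
  have "gc (f x * prod_list (map f xs)) S = gc (g x * prod_list (map g xs)) S"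
    unfolding gc_mult
  proof (rule sum.cong[OF refl])
    fix A assume "A \<in> Pow S"
    then have A: "A \<subseteq> X" "S - A \<subseteq> X" using Cons.prems(2) by auto
    have "gc (f x) A = gc (g x) A" by (rule Cons.prems(1)) (use A in auto)
    moreover have "gc (prod_list (map f xs)) (S - A) = gc (prod_list (map g xs)) (S - A)"
      by (rule Cons.IH[OF Cons.prems(1)]) (use A in auto)
    ultimately show "sg A (S - A) * gc (f x) A * gc (prod_list (map f xs)) (S - A) =
        sg A (S - A) * gc (g x) A * gc (prod_list (map g xs)) (S - A)" by simp
  qed
  then show ?case by simp
qed simp

text \<open>Expand each factor in the generators; only bijections contribute to the top coefficient.\<close>

lemma gc_prod_lin: "gc (prod_list (map (\<lambda>m. lin (c m)) [0..<k])) {..<k} = detsum k c"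
proof -
  let ?g = "\<lambda>m. \<Sum>j<k. c m j *\<^sub>R xi j"
  let ?E = "Pi\<^sub>E {..<k} (\<lambda>_. {..<k})"
  have "gc (prod_list (map (\<lambda>m. lin (c m)) [0..<k])) {..<k} = gc (prod_list (map ?g [0..<k])) {..<k}"
  proof (rule gc_prod_cong[where X = "{..<k}"])
    fix S m assume "S \<subseteq> {..<k}"
    then show "gc (lin (c m)) S = gc (?g m) S"
      by (auto simp: gc_xi gc_lin card_1_singleton_iff sum.delta intro!: sum.neutral[symmetric])
  qed simp
  also have "\<dots> = (\<Sum>f\<in>?E. (\<Prod>m<k. c m (f m)) * gc (prod_list (map (xi \<circ> f) [0..<k])) {..<k})"
    by (subst prod_list_sum_distrib) (auto simp: prod_list_scaleR o_def lessThan_atLeast0)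
  also have "\<dots> = (\<Sum>f\<in>{f\<in>?E. f ` {..<k} = {..<k}}.
      (\<Prod>m<k. c m (f m)) * gc (prod_list (map (xi \<circ> f) [0..<k])) {..<k})"
  proof (rule sum.mono_neutral_right)
    show "finite ?E" by (simp add: finite_PiE)
    show "\<forall>f\<in>?E - {f\<in>?E. f ` {..<k} = {..<k}}.
        (\<Prod>m<k. c m (f m)) * gc (prod_list (map (xi \<circ> f) [0..<k])) {..<k} = 0"
    proof
      fix f assume f: "f \<in> ?E - {f\<in>?E. f ` {..<k} = {..<k}}"
      then have "\<not> {..<k} \<subseteq> f ` {..<k}" by (auto simp: PiE_iff)
      moreover have "suppin (f ` {..<k}) (prod_list (map (xi \<circ> f) [0..<k]))"
        by (auto intro!: suppin_prod_list suppin_lin simp: xi_def)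
      ultimately show "(\<Prod>m<k. c m (f m)) * gc (prod_list (map (xi \<circ> f) [0..<k])) {..<k} = 0"
        by (simp add: suppin_def)
    qed
  qed auto
  also have "\<dots> = detsum k c"
    unfolding detsum_def
  proof (rule sum.reindex_bij_witness[where i = "\<lambda>\<pi>. restrict \<pi> {..<k}" and
        j = "\<lambda>f x. if x < k then f x else x"])
    fix f assume "f \<in> {f\<in>?E. f ` {..<k} = {..<k}}"
    then have f: "f \<in> ?E" "f ` {..<k} = {..<k}" by auto
    let ?p = "\<lambda>x. if x < k then f x else x"
    show "restrict ?p {..<k} = f" using f(1) by (auto simp: fun_eq_iff PiE_def extensional_def)
    have "?p ` {..<k} = f ` {..<k}" by (rule image_cong) auto
    then have "?p ` {..<k} = {..<k}" using f(2) by simp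
    then have "bij_betw ?p {..<k} {..<k}" by (simp add: bij_betw_def eq_card_imp_inj_on)
    then have p: "?p permutes {..<k}" by (rule bij_imp_permutes) simp
    then show "?p \<in> {\<pi>. \<pi> permutes {..<k}}" by simp
    have m: "map (xi \<circ> f) [0..<k] = map (xi \<circ> ?p) [0..<k]" by auto
    have pl: "prod_list (map (xi \<circ> ?p) [0..<k]) = of_int (sign ?p) *\<^sub>R prod_list (map xi [0..<k])"
      by (rule prod_list_permute[OF p]) (rule xi_anticommute)
    have "gc (prod_list (map (xi \<circ> f) [0..<k])) {..<k} = of_int (sign ?p)"
      unfolding m pl gc_simps gc_prod_xi by simp
    then show "of_int (sign ?p) * (\<Prod>m<k. c m (?p m)) =
        (\<Prod>m<k. c m (f m)) * gc (prod_list (map (xi \<circ> f) [0..<k])) {..<k}"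
      by simp
  next
    fix \<pi> assume "\<pi> \<in> {\<pi>. \<pi> permutes {..<k}}"
    then have \<pi>: "\<pi> permutes {..<k}" by simp
    show "(\<lambda>x. if x < k then restrict \<pi> {..<k} x else x) = \<pi>"
      using \<pi> by (auto simp: fun_eq_iff permutes_def)
    show "restrict \<pi> {..<k} \<in> {f\<in>?E. f ` {..<k} = {..<k}}"
      using permutes_image[OF \<pi>] by auto
  qed
  finally show ?thesis .
qed

text \<open>The elements that encode forms of degree k at one point. The \<open>l\<close> are
  arbitrary functions here; linear and continuous ones come with \<open>pform\<close>.\<close>

inductive ten :: "nat \<Rightarrow> ((nat \<Rightarrow> 'a) \<Rightarrow> grass) \<Rightarrow> bool" for k where
  zero: "ten k (\<lambda>v. 0)"
| add: "ten k F \<Longrightarrow> ten k G \<Longrightarrow> ten k (\<lambda>v. F v + G v)"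
| base: "length ls = k \<Longrightarrow> ten k (\<lambda>v. r *\<^sub>R prod_list (map (\<lambda>l. lin (\<lambda>j. l (v j))) ls))"

lemma ten_scaleR: "ten k F \<Longrightarrow> ten k (\<lambda>v. r *\<^sub>R F v)"
proof (induction rule: ten.induct)
  case (base ls s)
  then show ?case using ten.base[of ls k "r * s"] by simp
qed (auto simp: scaleR_add_right intro: ten.intros)

lemma ten_sum: "(\<And>i. i \<in> I \<Longrightarrow> ten k (F i)) \<Longrightarrow> ten k (\<lambda>v. \<Sum>i\<in>I. F i v)"
  by (induction I rule: infinite_finite_induct) (auto intro: ten.intros)

lemma ten_mult: "ten k F \<Longrightarrow> ten l G \<Longrightarrow> ten (k + l) (\<lambda>v. F v * G v)"
proof (induction rule: ten.induct)
  case (base ls r)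
  show ?case using base(2)
  proof (induction rule: ten.induct)
    case (base ls' s)
    then show ?case using ten.base[of "ls @ ls'" "k + l" "r * s"] \<open>length ls = k\<close> by (simp add: mult.commute)
  qed (auto simp: distrib_left intro: ten.intros)
qed (auto simp: distrib_right intro: ten.intros)

lemma ten_lin: "ten 1 (\<lambda>v. lin (\<lambda>j. l (v j)))"
  using ten.base[of "[l]" 1 1] by simp

lemma ten_one: "ten 0 (\<lambda>v. 1)"
  using ten.base[of "[]" 0 1] by simp

lemma gc_base:
  "length ls = k \<Longrightarrow> gc (r *\<^sub>R prod_list (map (\<lambda>l. lin (\<lambda>j. l (v j))) ls)) {..<k} =
    r * detsum k (\<lambda>m j. (ls ! m) (v j))"
proof -
  assume l: "length ls = k"
  have "map (\<lambda>l. lin (\<lambda>j. l (v j))) ls = map (\<lambda>m. lin (\<lambda>j. (ls ! m) (v j))) [0..<k]"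
    using l by (intro nth_equalityI) auto
  then show ?thesis using gc_prod_lin[of "\<lambda>m j. (ls ! m) (v j)" k] by simp
qed

lemma detsum_cong: "(\<And>m j. m < k \<Longrightarrow> j < k \<Longrightarrow> c m j = d m j) \<Longrightarrow> detsum k c = detsum k d"
  unfolding detsum_def
  by (intro sum.cong refl arg_cong2[where f = "(*)"] prod.cong)
    (metis lessThan_iff mem_Collect_eq permutes_in_image)

lemma ten_cong:
  assumes "ten k F" "\<And>i. i < k \<Longrightarrow> v i = w i" shows "gc (F v) {..<k} = gc (F w) {..<k}"
  using assms(1)
proof (induction rule: ten.induct)
  case (base ls r)
  then show ?case using assms(2) unfolding gc_base[OF base] by (auto intro!: detsum_cong)
qed auto

lemma ten_rel: "ten k F \<Longrightarrow> strict_mono f \<Longrightarrow> rel f (F v) = F (\<lambda>j. v (f j))"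
proof (induction rule: ten.induct)
  case (base ls r)
  have "rel f (prod_list (map (\<lambda>l. lin (\<lambda>j. l (v j))) ls)) = prod_list (map (\<lambda>l. lin (\<lambda>j. l (v (f j)))) ls)"
    by (induction ls) (auto simp: rel_mult rel_lin base)
  then show ?case by simp
qed auto

lemma ten_gc_image:
  "ten k F \<Longrightarrow> strict_mono f \<Longrightarrow> gc (F v) (f ` {..<k}) = gc (F (\<lambda>j. v (f j))) {..<k}"
  using ten_rel[of k F f v] by (metis finite_lessThan gc_rel)

text \<open>Composing every permutation with the transposition of \<open>i\<close> and
  \<open>j\<close> reverses its sign and keeps its product, so the sum equals its own
  negative.\<close>

lemma detsum_repeat:
  assumes "i < k" "j < k" "i \<noteq> j" "\<And>m. m < k \<Longrightarrow> c m i = c m j"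
  shows "detsum k c = 0"
proof -
  let ?t = "Transposition.transpose i j"
  have t: "?t permutes {..<k}" using assms by (intro permutes_swap_id) auto
  have ct: "c m (?t x) = c m x" if "m < k" for m x using assms(4)[OF that] by (auto simp: Transposition.transpose_def)
  have "detsum k c = (\<Sum>\<pi> | \<pi> permutes {..<k}. of_int (sign (?t \<circ> \<pi>)) * (\<Prod>m<k. c m ((?t \<circ> \<pi>) m)))"
    unfolding detsum_def by (rule setum_permutations_compose_left[OF t])
  also have "\<dots> = (\<Sum>\<pi> | \<pi> permutes {..<k}. - (of_int (sign \<pi>) * (\<Prod>m<k. c m (\<pi> m))))"
  proof (rule sum.cong[OF refl])
    fix \<pi> assume "\<pi> \<in> {\<pi>. \<pi> permutes {..<k}}"
    then have "permutation \<pi>" using permutes_imp_permutation[of "{..<k}"] by simp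
    then have "sign (?t \<circ> \<pi>) = - sign \<pi>"
      using assms(3)
      by (subst sign_compose) (auto simp: sign_swap_id permutation_swap_id)
    moreover have "(\<Prod>m<k. c m ((?t \<circ> \<pi>) m)) = (\<Prod>m<k. c m (\<pi> m))"
      by (rule prod.cong) (auto simp: ct)
    ultimately show "of_int (sign (?t \<circ> \<pi>)) * (\<Prod>m<k. c m ((?t \<circ> \<pi>) m)) =
        - (of_int (sign \<pi>) * (\<Prod>m<k. c m (\<pi> m)))" by simp
  qed
  also have "\<dots> = - detsum k c" by (simp add: detsum_def sum_negf)
  finally show ?thesis by simp
qed

lemma ten_repeat:
  assumes "ten k F" "i < k" "j < k" "i \<noteq> j" "v i = v j" shows "gc (F v) {..<k} = 0"
  using assms(1)
proof (induction rule: ten.induct)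
  case (base ls r)
  then show ?case using assms unfolding gc_base[OF base] by (auto intro!: detsum_repeat[of i _ j])
qed auto

text \<open>In each summand the argument at place \<open>i\<close> occurs exactly once, in the
  factor \<open>m0\<close> with \<open>\<pi> m0 = i\<close>; all other factors are constant.\<close>

lemma detsum_linear:
  fixes l :: "nat \<Rightarrow> 'a::real_vector \<Rightarrow> real"
  assumes "i < k" "\<And>m. m < k \<Longrightarrow> linear (l m)"
  shows "linear (\<lambda>u. detsum k (\<lambda>m j. l m ((v(i := u)) j)))"
  unfolding detsum_def
proof (rule linear_compose_sum, rule ballI)
  fix \<pi> assume "\<pi> \<in> {\<pi>. \<pi> permutes {..<k}}"
  then have \<pi>: "\<pi> permutes {..<k}" by simp
  then obtain m0 where m0: "m0 < k" "\<pi> m0 = i"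
    using assms(1) by (metis lessThan_iff permutes_image imageE)
  have ne: "\<pi> m \<noteq> i" if "m \<noteq> m0" for m using that m0 permutes_inj[OF \<pi>] by (auto dest: injD)
  have "(\<lambda>u. of_int (sign \<pi>) * (\<Prod>m<k. l m ((v(i := u)) (\<pi> m)))) =
      (\<lambda>u. (of_int (sign \<pi>) * (\<Prod>m\<in>{..<k} - {m0}. l m (v (\<pi> m)))) *\<^sub>R l m0 u)"
  proof
    fix u
    have "(\<Prod>m<k. l m ((v(i := u)) (\<pi> m))) = l m0 u * (\<Prod>m\<in>{..<k} - {m0}. l m ((v(i := u)) (\<pi> m)))"
      using m0 by (subst prod.remove[of _ m0]) auto
    also have "(\<Prod>m\<in>{..<k} - {m0}. l m ((v(i := u)) (\<pi> m))) = (\<Prod>m\<in>{..<k} - {m0}. l m (v (\<pi> m)))"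
      using ne by (intro prod.cong) auto
    finally show "of_int (sign \<pi>) * (\<Prod>m<k. l m ((v(i := u)) (\<pi> m))) =
        (of_int (sign \<pi>) * (\<Prod>m\<in>{..<k} - {m0}. l m (v (\<pi> m)))) *\<^sub>R l m0 u" by simp
  qed
  then show "linear (\<lambda>u. of_int (sign \<pi>) * (\<Prod>m<k. l m ((v(i := u)) (\<pi> m))))"
    using linear_compose_scale_right[OF assms(2)[OF m0(1)]] by simp
qed

text \<open>The antisymmetrization of \<open>a \<otimes> b\<close>: absorbing the permutations of the two blocks into \<open>\<pi>\<close>
  cancels the factorials in \<^const>\<open>wedge\<close>.\<close>

lemma detsum_wedge:
  "(\<Sum>\<pi> | \<pi> permutes {..<k + l}. of_int (sign \<pi>) * detsum k (\<lambda>m j. a m (\<pi> j)) *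
      detsum l (\<lambda>m j. b m (\<pi> (k + j)))) =
    fact k * fact l * detsum (k + l) (\<lambda>m. if m < k then a m else b (m - k))"
proof -
  let ?P = "\<lambda>n. {\<pi>. \<pi> permutes {..<n::nat}}"
  define c where "c = (\<lambda>m. if m < k then a m else b (m - k))"
  have "(\<Sum>\<pi>\<in>?P (k + l). of_int (sign \<pi>) * detsum k (\<lambda>m j. a m (\<pi> j)) *
      detsum l (\<lambda>m j. b m (\<pi> (k + j)))) =
    (\<Sum>\<pi>\<in>?P (k + l). \<Sum>\<rho>\<in>?P k. \<Sum>\<rho>'\<in>?P l. of_int (sign \<pi>) * of_int (sign \<rho>) * of_int (sign \<rho>') *
      ((\<Prod>m<k. a m (\<pi> (\<rho> m))) * (\<Prod>m<l. b m (\<pi> (k + \<rho>' m)))))"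
    unfolding detsum_def
    by (simp add: sum_product sum_distrib_left sum_distrib_right algebra_simps)
  also have "\<dots> = (\<Sum>\<rho>\<in>?P k. \<Sum>\<rho>'\<in>?P l. \<Sum>\<pi>\<in>?P (k + l).
      of_int (sign \<pi>) * of_int (sign \<rho>) * of_int (sign \<rho>') *
      ((\<Prod>m<k. a m (\<pi> (\<rho> m))) * (\<Prod>m<l. b m (\<pi> (k + \<rho>' m)))))"
    by (subst sum.swap, rule sum.cong[OF refl], rule sum.swap)
  also have "\<dots> = (\<Sum>\<rho>\<in>?P k. \<Sum>\<rho>'\<in>?P l. detsum (k + l) c)"
  proof (intro sum.cong refl)
    fix \<rho> \<rho>' assume "\<rho> \<in> ?P k" "\<rho>' \<in> ?P l"
    then have r: "\<rho> permutes {..<k}" "\<rho>' permutes {..<l}" by auto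
    define \<rho>2 where "\<rho>2 = map_permutation {..<l} ((+) k) \<rho>'"
    have im: "(+) k ` {..<l} = {k..<k + l}"
      by (simp add: image_add_atLeastLessThan lessThan_atLeast0 add.commute)
    have r2: "\<rho>2 permutes {k..<k + l}"
      unfolding \<rho>2_def using r(2) im
      by (intro map_permutation_permutes) (auto simp: bij_betw_def)
    have s2: "sign \<rho>2 = sign \<rho>'"
      unfolding \<rho>2_def using r(2) by (intro sign_map_permutation) auto
    have v2: "\<rho>2 (k + m) = k + \<rho>' m" if "m < l" for m
      unfolding \<rho>2_def using that by (subst map_permutation_apply) auto
    define \<kappa> where "\<kappa> = \<rho> \<circ> \<rho>2"
    have k: "\<kappa> permutes {..<k + l}" unfolding \<kappa>_def
      by (intro permutes_compose permutes_subset[OF r2] permutes_subset[OF r(1)]) auto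
    have sk: "sign \<kappa> = sign \<rho> * sign \<rho>'" unfolding \<kappa>_def s2[symmetric]
      using r r2 by (intro sign_compose permutes_imp_permutation[of "{..<k}"]
        permutes_imp_permutation[of "{k..<k + l}"]) auto
    have k1: "\<kappa> m = \<rho> m" if "m < k" for m
      using that permutes_not_in[OF r2, of m] by (simp add: \<kappa>_def)
    have k2: "\<kappa> (k + m) = k + \<rho>' m" if "m < l" for m
      using that permutes_not_in[OF r(1), of "k + \<rho>' m"] by (simp add: \<kappa>_def v2)
    have "(\<Sum>\<pi>\<in>?P (k + l). of_int (sign \<pi>) * of_int (sign \<rho>) * of_int (sign \<rho>') *
        ((\<Prod>m<k. a m (\<pi> (\<rho> m))) * (\<Prod>m<l. b m (\<pi> (k + \<rho>' m))))) =
      (\<Sum>\<pi>\<in>?P (k + l). of_int (sign (\<pi> \<circ> \<kappa>)) * (\<Prod>m<k + l. c m ((\<pi> \<circ> \<kappa>) m)))"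
    proof (rule sum.cong[OF refl])
      fix \<pi> assume "\<pi> \<in> ?P (k + l)"
      then have "sign (\<pi> \<circ> \<kappa>) = sign \<pi> * (sign \<rho> * sign \<rho>')" unfolding sk[symmetric]
        using k by (intro sign_compose permutes_imp_permutation[of "{..<k + l}"]) auto
      moreover have "(\<Prod>m<k + l. c m ((\<pi> \<circ> \<kappa>) m)) =
          (\<Prod>m<k. c m (\<pi> (\<kappa> m))) * (\<Prod>m=k..<k + l. c m (\<pi> (\<kappa> m)))"
        using prod.atLeastLessThan_concat[of 0 k "k + l" "\<lambda>m. c m (\<pi> (\<kappa> m))"]
        by (simp add: lessThan_atLeast0)
      moreover have "(\<Prod>m=k..<k + l. c m (\<pi> (\<kappa> m))) = (\<Prod>m<l. c (k + m) (\<pi> (\<kappa> (k + m))))"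
        using prod.shift_bounds_nat_ivl[of "\<lambda>m. c m (\<pi> (\<kappa> m))" 0 k l]
        by (simp add: lessThan_atLeast0 add.commute)
      ultimately show "of_int (sign \<pi>) * of_int (sign \<rho>) * of_int (sign \<rho>') *
          ((\<Prod>m<k. a m (\<pi> (\<rho> m))) * (\<Prod>m<l. b m (\<pi> (k + \<rho>' m)))) =
        of_int (sign (\<pi> \<circ> \<kappa>)) * (\<Prod>m<k + l. c m ((\<pi> \<circ> \<kappa>) m))"
        by (simp add: c_def k1 k2)
    qed
    also have "\<dots> = detsum (k + l) c"
      unfolding detsum_def by (rule sum_permutations_compose_right[OF k, symmetric])
    finally show "(\<Sum>\<pi>\<in>?P (k + l). of_int (sign \<pi>) * of_int (sign \<rho>) * of_int (sign \<rho>') *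
        ((\<Prod>m<k. a m (\<pi> (\<rho> m))) * (\<Prod>m<l. b m (\<pi> (k + \<rho>' m))))) = detsum (k + l) c" .
  qed
  also have "\<dots> = fact k * fact l * detsum (k + l) c"
    by (simp add: card_permutations[of _ k] card_permutations[of _ l])
  finally show ?thesis unfolding c_def .
qed

text \<open>On products of 1-forms this is \<open>detsum_wedge\<close>, and both sides are bilinear.
  It lets \<open>wedge\<close>, with its factorials, be computed as multiplication in the exterior
  algebra.\<close>

lemma ten_wedge:
  assumes "ten k F" "ten l G"
  shows "(\<Sum>\<pi> | \<pi> permutes {..<k + l}. of_int (sign \<pi>) * gc (F (\<lambda>i. v (\<pi> i))) {..<k} *
      gc (G (\<lambda>i. v (\<pi> (k + i)))) {..<l}) / (fact k * fact l) = gc (F v * G v) {..<k + l}"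
  using assms(1)
proof (induction rule: ten.induct)
  case (base ls r)
  note ls = base
  show ?case using assms(2)
  proof (induction rule: ten.induct)
    case (base ls' s)
    have l: "length (ls @ ls') = k + l" using base ls by simp
    have "gc (r *\<^sub>R prod_list (map (\<lambda>l. lin (\<lambda>j. l (v j))) ls) *
        s *\<^sub>R prod_list (map (\<lambda>l. lin (\<lambda>j. l (v j))) ls')) {..<k + l} =
      r * s * detsum (k + l) (\<lambda>m j. ((ls @ ls') ! m) (v j))"
      using gc_base[OF l, of "r * s" v] by (simp add: mult.commute)
    also have "detsum (k + l) (\<lambda>m j. ((ls @ ls') ! m) (v j)) =
      detsum (k + l) (\<lambda>m. if m < k then \<lambda>j. (ls ! m) (v j) else (\<lambda>j. (ls' ! (m - k)) (v j)))"
      using ls by (auto intro!: detsum_cong simp: nth_append)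
    also have "r * s * \<dots> = (r * s * (fact k * fact l * \<dots>)) / (fact k * fact l)" by simp
    also have "r * s * (fact k * fact l * detsum (k + l) (\<lambda>m. if m < k then \<lambda>j. (ls ! m) (v j)
          else (\<lambda>j. (ls' ! (m - k)) (v j)))) =
        (\<Sum>\<pi> | \<pi> permutes {..<k + l}. of_int (sign \<pi>) *
          gc (r *\<^sub>R prod_list (map (\<lambda>l. lin (\<lambda>j. l (v (\<pi> j)))) ls)) {..<k} *
          gc (s *\<^sub>R prod_list (map (\<lambda>l. lin (\<lambda>j. l (v (\<pi> (k + j))))) ls')) {..<l})"
      unfolding detsum_wedge[where a = "\<lambda>m j. (ls ! m) (v j)" and b = "\<lambda>m j. (ls' ! m) (v j)", symmetric]
        sum_distrib_left gc_base[OF ls] gc_base[OF base]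
      by (intro sum.cong refl) (simp add: algebra_simps)
    finally show ?case by (rule sym)
  qed (simp_all add: distrib_left sum.distrib add_divide_distrib)
qed (simp_all add: distrib_left distrib_right sum.distrib add_divide_distrib)

text \<open>The vectors are restricted to \<open>T\<close> because forms such as the curvature have
  a meaning on tangent vectors only, whereas \<open>F\<close> is defined on all sequences.\<close>

definition reps :: "'a \<Rightarrow> 'a set \<Rightarrow> nat \<Rightarrow> 'a form \<Rightarrow> ((nat \<Rightarrow> 'a) \<Rightarrow> grass) \<Rightarrow> bool" where
  "reps x T k \<alpha> F \<longleftrightarrow> ten k F \<and> (\<forall>v. (\<forall>i<k. v i \<in> T) \<longrightarrow> \<alpha> x v = gc (F v) {..<k})"

lemma reps_wedge:
  assumes "reps x T k \<alpha> F" "reps x T l \<beta> G"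
  shows "reps x T (k + l) (wedge k l \<alpha> \<beta>) (\<lambda>v. F v * G v)"
  unfolding reps_def
proof (intro conjI allI impI)
  show "ten (k + l) (\<lambda>v. F v * G v)" using assms by (auto simp: reps_def intro: ten_mult)
  fix v :: "nat \<Rightarrow> 'a" assume v: "\<forall>i<k + l. v i \<in> T"
  have "wedge k l \<alpha> \<beta> x v = (\<Sum>\<pi> | \<pi> permutes {..<k + l}. of_int (sign \<pi>) * gc (F (\<lambda>i. v (\<pi> i))) {..<k} *
      gc (G (\<lambda>i. v (\<pi> (k + i)))) {..<l}) / (fact k * fact l)"
    unfolding wedge_def
  proof (intro arg_cong2[where f = "(/)"] refl sum.cong)
    fix \<pi> assume "\<pi> \<in> {\<pi>. \<pi> permutes {..<k + l}}"
    then have "\<pi> i < k + l" if "i < k + l" for i using that permutes_in_image by force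
    then have "\<forall>i<k. v (\<pi> i) \<in> T" "\<forall>i<l. v (\<pi> (k + i)) \<in> T" using v by auto
    then show "of_int (sign \<pi>) * \<alpha> x (\<lambda>i. v (\<pi> i)) * \<beta> x (\<lambda>i. v (\<pi> (k + i))) =
        of_int (sign \<pi>) * gc (F (\<lambda>i. v (\<pi> i))) {..<k} * gc (G (\<lambda>i. v (\<pi> (k + i)))) {..<l}"
      using assms by (auto simp: reps_def)
  qed
  also have "\<dots> = gc (F v * G v) {..<k + l}"
    using assms by (intro ten_wedge) (auto simp: reps_def)
  finally show "wedge k l \<alpha> \<beta> x v = gc (F v * G v) {..<k + l}" .
qed

lemma reps_one: "reps x T 0 (\<lambda>x v. 1) (\<lambda>v. 1)"
  by (simp add: reps_def ten_one gc_one)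

lemma reps_wedge_list:
  assumes "\<And>k. k \<in> set ks \<Longrightarrow> reps x T (d k) (\<alpha> k) (F k)"
  shows "reps x T (sum_list (map d ks)) (wedge_list (map (\<lambda>k. (d k, \<alpha> k)) ks))
    (\<lambda>v. prod_list (map (\<lambda>k. F k v) ks))"
  using assms
proof (induction ks)
  case (Cons k ks)
  then show ?case using reps_wedge[of x T "d k" "\<alpha> k" "F k"] by (simp add: o_def)
qed (simp add: reps_one)

lemma reps_sum: "(\<And>i. i \<in> I \<Longrightarrow> reps x T k (\<alpha> i) (F i)) \<Longrightarrow>
  reps x T k (\<lambda>x v. \<Sum>i\<in>I. \<alpha> i x v) (\<lambda>v. \<Sum>i\<in>I. F i v)"
  by (auto simp: reps_def intro!: ten_sum sum.cong)

lemma reps_scaleR: "reps x T k \<alpha> F \<Longrightarrow> reps x T k (\<lambda>x v. r * \<alpha> x v) (\<lambda>v. r *\<^sub>R F v)"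
  by (auto simp: reps_def intro: ten_scaleR)

section \<open>Polynomial forms and their exterior derivative\<close>

text \<open>Polynomials in continuous linear functionals. They are closed under
  \<open>dir_deriv\<close>, so the smoothness along lines that \<open>smooth_on\<close> demands
  follows by induction on the order. The inverse of a special orthogonal matrix is its transpose and
  can be written within this class.\<close>

inductive polyfun :: "('a::{real_vector,t2_space} \<Rightarrow> real) \<Rightarrow> bool" where
  const: "polyfun (\<lambda>x. c)"
| functional: "linear l \<Longrightarrow> continuous_on UNIV l \<Longrightarrow> polyfun l"
| add: "polyfun f \<Longrightarrow> polyfun g \<Longrightarrow> polyfun (\<lambda>x. f x + g x)"
| mult: "polyfun f \<Longrightarrow> polyfun g \<Longrightarrow> polyfun (\<lambda>x. f x * g x)"

lemma polyfun_scale: "polyfun f \<Longrightarrow> polyfun (\<lambda>x. c * f x)"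
  by (intro polyfun.mult polyfun.const)

lemma polyfun_sum: "(\<And>i. i \<in> I \<Longrightarrow> polyfun (f i)) \<Longrightarrow> polyfun (\<lambda>x. \<Sum>i\<in>I. f i x)"
  by (induction I rule: infinite_finite_induct) (auto intro: polyfun.intros)

lemma polyfun_continuous: "polyfun f \<Longrightarrow> continuous_on UNIV f"
  by (induction rule: polyfun.induct) (auto intro!: continuous_intros)

lemma polyfun_deriv_ex:
  "polyfun f \<Longrightarrow> \<exists>f'. polyfun f' \<and> (\<forall>x. ((\<lambda>s. f (x + s *\<^sub>R v)) has_field_derivative f' x) (at 0))"
proof (induction rule: polyfun.induct)
  case (const c)
  then show ?case by (intro exI[of _ "\<lambda>x. 0"]) (auto intro: polyfun.const)
next
  case (functional l)
  have "((\<lambda>s. l (x + s *\<^sub>R v)) has_field_derivative l v) (at 0)" for x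
    unfolding linear_add[OF functional(1)] linear_scale[OF functional(1)]
    by (auto intro!: derivative_eq_intros)
  then show ?case by (intro exI[of _ "\<lambda>x. l v"]) (auto intro: polyfun.const)
next
  case (add f g)
  then obtain f' g' where "polyfun f'" "polyfun g'"
    "\<And>x. ((\<lambda>s. f (x + s *\<^sub>R v)) has_field_derivative f' x) (at 0)"
    "\<And>x. ((\<lambda>s. g (x + s *\<^sub>R v)) has_field_derivative g' x) (at 0)" by auto
  then show ?case
    by (intro exI[of _ "\<lambda>x. f' x + g' x"]) (auto intro: polyfun.add DERIV_add)
next
  case (mult f g)
  then obtain f' g' where p: "polyfun f'" "polyfun g'"
    and d: "\<And>x. ((\<lambda>s. f (x + s *\<^sub>R v)) has_field_derivative f' x) (at 0)"
    "\<And>x. ((\<lambda>s. g (x + s *\<^sub>R v)) has_field_derivative g' x) (at 0)" by auto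
  have "((\<lambda>s. f (x + s *\<^sub>R v) * g (x + s *\<^sub>R v)) has_field_derivative f' x * g x + g' x * f x) (at 0)" for x
    using DERIV_mult[OF d(1)[of x] d(2)[of x]] by simp
  then show ?case using p mult
    by (intro exI[of _ "\<lambda>x. f' x * g x + g' x * f x"]) (auto intro!: polyfun.intros)
qed

lemma polyfun_has_deriv:
  assumes "polyfun f"
  shows "((\<lambda>s. f (x + s *\<^sub>R v)) has_field_derivative dir_deriv f v x) (at 0)"
proof -
  obtain f' where f': "\<forall>x. ((\<lambda>s. f (x + s *\<^sub>R v)) has_field_derivative f' x) (at 0)"
    using polyfun_deriv_ex[OF assms, of v] by auto
  then show ?thesis unfolding dir_deriv_def by (metis DERIV_imp_deriv)
qed

lemma polyfun_dir_deriv: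
  assumes "polyfun f" shows "polyfun (dir_deriv f v)"
proof -
  obtain f' where "polyfun f'" and f': "\<forall>x. ((\<lambda>s. f (x + s *\<^sub>R v)) has_field_derivative f' x) (at 0)"
    using polyfun_deriv_ex[OF assms, of v] by auto
  moreover have "dir_deriv f v = f'" by (rule ext) (metis DERIV_imp_deriv dir_deriv_def f')
  ultimately show ?thesis by simp
qed

lemma polyfun_smooth: "polyfun f \<Longrightarrow> smooth_on U f"
  unfolding smooth_on_def
proof
  fix k show "polyfun f \<Longrightarrow> Ck_on k U f"
  proof (induction k arbitrary: f)
    case 0
    then show ?case using continuous_on_subset[OF polyfun_continuous[OF 0]] by simp
  next
    case (Suc k)
    have "(\<lambda>s. f (x + s *\<^sub>R v)) field_differentiable at 0" for x v
      using polyfun_has_deriv[OF Suc.prems] field_differentiable_def by blast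
    then show ?case
      using Suc.IH[OF polyfun_dir_deriv[OF Suc.prems]]
        continuous_on_subset[OF polyfun_continuous[OF Suc.prems]] by simp
  qed
qed

text \<open>Forms with polynomial coefficients on the whole ambient space. They serve as the
  extension in \<open>extends_on\<close>, with \<open>UNIV\<close> as the open set.\<close>

inductive pform :: "nat \<Rightarrow> ('a::{real_vector,t2_space} \<Rightarrow> (nat \<Rightarrow> 'a) \<Rightarrow> grass) \<Rightarrow> bool" for k where
  zero: "pform k (\<lambda>x v. 0)"
| add: "pform k F \<Longrightarrow> pform k G \<Longrightarrow> pform k (\<lambda>x v. F x v + G x v)"
| base: "polyfun f \<Longrightarrow> length ls = k \<Longrightarrow> (\<And>l. l \<in> set ls \<Longrightarrow> linear l \<and> continuous_on UNIV l) \<Longrightarrow>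
    pform k (\<lambda>x v. f x *\<^sub>R prod_list (map (\<lambda>l. lin (\<lambda>j. l (v j))) ls))"

lemma pform_sum: "(\<And>i. i \<in> I \<Longrightarrow> pform k (F i)) \<Longrightarrow> pform k (\<lambda>x v. \<Sum>i\<in>I. F i x v)"
  by (induction I rule: infinite_finite_induct) (auto intro: pform.intros)

lemma pform_scaleR: "pform k F \<Longrightarrow> polyfun g \<Longrightarrow> pform k (\<lambda>x v. g x *\<^sub>R F x v)"
proof (induction rule: pform.induct)
  case (base f ls)
  then show ?case using pform.base[of "\<lambda>x. g x * f x" ls k] by (auto intro: polyfun.mult)
qed (auto simp: scaleR_add_right intro: pform.intros)

lemma pform_uminus: "pform k F \<Longrightarrow> pform k (\<lambda>x v. - F x v)"
  using pform_scaleR[of k F "\<lambda>x. -1"] by (simp add: polyfun.const)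

lemma pform_mult: "pform k F \<Longrightarrow> pform l G \<Longrightarrow> pform (k + l) (\<lambda>x v. F x v * G x v)"
proof (induction rule: pform.induct)
  case (base f ls)
  note b = base
  show ?case using base(4)
  proof (induction rule: pform.induct)
    case (base g ls')
    have "pform (k + l) (\<lambda>x v. (g x * f x) *\<^sub>R prod_list (map (\<lambda>l. lin (\<lambda>j. l (v j))) (ls @ ls')))"
      using base b by (intro pform.base polyfun.mult) auto
    then show ?case by simp
  qed (auto simp: distrib_left intro: pform.intros)
qed (auto simp: distrib_right intro: pform.intros)

lemma pform_poly: "polyfun f \<Longrightarrow> pform 0 (\<lambda>x v. of_real (f x))"
  using pform.base[of f "[]" 0] by (simp add: of_real_def)

lemma pform_lin: "linear l \<Longrightarrow> continuous_on UNIV l \<Longrightarrow> pform 1 (\<lambda>x v. lin (\<lambda>j. l (v j)))"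
  using pform.base[of "\<lambda>x. 1" "[l]" 1] by (simp add: polyfun.const)

lemma pform_ten: "pform k F \<Longrightarrow> ten k (F x)"
  by (induction rule: pform.induct) (auto intro: ten.intros)

lemma pform_prod_list:
  "(\<And>i. i \<in> set is \<Longrightarrow> pform d (F i)) \<Longrightarrow> pform (d * length is) (\<lambda>x v. prod_list (map (\<lambda>i. F i x v) is))"
proof (induction "is")
  case Nil
  then show ?case using pform_poly[OF polyfun.const[of 1]] by simp
next
  case (Cons i "is")
  then show ?case using pform_mult[of d "F i" "d * length is"] by simp
qed

lemma polyfun_gc_pform: "pform k F \<Longrightarrow> polyfun (\<lambda>x. gc (F x v) S)"
  by (induction rule: pform.induct) (auto intro!: polyfun.intros)

lemma pform_linear:
  "pform k F \<Longrightarrow> i < k \<Longrightarrow> linear (\<lambda>u. gc (F x (v(i := u))) {..<k})"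
proof (induction rule: pform.induct)
  case zero
  then show ?case by (simp add: linear_iff)
next
  case (add F G)
  then show ?case by (auto intro: linear_compose_add)
next
  case (base f ls)
  have "linear (\<lambda>u. f x *\<^sub>R detsum k (\<lambda>m j. (ls ! m) ((v(i := u)) j)))"
    by (intro linear_compose_scale_right detsum_linear) (use base in auto)
  then show ?case unfolding gc_base[OF base(2)] by simp
qed

lemma pform_alternating:
  assumes "pform k F" shows "alternating k (\<lambda>v. gc (F x v) {..<k})"
  unfolding alternating_def
  using ten_cong[OF pform_ten[OF assms, of x]] ten_repeat[OF pform_ten[OF assms, of x]]
    pform_linear[OF assms, of _ x] by blast

lemma pform_extends_on:
  assumes "pform k F"
    "\<And>y v. y \<in> M \<Longrightarrow> (\<forall>i<k. v i \<in> tangent_space M y) \<Longrightarrow> \<omega> y v = gc (F y v) {..<k}"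
  shows "extends_on M k \<omega> UNIV (\<lambda>x v. gc (F x v) {..<k})"
  unfolding extends_on_def
  using assms pform_alternating[OF assms(1)] polyfun_smooth[OF polyfun_gc_pform[OF assms(1)]] by auto

lemma pform_smooth_form:
  assumes "pform k F"
    "\<And>y v. y \<in> M \<Longrightarrow> (\<forall>i<k. v i \<in> tangent_space M y) \<Longrightarrow> \<omega> y v = gc (F y v) {..<k}"
  shows "smooth_form M k \<omega>"
  unfolding smooth_form_def using pform_extends_on[OF assms] by auto

text \<open>\<open>G\<close> is the differential of \<open>F\<close> at \<open>x\<close>, contracted with \<open>v\<close>: \<open>G = \<Sum>\<^sub>j \<xi>\<^sub>j D\<^bsub>v j\<^esub> F\<close>.\<close>

definition hasd :: "'a::{real_vector,t2_space} \<Rightarrow> (nat \<Rightarrow> 'a) \<Rightarrow> ('a \<Rightarrow> grass) \<Rightarrow> grass \<Rightarrow> bool" where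
  "hasd x v F G \<longleftrightarrow> (\<exists>D. (\<forall>j S. ((\<lambda>s. gc (F (x + s *\<^sub>R v j)) S) has_field_derivative gc (D j) S) (at 0)) \<and>
     G = odot D)"

lemma hasd_const: "hasd x v (\<lambda>y. a) 0"
  unfolding hasd_def by (rule exI[of _ "\<lambda>j. 0"]) auto

lemma hasd_add: "hasd x v F F' \<Longrightarrow> hasd x v G G' \<Longrightarrow> hasd x v (\<lambda>y. F y + G y) (F' + G')"
  unfolding hasd_def
proof safe
  fix D E
  assume "\<forall>j S. ((\<lambda>s. gc (F (x + s *\<^sub>R v j)) S) has_field_derivative gc (D j) S) (at 0)"
    "\<forall>j S. ((\<lambda>s. gc (G (x + s *\<^sub>R v j)) S) has_field_derivative gc (E j) S) (at 0)"
  then show "\<exists>Da. (\<forall>j S. ((\<lambda>s. gc (F (x + s *\<^sub>R v j) + G (x + s *\<^sub>R v j)) S)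
      has_field_derivative gc (Da j) S) (at 0)) \<and> odot D + odot E = odot Da"
    by (intro exI[of _ "\<lambda>j. D j + E j"]) (auto intro: DERIV_add)
qed

lemma hasd_mult:
  "hasd x v F F' \<Longrightarrow> hasd x v G G' \<Longrightarrow> hasd x v (\<lambda>y. F y * G y) (F' * G x + par (F x) * G')"
  unfolding hasd_def
proof safe
  fix D E
  assume D: "\<forall>j S. ((\<lambda>s. gc (F (x + s *\<^sub>R v j)) S) has_field_derivative gc (D j) S) (at 0)"
    and E: "\<forall>j S. ((\<lambda>s. gc (G (x + s *\<^sub>R v j)) S) has_field_derivative gc (E j) S) (at 0)"
  have "((\<lambda>s. gc (F (x + s *\<^sub>R v j) * G (x + s *\<^sub>R v j)) S) has_field_derivative
      gc (D j * G x + F x * E j) S) (at 0)" for j S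
  proof -
    have "((\<lambda>s. \<Sum>A\<in>Pow S. sg A (S - A) * gc (F (x + s *\<^sub>R v j)) A * gc (G (x + s *\<^sub>R v j)) (S - A))
      has_field_derivative (\<Sum>A\<in>Pow S. sg A (S - A) * gc (D j) A * gc (G x) (S - A) +
        sg A (S - A) * gc (F x) A * gc (E j) (S - A))) (at 0)"
      by (rule DERIV_sum) (rule derivative_eq_intros D[rule_format] E[rule_format] refl | simp)+
    then show ?thesis unfolding gc_simps gc_mult sum.distrib .
  qed
  then show "\<exists>Da. (\<forall>j S. ((\<lambda>s. gc (F (x + s *\<^sub>R v j) * G (x + s *\<^sub>R v j)) S)
      has_field_derivative gc (Da j) S) (at 0)) \<and> odot D * G x + par (F x) * odot E = odot Da"
    by (intro exI[of _ "\<lambda>j. D j * G x + F x * E j"])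
      (simp add: odot_mult_left odot_mult_right)
qed

lemma hasd_functional: "linear l \<Longrightarrow> hasd x v (\<lambda>y. of_real (l y)) (lin (\<lambda>j. l (v j)))"
  unfolding hasd_def
proof (intro exI[of _ "\<lambda>j. l (v j) *\<^sub>R 1"] conjI allI)
  fix j S assume l: "linear l"
  show "((\<lambda>s. gc (of_real (l (x + s *\<^sub>R v j))) S) has_field_derivative gc (l (v j) *\<^sub>R 1) S) (at 0)"
    by (auto simp: linear_add[OF l] linear_scale[OF l] of_real_def intro!: derivative_eq_intros)
qed (simp add: odot_lin)

lemma hasd_scaleR: "hasd x v F F' \<Longrightarrow> hasd x v (\<lambda>y. r *\<^sub>R F y) (r *\<^sub>R F')"
  using hasd_mult[OF hasd_const[of x v "r *\<^sub>R 1"]] by fastforce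

lemma hasd_uminus: "hasd x v F F' \<Longrightarrow> hasd x v (\<lambda>y. - F y) (- F')"
  using hasd_scaleR[of x v F F' "-1"] by simp

lemma hasd_diff: "hasd x v F F' \<Longrightarrow> hasd x v G G' \<Longrightarrow> hasd x v (\<lambda>y. F y - G y) (F' - G')"
  using hasd_add[OF _ hasd_uminus] by fastforce

lemma hasd_sum: "(\<And>i. i \<in> I \<Longrightarrow> hasd x v (F i) (F' i)) \<Longrightarrow>
  hasd x v (\<lambda>y. \<Sum>i\<in>I. F i y) (\<Sum>i\<in>I. F' i)"
  by (induction I rule: infinite_finite_induct) (auto intro: hasd_const hasd_add)

text \<open>The coefficient of \<open>D j\<close> at \<open>{..<Suc k} - {j}\<close> is the
  derivative of that coefficient of \<open>F\<close>, and relabelling by the increasing map that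
  misses \<open>j\<close> turns it into the value of \<open>F\<close> with \<open>v j\<close>
  omitted.\<close>

lemma hasd_gc:
  assumes F: "pform k F" and G: "hasd x v (\<lambda>y. F y v) G"
  shows "gc G {..<Suc k} = (\<Sum>j\<le>k. (-1) ^ j *
    dir_deriv (\<lambda>y. gc (F y (\<lambda>i. if i < j then v i else v (Suc i))) {..<k}) (v j) x)"
proof -
  obtain D where D: "\<And>j S. ((\<lambda>s. gc (F (x + s *\<^sub>R v j) v) S) has_field_derivative gc (D j) S) (at 0)"
    and G: "G = odot D" using G by (auto simp: hasd_def)
  have "gc (D j) ({..<Suc k} - {j}) =
      dir_deriv (\<lambda>y. gc (F y (\<lambda>i. if i < j then v i else v (Suc i))) {..<k}) (v j) x"
    if j: "j < Suc k" for j
  proof -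
    let ?f = "\<lambda>i. if i < j then i else Suc i"
    have m: "strict_mono ?f" by (auto simp: strict_mono_def)
    have i: "?f ` {..<k} = {..<Suc k} - {j}"
    proof
      show "{..<Suc k} - {j} \<subseteq> ?f ` {..<k}"
      proof
        fix n assume n: "n \<in> {..<Suc k} - {j}"
        show "n \<in> ?f ` {..<k}"
          by (rule image_eqI[of _ _ "if n < j then n else n - 1"]) (use n j in auto)
      qed
    qed (use j in auto)
    have "gc (F y v) ({..<Suc k} - {j}) = gc (F y (\<lambda>i. v (?f i))) {..<k}" for y
      using ten_gc_image[OF pform_ten[OF F] m] i by metis
    moreover have "(\<lambda>i. v (?f i)) = (\<lambda>i. if i < j then v i else v (Suc i))" by auto
    ultimately show ?thesis
      using D[of j "{..<Suc k} - {j}"] by (simp add: dir_deriv_def DERIV_imp_deriv)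
  qed
  then show ?thesis unfolding G gc_odot_lessThan by (simp add: lessThan_Suc_atMost)
qed

lemma hasd_flat:
  "pform k F \<Longrightarrow> hasd x v (\<lambda>y. F y v) G \<Longrightarrow>
    flat_ext_deriv k (\<lambda>y u. gc (F y u) {..<k}) x v = gc G {..<Suc k}"
  by (simp add: hasd_gc flat_ext_deriv_def)

section \<open>Matrices over the exterior algebra, with wedge products of the entries in the matrix
  product\<close>

definition mre :: "real^'n^'n \<Rightarrow> grass^'n^'n" where "mre M = (\<chi> a b. of_real (M $ a $ b))"
definition mlin :: "(nat \<Rightarrow> real^'n^'n) \<Rightarrow> grass^'n^'n" where "mlin V = (\<chi> a b. lin (\<lambda>j. V j $ a $ b))"
definition mpar :: "grass^'n^'n \<Rightarrow> grass^'n^'n" where "mpar M = (\<chi> a b. par (M $ a $ b))"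
definition smul :: "grass \<Rightarrow> grass^'n^'n \<Rightarrow> grass^'n^'n" where "smul x M = (\<chi> a b. x * M $ a $ b)"

definition mhasd ::
    "'a::{real_vector,t2_space} \<Rightarrow> (nat \<Rightarrow> 'a) \<Rightarrow> ('a \<Rightarrow> grass^'n^'n) \<Rightarrow> grass^'n^'n \<Rightarrow> bool" where
  "mhasd x v F G \<longleftrightarrow> (\<forall>a b. hasd x v (\<lambda>y. F y $ a $ b) (G $ a $ b))"

definition mpform :: "nat \<Rightarrow> ('a::{real_vector,t2_space} \<Rightarrow> (nat \<Rightarrow> 'a) \<Rightarrow> grass^'n^'n) \<Rightarrow> bool" where
  "mpform k F \<longleftrightarrow> (\<forall>a b. pform k (\<lambda>x v. F x v $ a $ b))"

lemma matrix_mult_nth: "(A ** B) $ a $ b = (\<Sum>c\<in>UNIV. A $ a $ c * B $ c $ b)"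
  by (simp add: matrix_matrix_mult_def)

lemma mhasd_const: "mhasd x v (\<lambda>y. M) 0"
  by (simp add: mhasd_def hasd_const)

lemma mhasd_add: "mhasd x v F F' \<Longrightarrow> mhasd x v G G' \<Longrightarrow> mhasd x v (\<lambda>y. F y + G y) (F' + G')"
  by (simp add: mhasd_def hasd_add)

lemma mhasd_diff: "mhasd x v F F' \<Longrightarrow> mhasd x v G G' \<Longrightarrow> mhasd x v (\<lambda>y. F y - G y) (F' - G')"
  by (simp add: mhasd_def hasd_diff)

lemma mhasd_uminus: "mhasd x v F F' \<Longrightarrow> mhasd x v (\<lambda>y. - F y) (- F')"
  by (simp add: mhasd_def hasd_uminus)

lemma mhasd_sum: "(\<And>i. i \<in> I \<Longrightarrow> mhasd x v (F i) (F' i)) \<Longrightarrow>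
  mhasd x v (\<lambda>y. \<Sum>i\<in>I. F i y) (\<Sum>i\<in>I. F' i)"
  by (induction I rule: infinite_finite_induct) (auto intro: mhasd_const mhasd_add)

lemma mhasd_mult:
  fixes F G :: "'a::{real_vector,t2_space} \<Rightarrow> grass^'n::finite^'n"
  assumes "mhasd x v F F'" "mhasd x v G G'"
  shows "mhasd x v (\<lambda>y. F y ** G y) (F' ** G x + mpar (F x) ** G')"
  unfolding mhasd_def
proof (intro allI)
  fix a b
  have "hasd x v (\<lambda>y. \<Sum>c\<in>UNIV. F y $ a $ c * G y $ c $ b)
      (\<Sum>c\<in>UNIV. F' $ a $ c * G x $ c $ b + par (F x $ a $ c) * G' $ c $ b)"
    using assms by (intro hasd_sum hasd_mult) (auto simp: mhasd_def)
  then show "hasd x v (\<lambda>y. (F y ** G y) $ a $ b) ((F' ** G x + mpar (F x) ** G') $ a $ b)"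
    by (simp add: matrix_mult_nth sum.distrib mpar_def)
qed

lemma mhasd_smul:
  assumes "hasd x v f f'" "mhasd x v G G'"
  shows "mhasd x v (\<lambda>y. smul (f y) (G y)) (smul f' (G x) + smul (par (f x)) G')"
  using assms by (auto simp: mhasd_def smul_def intro!: hasd_mult)

lemma mpform_add: "mpform k F \<Longrightarrow> mpform k G \<Longrightarrow> mpform k (\<lambda>x v. F x v + G x v)"
  by (simp add: mpform_def pform.add)

lemma mpform_uminus: "mpform k F \<Longrightarrow> mpform k (\<lambda>x v. - F x v)"
  by (simp add: mpform_def pform_uminus)

lemma mpform_diff: "mpform k F \<Longrightarrow> mpform k G \<Longrightarrow> mpform k (\<lambda>x v. F x v - G x v)"
  using mpform_add[OF _ mpform_uminus, of k F G] by simp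

lemma mpform_sum: "(\<And>i. i \<in> I \<Longrightarrow> mpform k (F i)) \<Longrightarrow> mpform k (\<lambda>x v. \<Sum>i\<in>I. F i x v)"
  by (simp add: mpform_def pform_sum)

lemma mpform_mult:
  fixes F G :: "'a::{real_vector,t2_space} \<Rightarrow> (nat \<Rightarrow> 'a) \<Rightarrow> grass^'n::finite^'n"
  shows "mpform k F \<Longrightarrow> mpform l G \<Longrightarrow> mpform (k + l) (\<lambda>x v. F x v ** G x v)"
  by (auto simp: mpform_def matrix_mult_nth intro!: pform_sum pform_mult)

lemma mpform_smul: "pform k f \<Longrightarrow> mpform l G \<Longrightarrow> mpform (k + l) (\<lambda>x v. smul (f x v) (G x v))"
  by (auto simp: mpform_def smul_def intro!: pform_mult)

lemma mpform_mre: "(\<And>a b. polyfun (\<lambda>x. M x $ a $ b)) \<Longrightarrow> mpform 0 (\<lambda>x v. mre (M x))"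
  by (simp add: mpform_def mre_def pform_poly)

lemma mpform_mlin:
  assumes "\<And>a b. linear (\<lambda>u. L u $ a $ b) \<and> continuous_on UNIV (\<lambda>u. L u $ a $ b)"
  shows "mpform 1 (\<lambda>x v. mlin (\<lambda>j. L (v j)))"
  unfolding mpform_def mlin_def vec_lambda_beta
proof (intro allI)
  fix a b show "pform 1 (\<lambda>x v. lin (\<lambda>j. L (v j) $ a $ b))"
    using assms[of a b] by (intro pform_lin) auto
qed

lemma mpar_simps [simp]: "mpar (A + B) = mpar A + mpar B" "mpar (A - B) = mpar A - mpar B"
  "mpar (- A) = - mpar A" "mpar 0 = 0" "mpar (mre M) = mre M" "mpar (mlin V) = - mlin V"
  "mpar (mat 1) = mat 1"
  by (simp_all add: mpar_def vec_eq_iff mre_def mlin_def mat_def)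

lemma mpar_mult: "mpar (A ** B) = mpar A ** mpar B"
  by (simp add: mpar_def vec_eq_iff matrix_mult_nth)

lemma mpar_sum: "mpar (sum F I) = (\<Sum>i\<in>I. mpar (F i))"
  by (induction I rule: infinite_finite_induct) auto

lemma mpar_smul: "mpar (smul a B) = smul (par a) (mpar B)"
  by (simp add: mpar_def vec_eq_iff smul_def)

lemma mre_mult: "mre (A ** B) = mre A ** mre B"
  by (simp add: mre_def vec_eq_iff matrix_mult_nth)

lemma mre_mat1 [simp]: "mre (mat 1) = mat 1"
  by (simp add: mre_def vec_eq_iff mat_def)

lemma mlin_mult_left: "mre A ** mlin V = mlin (\<lambda>j. A ** V j)"
proof -
  have "(\<Sum>c\<in>UNIV. of_real (A $ a $ c) * lin (\<lambda>j. V j $ c $ b)) = lin (\<lambda>j. \<Sum>c\<in>UNIV. A $ a $ c * V j $ c $ b)" for a b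
    by (simp add: lin_sum lin_scale of_real_def)
  then show ?thesis by (simp add: mre_def mlin_def vec_eq_iff matrix_mult_nth)
qed

lemma mlin_mult_right: "mlin V ** mre A = mlin (\<lambda>j. V j ** A)"
proof -
  have "(\<Sum>c\<in>UNIV. lin (\<lambda>j. V j $ a $ c) * of_real (A $ c $ b)) = lin (\<lambda>j. \<Sum>c\<in>UNIV. A $ c $ b * V j $ a $ c)" for a b
    by (simp add: lin_sum lin_scale of_real_def)
  then show ?thesis by (simp add: mre_def mlin_def vec_eq_iff matrix_mult_nth mult.commute)
qed

lemma mlin_add: "mlin (\<lambda>j. V j + W j) = mlin V + mlin W"
  by (simp add: mlin_def vec_eq_iff lin_add)

lemma mlin_uminus: "mlin (\<lambda>j. - V j) = - mlin V"
  by (simp add: mlin_def vec_eq_iff lin_uminus)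

lemma mlin_diff: "mlin (\<lambda>j. V j - W j) = mlin V - mlin W"
  using mlin_add[of V "\<lambda>j. - W j"] by (simp add: mlin_uminus)

lemma mlin_sum: "mlin (\<lambda>j. \<Sum>i\<in>I. V i j) = (\<Sum>i\<in>I. mlin (V i))"
  by (simp add: mlin_def vec_eq_iff lin_sum)

lemma mlin_zero [simp]: "mlin (\<lambda>j. 0) = 0"
  by (simp add: mlin_def vec_eq_iff)

section \<open>Tangent spaces of products of special orthogonal groups\<close>

lemma tendsto_fun_iff:
  fixes f :: "'b \<Rightarrow> 'a \<Rightarrow> 'c::topological_space"
  shows "(f \<longlongrightarrow> l) F \<longleftrightarrow> (\<forall>i. ((\<lambda>x. f x i) \<longlongrightarrow> l i) F)"
proof
  assume h: "(f \<longlongrightarrow> l) F"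
  show "\<forall>i. ((\<lambda>x. f x i) \<longlongrightarrow> l i) F"
  proof
    fix i
    show "((\<lambda>x. f x i) \<longlongrightarrow> l i) F"
    proof (rule topological_tendstoI)
      fix S assume "open S" "l i \<in> S"
      then have "open ((\<lambda>g::'a \<Rightarrow> 'c. g i) -` S)" "l \<in> (\<lambda>g. g i) -` S"
        by (auto intro!: open_vimage continuous_on_product_coordinates)
      then show "\<forall>\<^sub>F x in F. f x i \<in> S" using topological_tendstoD[OF h] by fastforce
    qed
  qed
next
  assume h: "\<forall>i. ((\<lambda>x. f x i) \<longlongrightarrow> l i) F"
  show "(f \<longlongrightarrow> l) F"
  proof (rule topological_tendstoI)
    fix S assume "open S" "l \<in> S"
    then obtain X where X: "l \<in> Pi\<^sub>E UNIV X" "\<And>i. open (X i)" "finite {i. X i \<noteq> UNIV}" "Pi\<^sub>E UNIV X \<subseteq> S"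
      using product_topology_open_contains_basis[of "\<lambda>_. euclidean" UNIV S l]
      by (auto simp: open_fun_def)
    have "\<forall>\<^sub>F x in F. \<forall>i\<in>{i. X i \<noteq> UNIV}. f x i \<in> X i"
      by (rule eventually_ball_finite[OF X(3)])
        (use h X(1,2) in \<open>auto simp: PiE_iff intro!: topological_tendstoD\<close>)
    then show "\<forall>\<^sub>F x in F. f x \<in> S"
    proof eventually_elim
      case (elim x)
      then have "f x \<in> Pi\<^sub>E UNIV X" by auto
      then show ?case using X by auto
    qed
  qed
qed

lemma tendsto_matrix_mult:
  fixes f :: "'a \<Rightarrow> real^'n^'n"
  shows "(f \<longlongrightarrow> A) F \<Longrightarrow> (g \<longlongrightarrow> B) F \<Longrightarrow> ((\<lambda>x. f x ** g x) \<longlongrightarrow> A ** B) F"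
  unfolding matrix_matrix_mult_def
  by (intro vec_tendstoI) (auto intro!: tendsto_intros tendsto_vec_nth)

lemma tendsto_transpose:
  fixes f :: "'a \<Rightarrow> real^'n^'n"
  shows "(f \<longlongrightarrow> A) F \<Longrightarrow> ((\<lambda>x. transpose (f x)) \<longlongrightarrow> transpose A) F"
  unfolding Finite_Cartesian_Product.transpose_def
  by (intro vec_tendstoI) (auto intro!: tendsto_vec_nth)

lemma scaleR_fun_apply [simp]: "(c *\<^sub>R f) x = c *\<^sub>R f x"
  by (simp add: scaleR_fun_def)

lemma sum_fun_apply: "(sum f I) x = (\<Sum>i\<in>I. f i x)"
  by (induction I rule: infinite_finite_induct) auto

lemma matrix_scaleR_mult:
  fixes A B :: "real^'n^'n"
  shows "(c *\<^sub>R A) ** B = c *\<^sub>R (A ** B)" "A ** (c *\<^sub>R B) = c *\<^sub>R (A ** B)"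
  by (simp_all add: matrix_matrix_mult_def vec_eq_iff sum_distrib_left algebra_simps)

lemma matrix_diff_distrib:
  fixes A B C :: "'a::ring_1^'n^'n"
  shows "(A - B) ** C = A ** C - B ** C" "A ** (B - C) = A ** B - A ** C"
    "(- A) ** B = - (A ** B)" "A ** (- B) = - (A ** B)"
    "(0::'a^'n^'n) ** A = 0" "A ** (0::'a^'n^'n) = 0"
    "(A + B) ** C = A ** C + B ** C" "A ** (B + C) = A ** B + A ** C"
  by (simp_all add: matrix_matrix_mult_def vec_eq_iff sum_subtractf algebra_simps sum_negf sum.distrib)

lemma transpose_linear:
  fixes A B :: "'a::ring_1^'n^'n"
  shows "transpose (A + B) = transpose A + transpose B" "transpose (A - B) = transpose A - transpose B"
    "transpose (- A) = - transpose A" "transpose (0::'a^'n^'n) = 0"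
  by (simp_all add: Finite_Cartesian_Product.transpose_def vec_eq_iff)

lemma SO_transpose:
  assumes "A \<in> SO"
  shows "transpose A ** A = mat 1" "A ** transpose A = mat 1"
  using assms by (auto simp: SO_def rotation_matrix_def orthogonal_matrix_def)

lemma matrix_inv_eqI:
  fixes A B :: "'a::semiring_1^'n^'n"
  assumes "A ** B = mat 1" "B ** A = mat 1" shows "matrix_inv A = B"
  unfolding matrix_inv_def
proof (rule some_equality)
  fix C assume C: "A ** C = mat 1 \<and> C ** A = mat 1"
  then have "C = C ** (A ** B)" using assms by simp
  also have "\<dots> = B" using C by (simp add: matrix_mul_assoc)
  finally show "C = B" .
qed (use assms in simp)

lemma matrix_inv_invertible:
  fixes A :: "'a::semiring_1^'n^'n"
  assumes "invertible A" shows "A ** matrix_inv A = mat 1" "matrix_inv A ** A = mat 1"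
  using someI_ex[OF assms[unfolded invertible_def]] unfolding matrix_inv_def by auto

lemma SO_matrix_inv: "A \<in> SO \<Longrightarrow> matrix_inv A = transpose A"
  by (intro matrix_inv_eqI SO_transpose)

lemma SO_mult: "A \<in> SO \<Longrightarrow> B \<in> SO \<Longrightarrow> A ** B \<in> SO"
  by (simp add: SO_def rotation_matrix_def orthogonal_matrix_mul det_mul)

lemma SO_transpose_in: "A \<in> SO \<Longrightarrow> transpose A \<in> SO"
  by (simp add: SO_def rotation_matrix_def orthogonal_matrix_transpose)

lemma SO_mat1: "mat 1 \<in> SO"
  by (simp add: SO_def rotation_matrix_def orthogonal_matrix_id)

section \<open>Products of copies of SO and their tangent vectors\<close>

definition SOT :: "nat set \<Rightarrow> 'n::finite tuple set" where
  "SOT J = {h. \<forall>j. if j \<in> J then h j \<in> SO else h j = 0}"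

lemma NG_eq: "NG r = SOT {1..r}" and NGbar_eq: "NGbar r = SOT {..r}"
  by (auto simp: NG_def NGbar_def SOT_def)

text \<open>For \<open>j\<close> in \<open>J\<close> the condition says that the left translate of
  \<open>v j\<close> to the identity is skew-symmetric.\<close>

definition so_tangent :: "nat set \<Rightarrow> 'n::finite tuple \<Rightarrow> 'n tuple set" where
  "so_tangent J h = {v. \<forall>j. if j \<in> J then transpose (h j) ** v j + transpose (v j) ** h j = 0 else v j = 0}"

lemma subspace_so_tangent: "subspace (so_tangent J h)"
proof -
  have a: "A ** (B + C) + (transpose (B + C)) ** A' = (A ** B + transpose B ** A') + (A ** C + transpose C ** A')"
    for A A' B C :: "real^'n^'n"
    by (simp add: matrix_diff_distrib transpose_linear algebra_simps)
  have b: "A ** (c *\<^sub>R B) + (transpose (c *\<^sub>R B)) ** A' = c *\<^sub>R (A ** B + transpose B ** A')"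
    for A A' B :: "real^'n^'n" and c
    by (simp add: matrix_scaleR_mult transpose_scalar scaleR_add_right)
  show ?thesis
    unfolding subspace_def so_tangent_def
    by (auto simp: a b matrix_diff_distrib(5,6) transpose_linear(4) split: if_splits)
qed

lemma at_right_limit_eq:
  fixes f :: "real \<Rightarrow> 'a::t2_space"
  shows "(f \<longlongrightarrow> L) (at_right 0) \<Longrightarrow> \<forall>\<^sub>F s in at_right 0. f s = c \<Longrightarrow> L = c"
  by (rule tendsto_unique[OF trivial_limit_at_right_real _ tendsto_eventually])

lemma velocity_SOT:
  assumes "\<forall>\<^sub>F s in at_right 0. c s \<in> SOT J" "h \<in> SOT J"
    "((\<lambda>s. (c s - h) /\<^sub>R s) \<longlongrightarrow> v) (at_right (0::real))"
  shows "v \<in> so_tangent J h"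
proof -
  have "if j \<in> J then transpose (h j) ** v j + transpose (v j) ** h j = 0 else v j = 0" for j
  proof -
    have l: "((\<lambda>s. (c s j - h j) /\<^sub>R s) \<longlongrightarrow> v j) (at_right 0)"
      using assms(3)[unfolded tendsto_fun_iff, rule_format, of j] by simp
    have pos: "\<forall>\<^sub>F s in at_right (0::real). 0 < s" by (simp add: eventually_at_right_less)
    show ?thesis
    proof (cases "j \<in> J")
      case False
      have "\<forall>\<^sub>F s in at_right (0::real). (c s j - h j) /\<^sub>R s = 0"
        using assms(1) by eventually_elim (use assms(2) False in \<open>auto simp: SOT_def\<close>)
      then show ?thesis using at_right_limit_eq[OF l] False by simp
    next
      case True
      let ?A = "transpose (h j)"
      have "((\<lambda>s. s *\<^sub>R ((c s j - h j) /\<^sub>R s) + h j) \<longlongrightarrow> 0 *\<^sub>R v j + h j) (at_right 0)"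
        by (intro tendsto_intros l)
      moreover have "\<forall>\<^sub>F s in at_right 0. s *\<^sub>R ((c s j - h j) /\<^sub>R s) + h j = c s j"
        using pos by eventually_elim simp
      ultimately have cl: "((\<lambda>s. c s j) \<longlongrightarrow> h j) (at_right 0)"
        by (simp add: tendsto_cong)
      \<comment> \<open>With \<open>c s j\<close> and not \<open>h j\<close> as the last factor the
        expression vanishes exactly for every \<open>s\<close>, since both matrices are orthogonal;
        in the limit \<open>c s j\<close> becomes \<open>h j\<close>.\<close>
      have "((\<lambda>s. ?A ** ((c s j - h j) /\<^sub>R s) + transpose ((c s j - h j) /\<^sub>R s) ** c s j) \<longlongrightarrow>
          ?A ** v j + transpose (v j) ** h j) (at_right 0)"
        by (intro tendsto_intros tendsto_matrix_mult tendsto_transpose l cl)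
      moreover have "\<forall>\<^sub>F s in at_right 0.
          ?A ** ((c s j - h j) /\<^sub>R s) + transpose ((c s j - h j) /\<^sub>R s) ** c s j = 0"
        using assms(1)
      proof eventually_elim
        case (elim s)
        then have "c s j \<in> SO" "h j \<in> SO" using assms(2) True by (auto simp: SOT_def)
        then have "?A ** (c s j - h j) + transpose (c s j - h j) ** c s j = 0"
          by (simp add: matrix_diff_distrib transpose_linear SO_transpose)
        moreover have "?A ** ((c s j - h j) /\<^sub>R s) + transpose ((c s j - h j) /\<^sub>R s) ** c s j =
            (?A ** (c s j - h j) + transpose (c s j - h j) ** c s j) /\<^sub>R s"
          by (simp add: matrix_scaleR_mult transpose_scalar scaleR_add_right)
        ultimately show ?case by simp
      qed
      ultimately have "?A ** v j + transpose (v j) ** h j = 0"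
        by (rule at_right_limit_eq)
      then show ?thesis using True by simp
    qed
  qed
  then show ?thesis by (simp add: so_tangent_def)
qed

text \<open>For skew-symmetric \<open>A\<close> a curve in SO through the identity with velocity
  \<open>2A\<close>. It is rational in \<open>s\<close> and takes the place of the
  exponential.\<close>

definition cayley :: "real^'n^'n \<Rightarrow> real \<Rightarrow> real^'n^'n" where
  "cayley A s = matrix_inv (mat 1 - s *\<^sub>R A) ** (mat 1 + s *\<^sub>R A)"

text \<open>A vector \<open>x\<close> in the kernel satisfies \<open>x = s A x\<close>, while x is
  orthogonal to \<open>A x\<close> for skew-symmetric \<open>A\<close>. So \<open>x\<close> is
  orthogonal to itself.\<close>

lemma skew_invertible:
  fixes A :: "real^'n^'n"
  assumes "transpose A = - A"
  shows "invertible (mat 1 - s *\<^sub>R A)"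
proof -
  have "x = 0" if h: "(mat 1 - s *\<^sub>R A) *v x = 0" for x
  proof -
    have 1: "x = s *\<^sub>R (A *v x)"
      using h by (simp add: matrix_vector_mult_diff_rdistrib scaleR_matrix_vector_assoc)
    have "x \<bullet> (A *v x) = (transpose A *v x) \<bullet> x"
      by (simp add: dot_lmul_matrix)
    also have "\<dots> = - (x \<bullet> (A *v x))"
      unfolding assms by (simp add: inner_commute matrix_vector_mult_def inner_vec_def sum_negf sum_distrib_left)
    finally have "x \<bullet> (A *v x) = 0" by simp
    then have "x \<bullet> x = 0" by (subst (2) 1) simp
    then show ?thesis by simp
  qed
  then show ?thesis
    using matrix_left_invertible_ker[of "mat 1 - s *\<^sub>R A"] invertible_left_inverse by blast
qed

text \<open>Let N = 1 - sA and P = 1 + sA. Orthogonality holds because P is the transpose of N and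
  commutes with it, and the determinant is 1 because N and P have the same determinant. The second
  claim is \<open>N C = P\<close> rewritten; it yields the velocity at 0 without differentiating an
  inverse.\<close>

lemma cayley_SO:
  fixes A :: "real^'n^'n"
  assumes A: "transpose A = - A"
  shows "cayley A s \<in> SO" "cayley A s - mat 1 = s *\<^sub>R (A ** (cayley A s + mat 1))"
proof -
  define N where "N = mat 1 - s *\<^sub>R A"
  define P where "P = mat 1 + s *\<^sub>R A"
  define I where "I = matrix_inv N"
  define C where "C = cayley A s"
  have C: "C = I ** P" by (simp add: C_def cayley_def I_def N_def P_def)
  have I: "N ** I = mat 1" "I ** N = mat 1"
    using matrix_inv_invertible[OF skew_invertible[OF A, of s]] unfolding I_def N_def by auto
  have NT: "transpose N = P" by (simp add: N_def P_def transpose_linear transpose_scalar A)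
  have PT: "transpose P = N" using NT by (metis transpose_transpose)
  have comm: "P ** N = N ** P"
    by (simp add: N_def P_def matrix_diff_distrib matrix_scaleR_mult algebra_simps)
  have IP: "I ** P = P ** I"
    by (metis I comm matrix_mul_assoc matrix_mul_lid matrix_mul_rid)
  have 1: "transpose I ** P = mat 1"
    using arg_cong[OF I(1), of transpose] by (simp add: matrix_transpose_mul NT)
  have "transpose C = N ** transpose I" unfolding C matrix_transpose_mul PT ..
  then have "transpose C ** C = N ** transpose I ** P ** I"
    by (simp add: C IP matrix_mul_assoc)
  also have "\<dots> = mat 1" by (metis 1 I(1) matrix_mul_assoc matrix_mul_rid)
  finally have "orthogonal_matrix C" by (simp add: orthogonal_matrix)
  moreover have "det C = 1"
  proof -
    have "det C = det I * det N" unfolding C det_mul using NT det_transpose[of N] by simp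
    also have "\<dots> = 1" using I(2) by (metis det_I det_mul)
    finally show ?thesis .
  qed
  ultimately show "cayley A s \<in> SO" by (simp add: SO_def rotation_matrix_def C_def)
  have "N ** C = P" unfolding C by (metis I(1) matrix_mul_assoc matrix_mul_lid)
  then have "C - s *\<^sub>R (A ** C) = mat 1 + s *\<^sub>R A"
    by (simp add: N_def P_def matrix_diff_distrib matrix_scaleR_mult)
  then show "cayley A s - mat 1 = s *\<^sub>R (A ** (cayley A s + mat 1))"
    unfolding C_def[symmetric] by (simp add: matrix_diff_distrib algebra_simps)
qed

lemma SO_entry_bound: "A \<in> SO \<Longrightarrow> \<bar>A $ i $ j\<bar> \<le> 1"
proof -
  assume "A \<in> SO"
  then have "(\<Sum>k\<in>UNIV. A $ k $ j * A $ k $ j) = 1"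
    using SO_transpose(1)[of A] by (auto simp: matrix_matrix_mult_def mat_def vec_eq_iff Finite_Cartesian_Product.transpose_def)
  moreover have "A $ i $ j * A $ i $ j \<le> (\<Sum>k\<in>UNIV. A $ k $ j * A $ k $ j)"
    by (rule member_le_sum) auto
  ultimately show ?thesis by (simp add: abs_square_le_1[symmetric] power2_eq_square)
qed

text \<open>The entries of the Cayley curve are bounded by 1, so its difference to the identity,
  which is \<open>s\<close> times a bounded matrix, tends to 0. The difference quotient
  \<open>A (C + 1)\<close> then tends to \<open>2A\<close>.\<close>

lemma cayley_velocity:
  fixes A :: "real^'n^'n"
  assumes A: "transpose A = - A"
  shows "((\<lambda>s. (cayley A s - mat 1) /\<^sub>R s) \<longlongrightarrow> 2 *\<^sub>R A) (at 0)"
proof -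
  have "((\<lambda>s. cayley A s - mat 1) \<longlongrightarrow> 0) (at 0)"
  proof (intro vec_tendstoI)
    fix a b
    define K where "K = (\<Sum>k\<in>UNIV. \<bar>A $ a $ k\<bar> * 2)"
    have b2: "\<bar>cayley A s $ k $ b + mat 1 $ k $ b\<bar> \<le> 2" for s k
      using SO_entry_bound[OF cayley_SO(1)[OF A], of s k b] by (auto simp: mat_def)
    have bound: "\<bar>(cayley A s - mat 1) $ a $ b\<bar> \<le> \<bar>s\<bar> * K" for s
    proof -
      have "\<bar>\<Sum>k\<in>UNIV. A $ a $ k * (cayley A s $ k $ b + mat 1 $ k $ b)\<bar> \<le> K"
        unfolding K_def
        by (rule order_trans[OF sum_abs]) (intro sum_mono, simp add: abs_mult mult_left_mono b2)
      then have "\<bar>s\<bar> * \<bar>\<Sum>k\<in>UNIV. A $ a $ k * (cayley A s $ k $ b + mat 1 $ k $ b)\<bar> \<le> \<bar>s\<bar> * K"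
        by (rule mult_left_mono) simp
      moreover have "(cayley A s - mat 1) $ a $ b =
          s * (\<Sum>k\<in>UNIV. A $ a $ k * (cayley A s $ k $ b + mat 1 $ k $ b))"
        unfolding cayley_SO(2)[OF A] by (simp add: matrix_matrix_mult_def)
      ultimately show ?thesis by (simp add: abs_mult)
    qed
    have lim: "((\<lambda>s. \<bar>s\<bar> * K) \<longlongrightarrow> 0) (at 0)"
      by (auto intro!: tendsto_eq_intros)
    show "((\<lambda>s. (cayley A s - mat 1) $ a $ b) \<longlongrightarrow> (0::real^'n^'n) $ a $ b) (at 0)"
      unfolding zero_index
      by (rule Lim_null_comparison[OF _ lim], rule always_eventually, rule allI, unfold real_norm_def, rule bound)
  qed
  then have c: "(cayley A \<longlongrightarrow> mat 1) (at 0)" using Lim_null by blast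
  have "((\<lambda>s. A ** (cayley A s + mat 1)) \<longlongrightarrow> A ** (mat 1 + mat 1)) (at 0)"
    by (intro tendsto_matrix_mult tendsto_intros c)
  moreover have "\<forall>\<^sub>F s in at (0::real). A ** (cayley A s + mat 1) = (cayley A s - mat 1) /\<^sub>R s"
    using eventually_neq_at_within[of 0 0 UNIV] by eventually_elim (simp add: cayley_SO(2)[OF A])
  moreover have "A ** (mat 1 + mat 1) = 2 *\<^sub>R A"
    unfolding matrix_diff_distrib(8) scaleR_2 by simp
  ultimately show ?thesis by (simp add: tendsto_cong)
qed

lemma so_tangent_velocity:
  assumes h: "h \<in> SOT J" and v: "v \<in> so_tangent J h"
  obtains c where "c 0 = h" "\<And>s. c s \<in> SOT J" "((\<lambda>s. (c s - h) /\<^sub>R s) \<longlongrightarrow> v) (at_right (0::real))"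
proof
  \<comment> \<open>The factor 1/2 compensates for the velocity \<open>2A\<close> of the Cayley
    curve.\<close>
  define A where "A j = (1/2) *\<^sub>R (transpose (h j) ** v j)" for j
  define c where "c s = (\<lambda>j. if j \<in> J then h j ** cayley (A j) s else 0)" for s
  have A: "transpose (A j) = - A j" if "j \<in> J" for j
  proof -
    have "transpose (h j) ** v j + transpose (v j) ** h j = 0" using v that by (auto simp: so_tangent_def split: if_splits)
    then have "transpose (v j) ** h j = - (transpose (h j) ** v j)" by (simp add: add_eq_0_iff)
    then show ?thesis by (simp add: A_def transpose_scalar matrix_transpose_mul)
  qed
  have SO: "h j \<in> SO" if "j \<in> J" for j using h that by (auto simp: SOT_def)
  have h0: "h j = 0" if "j \<notin> J" for j using h that by (auto simp: SOT_def)
  have v0: "v j = 0" if "j \<notin> J" for j using v that by (auto simp: so_tangent_def)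
  have "cayley (A j) 0 = mat 1" if "j \<in> J" for j using cayley_SO(2)[OF A[OF that], of 0] by simp
  then show "c 0 = h" by (auto simp: c_def h0)
  show "c s \<in> SOT J" for s using SO_mult[OF SO cayley_SO(1)[OF A]] by (auto simp: c_def SOT_def)
  show "((\<lambda>s. (c s - h) /\<^sub>R s) \<longlongrightarrow> v) (at_right (0::real))"
    unfolding tendsto_fun_iff
  proof
    fix j show "((\<lambda>s. ((c s - h) /\<^sub>R s) j) \<longlongrightarrow> v j) (at_right (0::real))"
    proof (cases "j \<in> J")
      case True
      have "((\<lambda>s. h j ** ((cayley (A j) s - mat 1) /\<^sub>R s)) \<longlongrightarrow> h j ** (2 *\<^sub>R A j)) (at_right 0)"
        by (intro tendsto_matrix_mult tendsto_const tendsto_mono[OF at_le cayley_velocity] A True) simp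
      moreover have "h j ** (2 *\<^sub>R A j) = v j"
        using SO_transpose(2)[OF SO[OF True]] by (simp add: A_def matrix_scaleR_mult matrix_mul_assoc)
      moreover have "((c s - h) /\<^sub>R s) j = h j ** ((cayley (A j) s - mat 1) /\<^sub>R s)" for s
        using True by (simp add: c_def matrix_scaleR_mult matrix_diff_distrib)
      ultimately show ?thesis by simp
    qed (simp add: c_def h0 v0)
  qed
qed

lemma tangent_space_SOT:
  assumes h: "h \<in> SOT J" shows "tangent_space (SOT J) h = so_tangent J h"
proof
  show "tangent_space (SOT J) h \<subseteq> so_tangent J h"
    unfolding tangent_space_def
    by (rule span_minimal[OF subsetI subspace_so_tangent], elim CollectE exE conjE)
      (rule velocity_SOT[OF _ h])
  show "so_tangent J h \<subseteq> tangent_space (SOT J) h"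
  proof
    fix v assume "v \<in> so_tangent J h"
    then obtain c where "c 0 = h" "\<And>s. c s \<in> SOT J" "((\<lambda>s. (c s - h) /\<^sub>R s) \<longlongrightarrow> v) (at_right (0::real))"
      using so_tangent_velocity[OF h] by blast
    then show "v \<in> tangent_space (SOT J) h"
      unfolding tangent_space_def by (intro span_base CollectI exI[of _ c]) auto
  qed
qed

section \<open>The simplex as an additional factor\<close>

definition simplex_tangent :: "nat \<Rightarrow> (nat \<Rightarrow> real) set" where
  "simplex_tangent r = {a. (\<Sum>i\<le>r. a i) = 0 \<and> (\<forall>i>r. a i = 0)}"

lemma subspace_simplex_tangent: "subspace (simplex_tangent r)"
  by (auto simp: subspace_def simplex_tangent_def sum.distrib sum_distrib_left[symmetric])

lemma simplex_vec_tangent: "j \<in> {1..r} \<Longrightarrow> simplex_vec j \<in> simplex_tangent r"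
proof -
  assume j: "j \<in> {1..r}"
  have "(\<Sum>i\<le>r. simplex_vec j i) = (\<Sum>i\<le>r. of_bool (i = j)) - (\<Sum>i\<le>r. of_bool (i = 0))"
    unfolding sum_subtractf[symmetric] by (rule sum.cong) (use j in \<open>auto simp: simplex_vec_def\<close>)
  then show ?thesis using j by (auto simp: simplex_tangent_def simplex_vec_def sum.delta of_bool_def)
qed

text \<open>At a boundary point of the simplex only inward velocities occur. The vectors from
  \<open>t\<close> to the vertices are always among them and they span: \<open>a\<close> is the sum
  of the \<open>a i\<close> times (vertex i minus \<open>t\<close>) as soon as the
  \<open>a i\<close> add up to 0.\<close>

lemma tangent_space_simplex_SOT:
  fixes h :: "'a::finite tuple"
  assumes t: "t \<in> standard_simplex r" and h: "h \<in> SOT J"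
  shows "tangent_space (standard_simplex r \<times> SOT J) (t, h) = simplex_tangent r \<times> so_tangent J h"
proof
  show "tangent_space (standard_simplex r \<times> SOT J) (t, h) \<subseteq> simplex_tangent r \<times> so_tangent J h"
    unfolding tangent_space_def
  proof (rule span_minimal, safe)
    fix a v c
    assume c: "c (0::real) = (t, h)" "\<forall>\<^sub>F s in at_right 0. c s \<in> standard_simplex r \<times> SOT J"
      "((\<lambda>s. (c s - (t, h)) /\<^sub>R s) \<longlongrightarrow> (a, v)) (at_right 0)"
    have 1: "((\<lambda>s. (fst (c s) - t) /\<^sub>R s) \<longlongrightarrow> a) (at_right 0)" using tendsto_fst[OF c(3)] by simp
    have 2: "((\<lambda>s. (snd (c s) - h) /\<^sub>R s) \<longlongrightarrow> v) (at_right 0)" using tendsto_snd[OF c(3)] by simp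
    show "v \<in> so_tangent J h"
      by (rule velocity_SOT[OF _ h 2]) (use c(2) in \<open>auto elim: eventually_mono\<close>)
    have l: "((\<lambda>s. (fst (c s) i - t i) / s) \<longlongrightarrow> a i) (at_right 0)" for i
      using 1[unfolded tendsto_fun_iff, rule_format, of i] by (simp add: divide_inverse mult.commute)
    have "a i = 0" if "i > r" for i
    proof -
      have "\<forall>\<^sub>F s in at_right 0. (fst (c s) i - t i) / s = 0"
        using c(2) by eventually_elim (use that t in \<open>auto simp: standard_simplex_def mem_Times_iff\<close>)
      then show ?thesis by (rule at_right_limit_eq[OF l])
    qed
    moreover have "(\<Sum>i\<le>r. a i) = 0"
    proof -
      have "((\<lambda>s. \<Sum>i\<le>r. (fst (c s) i - t i) / s) \<longlongrightarrow> (\<Sum>i\<le>r. a i)) (at_right 0)"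
        by (intro tendsto_sum l)
      moreover have "\<forall>\<^sub>F s in at_right 0. (\<Sum>i\<le>r. (fst (c s) i - t i) / s) = 0"
        using c(2) by eventually_elim
          (use t in \<open>auto simp: standard_simplex_def mem_Times_iff sum_divide_distrib[symmetric] sum_subtractf\<close>)
      ultimately show ?thesis by (rule at_right_limit_eq)
    qed
    ultimately show "a \<in> simplex_tangent r" by (simp add: simplex_tangent_def)
  qed (intro subspace_Times subspace_simplex_tangent subspace_so_tangent)
  let ?T = "tangent_space (standard_simplex r \<times> SOT J) (t, h)"
  show "simplex_tangent r \<times> so_tangent J h \<subseteq> ?T"
  proof safe
    fix a v assume a: "a \<in> simplex_tangent r" and v: "v \<in> so_tangent J h"
    obtain c where c: "c 0 = h" "\<And>s. c s \<in> SOT J" "((\<lambda>s. (c s - h) /\<^sub>R s) \<longlongrightarrow> v) (at_right (0::real))"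
      using so_tangent_velocity[OF h v] by blast
    have sub: "subspace ?T" by (simp add: tangent_space_def)
    have "(0, v) \<in> ?T"
      unfolding tangent_space_def
      using tendsto_Pair[OF tendsto_const[of 0] c(3)] c(1,2) t
      by (intro span_base CollectI exI[of _ "\<lambda>s. (t, c s)"]) auto
    moreover have "(a, 0) \<in> ?T"
    proof -
      let ?e = "\<lambda>i j. of_bool (j = i) :: real"
      have "(?e i - t, 0) \<in> ?T" if i: "i \<le> r" for i
        unfolding tangent_space_def
      proof (intro span_base CollectI exI[of _ "\<lambda>s::real. (t + s *\<^sub>R (?e i - t), h)"] conjI)
        have "\<forall>\<^sub>F s in at_right (0::real). s < 1" by (auto simp: eventually_at_right_field intro: exI[of _ 1])
        moreover have "\<forall>\<^sub>F s in at_right (0::real). 0 < s" by (simp add: eventually_at_right_less)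
        ultimately show "\<forall>\<^sub>F s in at_right 0. (t + s *\<^sub>R (?e i - t), h) \<in> standard_simplex r \<times> SOT J"
        proof eventually_elim
          case (elim s)
          have "(\<lambda>j. (1 - s) * t j + s * (if j = i then 1 else 0)) \<in> standard_simplex r"
            using elim t i by (intro convex_standard_simplex) auto
          moreover have "(\<lambda>j. (1 - s) * t j + s * (if j = i then 1 else 0)) = t + s *\<^sub>R (?e i - t)"
            by (auto simp: fun_eq_iff algebra_simps)
          ultimately show ?case using h by simp
        qed
        have "\<forall>\<^sub>F s in at_right (0::real). ((t + s *\<^sub>R (?e i - t), h) - (t, h)) /\<^sub>R s = (?e i - t, 0)"
          using eventually_at_right_less[of "0::real"] by eventually_elim simp
        then show "((\<lambda>s. ((t + s *\<^sub>R (?e i - t), h) - (t, h)) /\<^sub>R s) \<longlongrightarrow> (?e i - t, 0)) (at_right 0)"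
          by (rule tendsto_eventually)
      qed simp
      then have "(\<Sum>i\<le>r. a i *\<^sub>R (?e i - t, 0::'a tuple)) \<in> ?T"
        by (intro subspace_sum[OF sub] subspace_scale[OF sub]) auto
      moreover have "(\<Sum>i\<le>r. a i *\<^sub>R (?e i - t, 0::'a tuple)) = (a, 0)"
      proof -
        have "(\<Sum>i\<le>r. a i * (of_bool (j = i) - t j)) = a j" for j
        proof -
          have "(\<Sum>i\<le>r. a i * (of_bool (j = i) - t j)) = (\<Sum>i\<le>r. if i = j then a j else 0) - (\<Sum>i\<le>r. a i) * t j"
            unfolding sum_distrib_right sum_subtractf[symmetric] by (rule sum.cong) (auto simp: algebra_simps)
          then show ?thesis using a by (auto simp: simplex_tangent_def)
        qed
        then have "(\<Sum>i\<le>r. a i *\<^sub>R (?e i - t)) = a"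
          by (auto simp: fun_eq_iff sum_fun_apply)
        then show ?thesis by (simp add: prod_eq_iff fst_sum snd_sum)
      qed
      ultimately show ?thesis by simp
    qed
    ultimately show "(a, v) \<in> ?T" using subspace_add[OF sub] by fastforce
  qed
qed

section \<open>Independence of the exterior derivative of the extension\<close>

definition ins_at :: "nat \<Rightarrow> 'a \<Rightarrow> (nat \<Rightarrow> 'a) \<Rightarrow> nat \<Rightarrow> 'a" where
  "ins_at i z u = (\<lambda>j. if j < i then u j else if j = i then z else u (j - 1))"

lemma alternating_add:
  assumes "alternating s a" "i < s" shows "a (v(i := u + w)) = a (v(i := u)) + a (v(i := w))"
  using assms linear_add[of "\<lambda>u. a (v(i := u))"] by (simp add: alternating_def)

lemma alternating_scale:
  assumes "alternating s a" "i < s" shows "a (v(i := r *\<^sub>R u)) = r * a (v(i := u))"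
  using assms linear_scale[of "\<lambda>u. a (v(i := u))"] by (simp add: alternating_def)

lemma alternating_swap:
  assumes "alternating s a" "i < s" "j < s" "i \<noteq> j"
  shows "a (v(i := y, j := x)) = - a (v(i := x, j := y))"
proof -
  have z: "a (v(i := x, j := x)) = 0" for x
    using assms unfolding alternating_def by (metis fun_upd_def)
  have i: "a (v(i := p + q, j := r)) = a (v(i := p, j := r)) + a (v(i := q, j := r))" for p q r
    using alternating_add[OF assms(1,2), of "v(j := r)" p q] assms(4) by (simp add: fun_upd_twist)
  have "0 = a (v(i := x + y, j := x + y))" by (simp add: z)
  also have "\<dots> = a (v(i := x, j := y)) + a (v(i := y, j := x))"
    unfolding alternating_add[OF assms(1,3)] i by (simp add: z)
  finally show ?thesis by simp
qed

text \<open>Moving the inserted vector by one place is one interchange of neighbouring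
  arguments.\<close>

lemma alternating_ins_at:
  assumes "alternating s a" "i \<le> m" "m < s"
  shows "a (ins_at i z u) = (-1) ^ (m - i) * a (ins_at m z u)"
  using assms(2,3)
proof (induction m rule: dec_induct)
  case (step m)
  let ?v = "ins_at m z u"
  have "ins_at m z u = (ins_at m z u)(m := z, Suc m := u m)"
    "ins_at (Suc m) z u = (ins_at m z u)(m := u m, Suc m := z)"
    by (auto simp: ins_at_def fun_eq_iff less_Suc_eq)
  then have "a (ins_at (Suc m) z u) = - a (ins_at m z u)"
    using alternating_swap[OF assms(1), of m "Suc m" "ins_at m z u" "u m" z] step by auto
  then show ?case using step by (simp add: Suc_diff_le)
qed simp

text \<open>The coordinates \<open>\<kappa>\<close> and vectors \<open>E\<close> present a finite-dimensional subspace containing \<open>M\<close>; the affine vector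
  field \<open>y \<mapsto> v + L x v (y - x)\<close> extends the tangent vector \<open>v\<close> at \<open>x\<close> and is tangent to \<open>M\<close>.\<close>

locale spanned_set =
  fixes M :: "'a::{real_vector,t2_space} set" and I :: "'i set" and \<kappa> :: "'i \<Rightarrow> 'a \<Rightarrow> real"
    and E :: "'i \<Rightarrow> 'a" and L :: "'a \<Rightarrow> 'a \<Rightarrow> 'a \<Rightarrow> 'a"
  assumes fin: "finite I"
    and \<kappa>_linear: "i \<in> I \<Longrightarrow> linear (\<kappa> i)"
    and \<kappa>_cont: "i \<in> I \<Longrightarrow> continuous_on UNIV (\<kappa> i)"
    \<comment> \<open>The class \<open>real_vector\<close> does not tie the vector operations to the
      topology; this condition supplies the continuity that is used.\<close>
    and conv: "(\<And>i. i \<in> I \<Longrightarrow> (\<lambda>n. b n i) \<longlonglongrightarrow> 0) \<Longrightarrow> (\<lambda>n::nat. x + (\<Sum>i\<in>I. b n i *\<^sub>R E i)) \<longlonglongrightarrow> x"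
    and span_M: "y \<in> M \<Longrightarrow> (\<Sum>i\<in>I. \<kappa> i y *\<^sub>R E i) = y"
    and span_T: "y \<in> M \<Longrightarrow> v \<in> tangent_space M y \<Longrightarrow> (\<Sum>i\<in>I. \<kappa> i v *\<^sub>R E i) = v"
    and L_linear: "linear (L y v)"
    and L_cont: "i \<in> I \<Longrightarrow> continuous_on UNIV (\<lambda>z. \<kappa> i (L y v z))"
    and span_L: "y \<in> M \<Longrightarrow> v \<in> tangent_space M y \<Longrightarrow> (\<Sum>i\<in>I. \<kappa> i (L y v z) *\<^sub>R E i) = L y v z"
    and L_tangent: "y \<in> M \<Longrightarrow> x \<in> M \<Longrightarrow> v \<in> tangent_space M x \<Longrightarrow> v + L x v (y - x) \<in> tangent_space M y"
    \<comment> \<open>The difference is the bracket at \<open>x\<close> of the affine fields that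
      extend \<open>v\<close> and \<open>w\<close>.\<close>
    and L_bracket: "x \<in> M \<Longrightarrow> v \<in> tangent_space M x \<Longrightarrow> w \<in> tangent_space M x \<Longrightarrow>
      L x w v - L x v w \<in> tangent_space M x"
begin

definition coord_span :: "'a set" where "coord_span = {v. (\<Sum>i\<in>I. \<kappa> i v *\<^sub>R E i) = v}"

text \<open>Otherwise there would be, for every n, an offset from \<open>x\<close> with coefficients
  below 1/(n+1) that leads out of \<open>V\<close>, although these points converge to
  \<open>x\<close> by \<open>conv\<close>.\<close>

lemma open_box:
  assumes "open V" "x \<in> V"
  shows "\<exists>\<delta>>0. \<forall>b. (\<forall>i\<in>I. \<bar>b i\<bar> < \<delta>) \<longrightarrow> x + (\<Sum>i\<in>I. b i *\<^sub>R E i) \<in> V"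
proof (rule ccontr)
  assume n: "\<not> ?thesis"
  have "\<exists>b. (\<forall>i\<in>I. \<bar>b i\<bar> < inverse (real (Suc n))) \<and> x + (\<Sum>i\<in>I. b i *\<^sub>R E i) \<notin> V" for n
    using n inverse_positive_iff_positive[of "real (Suc n)"] of_nat_0_less_iff[of "Suc n"] by blast
  then obtain b where b: "\<And>n i. i \<in> I \<Longrightarrow> \<bar>b n i\<bar> < inverse (real (Suc n))"
    "\<And>n. x + (\<Sum>i\<in>I. b n i *\<^sub>R E i) \<notin> V" by metis
  have "(\<lambda>n. b n i) \<longlonglongrightarrow> 0" if "i \<in> I" for i
    by (rule Lim_null_comparison[OF _ LIMSEQ_inverse_real_of_nat])
      (rule always_eventually, use b(1)[OF that] in \<open>auto intro: less_imp_le\<close>)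
  then have "(\<lambda>n. x + (\<Sum>i\<in>I. b n i *\<^sub>R E i)) \<longlonglongrightarrow> x" by (rule conv)
  then have "\<forall>\<^sub>F n in sequentially. x + (\<Sum>i\<in>I. b n i *\<^sub>R E i) \<in> V"
    using assms topological_tendstoD by blast
  then show False using b(2) by (auto simp: eventually_sequentially)
qed

lemma tendsto_box:
  assumes "\<And>i. i \<in> I \<Longrightarrow> (b i \<longlongrightarrow> 0) F"
  shows "((\<lambda>\<tau>. x + (\<Sum>i\<in>I. b i \<tau> *\<^sub>R E i)) \<longlongrightarrow> x) F"
proof (rule topological_tendstoI)
  fix V assume "open V" "x \<in> V"
  then obtain \<delta> where \<delta>: "\<delta> > 0" "\<And>b. (\<forall>i\<in>I. \<bar>b i\<bar> < \<delta>) \<Longrightarrow> x + (\<Sum>i\<in>I. b i *\<^sub>R E i) \<in> V"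
    using open_box by metis
  have "\<forall>\<^sub>F \<tau> in F. \<forall>i\<in>I. \<bar>b i \<tau>\<bar> < \<delta>"
  proof (rule eventually_ball_finite[OF fin], rule ballI)
    fix i assume "i \<in> I"
    then have "\<forall>\<^sub>F \<tau> in F. dist (b i \<tau>) 0 < \<delta>" using assms \<delta>(1) tendstoD by blast
    then show "\<forall>\<^sub>F \<tau> in F. \<bar>b i \<tau>\<bar> < \<delta>" by simp
  qed
  then show "\<forall>\<^sub>F \<tau> in F. x + (\<Sum>i\<in>I. b i \<tau> *\<^sub>R E i) \<in> V"
    by eventually_elim (rule \<delta>(2))
qed

lemma tendsto_line: "v \<in> coord_span \<Longrightarrow> ((\<lambda>s. x + s *\<^sub>R v) \<longlongrightarrow> x) (at 0)"
proof -
  assume v: "v \<in> coord_span"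
  have "((\<lambda>\<tau>. x + (\<Sum>i\<in>I. (\<tau> * \<kappa> i v) *\<^sub>R E i)) \<longlongrightarrow> x) (at 0)"
    by (rule tendsto_box) (auto intro!: tendsto_eq_intros)
  moreover have "(\<Sum>i\<in>I. (\<tau> * \<kappa> i v) *\<^sub>R E i) = \<tau> *\<^sub>R v" for \<tau>
    using v by (simp add: coord_span_def scaleR_sum_right[symmetric] flip: scaleR_scaleR)
  ultimately show ?thesis by simp
qed

lemma eventually_line:
  assumes "open U" "x \<in> U" "v \<in> coord_span" shows "\<forall>\<^sub>F s in nhds 0. x + s *\<^sub>R v \<in> U"
  using topological_tendstoD[OF tendsto_line[OF assms(3), of x] assms(1,2)] assms(2)
  by (auto simp: eventually_at_filter elim!: eventually_mono)

text \<open>Only directions in \<open>coord_span\<close> count: along these a line through a point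
  of an open set stays in the set for small parameters, by \<open>eventually_line\<close>.\<close>

definition C1 :: "'a set \<Rightarrow> ('a \<Rightarrow> real) \<Rightarrow> bool" where
  "C1 U f \<longleftrightarrow> continuous_on U f \<and> (\<forall>v\<in>coord_span.
     (\<forall>x\<in>U. ((\<lambda>s. f (x + s *\<^sub>R v)) has_field_derivative dir_deriv f v x) (at 0)) \<and>
     continuous_on U (dir_deriv f v))"

lemma C1_smooth: "smooth_on U f \<Longrightarrow> C1 U f"
proof -
  assume "smooth_on U f"
  then have "Ck_on (Suc 0) U f" unfolding smooth_on_def by blast
  moreover have "((\<lambda>s. f (x + s *\<^sub>R v)) has_field_derivative dir_deriv f v x) (at 0)"
    if "(\<lambda>s. f (x + s *\<^sub>R v)) field_differentiable at 0" for x v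
    using that by (simp add: dir_deriv_def DERIV_deriv_iff_field_differentiable)
  ultimately show ?thesis by (auto simp: C1_def)
qed

lemma C1_I:
  assumes "continuous_on U f"
    "\<And>v x. v \<in> coord_span \<Longrightarrow> x \<in> U \<Longrightarrow> ((\<lambda>s. f (x + s *\<^sub>R v)) has_field_derivative f' v x) (at 0)"
    "\<And>v. v \<in> coord_span \<Longrightarrow> continuous_on U (f' v)"
  shows "C1 U f"
proof -
  have "dir_deriv f v x = f' v x" if "v \<in> coord_span" "x \<in> U" for v x
    using assms(2)[OF that] by (simp add: dir_deriv_def DERIV_imp_deriv)
  moreover from this have "continuous_on U (dir_deriv f v)" if "v \<in> coord_span" for v
    using assms(3)[OF that] that continuous_on_cong by metis
  ultimately show ?thesis using assms(1,2) unfolding C1_def by auto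
qed

lemma C1_add: "C1 U f \<Longrightarrow> C1 U g \<Longrightarrow> C1 U (\<lambda>x. f x + g x)"
  by (rule C1_I[where f' = "\<lambda>v x. dir_deriv f v x + dir_deriv g v x"])
    (auto simp: C1_def intro!: continuous_intros DERIV_add)

lemma C1_mult:
  assumes "C1 U f" "C1 U g" shows "C1 U (\<lambda>x. f x * g x)"
proof (rule C1_I[where f' = "\<lambda>v x. dir_deriv f v x * g x + dir_deriv g v x * f x"])
  fix v x assume "v \<in> coord_span" "x \<in> U"
  then show "((\<lambda>s. f (x + s *\<^sub>R v) * g (x + s *\<^sub>R v)) has_field_derivative
      dir_deriv f v x * g x + dir_deriv g v x * f x) (at 0)"
    using assms DERIV_mult[of "\<lambda>s. f (x + s *\<^sub>R v)" "dir_deriv f v x" 0 UNIV "\<lambda>s. g (x + s *\<^sub>R v)" "dir_deriv g v x"]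
    by (simp add: C1_def)
qed (use assms in \<open>auto simp: C1_def intro!: continuous_intros\<close>)

lemma C1_sum: "(\<And>i. i \<in> A \<Longrightarrow> C1 U (f i)) \<Longrightarrow> C1 U (\<lambda>x. \<Sum>i\<in>A. f i x)"
proof (induction A rule: infinite_finite_induct)
  case (insert a A)
  then show ?case using C1_add[of U "f a" "\<lambda>x. \<Sum>i\<in>A. f i x"] by simp
qed (auto intro: C1_smooth polyfun_smooth polyfun.const)

lemma C1_cong:
  assumes "open U" "\<And>x. x \<in> U \<Longrightarrow> f x = g x" "C1 U g" shows "C1 U f"
proof (rule C1_I[where f' = "\<lambda>v. dir_deriv g v"])
  fix v x assume v: "v \<in> coord_span" and x: "x \<in> U"
  have "\<forall>\<^sub>F s in nhds 0. f (x + s *\<^sub>R v) = g (x + s *\<^sub>R v)"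
    using eventually_line[OF assms(1) x v] by eventually_elim (rule assms(2))
  then show "((\<lambda>s. f (x + s *\<^sub>R v)) has_field_derivative dir_deriv g v x) (at 0)"
    using assms(3) v x by (subst DERIV_cong_ev[OF refl _ refl]) (auto simp: C1_def)
qed (use assms in \<open>auto simp: C1_def cong: continuous_on_cong\<close>)

text \<open>The one-sided chain rule when only partial derivatives are known to be continuous. The
  coordinates are switched on one at a time, \<open>J\<close> being those already moving; the mean
  value theorem treats each of them, and continuity of the partial derivative removes the
  intermediate point in the limit.\<close>

lemma C1_chain:
  assumes U: "open U" "x \<in> U" and f: "C1 U f" and J: "J \<subseteq> I"
    and E: "\<And>i. i \<in> I \<Longrightarrow> E i \<in> coord_span"
    and b: "\<And>i. i \<in> I \<Longrightarrow> ((\<lambda>\<tau>. b i \<tau> / \<tau>) \<longlongrightarrow> c i) (at_right 0)"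
  shows "((\<lambda>\<tau>. (f (x + (\<Sum>i\<in>I. (if i \<in> J then b i \<tau> else 0) *\<^sub>R E i)) - f x) / \<tau>) \<longlongrightarrow>
    (\<Sum>i\<in>J. c i * dir_deriv f (E i) x)) (at_right (0::real))"
  using finite_subset[OF J fin] J
proof (induction J rule: finite_induct)
  case empty
  then show ?case by simp
next
  case (insert i J)
  have b0: "(b i \<longlongrightarrow> 0) (at_right 0)" if "i \<in> I" for i
  proof -
    have "((\<lambda>\<tau>. \<tau> * (b i \<tau> / \<tau>)) \<longlongrightarrow> 0 * c i) (at_right 0)"
      by (intro tendsto_intros b that)
    moreover have "\<forall>\<^sub>F \<tau> in at_right 0. \<tau> * (b i \<tau> / \<tau>) = b i \<tau>"
      using eventually_at_right_less[of 0] by eventually_elim simp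
    ultimately show ?thesis by (simp add: tendsto_cong)
  qed
  let ?y = "\<lambda>\<tau> \<theta>. x + (\<Sum>j\<in>I. (if j = i then \<theta> * b i \<tau> else if j \<in> J then b j \<tau> else 0) *\<^sub>R E j)"
  have i: "i \<in> I" using insert by auto
  have y: "?y \<tau> \<theta> = ?y \<tau> 0 + (\<theta> * b i \<tau>) *\<^sub>R E i" for \<tau> \<theta>
    using sum.remove[OF fin i, of "\<lambda>j. (if j = i then \<theta> * b i \<tau> else if j \<in> J then b j \<tau> else 0) *\<^sub>R E j"]
      sum.remove[OF fin i, of "\<lambda>j. (if j = i then 0 * b i \<tau> else if j \<in> J then b j \<tau> else 0) *\<^sub>R E j"]
    by (simp add: algebra_simps)
  obtain \<delta> where \<delta>: "\<delta> > 0" "\<And>b. (\<forall>i\<in>I. \<bar>b i\<bar> < \<delta>) \<Longrightarrow> x + (\<Sum>i\<in>I. b i *\<^sub>R E i) \<in> U"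
    using open_box[OF U] by metis
  have small: "\<forall>\<^sub>F \<tau> in at_right 0. \<forall>j\<in>I. \<bar>b j \<tau>\<bar> < \<delta>"
  proof (rule eventually_ball_finite[OF fin], rule ballI)
    fix j assume "j \<in> I"
    then have "\<forall>\<^sub>F \<tau> in at_right 0. dist (b j \<tau>) 0 < \<delta>" using b0 \<delta>(1) tendstoD by blast
    then show "\<forall>\<^sub>F \<tau> in at_right 0. \<bar>b j \<tau>\<bar> < \<delta>" by simp
  qed
  \<comment> \<open>The bounds on \<open>\<theta>\<close> are demanded for every
    \<open>\<tau>\<close> and the mean value equation only for small offsets, so that
    \<open>\<theta>\<close> can be chosen as a function of all \<open>\<tau>\<close>.\<close>
  define Q where "Q \<tau> \<theta> \<longleftrightarrow> 0 \<le> \<theta> \<and> \<theta> \<le> 1 \<and> ((\<forall>j\<in>I. \<bar>b j \<tau>\<bar> < \<delta>) \<longrightarrow>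
      f (?y \<tau> 1) - f (?y \<tau> 0) = b i \<tau> * dir_deriv f (E i) (?y \<tau> \<theta>))" for \<tau> \<theta>
  have "\<exists>\<theta>. Q \<tau> \<theta>" for \<tau>
  proof (cases "\<forall>j\<in>I. \<bar>b j \<tau>\<bar> < \<delta>")
    case True
    have yU: "?y \<tau> \<theta> \<in> U" if "0 \<le> \<theta>" "\<theta> \<le> 1" for \<theta>
    proof (rule \<delta>(2), rule ballI)
      fix j assume j: "j \<in> I"
      have "\<bar>\<theta> * b i \<tau>\<bar> \<le> 1 * \<bar>b i \<tau>\<bar>" unfolding abs_mult by (rule mult_right_mono) (use that in auto)
      then show "\<bar>if j = i then \<theta> * b i \<tau> else if j \<in> J then b j \<tau> else 0\<bar> < \<delta>"
        using True i j \<delta>(1) by fastforce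
    qed
    have "((\<lambda>\<theta>. f (?y \<tau> \<theta>)) has_field_derivative b i \<tau> * dir_deriv f (E i) (?y \<tau> \<theta>)) (at \<theta>)"
      if \<theta>: "0 \<le> \<theta>" "\<theta> \<le> 1" for \<theta>
    proof -
      have d: "((\<lambda>s. f (?y \<tau> \<theta> + s *\<^sub>R E i)) has_field_derivative dir_deriv f (E i) (?y \<tau> \<theta>)) (at ((\<theta> - \<theta>) * b i \<tau>))"
        using f yU[OF \<theta>] E[OF i] by (simp add: C1_def)
      have "((\<lambda>\<theta>'. (\<theta>' - \<theta>) * b i \<tau>) has_field_derivative b i \<tau>) (at \<theta>)"
        by (auto intro!: derivative_eq_intros)
      from DERIV_chain2[OF d this]
      have "((\<lambda>\<theta>'. f (?y \<tau> \<theta> + ((\<theta>' - \<theta>) * b i \<tau>) *\<^sub>R E i)) has_field_derivative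
          dir_deriv f (E i) (?y \<tau> \<theta>) * b i \<tau>) (at \<theta>)" .
      moreover have "?y \<tau> \<theta> + ((\<theta>' - \<theta>) * b i \<tau>) *\<^sub>R E i = ?y \<tau> \<theta>'" for \<theta>'
        by (subst (1 2) y) (simp add: algebra_simps)
      ultimately show ?thesis by (simp add: mult.commute)
    qed
    from MVT2[OF zero_less_one this] obtain \<theta> where th: "0 < \<theta>" "\<theta> < 1"
      "f (?y \<tau> 1) - f (?y \<tau> 0) = (1 - 0) * (b i \<tau> * dir_deriv f (E i) (?y \<tau> \<theta>))" by blast
    show ?thesis
      unfolding Q_def
    proof (intro exI[of _ \<theta>] conjI impI)
      show "f (?y \<tau> 1) - f (?y \<tau> 0) = b i \<tau> * dir_deriv f (E i) (?y \<tau> \<theta>)"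
        using th(3) by (simp only: diff_zero mult_1)
    qed (use th in auto)
  qed (auto simp: Q_def intro: exI[of _ 0])
  then obtain \<theta> where Q: "\<And>\<tau>. Q \<tau> (\<theta> \<tau>)" by metis
  have \<theta>: "\<And>\<tau>. 0 \<le> \<theta> \<tau>" "\<And>\<tau>. \<theta> \<tau> \<le> 1"
    "\<And>\<tau>. \<forall>j\<in>I. \<bar>b j \<tau>\<bar> < \<delta> \<Longrightarrow> f (?y \<tau> 1) - f (?y \<tau> 0) = b i \<tau> * dir_deriv f (E i) (?y \<tau> (\<theta> \<tau>))"
    using Q unfolding Q_def by blast+
  have y0: "((\<lambda>\<tau>. ?y \<tau> (\<theta> \<tau>)) \<longlongrightarrow> x) (at_right 0)"
  proof (rule tendsto_box)
    fix j assume j: "j \<in> I"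
    show "((\<lambda>\<tau>. if j = i then \<theta> \<tau> * b i \<tau> else if j \<in> J then b j \<tau> else 0) \<longlongrightarrow> 0) (at_right 0)"
    proof (cases "j = i")
      case True
      have "\<bar>\<theta> \<tau> * b i \<tau>\<bar> \<le> 1 * \<bar>b i \<tau>\<bar>" for \<tau>
        unfolding abs_mult by (rule mult_right_mono) (use \<theta>(1,2) in auto)
      then show ?thesis using True tendsto_rabs_zero[OF b0[OF i]]
        by (auto intro!: Lim_null_comparison[of "\<lambda>\<tau>. \<theta> \<tau> * b i \<tau>" "\<lambda>\<tau>. \<bar>b i \<tau>\<bar>"] always_eventually)
    qed (cases "j \<in> J", use b0[OF j] in auto)
  qed
  have "continuous_on U (dir_deriv f (E i))" using f E[OF i] by (auto simp: C1_def)
  then have "isCont (dir_deriv f (E i)) x" using U by (simp add: continuous_on_eq_continuous_at)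
  then have "((\<lambda>\<tau>. dir_deriv f (E i) (?y \<tau> (\<theta> \<tau>))) \<longlongrightarrow> dir_deriv f (E i) x) (at_right 0)"
    using y0 isCont_tendsto_compose by blast
  then have l1: "((\<lambda>\<tau>. b i \<tau> / \<tau> * dir_deriv f (E i) (?y \<tau> (\<theta> \<tau>))) \<longlongrightarrow> c i * dir_deriv f (E i) x) (at_right 0)"
    by (intro tendsto_mult b i)
  have "?y \<tau> 0 = x + (\<Sum>j\<in>I. (if j \<in> J then b j \<tau> else 0) *\<^sub>R E j)" for \<tau>
    using insert(2) by (intro arg_cong2[where f = "(+)"] sum.cong) auto
  then have l2: "((\<lambda>\<tau>. (f (?y \<tau> 0) - f x) / \<tau>) \<longlongrightarrow> (\<Sum>i\<in>J. c i * dir_deriv f (E i) x)) (at_right (0::real))"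
    using insert by simp
  have y1: "?y \<tau> 1 = x + (\<Sum>j\<in>I. (if j \<in> insert i J then b j \<tau> else 0) *\<^sub>R E j)" for \<tau>
    by (intro arg_cong2[where f = "(+)"] sum.cong) auto
  have "((\<lambda>\<tau>. b i \<tau> / \<tau> * dir_deriv f (E i) (?y \<tau> (\<theta> \<tau>)) + (f (?y \<tau> 0) - f x) / \<tau>) \<longlongrightarrow>
      (\<Sum>i\<in>insert i J. c i * dir_deriv f (E i) x)) (at_right 0)"
    using tendsto_add[OF l1 l2] insert(1,2) by simp
  moreover have "\<forall>\<^sub>F \<tau> in at_right 0. b i \<tau> / \<tau> * dir_deriv f (E i) (?y \<tau> (\<theta> \<tau>)) + (f (?y \<tau> 0) - f x) / \<tau> =
      (f (?y \<tau> 1) - f x) / \<tau>"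
    using small
  proof eventually_elim
    case (elim \<tau>)
    have gen: "a - b = X \<Longrightarrow> a - d = X + (b - d)" for a b d X :: real by simp
    have "f (?y \<tau> 1) - f x = b i \<tau> * dir_deriv f (E i) (?y \<tau> (\<theta> \<tau>)) + (f (?y \<tau> 0) - f x)"
      by (rule gen[OF \<theta>(3)[OF elim]])
    then show ?case by (simp only: add_divide_distrib) simp
  qed
  ultimately show ?case unfolding y1[symmetric] using Lim_transform_eventually by fast
qed

lemma coord_span_subspace: "subspace coord_span"
proof (rule subspaceI)
  show "0 \<in> coord_span" using linear_0[OF \<kappa>_linear] by (simp add: coord_span_def)
next
  fix v w assume "v \<in> coord_span" "w \<in> coord_span"
  then show "v + w \<in> coord_span"
    by (simp add: coord_span_def linear_add[OF \<kappa>_linear] scaleR_add_left sum.distrib)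
next
  fix c v assume v: "v \<in> coord_span"
  have "(\<Sum>i\<in>I. \<kappa> i (c *\<^sub>R v) *\<^sub>R E i) = c *\<^sub>R (\<Sum>i\<in>I. \<kappa> i v *\<^sub>R E i)"
    unfolding scaleR_sum_right by (rule sum.cong) (auto simp: linear_scale[OF \<kappa>_linear])
  then show "c *\<^sub>R v \<in> coord_span" using v by (simp add: coord_span_def)
qed

text \<open>Along a curve in \<open>M\<close> the function is 0, hence so is its one-sided
  derivative. By the chain rule this derivative is a linear functional of the velocity, so it
  vanishes on the span of all velocities, which is the tangent space even at a corner.\<close>

lemma dir_deriv_vanish:
  assumes U: "open U" and xU: "x \<in> U" and xM: "x \<in> M" and f: "C1 U f"
    and E: "\<And>i. i \<in> I \<Longrightarrow> E i \<in> coord_span"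
    and van: "\<And>y. y \<in> M \<inter> U \<Longrightarrow> f y = 0" and v: "v \<in> tangent_space M x"
  shows "dir_deriv f v x = 0"
proof -
  let ?l = "\<lambda>v. \<Sum>i\<in>I. \<kappa> i v * dir_deriv f (E i) x"
  have lin: "linear ?l"
    by (rule linearI) (auto simp: linear_add[OF \<kappa>_linear] linear_scale[OF \<kappa>_linear]
      algebra_simps sum.distrib sum_distrib_left)
  have I: "(\<Sum>i\<in>I. (if i \<in> I then b i else 0) *\<^sub>R E i) = (\<Sum>i\<in>I. b i *\<^sub>R E i)" for b
    by (rule sum.cong) auto
  have "?l v = 0"
  proof (rule linear_eq_0_on_span[OF lin _ v[unfolded tangent_space_def]])
    fix w assume "w \<in> {v. \<exists>c. c 0 = x \<and> (\<forall>\<^sub>F s in at_right 0. c s \<in> M) \<and>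
      ((\<lambda>s. (c s - x) /\<^sub>R s) \<longlongrightarrow> v) (at_right (0::real))}"
    then obtain c where c: "\<forall>\<^sub>F s in at_right 0. c s \<in> M" "((\<lambda>s. (c s - x) /\<^sub>R s) \<longlongrightarrow> w) (at_right (0::real))"
      by blast
    have b: "((\<lambda>\<tau>. \<kappa> i (c \<tau> - x) / \<tau>) \<longlongrightarrow> \<kappa> i w) (at_right 0)" if i: "i \<in> I" for i
    proof -
      have "isCont (\<kappa> i) w" using \<kappa>_cont[OF i] by (simp add: continuous_on_eq_continuous_at)
      then have "((\<lambda>\<tau>. \<kappa> i ((c \<tau> - x) /\<^sub>R \<tau>)) \<longlongrightarrow> \<kappa> i w) (at_right 0)"
        using c(2) isCont_tendsto_compose by blast
      then show ?thesis by (simp add: linear_scale[OF \<kappa>_linear[OF i]] divide_inverse mult.commute)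
    qed
    have lim: "((\<lambda>\<tau>. (f (x + (\<Sum>i\<in>I. \<kappa> i (c \<tau> - x) *\<^sub>R E i)) - f x) / \<tau>) \<longlongrightarrow> ?l w) (at_right 0)"
      using C1_chain[OF U xU f subset_refl E b] unfolding I by simp
    have b0: "((\<lambda>\<tau>. \<kappa> i (c \<tau> - x)) \<longlongrightarrow> 0) (at_right 0)" if "i \<in> I" for i
    proof -
      have "((\<lambda>\<tau>. \<tau> * (\<kappa> i (c \<tau> - x) / \<tau>)) \<longlongrightarrow> 0 * \<kappa> i w) (at_right 0)"
        by (intro tendsto_intros b that)
      moreover have "\<forall>\<^sub>F \<tau> in at_right 0. \<tau> * (\<kappa> i (c \<tau> - x) / \<tau>) = \<kappa> i (c \<tau> - x)"
        using eventually_at_right_less[of 0] by eventually_elim simp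
      ultimately show ?thesis by (simp add: tendsto_cong)
    qed
    have "\<forall>\<^sub>F \<tau> in at_right 0. x + (\<Sum>i\<in>I. \<kappa> i (c \<tau> - x) *\<^sub>R E i) \<in> U"
      using topological_tendstoD[OF tendsto_box[OF b0] U xU] .
    then have ev: "\<forall>\<^sub>F \<tau> in at_right 0. (f (x + (\<Sum>i\<in>I. \<kappa> i (c \<tau> - x) *\<^sub>R E i)) - f x) / \<tau> = 0"
      using c(1)
    proof eventually_elim
      case (elim \<tau>)
      have "(\<Sum>i\<in>I. \<kappa> i (c \<tau> - x) *\<^sub>R E i) = (\<Sum>i\<in>I. \<kappa> i (c \<tau>) *\<^sub>R E i) - (\<Sum>i\<in>I. \<kappa> i x *\<^sub>R E i)"
        unfolding sum_subtractf[symmetric]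
        by (rule sum.cong) (auto simp: linear_diff[OF \<kappa>_linear] scaleR_diff_left)
      then have "x + (\<Sum>i\<in>I. \<kappa> i (c \<tau> - x) *\<^sub>R E i) = c \<tau>"
        using span_M[OF elim(2)] span_M[OF xM] by simp
      then show ?case using elim van xM xU by simp
    qed
    show "?l w = 0" by (rule at_right_limit_eq[OF lim ev])
  qed
  moreover have "dir_deriv f v x = ?l v"
  proof -
    have vW: "v \<in> coord_span" using span_T[OF xM v] by (simp add: coord_span_def)
    have b: "((\<lambda>\<tau>. \<tau> * \<kappa> i v / \<tau>) \<longlongrightarrow> \<kappa> i v) (at_right 0)" for i
    proof (rule tendsto_eventually)
      show "\<forall>\<^sub>F \<tau> in at_right 0. \<tau> * \<kappa> i v / \<tau> = \<kappa> i v"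
        using eventually_at_right_less[of 0] by eventually_elim simp
    qed
    have "(\<Sum>i\<in>I. (\<tau> * \<kappa> i v) *\<^sub>R E i) = \<tau> *\<^sub>R v" for \<tau>
      using vW by (simp add: coord_span_def scaleR_sum_right[symmetric] flip: scaleR_scaleR)
    then have "((\<lambda>\<tau>. (f (x + \<tau> *\<^sub>R v) - f x) / \<tau>) \<longlongrightarrow> ?l v) (at_right 0)"
      using C1_chain[OF U xU f subset_refl E, of "\<lambda>i \<tau>. \<tau> * \<kappa> i v" "\<lambda>i. \<kappa> i v"] b unfolding I by simp
    moreover have "((\<lambda>\<tau>. (f (x + \<tau> *\<^sub>R v) - f x) / \<tau>) \<longlongrightarrow> dir_deriv f v x) (at_right 0)"
    proof -
      have "((\<lambda>s. f (x + s *\<^sub>R v)) has_field_derivative dir_deriv f v x) (at 0)"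
        using f vW xU by (simp add: C1_def)
      then have "((\<lambda>\<tau>. (f (x + \<tau> *\<^sub>R v) - f x) / \<tau>) \<longlongrightarrow> dir_deriv f v x) (at 0)"
        by (simp add: DERIV_def)
      then show ?thesis by (rule tendsto_mono[rotated]) (simp add: at_within_le_at)
    qed
    ultimately show ?thesis using tendsto_unique[OF trivial_limit_at_right_real] by blast
  qed
  ultimately show ?thesis by simp
qed

definition tangent_field :: "'a \<Rightarrow> 'a \<Rightarrow> 'a \<Rightarrow> 'a" where "tangent_field x v y = v + L x v (y - x)"

text \<open>Induction on the number of arguments replaced by fields. The next field is expanded in
  the vectors \<open>E i\<close> with coefficients affine in \<open>y\<close>, and every summand has
  one field fewer.\<close>

lemma C1_field:
  assumes U: "open U" and xM: "x \<in> M"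
    and alt: "\<And>y. y \<in> U \<Longrightarrow> alternating s (\<alpha> y)" and sm: "\<And>u. C1 U (\<lambda>y. \<alpha> y u)"
    and w: "\<And>j. j < s \<Longrightarrow> w j \<in> tangent_space M x"
  shows "m \<le> s \<Longrightarrow> C1 U (\<lambda>y. \<alpha> y (\<lambda>j. if j < m then tangent_field x (w j) y else u j))"
proof (induction m arbitrary: u)
  case 0
  then show ?case by (simp add: sm)
next
  case (Suc m)
  let ?u = "\<lambda>y j. if j < m then tangent_field x (w j) y else u j"
  have C1k: "C1 U (\<lambda>y. \<kappa> i (tangent_field x (w m) y))" if i: "i \<in> I" for i
  proof -
    have "linear (\<lambda>z. \<kappa> i (L x (w m) z))"
      using linear_compose[OF L_linear[of x "w m"] \<kappa>_linear[OF i]] by (simp add: o_def)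
    then have "polyfun (\<lambda>y. \<kappa> i (L x (w m) y) + (\<kappa> i (w m) - \<kappa> i (L x (w m) x)))"
      by (intro polyfun.add polyfun.functional polyfun.const L_cont[OF i])
    moreover have "(\<lambda>y. \<kappa> i (tangent_field x (w m) y)) = (\<lambda>y. \<kappa> i (L x (w m) y) + (\<kappa> i (w m) - \<kappa> i (L x (w m) x)))"
      by (simp add: tangent_field_def linear_add[OF \<kappa>_linear[OF i]] linear_diff[OF \<kappa>_linear[OF i]] linear_diff[OF L_linear] fun_eq_iff)
    ultimately show ?thesis by (simp add: C1_smooth polyfun_smooth)
  qed
  have "C1 U (\<lambda>y. \<Sum>i\<in>I. \<kappa> i (tangent_field x (w m) y) * \<alpha> y (\<lambda>j. if j < m then tangent_field x (w j) y else (u(m := E i)) j))"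
    by (intro C1_sum C1_mult C1k Suc.IH) (use Suc.prems in auto)
  then show ?case
  proof (rule C1_cong[OF U, rotated])
    fix y assume y: "y \<in> U"
    have l: "linear (\<lambda>z. \<alpha> y ((?u y)(m := z)))"
      using alt[OF y] Suc.prems by (simp add: alternating_def)
    have "tangent_field x (w m) y = (\<Sum>i\<in>I. \<kappa> i (tangent_field x (w m) y) *\<^sub>R E i)"
    proof -
      have "w m \<in> coord_span" "L x (w m) (y - x) \<in> coord_span"
        using span_T[OF xM w] span_L[OF xM w] Suc.prems by (auto simp: coord_span_def)
      then have "tangent_field x (w m) y \<in> coord_span" unfolding tangent_field_def by (rule subspace_add[OF coord_span_subspace])
      then show ?thesis by (simp add: coord_span_def)
    qed
    then have "\<alpha> y ((?u y)(m := tangent_field x (w m) y)) = \<alpha> y ((?u y)(m := (\<Sum>i\<in>I. \<kappa> i (tangent_field x (w m) y) *\<^sub>R E i)))"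
      by simp
    also have "\<dots> = (\<Sum>i\<in>I. \<kappa> i (tangent_field x (w m) y) * \<alpha> y ((?u y)(m := E i)))"
      by (simp add: linear_sum[OF l] linear_scale[OF l] del: fun_upd_apply)
    also have "(\<lambda>i. (?u y)(m := E i)) = (\<lambda>i j. if j < m then tangent_field x (w j) y else (u(m := E i)) j)"
      by (auto simp: fun_eq_iff)
    also have "(?u y)(m := tangent_field x (w m) y) = (\<lambda>j. if j < Suc m then tangent_field x (w j) y else u j)"
      by (auto simp: fun_eq_iff less_Suc_eq)
    finally show "\<alpha> y (\<lambda>j. if j < Suc m then tangent_field x (w j) y else u j) =
        (\<Sum>i\<in>I. \<kappa> i (tangent_field x (w m) y) * \<alpha> y (\<lambda>j. if j < m then tangent_field x (w j) y else (u(m := E i)) j))"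
      by (simp add: fun_eq_iff)
  qed
qed

text \<open>The product rule for a multilinear \<open>\<alpha>\<close> whose arguments move with
  velocities \<open>z j\<close>. Each induction step splits off \<open>\<tau>\<close> times the
  value with \<open>z m\<close> inserted, whose derivative at 0 is that value at
  \<open>\<tau> = 0\<close>.\<close>

lemma deriv_field:
  assumes U: "open U" and xU: "x \<in> U" and v: "v \<in> coord_span"
    and alt: "\<And>y. y \<in> U \<Longrightarrow> alternating s (\<alpha> y)" and sm: "\<And>u. C1 U (\<lambda>y. \<alpha> y u)"
  shows "m \<le> s \<Longrightarrow> ((\<lambda>\<tau>. \<alpha> (x + \<tau> *\<^sub>R v) (\<lambda>j. if j < m then u j + \<tau> *\<^sub>R z j else u j)) has_field_derivative
    dir_deriv (\<lambda>y. \<alpha> y u) v x + (\<Sum>j<m. \<alpha> x (u(j := z j)))) (at 0)"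
proof (induction m arbitrary: u)
  case 0
  then show ?case using sm[of u] xU v by (simp add: C1_def)
next
  case (Suc m)
  have m: "m \<le> s" "m < s" using Suc.prems by auto
  let ?g = "\<lambda>u \<tau>. \<alpha> (x + \<tau> *\<^sub>R v) (\<lambda>j. if j < m then u j + \<tau> *\<^sub>R z j else u j)"
  have d: "((\<lambda>\<tau>. \<tau> * ?g (u(m := z m)) \<tau>) has_field_derivative 1 * ?g (u(m := z m)) 0 +
      (dir_deriv (\<lambda>y. \<alpha> y (u(m := z m))) v x + (\<Sum>j<m. \<alpha> x (u(m := z m, j := z j)))) * 0) (at 0)"
    by (rule DERIV_mult[OF DERIV_ident Suc.IH[OF m(1)]])
  have e: "?g w 0 = \<alpha> x w" for w by (rule arg_cong2[where f = \<alpha>]) auto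
  have "((\<lambda>\<tau>. ?g u \<tau> + \<tau> * ?g (u(m := z m)) \<tau>) has_field_derivative
      dir_deriv (\<lambda>y. \<alpha> y u) v x + (\<Sum>j<Suc m. \<alpha> x (u(j := z j)))) (at 0)"
    by (rule DERIV_cong[OF DERIV_add[OF Suc.IH[OF m(1), of u] d]])
      (simp only: e sum.lessThan_Suc mult_1 mult_zero_right add_0_right add.assoc)
  then show ?case
  proof (rule DERIV_cong_ev[OF refl _ refl, THEN iffD1, rotated])
    show "\<forall>\<^sub>F \<tau> in nhds 0. ?g u \<tau> + \<tau> * ?g (u(m := z m)) \<tau> =
        \<alpha> (x + \<tau> *\<^sub>R v) (\<lambda>j. if j < Suc m then u j + \<tau> *\<^sub>R z j else u j)"
      using eventually_line[OF U xU v]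
    proof eventually_elim
      case (elim \<tau>)
      let ?w = "\<lambda>j. if j < m then u j + \<tau> *\<^sub>R z j else u j"
      have e1: "(\<lambda>j. if j < Suc m then u j + \<tau> *\<^sub>R z j else u j) = ?w(m := u m + \<tau> *\<^sub>R z m)"
        by (auto simp: fun_eq_iff less_Suc_eq)
      have e2: "(\<lambda>j. if j < m then (u(m := z m)) j + \<tau> *\<^sub>R z j else (u(m := z m)) j) = ?w(m := z m)"
        by (auto simp: fun_eq_iff)
      have e3: "?w(m := u m) = ?w" by (auto simp: fun_eq_iff)
      have "\<alpha> (x + \<tau> *\<^sub>R v) (?w(m := u m + \<tau> *\<^sub>R z m)) =
          \<alpha> (x + \<tau> *\<^sub>R v) (?w(m := u m)) + \<tau> * \<alpha> (x + \<tau> *\<^sub>R v) (?w(m := z m))"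
        by (simp only: alternating_add[OF alt[OF elim] m(2)] alternating_scale[OF alt[OF elim] m(2)])
      then show ?case by (simp only: e1 e2 e3)
    qed
  qed
qed

text \<open>This is the invariant formula for the exterior derivative on vector fields. With fields
  tangent to \<open>M\<close> the functions obtained by inserting them vanish on \<open>M\<close>,
  so their derivatives along tangent vectors vanish; the remaining terms combine in pairs to values
  of \<open>\<alpha>\<close> on brackets, which vanish since brackets of the fields are
  tangent.\<close>

lemma flat_ext_deriv_vanish:
  assumes U: "open U" and xU: "x \<in> U" and xM: "x \<in> M"
    and E: "\<And>i. i \<in> I \<Longrightarrow> E i \<in> coord_span"
    and alt: "\<And>y. y \<in> U \<Longrightarrow> alternating s (\<alpha> y)" and sm: "\<And>u. C1 U (\<lambda>y. \<alpha> y u)"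
    and van: "\<And>y u. y \<in> M \<inter> U \<Longrightarrow> (\<And>i. i < s \<Longrightarrow> u i \<in> tangent_space M y) \<Longrightarrow> \<alpha> y u = 0"
    and v: "\<And>i. i \<le> s \<Longrightarrow> v i \<in> tangent_space M x"
  shows "flat_ext_deriv s \<alpha> x v = 0"
proof -
  define w where "w i = (\<lambda>j. if j < i then v j else v (Suc j))" for i
  have wT: "w i j \<in> tangent_space M x" if "j < s" for i j
    using v that by (auto simp: w_def)
  define g where "g i j = (-1) ^ i * \<alpha> x ((w i)(j := L x (w i j) (v i)))" for i j :: nat
  have D: "dir_deriv (\<lambda>y. \<alpha> y (w i)) (v i) x = - (\<Sum>j<s. \<alpha> x ((w i)(j := L x (w i j) (v i))))" if i: "i \<le> s" for i
  proof -
    have vi: "v i \<in> coord_span" using span_T[OF xM v[OF i]] by (simp add: coord_span_def)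
    let ?f = "\<lambda>y. \<alpha> y (\<lambda>j. if j < s then tangent_field x (w i j) y else w i j)"
    have "dir_deriv ?f (v i) x = 0"
    proof (rule dir_deriv_vanish[OF U xU xM _ E _ v[OF i]])
      show "C1 U ?f" by (rule C1_field[OF U xM alt sm wT]) auto
      fix y assume y: "y \<in> M \<inter> U"
      show "?f y = 0"
        by (rule van[OF y]) (use L_tangent[OF _ xM wT, of y] y in \<open>auto simp: tangent_field_def\<close>)
    qed
    moreover have f: "(\<lambda>j. if j < s then tangent_field x (w i j) (x + \<tau> *\<^sub>R v i) else w i j) =
        (\<lambda>j. if j < s then w i j + \<tau> *\<^sub>R L x (w i j) (v i) else w i j)" for \<tau>
      by (auto simp: fun_eq_iff tangent_field_def linear_scale[OF L_linear])
    moreover have "((\<lambda>\<tau>. ?f (x + \<tau> *\<^sub>R v i)) has_field_derivative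
        dir_deriv (\<lambda>y. \<alpha> y (w i)) (v i) x + (\<Sum>j<s. \<alpha> x ((w i)(j := L x (w i j) (v i))))) (at 0)"
      using deriv_field[OF U xU vi alt sm, of s "w i" "\<lambda>j. L x (w i j) (v i)"]
      unfolding f by simp
    ultimately show ?thesis by (simp add: dir_deriv_def DERIV_imp_deriv)
  qed
  have xMU: "x \<in> M \<inter> U" using xM xU by simp
  \<comment> \<open>Among the arguments without \<open>v a\<close> the vector \<open>v b\<close>
    stands at place \<open>b - 1\<close>, whereas among those without \<open>v b\<close> the vector
    \<open>v a\<close> stands at place \<open>a\<close>. Bringing both insertions to the place
    \<open>b - 1\<close> turns the pair into one value on the bracket.\<close>
  have pair: "g a (b - 1) + g b a = 0" if ab: "a < b" "b \<le> s" for a b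
  proof -
    define \<rho> where "\<rho> j = (if j < a then v j else if Suc j < b then v (Suc j) else v (Suc (Suc j)))" for j
    have 1: "(w a)(b - 1 := z) = ins_at (b - 1) z \<rho>" for z
      using ab by (auto simp: fun_eq_iff w_def ins_at_def \<rho>_def)
    have 2: "(w b)(a := z) = ins_at a z \<rho>" for z
      using ab by (auto simp: fun_eq_iff w_def ins_at_def \<rho>_def)
    have wv: "w a (b - 1) = v b" "w b a = v a" using ab by (auto simp: w_def)
    have al: "alternating s (\<alpha> x)" by (rule alt[OF xU])
    have b1: "a \<le> b - 1" "b - 1 < s" using ab by auto
    have "\<alpha> x (ins_at a z \<rho>) = (-1) ^ (b - 1 - a) * \<alpha> x (ins_at (b - 1) z \<rho>)" for z
      by (rule alternating_ins_at[OF al b1])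
    moreover have "(-1::real) ^ b * (-1) ^ (b - 1 - a) = - ((-1) ^ a)"
    proof -
      have "b + (b - 1 - a) + a + 1 = 2 * b" using ab by simp
      then have "(-1::real) ^ (b + (b - 1 - a)) * (-1) ^ a * (-1) = (-1) ^ (2 * b)"
        by (metis power_add power_one_right)
      then show ?thesis by (cases "even a") (auto simp: power_add)
    qed
    ultimately have "g a (b - 1) + g b a =
        (-1) ^ a * (\<alpha> x (ins_at (b - 1) (L x (v b) (v a)) \<rho>) - \<alpha> x (ins_at (b - 1) (L x (v a) (v b)) \<rho>))"
      unfolding g_def wv 1 2 by (simp add: algebra_simps flip: mult.assoc)
    also have "\<alpha> x (ins_at (b - 1) (L x (v b) (v a)) \<rho>) - \<alpha> x (ins_at (b - 1) (L x (v a) (v b)) \<rho>) =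
        \<alpha> x ((w a)(b - 1 := L x (v b) (v a) - L x (v a) (v b)))"
      unfolding 1[symmetric] using linear_diff[of "\<lambda>u. \<alpha> x ((w a)(b - 1 := u))"] al b1
      by (simp add: alternating_def)
    also have "\<dots> = 0"
      by (rule van[OF xMU]) (use wT L_bracket[OF xM v v, of a b] ab in auto)
    finally show ?thesis by simp
  qed
  have "flat_ext_deriv s \<alpha> x v = - (\<Sum>i\<le>s. \<Sum>j<s. g i j)"
    unfolding flat_ext_deriv_def w_def[symmetric]
    by (simp add: D g_def sum_negf sum_distrib_left)
  also have "(\<Sum>i\<le>s. \<Sum>j<s. g i j) = (\<Sum>(i, j)\<in>{..s} \<times> {..<s}. g i j)"
    by (simp add: sum.cartesian_product)
  also have "{..s} \<times> {..<s} = {(i, j). i \<le> j \<and> j < s} \<union> {(i, j). j < i \<and> i \<le> s}" by auto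
  also have "(\<Sum>(i, j)\<in>\<dots>. g i j) = (\<Sum>(i, j)\<in>{(i, j). i \<le> j \<and> j < s}. g i j) + (\<Sum>(i, j)\<in>{(i, j). j < i \<and> i \<le> s}. g i j)"
    by (rule sum.union_disjoint) (auto intro: finite_subset[of _ "{..s} \<times> {..s}"])
  also have "(\<Sum>(i, j)\<in>{(i, j). i \<le> j \<and> j < s}. g i j) = (\<Sum>(a, b)\<in>{(a, b). a < b \<and> b \<le> s}. g a (b - 1))"
    by (rule sum.reindex_bij_witness[where i = "\<lambda>(a, b). (a, b - 1)" and j = "\<lambda>(i, j). (i, Suc j)"]) auto
  also have "(\<Sum>(i, j)\<in>{(i, j). j < i \<and> i \<le> s}. g i j) = (\<Sum>(a, b)\<in>{(a, b). a < b \<and> b \<le> s}. g b a)"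
    by (rule sum.reindex_bij_witness[where i = "\<lambda>(a, b). (b, a)" and j = "\<lambda>(i, j). (j, i)"]) auto
  also have "(\<Sum>(a, b)\<in>{(a, b). a < b \<and> b \<le> s}. g a (b - 1)) + (\<Sum>(a, b)\<in>{(a, b). a < b \<and> b \<le> s}. g b a) = 0"
    unfolding sum.distrib[symmetric] by (rule sum.neutral) (use pair in auto)
  finally show ?thesis by simp
qed

text \<open>The difference of two local extensions vanishes on tangent vectors of \<open>M\<close>,
  so \<open>flat_ext_deriv_vanish\<close> gives the uniqueness that the definite description
  requires.\<close>

lemma ext_deriv_eq:
  assumes E: "\<And>i. i \<in> I \<Longrightarrow> E i \<in> coord_span"
    and ext: "extends_on M s \<omega> U \<eta>" and x: "x \<in> U" "x \<in> M"
    and v: "\<And>i. i \<le> s \<Longrightarrow> v i \<in> tangent_space M x"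
  shows "ext_deriv M s \<omega> x v = flat_ext_deriv s \<eta> x v"
  unfolding ext_deriv_def
proof (rule the_equality)
  show "\<exists>U \<eta>'. x \<in> U \<and> extends_on M s \<omega> U \<eta>' \<and> flat_ext_deriv s \<eta> x v = flat_ext_deriv s \<eta>' x v"
    using ext x by blast
  fix c assume "\<exists>U \<eta>. x \<in> U \<and> extends_on M s \<omega> U \<eta> \<and> c = flat_ext_deriv s \<eta> x v"
  then obtain U' \<eta>' where x': "x \<in> U'" and ext': "extends_on M s \<omega> U' \<eta>'" and c: "c = flat_ext_deriv s \<eta>' x v"
    by blast
  let ?V = "U \<inter> U'" and ?\<alpha> = "\<lambda>y u. \<eta> y u + (-1) * \<eta>' y u"
  have V: "open ?V" using ext ext' by (auto simp: extends_on_def)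
  have c1: "C1 ?V (\<lambda>y. \<eta> y u)" "C1 ?V (\<lambda>y. \<eta>' y u)" for u
  proof -
    have "C1 U (\<lambda>y. \<eta> y u)" "C1 U' (\<lambda>y. \<eta>' y u)" using ext ext' by (auto simp: extends_on_def intro: C1_smooth)
    then show "C1 ?V (\<lambda>y. \<eta> y u)" "C1 ?V (\<lambda>y. \<eta>' y u)"
      by (auto simp: C1_def intro: continuous_on_subset)
  qed
  have "flat_ext_deriv s ?\<alpha> x v = 0"
  proof (rule flat_ext_deriv_vanish[OF V _ x(2) E])
    show "x \<in> ?V" using x x' by simp
    show "alternating s (?\<alpha> y)" if y: "y \<in> ?V" for y
    proof -
      have a: "alternating s (\<eta> y)" "alternating s (\<eta>' y)" using y ext ext' by (auto simp: extends_on_def)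
      have "linear (\<lambda>u. ?\<alpha> y (v(i := u)))" if "i < s" for v i
      proof -
        have "linear (\<lambda>u. \<eta> y (v(i := u)) + (-1) *\<^sub>R \<eta>' y (v(i := u)))"
          by (intro linear_compose_add linear_compose_scale_right)
            (use a that in \<open>auto simp: alternating_def\<close>)
        then show ?thesis by (simp only: real_scaleR_def)
      qed
      moreover have "?\<alpha> y v = ?\<alpha> y w" if "\<forall>i<s. v i = w i" for v w
        using that a unfolding alternating_def by metis
      moreover have "?\<alpha> y v = 0" if "i < s" "j < s" "i \<noteq> j" "v i = v j" for v i j
        using that a unfolding alternating_def by simp
      ultimately show ?thesis unfolding alternating_def by blast
    qed
    show "C1 ?V (\<lambda>y. ?\<alpha> y u)" for u
      by (intro C1_add C1_mult c1) (auto intro: C1_smooth polyfun_smooth polyfun.const)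
    show "?\<alpha> y u = 0" if "y \<in> M \<inter> ?V" "\<And>i. i < s \<Longrightarrow> u i \<in> tangent_space M y" for y u
      using that ext ext' by (auto simp: extends_on_def)
  qed (auto intro: v)
  moreover have "flat_ext_deriv s ?\<alpha> x v = flat_ext_deriv s \<eta> x v - c"
  proof -
    have "dir_deriv (\<lambda>y. ?\<alpha> y u) (v i) x = dir_deriv (\<lambda>y. \<eta> y u) (v i) x - dir_deriv (\<lambda>y. \<eta>' y u) (v i) x"
      if "i \<le> s" for i u
    proof -
      have "v i \<in> coord_span" using span_T[OF x(2) v[OF that]] by (simp add: coord_span_def)
      then have "((\<lambda>s. \<eta> (x + s *\<^sub>R v i) u) has_field_derivative dir_deriv (\<lambda>y. \<eta> y u) (v i) x) (at 0)"
        "((\<lambda>s. \<eta>' (x + s *\<^sub>R v i) u) has_field_derivative dir_deriv (\<lambda>y. \<eta>' y u) (v i) x) (at 0)"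
        using c1[of u] x(1) x' by (auto simp: C1_def)
      from DERIV_diff[OF this] show ?thesis by (simp add: dir_deriv_def DERIV_imp_deriv)
    qed
    then show ?thesis unfolding c flat_ext_deriv_def
      by (simp add: sum_subtractf[symmetric] right_diff_distrib)
  qed
  ultimately show "c = flat_ext_deriv s \<eta> x v" by simp
qed

end

section \<open>Integration of polynomials over the simplex\<close>

text \<open>Integration by parts trades a power of \<open>y\<close> for a power of
  \<open>c - y\<close> until \<open>a = 0\<close>. The value is a beta integral, scaled to the
  interval from 0 to \<open>c\<close>.\<close>

lemma beta_antiderivative:
  fixes c :: real
  shows "\<exists>F. (\<forall>y. (F has_real_derivative y ^ a * (c - y) ^ b) (at y)) \<and>
    F c - F 0 = c ^ (a + b + 1) * fact a * fact b / fact (a + b + 1)"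
proof (induction a arbitrary: b)
  case 0
  show ?case
  proof (intro exI[of _ "\<lambda>y. - ((c - y) ^ Suc b / real (Suc b))"] conjI allI)
    fix y :: real
    show "((\<lambda>y. - ((c - y) ^ Suc b / real (Suc b))) has_real_derivative y ^ 0 * (c - y) ^ b) (at y)"
      by (rule derivative_eq_intros refl | simp)+
  qed (simp add: fact_Suc del: of_nat_Suc)
next
  case (Suc a)
  obtain F where F: "\<And>y. (F has_real_derivative y ^ a * (c - y) ^ Suc b) (at y)"
    "F c - F 0 = c ^ (a + Suc b + 1) * fact a * fact (Suc b) / fact (a + Suc b + 1)" using Suc[of "Suc b"] by auto
  let ?k = "real (Suc a) / real (Suc b)"
  let ?G = "\<lambda>y. ?k * F y - y ^ Suc a * (c - y) ^ Suc b / real (Suc b)"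
  show ?case
  proof (intro exI[of _ ?G] conjI allI)
    fix y :: real
    have "(?G has_real_derivative ?k * (y ^ a * (c - y) ^ Suc b) -
        (real (Suc a) * y ^ a * (c - y) ^ Suc b + y ^ Suc a * (real (Suc b) * (0 - 1) * (c - y) ^ b)) / real (Suc b)) (at y)"
      by (rule derivative_eq_intros refl F | simp)+ (simp add: algebra_simps add_divide_distrib diff_divide_distrib)
    also have "?k * (y ^ a * (c - y) ^ Suc b) -
        (real (Suc a) * y ^ a * (c - y) ^ Suc b + y ^ Suc a * (real (Suc b) * (0 - 1) * (c - y) ^ b)) / real (Suc b)
        = y ^ Suc a * (c - y) ^ b" by (simp add: field_simps del: of_nat_Suc)
    finally show "(?G has_real_derivative y ^ Suc a * (c - y) ^ b) (at y)" .
    have "?G c - ?G 0 = ?k * (F c - F 0)" by (simp add: algebra_simps diff_divide_distrib add_divide_distrib)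
    also have "\<dots> = c ^ (Suc a + b + 1) * fact (Suc a) * fact b / fact (Suc a + b + 1)"
    proof -
      have eq: "a + Suc b + 1 = Suc a + b + 1" by simp
      have gen: "s1 / s2 * (X * u * (s2 * v) / Y) = X * (s1 * u) * v / Y" if "s2 \<noteq> 0" for s1 s2 u v X Y :: real
        using that by simp
      show ?thesis unfolding F(2) eq fact_Suc by (rule gen) simp
    qed
    finally show "?G c - ?G 0 = c ^ (Suc a + b + 1) * fact (Suc a) * fact b / fact (Suc a + b + 1)" .
  qed
qed

lemma nn_integral_beta:
  fixes c :: real
  assumes "0 \<le> c"
  shows "(\<integral>\<^sup>+y. ennreal (y ^ a * (c - y) ^ b * indicator {0..c} y) \<partial>lborel) =
    ennreal (c ^ (a + b + 1) * fact a * fact b / fact (a + b + 1))"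
proof -
  obtain F where F: "\<And>y. (F has_real_derivative y ^ a * (c - y) ^ b) (at y)"
    "F c - F 0 = c ^ (a + b + 1) * fact a * fact b / fact (a + b + 1)"
    using beta_antiderivative[of a c b] by auto
  have "(\<integral>\<^sup>+y. ennreal (y ^ a * (c - y) ^ b * indicator {0..c} y) \<partial>lborel) =
      (\<integral>\<^sup>+y. ennreal (y ^ a * (c - y) ^ b) * indicator {0..c} y \<partial>lborel)"
    by (rule nn_integral_cong) (auto simp: indicator_def)
  also have "\<dots> = ennreal (F c - F 0)"
    using assms by (intro nn_integral_FTC_Icc) (auto intro!: DERIV_subset[OF F(1)] has_field_derivative_at_within F(1))
  finally show ?thesis by (simp add: F(2))
qed

text \<open>The slack \<open>c - \<Sum>u\<close> plays the role of the coordinate \<open>t\<^sub>0\<close>.\<close>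

lemma nn_integral_dirichlet:
  assumes "0 \<le> c"
  shows "(\<integral>\<^sup>+u. ennreal (indicator {u. (\<forall>i\<in>{1..r}. 0 \<le> u i) \<and> (\<Sum>i=1..r. u i) \<le> c} u *
      ((\<Prod>i=1..r. u i ^ a i) * (c - (\<Sum>i=1..r. u i)) ^ a 0)) \<partial>Pi\<^sub>M {1..r} (\<lambda>_. lborel)) =
    ennreal (c ^ (r + (\<Sum>i\<le>r. a i)) * (\<Prod>i\<le>r. fact (a i)) / fact (r + (\<Sum>i\<le>r. a i)))"
  using assms
proof (induction r arbitrary: c)
  case 0
  interpret product_sigma_finite "\<lambda>_::nat. lborel :: real measure" by standard
  show ?case using 0 by (simp add: space_PiM_empty)
next
  case (Suc r)
  interpret product_sigma_finite "\<lambda>_::nat. lborel :: real measure" by standard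
  let ?S = "\<lambda>r c. {u. (\<forall>i\<in>{1..r}. 0 \<le> u i) \<and> (\<Sum>i=1..r. u i) \<le> (c::real)} :: (nat \<Rightarrow> real) set"
  let ?f = "\<lambda>r c u. indicator (?S r c) u * ((\<Prod>i=1..r. u i ^ a i) * (c - (\<Sum>i=1..r. u i)) ^ a 0) :: real"
  let ?n = "r + (\<Sum>i\<le>r. a i)"
  let ?K = "(\<Prod>i\<le>r. fact (a i)) / fact ?n :: real"
  have ins: "{1..Suc r} = insert (Suc r) {1..r}" by auto
  have meas: "(\<lambda>u. ennreal (?f r c u)) \<in> borel_measurable (Pi\<^sub>M {1..r} (\<lambda>_. lborel))" for r c
  proof -
    have "{u \<in> space (Pi\<^sub>M {1..r} (\<lambda>_. lborel :: real measure)). (\<forall>i\<in>{1..r}. 0 \<le> u i) \<and> (\<Sum>i=1..r. u i) \<le> c}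
        \<in> sets (Pi\<^sub>M {1..r} (\<lambda>_. lborel))" by measurable
    then have "(indicator {u \<in> space (Pi\<^sub>M {1..r} (\<lambda>_. lborel :: real measure)).
        (\<forall>i\<in>{1..r}. 0 \<le> u i) \<and> (\<Sum>i=1..r. u i) \<le> c} :: _ \<Rightarrow> real)
        \<in> borel_measurable (Pi\<^sub>M {1..r} (\<lambda>_. lborel))" by (rule borel_measurable_indicator)
    then have "(indicator (?S r c) :: _ \<Rightarrow> real) \<in> borel_measurable (Pi\<^sub>M {1..r} (\<lambda>_. lborel))"
      by (rule measurable_cong[THEN iffD1, rotated]) (auto simp: indicator_def)
    moreover have "(\<lambda>u. (\<Prod>i=1..r. u i ^ a i) * (c - (\<Sum>i=1..r. u i)) ^ a 0)
        \<in> borel_measurable (Pi\<^sub>M {1..r} (\<lambda>_. lborel :: real measure))" by measurable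
    ultimately show ?thesis by measurable
  qed
  have "(\<integral>\<^sup>+u. ennreal (?f (Suc r) c u) \<partial>Pi\<^sub>M {1..Suc r} (\<lambda>_. lborel)) =
      (\<integral>\<^sup>+y. \<integral>\<^sup>+u. ennreal (?f (Suc r) c (u(Suc r := y))) \<partial>Pi\<^sub>M {1..r} (\<lambda>_. lborel) \<partial>lborel)"
    unfolding ins
    by (rule product_nn_integral_insert_rev) (use meas[of "Suc r" c] in \<open>auto simp: ins[symmetric]\<close>)
  \<comment> \<open>With the last coordinate fixed at \<open>y\<close>, the inner integral is of the
    same kind with total \<open>c - y\<close> instead of \<open>c\<close>.\<close>
  also have "\<dots> = (\<integral>\<^sup>+y. ennreal (y ^ a (Suc r) * (c - y) ^ ?n * indicator {0..c} y) * ennreal ?K \<partial>lborel)"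
  proof (rule nn_integral_cong)
    fix y :: real
    have upd: "(\<Sum>i=1..r. (u(Suc r := y)) i) = (\<Sum>i=1..r. u i)"
      "(\<Prod>i=1..r. (u(Suc r := y)) i ^ a i) = (\<Prod>i=1..r. u i ^ a i)" for u
      by (auto intro!: sum.cong prod.cong)
    show "(\<integral>\<^sup>+u. ennreal (?f (Suc r) c (u(Suc r := y))) \<partial>Pi\<^sub>M {1..r} (\<lambda>_. lborel)) =
        ennreal (y ^ a (Suc r) * (c - y) ^ ?n * indicator {0..c} y) * ennreal ?K"
    proof (cases "0 \<le> y \<and> y \<le> c")
      case True
      have f: "?f (Suc r) c (u(Suc r := y)) = y ^ a (Suc r) * ?f r (c - y) u" for u
      proof -
        have "(\<forall>i\<in>{1..Suc r}. 0 \<le> (u(Suc r := y)) i) \<longleftrightarrow> (\<forall>i\<in>{1..r}. 0 \<le> u i)"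
        proof (intro iffI ballI)
          fix i assume h: "\<forall>i\<in>{1..Suc r}. 0 \<le> (u(Suc r := y)) i" "i \<in> {1..r}"
          show "0 \<le> u i" using h(1)[rule_format, of i] h(2) by simp
        next
          fix i assume h: "\<forall>i\<in>{1..r}. 0 \<le> u i" "i \<in> {1..Suc r}"
          show "0 \<le> (u(Suc r := y)) i" using h(1)[rule_format, of i] h(2) True by (cases "i = Suc r") auto
        qed
        moreover have "(\<Sum>i=1..Suc r. (u(Suc r := y)) i) = (\<Sum>i=1..r. u i) + y"
          using upd(1)[of u] by simp
        ultimately have "u(Suc r := y) \<in> ?S (Suc r) c \<longleftrightarrow> u \<in> ?S r (c - y)"
          unfolding mem_Collect_eq by (simp only: le_diff_eq)
        then show ?thesis by (simp add: indicator_def upd algebra_simps del: fun_upd_apply) simp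
      qed
      have "(\<integral>\<^sup>+u. ennreal (?f (Suc r) c (u(Suc r := y))) \<partial>Pi\<^sub>M {1..r} (\<lambda>_. lborel)) =
          (\<integral>\<^sup>+u. ennreal (y ^ a (Suc r)) * ennreal (?f r (c - y) u) \<partial>Pi\<^sub>M {1..r} (\<lambda>_. lborel))"
        unfolding f using True by (intro nn_integral_cong ennreal_mult') simp
      also have "\<dots> = ennreal (y ^ a (Suc r)) * ennreal ((c - y) ^ ?n * (\<Prod>i\<le>r. fact (a i)) / fact ?n)"
        using Suc.IH[of "c - y"] True by (subst nn_integral_cmult[OF meas]) simp
      also have "\<dots> = ennreal (y ^ a (Suc r) * (c - y) ^ ?n * indicator {0..c} y) * ennreal ?K"
        using True by (simp add: ennreal_mult'[symmetric] prod_nonneg)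
      finally show ?thesis .
    next
      case False
      have z: "?f (Suc r) c (u(Suc r := y)) = 0" for u
      proof (cases "u(Suc r := y) \<in> ?S (Suc r) c")
        case True
        then have h: "\<forall>i\<in>{1..Suc r}. 0 \<le> (u(Suc r := y)) i" "(\<Sum>i=1..Suc r. (u(Suc r := y)) i) \<le> c" by blast+
        have "0 \<le> (\<Sum>i=1..r. (u(Suc r := y)) i)"
        proof (rule sum_nonneg)
          fix i assume "i \<in> {1..r}"
          then show "0 \<le> (u(Suc r := y)) i" by (intro h(1)[rule_format]) auto
        qed
        moreover have "(\<Sum>i=1..Suc r. (u(Suc r := y)) i) = (\<Sum>i=1..r. (u(Suc r := y)) i) + y"
          by simp
        ultimately have "y \<le> c" using h(2) by linarith
        moreover have "0 \<le> y" using h(1)[rule_format, of "Suc r"] by simp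
        ultimately show ?thesis using False by blast
      qed simp
      show ?thesis unfolding z using False by (auto simp: indicator_def)
    qed
  qed
  also have "\<dots> = ennreal (c ^ (a (Suc r) + ?n + 1) * fact (a (Suc r)) * fact ?n / fact (a (Suc r) + ?n + 1)) * ennreal ?K"
    using Suc.prems by (subst nn_integral_multc) (simp_all add: nn_integral_beta)
  also have "\<dots> = ennreal (c ^ (a (Suc r) + ?n + 1) * fact (a (Suc r)) * fact ?n / fact (a (Suc r) + ?n + 1) * ?K)"
    using Suc.prems by (intro ennreal_mult'[symmetric] divide_nonneg_nonneg mult_nonneg_nonneg zero_le_power fact_ge_zero)
  also have "c ^ (a (Suc r) + ?n + 1) * fact (a (Suc r)) * fact ?n / fact (a (Suc r) + ?n + 1) * ?K =
      c ^ (Suc r + (\<Sum>i\<le>Suc r. a i)) * (\<Prod>i\<le>Suc r. fact (a i)) / fact (Suc r + (\<Sum>i\<le>Suc r. a i))"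
    by (simp add: algebra_simps)
  finally show ?case .
qed

section \<open>Lebesgue integrals over the simplex in barycentric coordinates\<close>

lemma simplex_chart_in:
  "simplex_chart r u \<in> standard_simplex r \<longleftrightarrow> (\<forall>i\<in>{1..r}. 0 \<le> u i) \<and> (\<Sum>i=1..r. u i) \<le> 1"
proof -
  have s: "(\<Sum>i\<le>r. simplex_chart r u i) = 1"
  proof -
    have "{..r} = insert 0 {1..r}" by auto
    moreover have "(\<Sum>i=1..r. simplex_chart r u i) = (\<Sum>i=1..r. u i)"
      by (rule sum.cong) (auto simp: simplex_chart_def)
    ultimately show ?thesis by (simp add: simplex_chart_def)
  qed
  show ?thesis
  proof
    assume "simplex_chart r u \<in> standard_simplex r"
    then have h: "0 \<le> simplex_chart r u i" for i by (simp add: standard_simplex_def)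
    have "0 \<le> u i" if "i \<in> {1..r}" for i using h[of i] that by (auto simp: simplex_chart_def)
    moreover have "(\<Sum>i=1..r. u i) \<le> 1" using h[of 0] by (simp add: simplex_chart_def)
    ultimately show "(\<forall>i\<in>{1..r}. 0 \<le> u i) \<and> (\<Sum>i=1..r. u i) \<le> 1" by blast
  next
    assume h: "(\<forall>i\<in>{1..r}. 0 \<le> u i) \<and> (\<Sum>i=1..r. u i) \<le> 1"
    then have nn: "0 \<le> simplex_chart r u i" for i by (auto simp: simplex_chart_def)
    moreover have "simplex_chart r u i \<le> 1" for i
    proof (cases "i \<le> r")
      case True
      then have "simplex_chart r u i \<le> (\<Sum>i\<le>r. simplex_chart r u i)"
        by (intro member_le_sum) (auto simp: nn)
      then show ?thesis by (simp add: s)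
    qed (simp add: simplex_chart_def)
    moreover have "simplex_chart r u i = 0" if "i > r" for i using that by (simp add: simplex_chart_def)
    ultimately show "simplex_chart r u \<in> standard_simplex r" using s by (simp add: standard_simplex_def)
  qed
qed

lemma simplex_chart_sums:
  "i \<in> {1..r} \<Longrightarrow> simplex_chart r u i = u i" "simplex_chart r u 0 = 1 - (\<Sum>i=1..r. u i)"
  "i > r \<Longrightarrow> simplex_chart r u i = 0"
  by (auto simp: simplex_chart_def)

definition simplex_integrable :: "nat \<Rightarrow> ((nat \<Rightarrow> real) \<Rightarrow> real) \<Rightarrow> bool" where
  "simplex_integrable r f \<longleftrightarrow> set_integrable (Pi\<^sub>M {1..r} (\<lambda>_. lborel))
     {u. simplex_chart r u \<in> standard_simplex r} (\<lambda>u. f (simplex_chart r u))"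

lemma simplex_integral_monomial:
  shows "simplex_integrable r (\<lambda>t. \<Prod>i\<le>r. t i ^ a i)"
    and "simplex_integral r (\<lambda>t. \<Prod>i\<le>r. t i ^ a i) =
      (\<Prod>i\<le>r. fact (a i)) / fact (r + (\<Sum>i\<le>r. a i))"
proof -
  let ?M = "Pi\<^sub>M {1..r} (\<lambda>_. lborel :: real measure)"
  let ?S = "{u. (\<forall>i\<in>{1..r}. 0 \<le> u i) \<and> (\<Sum>i=1..r. u i) \<le> (1::real)} :: (nat \<Rightarrow> real) set"
  let ?g = "\<lambda>u. (\<Prod>i=1..r. u i ^ a i) * (1 - (\<Sum>i=1..r. u i)) ^ a 0 :: real"
  let ?f = "\<lambda>u. indicator ?S u * ?g u"
  have chart: "(\<Prod>i\<le>r. simplex_chart r u i ^ a i) = ?g u" for u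
  proof -
    have "{..r} = insert 0 {1..r}" by auto
    moreover have "(\<Prod>i=1..r. simplex_chart r u i ^ a i) = (\<Prod>i=1..r. u i ^ a i)"
      by (rule prod.cong) (auto simp: simplex_chart_def)
    ultimately show ?thesis by (simp add: simplex_chart_sums(2))
  qed
  have meas: "?f \<in> borel_measurable ?M"
  proof -
    have "{u \<in> space ?M. (\<forall>i\<in>{1..r}. 0 \<le> u i) \<and> (\<Sum>i=1..r. u i) \<le> 1} \<in> sets ?M" by measurable
    then have "(indicator {u \<in> space ?M. (\<forall>i\<in>{1..r}. 0 \<le> u i) \<and> (\<Sum>i=1..r. u i) \<le> 1} :: _ \<Rightarrow> real)
        \<in> borel_measurable ?M" by (rule borel_measurable_indicator)
    then have "(indicator ?S :: _ \<Rightarrow> real) \<in> borel_measurable ?M"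
      by (rule measurable_cong[THEN iffD1, rotated]) (auto simp: indicator_def)
    moreover have "?g \<in> borel_measurable ?M" by measurable
    ultimately show ?thesis by measurable
  qed
  have nonneg: "0 \<le> ?f u" for u by (auto simp: indicator_def intro!: mult_nonneg_nonneg prod_nonneg)
  have nn: "(\<integral>\<^sup>+u. ennreal (?f u) \<partial>?M) = ennreal ((\<Prod>i\<le>r. fact (a i)) / fact (r + (\<Sum>i\<le>r. a i)))"
    using nn_integral_dirichlet[of 1 r a] by simp
  have "integrable ?M ?f"
    by (rule integrableI_nonneg[OF meas]) (use nonneg nn in auto)
  then show "simplex_integrable r (\<lambda>t. \<Prod>i\<le>r. t i ^ a i)"
    unfolding simplex_integrable_def set_integrable_def chart simplex_chart_in by simp
  have "integral\<^sup>L ?M ?f = (\<Prod>i\<le>r. fact (a i)) / fact (r + (\<Sum>i\<le>r. a i))"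
    by (rule integral_eq_nn_integral[THEN trans, OF meas])
      (use nonneg nn in \<open>auto intro!: enn2real_ennreal divide_nonneg_nonneg prod_nonneg\<close>)
  then show "simplex_integral r (\<lambda>t. \<Prod>i\<le>r. t i ^ a i) = (\<Prod>i\<le>r. fact (a i)) / fact (r + (\<Sum>i\<le>r. a i))"
    unfolding simplex_integral_def set_lebesgue_integral_def chart simplex_chart_in by simp
qed

lemma simplex_integral_cong:
  "(\<And>t. t \<in> standard_simplex r \<Longrightarrow> f t = g t) \<Longrightarrow> simplex_integral r f = simplex_integral r g"
  unfolding simplex_integral_def set_lebesgue_integral_def
  by (rule Bochner_Integration.integral_cong) (auto simp: indicator_def)

lemma simplex_integral_add:
  "simplex_integrable r f \<Longrightarrow> simplex_integrable r g \<Longrightarrow>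
    simplex_integrable r (\<lambda>t. f t + g t) \<and>
    simplex_integral r (\<lambda>t. f t + g t) = simplex_integral r f + simplex_integral r g"
  unfolding simplex_integrable_def simplex_integral_def by (auto intro: set_integral_add)

lemma simplex_integral_scale:
  "simplex_integral r (\<lambda>t. c * f t) = c * simplex_integral r f"
  unfolding simplex_integral_def by simp

lemma simplex_integrable_scale:
  "simplex_integrable r f \<Longrightarrow> simplex_integrable r (\<lambda>t. c * f t)"
  unfolding simplex_integrable_def by simp

lemma simplex_integral_zero [simp]: "simplex_integral r (\<lambda>t. 0) = 0"
  using simplex_integral_scale[of r 0 "\<lambda>t. 0"] by simp

section \<open>Polynomials in barycentric coordinates: integrals, derivatives and Stokes'
  theorem\<close>

definition bary_mono :: "nat \<Rightarrow> (nat \<Rightarrow> nat) \<Rightarrow> (nat \<Rightarrow> real) \<Rightarrow> real" where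
  "bary_mono r a t = (\<Prod>i\<le>r. t i ^ a i)"

text \<open>Finite sums of products in which the variables are separated. Integration over the
  simplex acts on the monomial in \<open>t\<close> and differentiation along the group on the
  polynomial in \<open>h\<close>, so everything reduces to monomials.\<close>

inductive sep :: "nat \<Rightarrow> ((nat \<Rightarrow> real) \<Rightarrow> 'b::{real_vector,t2_space} \<Rightarrow> real) \<Rightarrow> bool" for r where
  zero: "sep r (\<lambda>t h. 0)"
| add: "sep r f \<Longrightarrow> sep r g \<Longrightarrow> sep r (\<lambda>t h. f t h + g t h)"
| base: "polyfun g \<Longrightarrow> sep r (\<lambda>t h. g h * bary_mono r a t)"

lemma bary_mono_mult: "bary_mono r a t * bary_mono r b t = bary_mono r (\<lambda>i. a i + b i) t"
  by (simp add: bary_mono_def power_add prod.distrib)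

lemma bary_mono_one: "bary_mono r (\<lambda>i. 0) t = 1"
  by (simp add: bary_mono_def)

lemma bary_mono_single: "i \<le> r \<Longrightarrow> bary_mono r (\<lambda>j. if j = i then 1 else 0) t = t i"
proof -
  assume "i \<le> r"
  then have "bary_mono r (\<lambda>j. if j = i then 1 else 0) t = (\<Prod>j\<le>r. if j = i then t j else 1)"
    unfolding bary_mono_def by (intro prod.cong) auto
  then show ?thesis using \<open>i \<le> r\<close> by (simp add: prod.delta)
qed

lemma sep_mult: "sep r f \<Longrightarrow> sep r g \<Longrightarrow> sep r (\<lambda>t h. f t h * g t h)"
proof (induction rule: sep.induct)
  case (base p a)
  note p = base
  show ?case using base(2)
  proof (induction rule: sep.induct)
    case (base q b)
    have "p h * bary_mono r a t * (q h * bary_mono r b t) = (p h * q h) * bary_mono r (\<lambda>i. a i + b i) t" for t h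
      unfolding bary_mono_mult[symmetric] by (simp only: mult_ac)
    then show ?case using sep.base[OF polyfun.mult[OF p(1) base], of r "\<lambda>i. a i + b i"] by (simp only:)
  qed (auto simp: distrib_left intro: sep.intros)
qed (auto simp: distrib_right intro: sep.intros)

lemma sep_sum: "(\<And>i. i \<in> I \<Longrightarrow> sep r (f i)) \<Longrightarrow> sep r (\<lambda>t h. \<Sum>i\<in>I. f i t h)"
  by (induction I rule: infinite_finite_induct) (auto intro: sep.intros)

text \<open>A point whose coordinates beyond \<open>r\<close> vanish is a finite combination of unit
  vectors. There a linear functional splits into the coordinates of \<open>t\<close> and a
  functional of \<open>h\<close>.\<close>

lemma sep_of_polyfun:
  "polyfun F \<Longrightarrow> \<exists>f. sep r f \<and> (\<forall>t h. (\<forall>i>r. t i = 0) \<longrightarrow> F (t, h) = f t h)"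
proof (induction rule: polyfun.induct)
  case (const c)
  show ?case
    using sep.base[OF polyfun.const[of c], of r "\<lambda>i. 0"] by (auto simp: bary_mono_one)
next
  case (functional l)
  let ?e = "\<lambda>i j. of_bool (j = i) :: real"
  let ?f = "\<lambda>t h. (\<Sum>i\<le>r. l (?e i, 0) * bary_mono r (\<lambda>j. if j = i then 1 else 0) t) + l (0, h) * bary_mono r (\<lambda>j. 0) t"
  have "continuous_on UNIV (\<lambda>h. l (0, h))"
    by (rule continuous_on_compose2[OF functional(2)]) (auto intro!: continuous_intros)
  moreover have "linear (\<lambda>h. l (0, h))"
  proof (rule linearI)
    show "l (0, x + y) = l (0, x) + l (0, y)" for x y
      using linear_add[OF functional(1), of "(0, x)" "(0, y)"] by simp
    show "l (0, c *\<^sub>R x) = c *\<^sub>R l (0, x)" for c x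
      using linear_scale[OF functional(1), of c "(0, x)"] by simp
  qed
  ultimately have "sep r ?f"
    by (intro sep.add sep_sum sep.base polyfun.const polyfun.functional)
  moreover have "l (t, h) = ?f t h" if t: "\<forall>i>r. t i = 0" for t h
  proof -
    have "(\<Sum>i\<le>r. t i *\<^sub>R ?e i) = t"
    proof
      fix j
      have "(\<Sum>i\<le>r. t i *\<^sub>R ?e i) j = (\<Sum>i\<le>r. if i = j then t j else 0)"
        unfolding sum_fun_apply by (intro sum.cong) (auto simp: scaleR_fun_def)
      then show "(\<Sum>i\<le>r. t i *\<^sub>R ?e i) j = t j" using t by (auto simp: not_le)
    qed
    then have "(t, h) = (\<Sum>i\<le>r. t i *\<^sub>R (?e i, 0)) + (0, h)"
      by (simp add: prod_eq_iff fst_sum snd_sum)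
    then have "l (t, h) = (\<Sum>i\<le>r. t i * l (?e i, 0)) + l (0, h)"
      by (simp only: linear_add[OF functional(1)] linear_sum[OF functional(1)] linear_scale[OF functional(1)] real_scaleR_def)
    moreover have "(\<Sum>i\<le>r. t i * l (?e i, 0)) =
        (\<Sum>i\<le>r. l (?e i, 0) * bary_mono r (\<lambda>j. if j = i then 1 else 0) t)"
      by (intro sum.cong) (auto simp: bary_mono_single)
    ultimately show ?thesis by (simp add: bary_mono_one)
  qed
  ultimately show ?case by blast
next
  case (add f g)
  then obtain f' g' where "sep r f'" "\<forall>t h. (\<forall>i>r. t i = 0) \<longrightarrow> f (t, h) = f' t h"
    "sep r g'" "\<forall>t h. (\<forall>i>r. t i = 0) \<longrightarrow> g (t, h) = g' t h" by auto
  then show ?case by (intro exI[of _ "\<lambda>t h. f' t h + g' t h"]) (auto intro: sep.add)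
next
  case (mult f g)
  then obtain f' g' where "sep r f'" "\<forall>t h. (\<forall>i>r. t i = 0) \<longrightarrow> f (t, h) = f' t h"
    "sep r g'" "\<forall>t h. (\<forall>i>r. t i = 0) \<longrightarrow> g (t, h) = g' t h" by auto
  then show ?case by (intro exI[of _ "\<lambda>t h. f' t h * g' t h"]) (auto intro: sep_mult)
qed

lemma bary_mono_integrable: "simplex_integrable r (bary_mono r a)"
  using simplex_integral_monomial(1)[of r a] by (simp add: bary_mono_def[abs_def])

lemma bary_mono_integral: "simplex_integral r (bary_mono r a) = (\<Prod>i\<le>r. fact (a i)) / fact (r + (\<Sum>i\<le>r. a i))"
  using simplex_integral_monomial(2)[of r a] by (simp add: bary_mono_def[abs_def])

lemma simplex_integrable_zero [simp]: "simplex_integrable r (\<lambda>t. 0)"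
  using simplex_integrable_scale[OF bary_mono_integrable, of r 0] by simp

lemma sep_integrable: "sep r f \<Longrightarrow> simplex_integrable r (\<lambda>t. f t h)"
  by (induction rule: sep.induct)
    (auto simp: simplex_integral_add intro: simplex_integrable_scale bary_mono_integrable)

lemma sep_integral_poly: "sep r f \<Longrightarrow> polyfun (\<lambda>h. simplex_integral r (\<lambda>t. f t h))"
proof (induction rule: sep.induct)
  case zero
  then show ?case by (simp add: polyfun.const)
next
  case (add f g)
  have "simplex_integral r (\<lambda>t. f t h + g t h) =
      simplex_integral r (\<lambda>t. f t h) + simplex_integral r (\<lambda>t. g t h)" for h
    using simplex_integral_add[OF sep_integrable[OF add(1)] sep_integrable[OF add(2)]] by blast
  then show ?case using polyfun.add[OF add(3,4)] by simp
next
  case (base g a)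
  then show ?case unfolding simplex_integral_scale by (intro polyfun.mult polyfun.const)
qed

text \<open>Differentiation under the integral sign: in each summand the integral over
  \<open>t\<close> is a constant factor.\<close>

lemma sep_deriv:
  "sep r f \<Longrightarrow> \<exists>f'. sep r f' \<and>
    (\<forall>t h. ((\<lambda>s. f t (h + s *\<^sub>R w)) has_field_derivative f' t h) (at 0)) \<and>
    (\<forall>h. ((\<lambda>s. simplex_integral r (\<lambda>t. f t (h + s *\<^sub>R w))) has_field_derivative
      simplex_integral r (\<lambda>t. f' t h)) (at 0))"
proof (induction rule: sep.induct)
  case zero
  then show ?case by (intro exI[of _ "\<lambda>t h. 0"]) (auto intro: sep.zero)
next
  case (add f g)
  then obtain f' g' where *: "sep r f'" "sep r g'"
    "\<And>t h. ((\<lambda>s. f t (h + s *\<^sub>R w)) has_field_derivative f' t h) (at 0)"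
    "\<And>h. ((\<lambda>s. simplex_integral r (\<lambda>t. f t (h + s *\<^sub>R w))) has_field_derivative
      simplex_integral r (\<lambda>t. f' t h)) (at 0)"
    "\<And>t h. ((\<lambda>s. g t (h + s *\<^sub>R w)) has_field_derivative g' t h) (at 0)"
    "\<And>h. ((\<lambda>s. simplex_integral r (\<lambda>t. g t (h + s *\<^sub>R w))) has_field_derivative
      simplex_integral r (\<lambda>t. g' t h)) (at 0)" by auto
  have "simplex_integral r (\<lambda>t. f t h + g t h) =
      simplex_integral r (\<lambda>t. f t h) + simplex_integral r (\<lambda>t. g t h)"
    "simplex_integral r (\<lambda>t. f' t h + g' t h) =
      simplex_integral r (\<lambda>t. f' t h) + simplex_integral r (\<lambda>t. g' t h)" for h
    using simplex_integral_add[OF sep_integrable sep_integrable] add(1,2) *(1,2) by blast+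
  then show ?case using *
    by (intro exI[of _ "\<lambda>t h. f' t h + g' t h"]) (auto intro: sep.add DERIV_add)
next
  case (base g a)
  show ?case
    unfolding simplex_integral_scale
    by (intro exI[of _ "\<lambda>t h. dir_deriv g w h * bary_mono r a t"] conjI allI, rule sep.base[OF polyfun_dir_deriv[OF base]])
      (auto simp: simplex_integral_scale intro!: DERIV_cmult_right polyfun_has_deriv[OF base])
qed

definition coface :: "nat \<Rightarrow> (nat \<Rightarrow> real) \<Rightarrow> nat \<Rightarrow> real" where
  "coface s t = (\<lambda>j. if j < s then t j else if j = s then 0 else t (j - 1))"

text \<open>The same map describes the vertices of a face of the simplex and the arguments that
  remain when one argument of a form is omitted.\<close>

definition skip :: "nat \<Rightarrow> nat \<Rightarrow> nat" where "skip s i = (if i < s then i else Suc i)"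

lemma coface_skip [simp]: "coface s t (skip s i) = t i" "coface s t s = 0"
  by (auto simp: coface_def skip_def)

lemma skip_bij: "s \<le> Suc r \<Longrightarrow> bij_betw (skip s) {..r} ({..Suc r} - {s})"
  by (rule bij_betw_byWitness[where f' = "\<lambda>i. if i < s then i else i - 1"]) (auto simp: skip_def)

lemma bary_mono_coface:
  assumes "s \<le> Suc r"
  shows "bary_mono (Suc r) a (coface s t) = (if a s = 0 then bary_mono r (\<lambda>i. a (skip s i)) t else 0)"
proof -
  have "bary_mono (Suc r) a (coface s t) = coface s t s ^ a s * (\<Prod>i\<in>{..Suc r} - {s}. coface s t i ^ a i)"
    unfolding bary_mono_def using assms by (subst prod.remove[of _ s]) auto
  also have "(\<Prod>i\<in>{..Suc r} - {s}. coface s t i ^ a i) = (\<Prod>i\<le>r. coface s t (skip s i) ^ a (skip s i))"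
    by (rule prod.reindex_bij_betw[OF skip_bij[OF assms], symmetric])
  finally show ?thesis by (simp add: bary_mono_def)
qed

lemma integral_mono_coface:
  assumes "s \<le> Suc r"
  shows "simplex_integral r (\<lambda>t. bary_mono (Suc r) a (coface s t)) =
    (if a s = 0 then (\<Prod>i\<le>Suc r. fact (a i)) / fact (r + (\<Sum>i\<le>Suc r. a i)) else 0)"
proof (cases "a s = 0")
  case True
  have "(\<Prod>i\<le>Suc r. fact (a i)) = (fact (a s) :: real) * (\<Prod>i\<in>{..Suc r} - {s}. fact (a i))"
    using assms by (subst prod.remove[of _ s]) auto
  also have "(\<Prod>i\<in>{..Suc r} - {s}. fact (a i)) = (\<Prod>i\<le>r. fact (a (skip s i)) :: real)"
    by (rule prod.reindex_bij_betw[OF skip_bij[OF assms], symmetric])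
  finally have p: "(\<Prod>i\<le>Suc r. fact (a i)) = (\<Prod>i\<le>r. fact (a (skip s i)) :: real)" using True by simp
  have "(\<Sum>i\<le>Suc r. a i) = a s + (\<Sum>i\<in>{..Suc r} - {s}. a i)"
    using assms by (subst sum.remove[of _ s]) auto
  also have "(\<Sum>i\<in>{..Suc r} - {s}. a i) = (\<Sum>i\<le>r. a (skip s i))"
    by (rule sum.reindex_bij_betw[OF skip_bij[OF assms], symmetric])
  finally have "(\<Sum>i\<le>Suc r. a i) = (\<Sum>i\<le>r. a (skip s i))" using True by simp
  then show ?thesis using True p by (simp only: bary_mono_coface[OF assms] bary_mono_integral[unfolded bary_mono_def[abs_def]] if_True) (simp add: bary_mono_integral)
qed (simp add: bary_mono_coface[OF assms])

text \<open>The direction \<open>simplex_vec s\<close> raises \<open>t s\<close> and lowers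
  \<open>t 0\<close>. If an exponent is 0, the truncated subtraction in it does no harm because of
  the factor in front.\<close>

lemma bary_mono_deriv:
  assumes "s \<in> {1..r}"
  shows "((\<lambda>x. bary_mono r a (t + x *\<^sub>R simplex_vec s)) has_field_derivative
    real (a s) * bary_mono r (a(s := a s - 1)) t - real (a 0) * bary_mono r (a(0 := a 0 - 1)) t) (at 0)"
proof -
  let ?R = "{..r} - {0} - {s}"
  have split: "bary_mono r b u = u 0 ^ b 0 * (u s ^ b s * (\<Prod>i\<in>?R. u i ^ b i))" for b u
    unfolding bary_mono_def using assms by (subst prod.remove[of _ 0], simp, simp, subst prod.remove[of _ s]) auto
  have rest: "(\<Prod>i\<in>?R. (t + x *\<^sub>R simplex_vec s) i ^ a i) = (\<Prod>i\<in>?R. t i ^ a i)" for x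
    by (rule prod.cong) (auto simp: simplex_vec_def scaleR_fun_def)
  have r': "(\<Prod>i\<in>?R. t i ^ (a(k := n)) i) = (\<Prod>i\<in>?R. t i ^ a i)" if "k = 0 \<or> k = s" for k n
    by (rule prod.cong) (use that in auto)
  let ?Q = "\<Prod>i\<in>?R. t i ^ a i"
  have "((\<lambda>x. (t 0 - x) ^ a 0 * ((t s + x) ^ a s * ?Q)) has_field_derivative
      real (a 0) * (0 - 1) * (t 0 - 0) ^ (a 0 - 1) * ((t s + 0) ^ a s * ?Q) +
      (t 0 - 0) ^ a 0 * (real (a s) * (0 + 1) * (t s + 0) ^ (a s - 1) * ?Q)) (at 0)"
    by (rule derivative_eq_intros refl | simp)+
  moreover have "(\<lambda>x. bary_mono r a (t + x *\<^sub>R simplex_vec s)) = (\<lambda>x. (t 0 - x) ^ a 0 * ((t s + x) ^ a s * ?Q))"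
    unfolding split rest using assms by (auto simp: simplex_vec_def scaleR_fun_def)
  ultimately show ?thesis using assms by (simp add: split r' algebra_simps)
qed

text \<open>The value is the one in \<open>integral_mono_coface\<close>, but in the complementary
  case for \<open>a s\<close>. The sum of the two is therefore the same for all \<open>s\<close>,
  and comparing \<open>s\<close> with 0 is Stokes' theorem for monomials.\<close>

lemma integral_mono_lower:
  assumes "s \<le> Suc r"
  shows "real (a s) * simplex_integral (Suc r) (bary_mono (Suc r) (a(s := a s - 1))) =
    (if a s = 0 then 0 else (\<Prod>i\<le>Suc r. fact (a i)) / fact (r + (\<Sum>i\<le>Suc r. a i)))"
proof (cases "a s = 0")
  case False
  let ?b = "a(s := a s - 1)"
  have f: "real (a s) * fact (a s - 1) = fact (a s)" using False by (simp add: fact_reduce[of "a s"])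
  have "(\<Prod>i\<le>Suc r. fact (?b i)) = (fact (a s - 1) :: real) * (\<Prod>i\<in>{..Suc r} - {s}. fact (a i))"
    using assms by (subst prod.remove[of _ s]) (auto intro!: prod.cong)
  moreover have "(\<Prod>i\<le>Suc r. fact (a i)) = (fact (a s) :: real) * (\<Prod>i\<in>{..Suc r} - {s}. fact (a i))"
    using assms by (subst prod.remove[of _ s]) auto
  ultimately have p: "real (a s) * (\<Prod>i\<le>Suc r. fact (?b i)) = (\<Prod>i\<le>Suc r. fact (a i))"
    using f by (simp only: mult.assoc[symmetric])
  have "(\<Sum>i\<le>Suc r. ?b i) = (a s - 1) + (\<Sum>i\<in>{..Suc r} - {s}. a i)"
    using assms by (subst sum.remove[of _ s]) (auto intro!: sum.cong)
  moreover have "(\<Sum>i\<le>Suc r. a i) = a s + (\<Sum>i\<in>{..Suc r} - {s}. a i)"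
    using assms by (subst sum.remove[of _ s]) auto
  ultimately have "Suc r + (\<Sum>i\<le>Suc r. ?b i) = r + (\<Sum>i\<le>Suc r. a i)" using False by linarith
  then show ?thesis using False p by (simp only: bary_mono_integral times_divide_eq_right if_False)
qed simp

text \<open>The direction \<open>simplex_vec s\<close> is tangent to all faces of the simplex except
  those opposite to the vertices 0 and \<open>s\<close>, so only these two contribute.\<close>

lemma sep_stokes:
  assumes s: "s \<in> {1..Suc r}"
  shows "sep (Suc r) f \<Longrightarrow> \<exists>f'. sep (Suc r) f' \<and>
    (\<forall>t h. ((\<lambda>x. f (t + x *\<^sub>R simplex_vec s) h) has_field_derivative f' t h) (at 0)) \<and>
    (\<forall>h i. i \<le> Suc r \<longrightarrow> simplex_integrable r (\<lambda>t. f (coface i t) h)) \<and>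
    (\<forall>h. simplex_integral (Suc r) (\<lambda>t. f' t h) =
      simplex_integral r (\<lambda>t. f (coface 0 t) h) - simplex_integral r (\<lambda>t. f (coface s t) h))"
proof (induction rule: sep.induct)
  case zero
  then show ?case by (intro exI[of _ "\<lambda>t h. 0"]) (auto intro: sep.zero)
next
  case (add f g)
  obtain f' where f: "sep (Suc r) f'"
    "\<forall>t h. ((\<lambda>x. f (t + x *\<^sub>R simplex_vec s) h) has_field_derivative f' t h) (at 0)"
    "\<forall>h i. i \<le> Suc r \<longrightarrow> simplex_integrable r (\<lambda>t. f (coface i t) h)"
    "\<forall>h. simplex_integral (Suc r) (\<lambda>t. f' t h) =
      simplex_integral r (\<lambda>t. f (coface 0 t) h) - simplex_integral r (\<lambda>t. f (coface s t) h)"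
    using add(3) by blast
  obtain g' where g: "sep (Suc r) g'"
    "\<forall>t h. ((\<lambda>x. g (t + x *\<^sub>R simplex_vec s) h) has_field_derivative g' t h) (at 0)"
    "\<forall>h i. i \<le> Suc r \<longrightarrow> simplex_integrable r (\<lambda>t. g (coface i t) h)"
    "\<forall>h. simplex_integral (Suc r) (\<lambda>t. g' t h) =
      simplex_integral r (\<lambda>t. g (coface 0 t) h) - simplex_integral r (\<lambda>t. g (coface s t) h)"
    using add(4) by blast
  note * = f(1) g(1) f(2)[rule_format] g(2)[rule_format] f(3)[rule_format] g(3)[rule_format]
    f(4)[rule_format] g(4)[rule_format]
  have 1: "simplex_integral (Suc r) (\<lambda>t. f' t h + g' t h) =
      simplex_integral (Suc r) (\<lambda>t. f' t h) + simplex_integral (Suc r) (\<lambda>t. g' t h)" for h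
    using simplex_integral_add[OF sep_integrable[OF *(1)] sep_integrable[OF *(2)]] by blast
  have 2: "simplex_integrable r (\<lambda>t. f (coface i t) h + g (coface i t) h)"
    "simplex_integral r (\<lambda>t. f (coface i t) h + g (coface i t) h) =
      simplex_integral r (\<lambda>t. f (coface i t) h) + simplex_integral r (\<lambda>t. g (coface i t) h)"
    if "i \<le> Suc r" for i h
    using simplex_integral_add[OF *(5)[OF that] *(6)[OF that]] by blast+
  show ?case
  proof (intro exI[of _ "\<lambda>t h. f' t h + g' t h"] conjI allI impI)
    show "sep (Suc r) (\<lambda>t h. f' t h + g' t h)" by (intro sep.add *(1,2))
    show "((\<lambda>x. f (t + x *\<^sub>R simplex_vec s) h + g (t + x *\<^sub>R simplex_vec s) h) has_field_derivative
        f' t h + g' t h) (at 0)" for t h by (intro DERIV_add *(3,4))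
    show "simplex_integral (Suc r) (\<lambda>t. f' t h + g' t h) =
        simplex_integral r (\<lambda>t. f (coface 0 t) h + g (coface 0 t) h) -
        simplex_integral r (\<lambda>t. f (coface s t) h + g (coface s t) h)" for h
      using s by (simp add: 1 2(2) *(7,8))
  qed (rule 2(1))
next
  case (base g a)
  let ?f' = "\<lambda>t h. g h * (real (a s) * bary_mono (Suc r) (a(s := a s - 1)) t - real (a 0) * bary_mono (Suc r) (a(0 := a 0 - 1)) t)"
  have "sep (Suc r) (\<lambda>t h. (real (a s) * g h) * bary_mono (Suc r) (a(s := a s - 1)) t +
      (- real (a 0) * g h) * bary_mono (Suc r) (a(0 := a 0 - 1)) t)"
    by (intro sep.add sep.base polyfun_scale base)
  then have 1: "sep (Suc r) ?f'" by (simp add: algebra_simps)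
  have 2: "((\<lambda>x. g h * bary_mono (Suc r) a (t + x *\<^sub>R simplex_vec s)) has_field_derivative ?f' t h) (at 0)" for t h
    by (intro DERIV_cmult bary_mono_deriv s)
  have 3: "simplex_integrable r (\<lambda>t. g h * bary_mono (Suc r) a (coface i t))" if "i \<le> Suc r" for h i
    by (intro simplex_integrable_scale, cases "a i = 0") (auto simp: bary_mono_coface[OF that] intro: bary_mono_integrable[unfolded bary_mono_def[abs_def]] bary_mono_integrable)
  have "simplex_integral (Suc r) (\<lambda>t. real (a s) * bary_mono (Suc r) (a(s := a s - 1)) t +
      (- real (a 0)) * bary_mono (Suc r) (a(0 := a 0 - 1)) t) =
    real (a s) * simplex_integral (Suc r) (bary_mono (Suc r) (a(s := a s - 1))) +
      (- real (a 0)) * simplex_integral (Suc r) (bary_mono (Suc r) (a(0 := a 0 - 1)))"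
    using simplex_integral_add[OF simplex_integrable_scale[OF bary_mono_integrable] simplex_integrable_scale[OF bary_mono_integrable]]
    by (simp only: simplex_integral_scale) 
  also have "\<dots> = simplex_integral r (\<lambda>t. bary_mono (Suc r) a (coface 0 t)) -
      simplex_integral r (\<lambda>t. bary_mono (Suc r) a (coface s t))"
  proof -
    have s': "s \<le> Suc r" using s by simp
    show ?thesis unfolding mult_minus_left integral_mono_lower[OF s'] integral_mono_lower[OF le0]
        integral_mono_coface[OF s'] integral_mono_coface[OF le0] by simp
  qed
  finally have 4: "simplex_integral (Suc r) (\<lambda>t. ?f' t h) =
      simplex_integral r (\<lambda>t. g h * bary_mono (Suc r) a (coface 0 t)) -
      simplex_integral r (\<lambda>t. g h * bary_mono (Suc r) a (coface s t))" for h
    unfolding simplex_integral_scale by (simp add: right_diff_distrib)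
  show ?case using 1 2 3 4 by blast
qed

section \<open>Curvature and Pfaffian\<close>

text \<open>The curvature \<open>d\<theta> + \<theta> \<theta>\<close> of
  \<open>\<theta> = - \<Sum> t_i \<psi>_i\<close>, in which \<open>d \<psi>_i\<close> has been
  replaced by \<open>\<psi>_i \<psi>_i\<close> according to the Maurer-Cartan equation.\<close>

definition curv :: "nat \<Rightarrow> (nat \<Rightarrow> real) \<Rightarrow> (nat \<Rightarrow> grass) \<Rightarrow> (nat \<Rightarrow> grass^'n^'n) \<Rightarrow> grass^'n::finite^'n" where
  "curv r t dt \<psi> = - (\<Sum>i\<le>r. smul (dt i) (\<psi> i)) - (\<Sum>i\<le>r. t i *\<^sub>R (\<psi> i ** \<psi> i)) +
     (\<Sum>i\<le>r. t i *\<^sub>R \<psi> i) ** (\<Sum>i\<le>r. t i *\<^sub>R \<psi> i)"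

lemma gmat_scaleR:
  fixes A B :: "grass^'n::finite^'n"
  shows "(c *\<^sub>R A) ** B = c *\<^sub>R (A ** B)" "A ** (c *\<^sub>R B) = c *\<^sub>R (A ** B)"
  by (simp_all add: matrix_matrix_mult_def vec_eq_iff scaleR_sum_right)

lemma gmat_sum:
  fixes A :: "'i \<Rightarrow> grass^'n::finite^'n"
  shows "(\<Sum>i\<in>I. A i) ** B = (\<Sum>i\<in>I. A i ** B)" "B ** (\<Sum>i\<in>I. A i) = (\<Sum>i\<in>I. B ** A i)"
  by (induction I rule: infinite_finite_induct) (auto simp: matrix_diff_distrib)

lemma smul_simps: "smul x (A + B) = smul x A + smul x B" "smul (x + y) A = smul x A + smul y A"
  "smul 0 A = 0" "smul x 0 = 0" "smul (- x) A = - smul x A" "smul x (- A) = - smul x A"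
  "smul x (A - B) = smul x A - smul x B"
  by (simp_all add: smul_def vec_eq_iff algebra_simps)

lemma smul_of_real: "smul (of_real c) A = c *\<^sub>R A"
  by (simp add: smul_def vec_eq_iff of_real_def)

lemma smul_sum: "smul (\<Sum>i\<in>I. x i) A = (\<Sum>i\<in>I. smul (x i) A)" "smul z (\<Sum>i\<in>I. F i) = (\<Sum>i\<in>I. smul z (F i))"
  by (induction I rule: infinite_finite_induct) (auto simp: smul_simps)

lemma smul_mult: "smul x A ** B = smul x (A ** B)"
  by (simp add: smul_def vec_eq_iff matrix_mult_nth sum_distrib_left mult.assoc)

lemma mre_smul: "mre g ** smul x A = smul x (mre g ** A)"
  by (simp add: smul_def mre_def vec_eq_iff matrix_mult_nth sum_distrib_left of_real_def)

text \<open>The terms in \<open>\<kappa>\<close> cancel because the \<open>t i\<close> add up to 1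
  and the \<open>dt i\<close> to 0. It removes \<open>\<theta>_0\<close> on the total space, and a
  common summand on the face \<open>t 0 = 0\<close>.\<close>

lemma curv_shift:
  assumes "(\<Sum>i\<le>r. t i) = 1" "(\<Sum>i\<le>r. dt i) = 0"
  shows "curv r t dt (\<lambda>i. \<psi> i + \<kappa>) = curv r t dt \<psi>"
proof -
  have 1: "(\<Sum>i\<le>r. smul (dt i) (\<psi> i + \<kappa>)) = (\<Sum>i\<le>r. smul (dt i) (\<psi> i))"
    using assms(2) by (simp add: smul_simps sum.distrib smul_sum(1)[symmetric])
  have 2: "(\<Sum>i\<le>r. t i *\<^sub>R (\<psi> i + \<kappa>)) = (\<Sum>i\<le>r. t i *\<^sub>R \<psi> i) + \<kappa>"
    using assms(1) by (simp add: scaleR_add_right sum.distrib scaleR_sum_left[symmetric])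
  have 3: "(\<Sum>i\<le>r. t i *\<^sub>R ((\<psi> i + \<kappa>) ** (\<psi> i + \<kappa>))) = (\<Sum>i\<le>r. t i *\<^sub>R (\<psi> i ** \<psi> i)) +
      (\<Sum>i\<le>r. t i *\<^sub>R \<psi> i) ** \<kappa> + \<kappa> ** (\<Sum>i\<le>r. t i *\<^sub>R \<psi> i) + \<kappa> ** \<kappa>"
    using assms(1)
    by (simp add: matrix_diff_distrib scaleR_add_right sum.distrib scaleR_sum_left[symmetric] gmat_sum gmat_scaleR algebra_simps)
  show ?thesis unfolding curv_def 1 2 3 by (simp add: matrix_diff_distrib algebra_simps)
qed

text \<open>\<open>curv\<close> contains no derivatives, so conjugation by a matrix of numbers
  passes through it term by term, even if that matrix varies from point to point.\<close>

lemma curv_conj: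
  assumes "transpose g ** g = mat 1"
  shows "curv r t dt (\<lambda>i. mre g ** \<psi> i ** mre (transpose g)) = mre g ** curv r t dt \<psi> ** mre (transpose g)"
proof -
  let ?g = "mre g" and ?h = "mre (transpose g)"
  have hg: "?h ** ?g = mat 1" using assms by (metis mre_mult mre_mat1)
  have sq: "(?g ** A ** ?h) ** (?g ** B ** ?h) = ?g ** (A ** B) ** ?h" for A B
  proof -
    have "(?g ** A ** ?h) ** (?g ** B ** ?h) = ?g ** A ** (?h ** ?g) ** B ** ?h" by (simp add: matrix_mul_assoc)
    then show ?thesis by (simp add: hg matrix_mul_assoc)
  qed
  have sm: "smul x (?g ** A ** ?h) = ?g ** smul x A ** ?h" for x A by (simp add: mre_smul smul_mult)
  have sc: "c *\<^sub>R (?g ** A ** ?h) = ?g ** (c *\<^sub>R A) ** ?h" for c A by (simp add: gmat_scaleR)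
  have su: "(\<Sum>i\<le>r. ?g ** F i ** ?h) = ?g ** (\<Sum>i\<le>r. F i) ** ?h" for F by (simp add: gmat_sum)
  show ?thesis unfolding curv_def sq sm sc su by (simp add: matrix_diff_distrib)
qed

lemma sum_square_pairs:
  fixes f :: "nat \<Rightarrow> nat \<Rightarrow> 'a::ab_group_add"
  assumes "\<And>i. f i i = 0"
  shows "(\<Sum>i\<le>r. \<Sum>j\<le>r. f i j) = (\<Sum>(i, j)\<in>{(i, j). i < j \<and> j \<le> r}. f i j + f j i)"
proof -
  let ?A = "{(i, j). i < j \<and> j \<le> r}" and ?B = "{(i, j). j < i \<and> i \<le> r}" and ?C = "{(i, j). i = j \<and> j \<le> r}"
  have fin: "finite ?A" "finite ?B" "finite ?C"
    by (rule finite_subset[of _ "{..r} \<times> {..r}"], auto)+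
  have dis: "?A \<inter> (?B \<union> ?C) = {}" "?B \<inter> ?C = {}" by auto
  have "(\<Sum>i\<le>r. \<Sum>j\<le>r. f i j) = (\<Sum>(i, j)\<in>{..r} \<times> {..r}. f i j)" by (simp add: sum.cartesian_product)
  also have "{..r} \<times> {..r} = ?A \<union> (?B \<union> ?C)" by auto
  also have "(\<Sum>(i, j)\<in>?A \<union> (?B \<union> ?C). f i j) = (\<Sum>(i, j)\<in>?A. f i j) +
      ((\<Sum>(i, j)\<in>?B. f i j) + (\<Sum>(i, j)\<in>?C. f i j))"
    by (simp only: sum.union_disjoint[OF fin(1) finite_UnI[OF fin(2,3)] dis(1)] sum.union_disjoint[OF fin(2,3) dis(2)])
  also have "(\<Sum>(i, j)\<in>{(i, j). i = j \<and> j \<le> r}. f i j) = 0" by (rule sum.neutral) (use assms in auto)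
  also have "(\<Sum>(i, j)\<in>{(i, j). j < i \<and> i \<le> r}. f i j) = (\<Sum>(i, j)\<in>{(i, j). i < j \<and> j \<le> r}. f j i)"
    by (rule sum.reindex_bij_witness[where i = prod.swap and j = prod.swap]) auto
  finally have "(\<Sum>i\<le>r. \<Sum>j\<le>r. f i j) = (\<Sum>(i, j)\<in>?A. f i j) + (\<Sum>(i, j)\<in>?A. f j i)" by simp
  moreover have "(\<Sum>(i, j)\<in>?A. f i j + f j i) = (\<Sum>(i, j)\<in>?A. f i j) + (\<Sum>(i, j)\<in>?A. f j i)"
    by (rule trans[OF sum.cong[OF refl] sum.distrib]) auto
  ultimately show ?thesis by (simp only:)
qed

text \<open>The identity of the variance, mean of squares minus square of the mean, valid for
  noncommuting \<open>\<psi> i\<close>. It is the origin of the squares \<open>R_ij\<close> and of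
  their weights, products of two barycentric coordinates.\<close>

lemma curv_pairs:
  assumes "(\<Sum>i\<le>r. t i) = 1"
  shows "curv r t dt \<psi> = - (\<Sum>i\<le>r. smul (dt i) (\<psi> i)) -
    (\<Sum>(i, j)\<in>{(i, j). i < j \<and> j \<le> r}. (t i * t j) *\<^sub>R ((\<psi> i - \<psi> j) ** (\<psi> i - \<psi> j)))"
proof -
  let ?f = "\<lambda>i j. (t i * t j) *\<^sub>R (\<psi> i ** \<psi> i - \<psi> i ** \<psi> j)"
  have "(\<Sum>i\<le>r. t i *\<^sub>R (\<psi> i ** \<psi> i)) - (\<Sum>i\<le>r. t i *\<^sub>R \<psi> i) ** (\<Sum>i\<le>r. t i *\<^sub>R \<psi> i) = (\<Sum>i\<le>r. \<Sum>j\<le>r. ?f i j)"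
  proof -
    have "(\<Sum>i\<le>r. t i *\<^sub>R (\<psi> i ** \<psi> i)) = (\<Sum>i\<le>r. \<Sum>j\<le>r. (t i * t j) *\<^sub>R (\<psi> i ** \<psi> i))"
      using assms by (simp add: scaleR_sum_left[symmetric] sum_distrib_left[symmetric])
    moreover have "(\<Sum>i\<le>r. t i *\<^sub>R \<psi> i) ** (\<Sum>i\<le>r. t i *\<^sub>R \<psi> i) = (\<Sum>i\<le>r. \<Sum>j\<le>r. (t i * t j) *\<^sub>R (\<psi> i ** \<psi> j))"
      unfolding gmat_sum(1) unfolding gmat_sum(2) by (simp add: gmat_scaleR mult.commute)
    ultimately show ?thesis by (simp add: scaleR_diff_right sum_subtractf)
  qed
  also have "\<dots> = (\<Sum>(i, j)\<in>{(i, j). i < j \<and> j \<le> r}. ?f i j + ?f j i)"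
    by (rule sum_square_pairs) simp
  also have "\<dots> = (\<Sum>(i, j)\<in>{(i, j). i < j \<and> j \<le> r}. (t i * t j) *\<^sub>R ((\<psi> i - \<psi> j) ** (\<psi> i - \<psi> j)))"
    by (intro sum.cong refl) (auto simp: matrix_diff_distrib algebra_simps)
  finally show ?thesis unfolding curv_def by (simp add: algebra_simps)
qed

text \<open>One summand of the Pfaffian for an index map \<open>F\<close> that need not be a
  permutation. Such maps arise when a product of matrices is expanded and when single indices are
  contracted.\<close>

definition pfG :: "nat \<Rightarrow> (nat \<Rightarrow> 'n) \<Rightarrow> grass^'n::finite^'n \<Rightarrow> ('n \<Rightarrow> 'n) \<Rightarrow> grass" where
  "pfG p e A F = prod_list (map (\<lambda>k. A $ F (e (2 * k - 1)) $ F (e (2 * k))) [1..<p + 1])"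

definition pfaffian :: "nat \<Rightarrow> (nat \<Rightarrow> 'n) \<Rightarrow> grass^'n::finite^'n \<Rightarrow> grass" where
  "pfaffian p e A = (1 / (2 ^ (2 * p) * pi ^ p * fact p)) *\<^sub>R
     (\<Sum>\<tau> | \<tau> permutes {1..2 * p}. of_int (sign \<tau>) *\<^sub>R
        prod_list (map (\<lambda>k. A $ e (\<tau> (2 * k - 1)) $ e (\<tau> (2 * k))) [1..<p + 1]))"

text \<open>Transport along \<open>e\<close> to permutations of the index type itself, where
  \<open>det\<close> and its properties apply.\<close>

lemma pfaffian_UNIV:
  assumes e: "bij_betw e {1..2 * p} (UNIV :: 'n::finite set)"
  shows "pfaffian p e A = (1 / (2 ^ (2 * p) * pi ^ p * fact p)) *\<^sub>R
    (\<Sum>P | P permutes UNIV. of_int (sign P) *\<^sub>R pfG p e A P)"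
  unfolding pfaffian_def
proof (rule arg_cong[where f = "\<lambda>x. _ *\<^sub>R x"])
  let ?S = "{1..2 * p}" and ?e' = "inv_into {1..2 * p} e"
  have inj: "inj_on e ?S" and im: "e ` ?S = UNIV" using e by (auto simp: bij_betw_def)
  have e': "bij_betw ?e' UNIV ?S" using e by (rule bij_betw_inv_into)
  have mp: "map_permutation ?S e \<tau> (e j) = e (\<tau> j)" if "j \<in> ?S" for \<tau> j
    using that inj im by (simp add: map_permutation_def restrict_id_def)
  show "(\<Sum>\<tau> | \<tau> permutes ?S. of_int (sign \<tau>) *\<^sub>R
        prod_list (map (\<lambda>k. A $ e (\<tau> (2 * k - 1)) $ e (\<tau> (2 * k))) [1..<p + 1])) =
    (\<Sum>P | P permutes UNIV. of_int (sign P) *\<^sub>R pfG p e A P)"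
  proof (rule sum.reindex_bij_witness[where j = "map_permutation ?S e" and i = "map_permutation UNIV ?e'"])
    fix \<tau> assume "\<tau> \<in> {\<tau>. \<tau> permutes ?S}"
    then have t: "\<tau> permutes ?S" by simp
    show "map_permutation ?S e \<tau> \<in> {P. P permutes UNIV}"
      using map_permutation_permutes[OF e t] by simp
    show "map_permutation UNIV ?e' (map_permutation ?S e \<tau>) = \<tau>"
      by (rule map_permutation_compose_inv[OF e t]) (use inj in auto)
    have "prod_list (map (\<lambda>k. A $ e (\<tau> (2 * k - 1)) $ e (\<tau> (2 * k))) [1..<p + 1]) =
        prod_list (map (\<lambda>k. A $ map_permutation ?S e \<tau> (e (2 * k - 1)) $ map_permutation ?S e \<tau> (e (2 * k))) [1..<p + 1])"
    proof (intro arg_cong[of _ _ prod_list] map_cong refl)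
      fix k assume "k \<in> set [1..<p + 1]"
      then have "2 * k - 1 \<in> ?S" "2 * k \<in> ?S" by auto
      then show "A $ e (\<tau> (2 * k - 1)) $ e (\<tau> (2 * k)) =
          A $ map_permutation ?S e \<tau> (e (2 * k - 1)) $ map_permutation ?S e \<tau> (e (2 * k))"
        by (simp only: mp)
    qed
    then show "of_int (sign (map_permutation ?S e \<tau>)) *\<^sub>R pfG p e A (map_permutation ?S e \<tau>) =
        of_int (sign \<tau>) *\<^sub>R prod_list (map (\<lambda>k. A $ e (\<tau> (2 * k - 1)) $ e (\<tau> (2 * k))) [1..<p + 1])"
      using sign_map_permutation[OF inj t] by (simp add: pfG_def)
  next
    fix P :: "'n \<Rightarrow> 'n" assume "P \<in> {P. P permutes UNIV}"
    then have P: "P permutes UNIV" by simp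
    show "map_permutation UNIV ?e' P \<in> {\<tau>. \<tau> permutes ?S}"
      using map_permutation_permutes[OF e' P] by simp
    show "map_permutation ?S e (map_permutation UNIV ?e' P) = P"
      by (rule map_permutation_compose_inv[OF e' P]) (use im in \<open>auto simp: f_inv_into_f\<close>)
  qed
qed

text \<open>Expanding \<open>g A g\<^sup>T\<close> gives minors of \<open>g\<close>; only bijective index maps survive, with \<open>det g = 1\<close>.\<close>

lemma pfaffian_conj:
  fixes A :: "grass^'n::finite^'n"
  assumes e: "bij_betw e {1..2 * p} (UNIV :: 'n set)" and g: "g \<in> SO"
  shows "pfaffian p e (mre g ** A ** mre (transpose g)) = pfaffian p e A"
proof -
  have inj: "inj_on e {1..2 * p}" and im: "e ` {1..2 * p} = UNIV" using e by (auto simp: bij_betw_def)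
  let ?B = "mre g ** A ** mre (transpose g)"
  have B: "?B $ a $ b = (\<Sum>(c, d)\<in>UNIV \<times> UNIV. (g $ a $ c * g $ b $ d) *\<^sub>R A $ c $ d)" for a b
  proof -
    have "?B $ a $ b = (\<Sum>d\<in>UNIV. \<Sum>c\<in>UNIV. (g $ a $ c * g $ b $ d) *\<^sub>R A $ c $ d)"
      by (simp add: matrix_mult_nth mre_def Finite_Cartesian_Product.transpose_def sum_distrib_right of_real_def scaleR_sum_right mult.commute)
    also have "\<dots> = (\<Sum>c\<in>UNIV. \<Sum>d\<in>UNIV. (g $ a $ c * g $ b $ d) *\<^sub>R A $ c $ d)" by (rule sum.swap)
    finally show ?thesis by (simp add: sum.cartesian_product)
  qed
  define pr where "pr k H = (H (e (2 * k - 1)), H (e (2 * k)))" for k and H :: "'n \<Rightarrow> 'n"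
  have prod2: "(\<Prod>i\<in>UNIV. h i) = (\<Prod>k\<in>{1..<p + 1}. h (e (2 * k - 1)) * h (e (2 * k)))" for h :: "'n \<Rightarrow> real"
  proof -
    have "(\<Prod>i\<in>UNIV. h i) = (\<Prod>j\<in>{1..2 * p}. h (e j))" by (rule prod.reindex_bij_betw[OF e, symmetric])
    also have "\<dots> = (\<Prod>k\<in>{1..<p + 1}. h (e (2 * k - 1)) * h (e (2 * k)))"
      by (induction p) (simp_all add: algebra_simps)
    finally show ?thesis .
  qed
  have exp: "pfG p e ?B F = (\<Sum>H\<in>UNIV. (\<Prod>i\<in>UNIV. g $ F i $ H i) *\<^sub>R pfG p e A H)" for F
  proof -
    let ?T = "\<lambda>k (c, d). (g $ F (e (2 * k - 1)) $ c * g $ F (e (2 * k)) $ d) *\<^sub>R A $ c $ d"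
    have "pfG p e ?B F = (\<Sum>\<phi>\<in>Pi\<^sub>E {1..<p + 1} (\<lambda>_. UNIV \<times> UNIV). prod_list (map (\<lambda>k. ?T k (\<phi> k)) [1..<p + 1]))"
      unfolding pfG_def B by (rule prod_list_sum_distrib[OF distinct_upt, unfolded set_upt])
    also have "\<dots> = (\<Sum>H\<in>UNIV. prod_list (map (\<lambda>k. ?T k (pr k H)) [1..<p + 1]))"
    \<comment> \<open>Choosing a pair of indices for every \<open>k\<close> amounts to choosing a
      map \<open>H\<close> on the index type: the pair consists of its values at
      \<open>e (2 * k - 1)\<close> and \<open>e (2 * k)\<close>.\<close>
    proof (rule sum.reindex_bij_witness[where i = "\<lambda>H. \<lambda>k\<in>{1..<p + 1}. pr k H" and
        j = "\<lambda>\<phi> i. let j = inv_into {1..2 * p} e i in if odd j then fst (\<phi> (Suc j div 2)) else snd (\<phi> (j div 2))"])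
      fix \<phi> assume \<phi>: "\<phi> \<in> Pi\<^sub>E {1..<p + 1} (\<lambda>_. (UNIV :: 'n set) \<times> (UNIV :: 'n set))"
      let ?H = "\<lambda>i. let j = inv_into {1..2 * p} e i in if odd j then fst (\<phi> (Suc j div 2)) else snd (\<phi> (j div 2))"
      have pr: "pr k ?H = \<phi> k" if "k \<in> {1..<p + 1}" for k
      proof -
        have "2 * k - 1 \<in> {1..2 * p}" "2 * k \<in> {1..2 * p}" using that by auto
        then have "inv_into {1..2 * p} e (e (2 * k - 1)) = 2 * k - 1" "inv_into {1..2 * p} e (e (2 * k)) = 2 * k"
          by (auto simp only: inv_into_f_f[OF inj])
        moreover have "odd (2 * k - 1)" "Suc (2 * k - 1) div 2 = k" using that by auto
        ultimately show ?thesis by (simp add: pr_def Let_def)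
      qed
      show "(\<lambda>k\<in>{1..<p + 1}. pr k ?H) = \<phi>"
        using \<phi> pr by (auto simp: fun_eq_iff PiE_def extensional_def)
      show "prod_list (map (\<lambda>k. ?T k (pr k ?H)) [1..<p + 1]) = prod_list (map (\<lambda>k. ?T k (\<phi> k)) [1..<p + 1])"
      proof (intro arg_cong[of _ _ prod_list] map_cong refl)
        fix k assume "k \<in> set [1..<p + 1]"
        then have "k \<in> {1..<p + 1}" by (simp only: set_upt)
        then show "?T k (pr k ?H) = ?T k (\<phi> k)" by (simp only: pr)
      qed
    next
      fix H :: "'n \<Rightarrow> 'n"
      show "(\<lambda>i. let j = inv_into {1..2 * p} e i in if odd j then fst ((\<lambda>k\<in>{1..<p + 1}. pr k H) (Suc j div 2))
          else snd ((\<lambda>k\<in>{1..<p + 1}. pr k H) (j div 2))) = H"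
      proof
        fix i
        obtain j where j: "j \<in> {1..2 * p}" "i = e j" using im by blast
        have ij: "inv_into {1..2 * p} e (e j) = j" by (rule inv_into_f_f[OF inj j(1)])
        show "(let j = inv_into {1..2 * p} e i in if odd j then fst ((\<lambda>k\<in>{1..<p + 1}. pr k H) (Suc j div 2))
            else snd ((\<lambda>k\<in>{1..<p + 1}. pr k H) (j div 2))) = H i"
        proof (cases "odd j")
          case True
          then have "Suc j div 2 \<in> {1..<p + 1}" "2 * (Suc j div 2) - 1 = j" using j(1) by (auto elim!: oddE)
          then show ?thesis unfolding j(2) using True by (simp only: Let_def ij if_True restrict_apply pr_def fst_conv not_False_eq_True)
        next
          case False
          then have "j div 2 \<in> {1..<p + 1}" "2 * (j div 2) = j" using j(1) by auto
          then show ?thesis unfolding j(2) using False by (simp only: Let_def ij if_True if_False restrict_apply pr_def snd_conv)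
        qed
      qed
    qed auto
    also have "\<dots> = (\<Sum>H\<in>UNIV. (\<Prod>i\<in>UNIV. g $ F i $ H i) *\<^sub>R pfG p e A H)"
    proof (rule sum.cong[OF refl])
      fix H :: "'n \<Rightarrow> 'n"
      show "prod_list (map (\<lambda>k. ?T k (pr k H)) [1..<p + 1]) = (\<Prod>i\<in>UNIV. g $ F i $ H i) *\<^sub>R pfG p e A H"
        unfolding pr_def prod.case prod2 pfG_def prod_list_scaleR[OF distinct_upt] set_upt ..
    qed
    finally show ?thesis .
  qed
  have D: "(\<Sum>P | P permutes UNIV. of_int (sign P) * (\<Prod>i\<in>UNIV. g $ P i $ H i)) =
      (if H permutes UNIV then of_int (sign H) else 0)" for H :: "'n \<Rightarrow> 'n"
  proof -
    have "(\<Sum>P | P permutes UNIV. of_int (sign P) * (\<Prod>i\<in>UNIV. g $ P i $ H i)) =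
        det (\<chi> i. transpose g $ H i)"
      unfolding det_def by (simp add: Finite_Cartesian_Product.transpose_def)
    also have "\<dots> = (if H permutes UNIV then of_int (sign H) else 0)"
    proof (cases "H permutes UNIV")
      case True
      then have "det (\<chi> i. transpose g $ H i) = of_int (sign H) * det (transpose g)"
        by (rule det_permute_rows)
      then show ?thesis using g True by (simp add: SO_def rotation_matrix_def)
    next
      case False
      have "\<not> inj H"
      proof
        assume "inj H"
        then have "bij H" by (simp add: bij_def finite_UNIV_inj_surj)
        then show False using False bij_imp_permutes[of H UNIV] by simp
      qed
      then obtain i j where "i \<noteq> j" "H i = H j" by (auto simp: inj_def)
      then have "det (\<chi> i. transpose g $ H i) = 0"
        by (intro det_identical_rows[of i j]) (auto simp: row_def)
      then show ?thesis using False by simp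
    qed
    finally show ?thesis .
  qed
  have "(\<Sum>P | P permutes UNIV. of_int (sign P) *\<^sub>R pfG p e ?B P) =
      (\<Sum>H\<in>UNIV. (\<Sum>P | P permutes UNIV. of_int (sign P) * (\<Prod>i\<in>UNIV. g $ P i $ H i)) *\<^sub>R pfG p e A H)"
    unfolding exp scaleR_sum_right scaleR_sum_left scaleR_scaleR by (rule sum.swap)
  also have "\<dots> = (\<Sum>H\<in>UNIV. if H permutes UNIV then of_int (sign H) *\<^sub>R pfG p e A H else 0)"
    unfolding D by (rule sum.cong) auto
  also have "\<dots> = (\<Sum>P | P permutes UNIV. of_int (sign P) *\<^sub>R pfG p e A P)"
    by (simp add: sum.inter_filter[symmetric])
  finally show ?thesis unfolding pfaffian_UNIV[OF e] by simp
qed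

lemma hasd_prod_list:
  assumes "distinct ks" "\<And>k. k \<in> set ks \<Longrightarrow> hasd x v (F k) (F' k)" "\<And>k. k \<in> set ks \<Longrightarrow> par (F k x) = F k x"
  shows "hasd x v (\<lambda>y. prod_list (map (\<lambda>k. F k y) ks))
    (\<Sum>k\<in>set ks. prod_list (map (\<lambda>l. if l = k then F' k else F l x) ks))"
  using assms
proof (induction ks)
  case Nil
  then show ?case by (simp add: hasd_const)
next
  case (Cons a ks)
  have "hasd x v (\<lambda>y. F a y * prod_list (map (\<lambda>k. F k y) ks))
      (F' a * prod_list (map (\<lambda>k. F k x) ks) + par (F a x) *
        (\<Sum>k\<in>set ks. prod_list (map (\<lambda>l. if l = k then F' k else F l x) ks)))"
    using Cons by (intro hasd_mult) auto
  moreover have "prod_list (map (\<lambda>l. if l = a then F' a else F l x) ks) = prod_list (map (\<lambda>k. F k x) ks)"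
    using Cons.prems(1) by (intro arg_cong[of _ _ prod_list] map_cong) auto
  moreover have "(\<Sum>k\<in>set ks. (if a = k then F' k else F a x) * prod_list (map (\<lambda>l. if l = k then F' k else F l x) ks)) =
      (\<Sum>k\<in>set ks. F a x * prod_list (map (\<lambda>l. if l = k then F' k else F l x) ks))"
    using Cons.prems(1) by (intro sum.cong) auto
  ultimately show ?case using Cons.prems by (simp add: sum_distrib_left)
qed

lemma prod_list_pull:
  fixes F :: "'k \<Rightarrow> grass"
  assumes "distinct ks" "k \<in> set ks" "\<And>l. l \<in> set ks \<Longrightarrow> par (F l) = F l"
  shows "prod_list (map (\<lambda>l. if l = k then b * X else F l) ks) =
    b * prod_list (map (\<lambda>l. if l = k then X else F l) ks)"
  using assms
proof (induction ks)
  case (Cons a ks)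
  show ?case
  proof (cases "a = k")
    case True
    then have "prod_list (map (\<lambda>l. if l = k then b * X else F l) ks) = prod_list (map (\<lambda>l. if l = k then X else F l) ks)"
      using Cons.prems(1) by (intro arg_cong[of _ _ prod_list] map_cong) auto
    then show ?thesis using True by (simp add: mult.assoc)
  next
    case False
    then have "F a * b = b * F a" using even_commute[of "F a" b] Cons.prems(3) by simp
    then show ?thesis using Cons False by (simp add: mult.assoc[symmetric])
  qed
qed simp

text \<open>As \<open>P\<close> is a bijection, \<open>c\<close> can be written as
  \<open>P j\<close>, which gives a double sum of the \<open>S i j\<close>. Composing
  \<open>P\<close> with the transposition of \<open>i\<close> and \<open>j\<close> shows
  \<open>S i j = - S j i\<close> for distinct indices, and the diagonal terms vanish with the
  diagonal of \<open>B\<close>.\<close>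

lemma pfG_sum_zero:
  fixes B :: "grass^'n::finite^'n"
  assumes "\<And>a b. B $ b $ a = - (B $ a $ b)"
  shows "(\<Sum>P | P permutes UNIV. of_int (sign P) *\<^sub>R (\<Sum>i\<in>UNIV. \<Sum>c\<in>UNIV. B $ P i $ c * G (P(i := c)))) = (0 :: grass)"
proof -
  have diag: "B $ a $ a = 0" for a
  proof -
    have "2 *\<^sub>R (B $ a $ a) = 0" using assms[of a a] by (simp add: scaleR_2 eq_neg_iff_add_eq_0)
    then show ?thesis by simp
  qed
  define S where "S i j = (\<Sum>P | P permutes UNIV. of_int (sign P) *\<^sub>R (B $ P i $ P j * G (P(i := P j))))" for i j :: 'n
  have anti: "S i j = - S j i" for i j
  proof (cases "i = j")
    case True
    then show ?thesis by (simp add: S_def diag)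
  next
    case False
    let ?t = "Transposition.transpose i j"
    have t: "?t permutes UNIV" by (rule permutes_swap_id) auto
    have "S i j = (\<Sum>P | P permutes UNIV. of_int (sign (P \<circ> ?t)) *\<^sub>R (B $ (P \<circ> ?t) i $ (P \<circ> ?t) j * G ((P \<circ> ?t)(i := (P \<circ> ?t) j))))"
      unfolding S_def by (rule sum_permutations_compose_right[OF t])
    also have "\<dots> = (\<Sum>P | P permutes UNIV. - (of_int (sign P) *\<^sub>R (B $ P j $ P i * G (P(j := P i)))))"
    proof (rule sum.cong[OF refl])
      fix P :: "'n \<Rightarrow> 'n" assume "P \<in> {P. P permutes UNIV}"
      then have "sign (P \<circ> ?t) = - sign P"
        using False permutes_imp_permutation[of UNIV P]
        by (subst sign_compose) (auto simp: sign_swap_id permutation_swap_id)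
      moreover have "(P \<circ> ?t)(i := (P \<circ> ?t) j) = P(j := P i)"
        by (auto simp: fun_eq_iff Transposition.transpose_def)
      ultimately show "of_int (sign (P \<circ> ?t)) *\<^sub>R (B $ (P \<circ> ?t) i $ (P \<circ> ?t) j * G ((P \<circ> ?t)(i := (P \<circ> ?t) j))) =
          - (of_int (sign P) *\<^sub>R (B $ P j $ P i * G (P(j := P i))))" by simp
    qed
    also have "\<dots> = - S j i" by (simp add: S_def sum_negf)
    finally show ?thesis .
  qed
  have "(\<Sum>P | P permutes UNIV. of_int (sign P) *\<^sub>R (\<Sum>i\<in>UNIV. \<Sum>c\<in>UNIV. B $ P i $ c * G (P(i := c)))) =
      (\<Sum>P | P permutes UNIV. \<Sum>i\<in>UNIV. \<Sum>j\<in>UNIV. of_int (sign P) *\<^sub>R (B $ P i $ P j * G (P(i := P j))))"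
  proof (rule sum.cong[OF refl])
    fix P :: "'n \<Rightarrow> 'n" assume "P \<in> {P. P permutes UNIV}"
    then have "bij P" by (simp add: permutes_bij)
    then have "(\<Sum>c\<in>UNIV. B $ P i $ c * G (P(i := c))) = (\<Sum>j\<in>UNIV. B $ P i $ P j * G (P(i := P j)))" for i
      by (intro sum.reindex_bij_betw[symmetric]) auto
    then show "of_int (sign P) *\<^sub>R (\<Sum>i\<in>UNIV. \<Sum>c\<in>UNIV. B $ P i $ c * G (P(i := c))) =
        (\<Sum>i\<in>UNIV. \<Sum>j\<in>UNIV. of_int (sign P) *\<^sub>R (B $ P i $ P j * G (P(i := P j))))"
      by (simp add: scaleR_sum_right)
  qed
  also have "\<dots> = (\<Sum>i\<in>UNIV. \<Sum>j\<in>UNIV. S i j)"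
    unfolding S_def by (subst sum.swap, rule sum.cong[OF refl], rule sum.swap)
  finally have e: "(\<Sum>P | P permutes UNIV. of_int (sign P) *\<^sub>R (\<Sum>i\<in>UNIV. \<Sum>c\<in>UNIV. B $ P i $ c * G (P(i := c)))) =
      (\<Sum>i\<in>UNIV. \<Sum>j\<in>UNIV. S i j)" .
  have "(\<Sum>i\<in>UNIV. \<Sum>j\<in>UNIV. S i j) = (\<Sum>i\<in>UNIV. \<Sum>j\<in>UNIV. - S j i)"
    by (intro sum.cong refl anti)
  also have "\<dots> = - (\<Sum>i\<in>UNIV. \<Sum>j\<in>UNIV. S i j)" by (simp add: sum_negf) (rule sum.swap)
  finally have "2 *\<^sub>R (\<Sum>i\<in>UNIV. \<Sum>j\<in>UNIV. S i j) = 0" by (simp add: scaleR_2 eq_neg_iff_add_eq_0)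
  then show ?thesis using e by simp
qed

text \<open>The Bianchi identity \<open>dA = [B, A]\<close> and the infinitesimal invariance of the Pfaffian.\<close>

lemma pfaffian_closed:
  fixes A :: "'a::{real_vector,t2_space} \<Rightarrow> grass^'n::finite^'n"
  assumes e: "bij_betw e {1..2 * p} (UNIV :: 'n set)"
    and dA: "mhasd x v A (B ** A x - A x ** B)" and even: "mpar (A x) = A x"
    and B: "\<And>a b. B $ b $ a = - (B $ a $ b)"
  shows "hasd x v (\<lambda>y. pfaffian p e (A y)) 0"
proof -
  let ?ks = "[1..<p + 1]"
  have inj: "inj_on e {1..2 * p}" using e by (auto simp: bij_betw_def)
  have ev: "par (A x $ a $ b) = A x $ a $ b" for a b using even by (simp add: mpar_def vec_eq_iff)
  have comm: "A x $ a $ c * y = y * A x $ a $ c" for a c y by (rule even_commute[OF ev])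
  let ?C = "B ** A x - A x ** B"
  \<comment> \<open>Since \<open>A x\<close> is even and \<open>B\<close> skew-symmetric, the
    commutator becomes the action of \<open>B\<close> on each of the two indices of
    \<open>A x\<close>.\<close>
  have C: "?C $ a $ b = (\<Sum>c\<in>UNIV. B $ a $ c * A x $ c $ b + B $ b $ c * A x $ a $ c)" for a b
  proof -
    have "?C $ a $ b = (\<Sum>c\<in>UNIV. B $ a $ c * A x $ c $ b - A x $ a $ c * B $ c $ b)"
      by (simp add: matrix_mult_nth sum_subtractf)
    also have "\<dots> = (\<Sum>c\<in>UNIV. B $ a $ c * A x $ c $ b + B $ b $ c * A x $ a $ c)"
    proof (rule sum.cong[OF refl])
      fix c show "B $ a $ c * A x $ c $ b - A x $ a $ c * B $ c $ b = B $ a $ c * A x $ c $ b + B $ b $ c * A x $ a $ c"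
        unfolding comm[of a c] B[of c b] by simp
    qed
    finally show ?thesis .
  qed
  have G: "hasd x v (\<lambda>y. pfG p e (A y) P) (\<Sum>i\<in>UNIV. \<Sum>c\<in>UNIV. B $ P i $ c * pfG p e (A x) (P(i := c)))" for P
  proof -
    let ?F = "\<lambda>k y. A y $ P (e (2 * k - 1)) $ P (e (2 * k))"
    let ?F' = "\<lambda>k. ?C $ P (e (2 * k - 1)) $ P (e (2 * k))"
    have h1: "hasd x v (\<lambda>y. prod_list (map (\<lambda>k. ?F k y) ?ks))
        (\<Sum>k\<in>set ?ks. prod_list (map (\<lambda>l. if l = k then ?F' k else ?F l x) ?ks))"
      using dA ev by (intro hasd_prod_list) (auto simp: mhasd_def)
    have h2: "prod_list (map (\<lambda>l. if l = k then ?F' k else ?F l x) ?ks) =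
        (\<Sum>c\<in>UNIV. B $ P (e (2 * k - 1)) $ c * pfG p e (A x) (P(e (2 * k - 1) := c))) +
        (\<Sum>c\<in>UNIV. B $ P (e (2 * k)) $ c * pfG p e (A x) (P(e (2 * k) := c)))" if k: "k \<in> set ?ks" for k
    proof -
      have d: "distinct ?ks" by simp
      have lin: "prod_list (map (\<lambda>l. if l = k then (\<Sum>c\<in>UNIV. X c) else ?F l x) ?ks) =
          (\<Sum>c\<in>UNIV. prod_list (map (\<lambda>l. if l = k then X c else ?F l x) ?ks))" for X :: "'n \<Rightarrow> grass"
      proof -
        obtain us ws where uw: "?ks = us @ k # ws" using split_list[OF k] by blast
        then have "k \<notin> set us" "k \<notin> set ws" using d by (metis distinct.simps(2) distinct_append disjoint_iff list.set_intros(1))+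
        then have m: "map (\<lambda>l. if l = k then Y else ?F l x) us = map (\<lambda>l. ?F l x) us"
          "map (\<lambda>l. if l = k then Y else ?F l x) ws = map (\<lambda>l. ?F l x) ws" for Y by auto
        show ?thesis unfolding uw map_append list.map prod_list.append prod_list.Cons m
          by (simp add: sum_distrib_left sum_distrib_right)
      qed
      have lin2: "prod_list (map (\<lambda>l. if l = k then X + Y else ?F l x) ?ks) =
          prod_list (map (\<lambda>l. if l = k then X else ?F l x) ?ks) + prod_list (map (\<lambda>l. if l = k then Y else ?F l x) ?ks)" for X Y :: grass
      proof -
        obtain us ws where uw: "?ks = us @ k # ws" using split_list[OF k] by blast
        then have "k \<notin> set us" "k \<notin> set ws" using d by (metis distinct.simps(2) distinct_append disjoint_iff list.set_intros(1))+
        then have m: "map (\<lambda>l. if l = k then Y else ?F l x) us = map (\<lambda>l. ?F l x) us"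
          "map (\<lambda>l. if l = k then Y else ?F l x) ws = map (\<lambda>l. ?F l x) ws" for Y by auto
        show ?thesis unfolding uw map_append list.map prod_list.append prod_list.Cons m
          by (simp add: algebra_simps)
      qed
      have inn: "2 * l - 1 \<in> {1..2 * p}" "2 * l \<in> {1..2 * p}" if "l \<in> set ?ks" for l using that by auto
      have u1: "pfG p e (A x) (P(e (2 * k - 1) := c)) = prod_list (map (\<lambda>l. if l = k then A x $ c $ P (e (2 * k)) else ?F l x) ?ks)" for c
        unfolding pfG_def
      proof (intro arg_cong[of _ _ prod_list] map_cong refl)
        fix l assume l: "l \<in> set ?ks"
        have "1 \<le> l" "1 \<le> k" using l k by auto
        then have "2 * l - 1 = 2 * k - 1 \<longleftrightarrow> l = k" "2 * l \<noteq> 2 * k - 1" by presburger+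
        then have "e (2 * l - 1) = e (2 * k - 1) \<longleftrightarrow> l = k" "e (2 * l) \<noteq> e (2 * k - 1)"
          using inj_on_eq_iff[OF inj inn(1)[OF l] inn(1)[OF k]] inj_on_eq_iff[OF inj inn(2)[OF l] inn(1)[OF k]]
          by blast+
        then show "A x $ (P(e (2 * k - 1) := c)) (e (2 * l - 1)) $ (P(e (2 * k - 1) := c)) (e (2 * l)) =
            (if l = k then A x $ c $ P (e (2 * k)) else ?F l x)" by auto
      qed
      have u2: "pfG p e (A x) (P(e (2 * k) := c)) = prod_list (map (\<lambda>l. if l = k then A x $ P (e (2 * k - 1)) $ c else ?F l x) ?ks)" for c
        unfolding pfG_def
      proof (intro arg_cong[of _ _ prod_list] map_cong refl)
        fix l assume l: "l \<in> set ?ks"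
        have "1 \<le> l" "1 \<le> k" using l k by auto
        then have "2 * l = 2 * k \<longleftrightarrow> l = k" "2 * l - 1 \<noteq> 2 * k" by presburger+
        then have "e (2 * l) = e (2 * k) \<longleftrightarrow> l = k" "e (2 * l - 1) \<noteq> e (2 * k)"
          using inj_on_eq_iff[OF inj inn(2)[OF l] inn(2)[OF k]] inj_on_eq_iff[OF inj inn(1)[OF l] inn(2)[OF k]]
          by blast+
        then show "A x $ (P(e (2 * k) := c)) (e (2 * l - 1)) $ (P(e (2 * k) := c)) (e (2 * l)) =
            (if l = k then A x $ P (e (2 * k - 1)) $ c else ?F l x)" by auto
      qed
      show ?thesis
        unfolding C lin lin2 u1 u2 sum.distrib
        by (intro arg_cong2[where f = "(+)"] sum.cong refl prod_list_pull) (use k ev in auto)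
    qed
    have h3: "(\<Sum>k\<in>set ?ks. h (e (2 * k - 1)) + h (e (2 * k))) = (\<Sum>i\<in>UNIV. h i)" for h :: "'n \<Rightarrow> grass"
    proof -
      have "(\<Sum>i\<in>UNIV. h i) = (\<Sum>j\<in>{1..2 * p}. h (e j))" by (rule sum.reindex_bij_betw[OF e, symmetric])
      also have "\<dots> = (\<Sum>k\<in>set ?ks. h (e (2 * k - 1)) + h (e (2 * k)))"
        by (induction p) (simp_all add: algebra_simps atLeastLessThanSuc)
      finally show ?thesis by simp
    qed
    have eq: "(\<Sum>k\<in>set ?ks. prod_list (map (\<lambda>l. if l = k then ?F' k else ?F l x) ?ks)) =
        (\<Sum>i\<in>UNIV. \<Sum>c\<in>UNIV. B $ P i $ c * pfG p e (A x) (P(i := c)))"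
      by (rule trans[OF sum.cong[OF refl h2] h3])
    show ?thesis using h1 unfolding eq by (simp only: pfG_def[of p e "A y" P for y])
  qed
  have "hasd x v (\<lambda>y. (1 / (2 ^ (2 * p) * pi ^ p * fact p)) *\<^sub>R (\<Sum>P | P permutes UNIV. of_int (sign P) *\<^sub>R pfG p e (A y) P))
      ((1 / (2 ^ (2 * p) * pi ^ p * fact p)) *\<^sub>R (\<Sum>P | P permutes UNIV. of_int (sign P) *\<^sub>R
        (\<Sum>i\<in>UNIV. \<Sum>c\<in>UNIV. B $ P i $ c * pfG p e (A x) (P(i := c)))))"
    by (intro hasd_scaleR hasd_sum G)
  then show ?thesis unfolding pfaffian_UNIV[OF e] pfG_sum_zero[OF B] by simp
qed

section \<open>The descended Pfaffian form\<close>

primrec dk :: "'n::finite tuple \<Rightarrow> 'n tuple \<Rightarrow> nat \<Rightarrow> real^'n^'n" where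
  "dk h u 0 = 0"
| "dk h u (Suc s) = dk h u s ** h (Suc s) + hprod h s ** u (Suc s)"

text \<open>\<open>dk\<close> is the differential of the partial product \<open>hprod h s\<close>.
  The transpose stands for the inverse, which keeps the form polynomial on the ambient space; the
  two agree on SO.\<close>

definition psi :: "nat \<Rightarrow> 'n::finite tuple \<Rightarrow> 'n tuple \<Rightarrow> real^'n^'n" where
  "psi s h u = dk h u s ** transpose (hprod h s)"

lemma hprod_SO: "h \<in> SOT {1..r} \<Longrightarrow> s \<le> r \<Longrightarrow> hprod h s \<in> SO"
  by (induction s) (auto simp: SO_mat1 SOT_def intro!: SO_mult)

lemma hprod_inv_eq: "h \<in> SOT {1..r} \<Longrightarrow> s \<le> r \<Longrightarrow> hprod_inv h s = transpose (hprod h s)"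
proof (induction s)
  case (Suc s)
  then have "h (Suc s) \<in> SO" by (auto simp: SOT_def)
  then show ?case using Suc by (simp add: SO_matrix_inv matrix_transpose_mul)
qed simp

lemma dk_tangent:
  assumes "h \<in> SOT {1..r}" "u \<in> so_tangent {1..r} h"
  shows "s \<le> r \<Longrightarrow> transpose (hprod h s) ** dk h u s + transpose (dk h u s) ** hprod h s = 0"
proof (induction s)
  case (Suc s)
  let ?k = "hprod h s" and ?d = "dk h u s" and ?h = "h (Suc s)" and ?u = "u (Suc s)"
  have k: "transpose ?k ** ?k = mat 1" by (rule SO_transpose(1)[OF hprod_SO[OF assms(1)]]) (use Suc in auto)
  have u: "transpose ?h ** ?u + transpose ?u ** ?h = 0"
    using assms(2) Suc.prems by (auto simp: so_tangent_def dest!: spec[of _ "Suc s"])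
  have kk: "transpose ?h ** transpose ?k ** ?k ** ?u = transpose ?h ** ?u"
    "transpose ?u ** transpose ?k ** ?k ** ?h = transpose ?u ** ?h"
    using k by (metis matrix_mul_assoc matrix_mul_rid)+
  have "transpose (hprod h (Suc s)) ** dk h u (Suc s) + transpose (dk h u (Suc s)) ** hprod h (Suc s) =
      transpose ?h ** (transpose ?k ** ?d + transpose ?d ** ?k) ** ?h +
      (transpose ?h ** transpose ?k ** ?k ** ?u + transpose ?u ** transpose ?k ** ?k ** ?h)"
    by (simp add: matrix_transpose_mul transpose_linear matrix_diff_distrib matrix_mul_assoc algebra_simps)
  then show ?case using Suc u by (simp add: kk matrix_diff_distrib)
qed (simp add: matrix_diff_distrib transpose_linear)

text \<open>With the transpose as inverse, the first equation is the rule for the differential of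
  \<open>K^-1\<close>, and the second says that \<open>D K^-1\<close> is skew-symmetric.\<close>

lemma SO_tangent_transpose:
  fixes K D :: "real^'n::finite^'n"
  assumes "K \<in> SO" "transpose K ** D + transpose D ** K = 0"
  shows "transpose D = - (transpose K ** D ** transpose K)"
    "D ** transpose K + K ** transpose D = 0"
proof -
  have "transpose D ** K = - (transpose K ** D)" using assms(2) by (simp add: eq_neg_iff_add_eq_0 add.commute)
  then have "transpose D ** K ** transpose K = - (transpose K ** D) ** transpose K" by simp
  then show 1: "transpose D = - (transpose K ** D ** transpose K)"
    using SO_transpose(2)[OF assms(1)] by (simp add: matrix_mul_assoc[symmetric] matrix_diff_distrib)
  show "D ** transpose K + K ** transpose D = 0"
    unfolding 1 using SO_transpose(2)[OF assms(1)]
    by (simp add: matrix_mul_assoc matrix_diff_distrib)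
qed

lemma psi_skew:
  assumes "h \<in> SOT {1..r}" "u \<in> so_tangent {1..r} h" "s \<le> r"
  shows "transpose (psi s h u) = - psi s h u"
proof -
  have "dk h u s ** transpose (hprod h s) + hprod h s ** transpose (dk h u s) = 0"
    by (rule SO_tangent_transpose(2)[OF hprod_SO dk_tangent]) (use assms in auto)
  then show ?thesis by (simp add: psi_def matrix_transpose_mul eq_neg_iff_add_eq_0 add.commute)
qed

lemma zero_so_tangent: "0 \<in> so_tangent J h"
  by (rule subspace_0[OF subspace_so_tangent])

section \<open>The polynomial representative on the product of the simplex and NG(r)\<close>

type_synonym 'n spt = "(nat \<Rightarrow> real) \<times> 'n tuple"

definition dtform :: "(nat \<Rightarrow> 'n::finite spt) \<Rightarrow> nat \<Rightarrow> grass" where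
  "dtform v i = lin (\<lambda>j. fst (v j) i)"

definition Psi :: "nat \<Rightarrow> 'n::finite spt \<Rightarrow> (nat \<Rightarrow> 'n spt) \<Rightarrow> grass^'n^'n" where
  "Psi s x v = mlin (\<lambda>j. psi s (snd x) (snd (v j)))"

definition base_curv :: "nat \<Rightarrow> 'n::finite spt \<Rightarrow> (nat \<Rightarrow> 'n spt) \<Rightarrow> grass^'n^'n" where
  "base_curv r x v = curv r (fst x) (dtform v) (\<lambda>i. Psi i x v)"

definition pf_base :: "nat \<Rightarrow> (nat \<Rightarrow> 'n) \<Rightarrow> nat \<Rightarrow> 'n::finite spt form" where
  "pf_base p e r x v = gc (pfaffian p e (base_curv r x v)) {..<2 * p}"

lemma linear_fst_coord: "linear (\<lambda>z::'n::finite spt. fst z i)"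
  by (rule linearI) auto

lemma linear_snd_coord: "linear (\<lambda>z::'n::finite spt. snd z s $ a $ b)"
  by (rule linearI) auto

lemma cont_fst_coord: "continuous_on UNIV (\<lambda>z::'n::finite spt. fst z i)"
  using continuous_on_compose2[OF continuous_on_product_coordinates continuous_on_fst[OF continuous_on_id]] by simp

lemma cont_snd_coord: "continuous_on UNIV (\<lambda>z::'n::finite spt. snd z s $ a $ b)"
proof -
  have "continuous_on UNIV (\<lambda>z::'n::finite spt. snd z s)"
    using continuous_on_compose2[OF continuous_on_product_coordinates continuous_on_snd[OF continuous_on_id]] by simp
  then show ?thesis by (intro continuous_on_component)
qed

lemma polyfun_fst: "polyfun (\<lambda>z::'n::finite spt. fst z i)"
  by (rule polyfun.functional[OF linear_fst_coord cont_fst_coord])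

lemma polyfun_snd: "polyfun (\<lambda>z::'n::finite spt. snd z s $ a $ b)"
  by (rule polyfun.functional[OF linear_snd_coord cont_snd_coord])

lemma polyfun_hprod: "polyfun (\<lambda>z::'n::finite spt. hprod (snd z) s $ a $ b)"
  by (induction s arbitrary: a b)
    (auto simp: matrix_matrix_mult_def intro!: polyfun_sum polyfun.mult polyfun_snd polyfun.const)

lemma pform_dtform: "pform 1 (\<lambda>x v. dtform v i)"
  unfolding dtform_def by (rule pform_lin[OF linear_fst_coord cont_fst_coord])

lemma mpform_dh: "mpform 1 (\<lambda>(x::'n::finite spt) v. mlin (\<lambda>j. snd (v j) s))"
  by (rule mpform_mlin[of "\<lambda>z. snd z s"]) (simp add: linear_snd_coord cont_snd_coord)

lemma mlin_dk_Suc: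
  "mlin (\<lambda>j. dk h (w j) (Suc s)) = mlin (\<lambda>j. dk h (w j) s) ** mre (h (Suc s)) + mre (hprod h s) ** mlin (\<lambda>j. w j (Suc s))"
  by (simp add: mlin_add mlin_mult_left mlin_mult_right)

lemma mpform_dk: "mpform 1 (\<lambda>(x::'n::finite spt) v. mlin (\<lambda>j. dk (snd x) (snd (v j)) s))"
proof (induction s)
  case 0
  then show ?case by (simp add: mpform_def pform.zero)
next
  case (Suc s)
  have "mpform (1 + 0) (\<lambda>(x::'n spt) v. mlin (\<lambda>j. dk (snd x) (snd (v j)) s) ** mre (snd x (Suc s)))"
    by (intro mpform_mult Suc mpform_mre polyfun_snd)
  moreover have "mpform (0 + 1) (\<lambda>(x::'n spt) v. mre (hprod (snd x) s) ** mlin (\<lambda>j. snd (v j) (Suc s)))"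
    by (intro mpform_mult mpform_dh mpform_mre polyfun_hprod)
  ultimately show ?case unfolding mlin_dk_Suc by (intro mpform_add) auto
qed

lemma Psi_eq: "Psi s x v = mlin (\<lambda>j. dk (snd x) (snd (v j)) s) ** mre (transpose (hprod (snd x) s))"
  by (simp add: Psi_def psi_def mlin_mult_right)

lemma mpform_Psi: "mpform 1 (Psi s :: 'n::finite spt \<Rightarrow> _)"
proof -
  have "mpform (1 + 0) (\<lambda>(x::'n spt) v. mlin (\<lambda>j. dk (snd x) (snd (v j)) s) ** mre (transpose (hprod (snd x) s)))"
    by (intro mpform_mult mpform_dk mpform_mre) (simp add: Finite_Cartesian_Product.transpose_def polyfun_hprod)
  then show ?thesis unfolding Psi_eq[abs_def] by simp
qed

lemma mpform_scaleR: "mpform k F \<Longrightarrow> polyfun g \<Longrightarrow> mpform k (\<lambda>x v. g x *\<^sub>R F x v)"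
  by (simp add: mpform_def pform_scaleR)

lemma mpform_curv:
  assumes "\<And>i. mpform 1 (\<psi> i :: 'n::finite spt \<Rightarrow> _ \<Rightarrow> grass^'n^'n)"
  shows "mpform 2 (\<lambda>x v. curv r (fst x) (dtform v) (\<lambda>i. \<psi> i x v))"
proof -
  have sq: "mpform 2 (\<lambda>x v. F x v ** G x v)" if "mpform 1 F" "mpform 1 G" for F G :: "'n spt \<Rightarrow> _ \<Rightarrow> grass^'n^'n"
    using mpform_mult[OF that] by (simp add: numeral_2_eq_2)
  have sm: "mpform 2 (\<lambda>x v. smul (dtform v i) (\<psi> i x v))" for i
    using mpform_smul[OF pform_dtform assms, of i i] by (simp add: numeral_2_eq_2)
  have s1: "mpform 1 (\<lambda>x v. \<Sum>i\<le>r. fst x i *\<^sub>R \<psi> i x v)"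
    by (intro mpform_sum mpform_scaleR assms polyfun_fst)
  show ?thesis unfolding curv_def
    by (intro mpform_add mpform_diff mpform_uminus mpform_sum mpform_scaleR sm sq assms s1 polyfun_fst)
qed

lemma pform_pfaffian:
  assumes "mpform 2 (F :: 'n::finite spt \<Rightarrow> _ \<Rightarrow> grass^'n^'n)"
  shows "pform (2 * p) (\<lambda>x v. pfaffian p e (F x v))"
proof -
  have "pform (2 * p) (\<lambda>x v. prod_list (map (\<lambda>k. F x v $ a k $ b k) [1..<p + 1]))" for a b :: "nat \<Rightarrow> 'n"
    using pform_prod_list[of "[1..<p + 1]" 2 "\<lambda>k x v. F x v $ a k $ b k"] assms
    unfolding mpform_def by (simp del: upt_Suc)
  then show ?thesis unfolding pfaffian_def by (intro pform_scaleR pform_sum polyfun.const)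
qed

lemma pform_pf_base: "pform (2 * p) (\<lambda>x v. pfaffian p e (base_curv r x v))"
  unfolding base_curv_def by (intro pform_pfaffian mpform_curv mpform_Psi)

lemma mhasd_coord: "mhasd x v (\<lambda>y::'n::finite spt. mre (snd y s)) (mlin (\<lambda>j. snd (v j) s))"
  by (simp add: mhasd_def mre_def mlin_def hasd_functional[OF linear_snd_coord])

lemma mhasd_hprod:
  "mhasd x v (\<lambda>y::'n::finite spt. mre (hprod (snd y) s)) (mlin (\<lambda>j. dk (snd x) (snd (v j)) s))"
proof (induction s)
  case 0
  then show ?case by (simp add: mhasd_const)
next
  case (Suc s)
  show ?case using mhasd_mult[OF Suc mhasd_coord[of x v "Suc s"]]
    unfolding mlin_dk_Suc hprod.simps mre_mult by simp
qed

text \<open>\<open>dk\<close> is the differential of \<open>hprod\<close> by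
  \<open>mhasd_hprod\<close>, so this is d d = 0.\<close>

lemma mhasd_dk: "mhasd x v (\<lambda>y::'n::finite spt. mlin (\<lambda>j. dk (snd y) (snd (v j)) s)) 0"
proof (induction s)
  case 0
  then show ?case by (simp add: mhasd_const)
next
  case (Suc s)
  show ?case unfolding mlin_dk_Suc
    using mhasd_add[OF mhasd_mult[OF Suc mhasd_coord[of x v "Suc s"]] mhasd_mult[OF mhasd_hprod[of x v s] mhasd_const[of x v "mlin (\<lambda>j. snd (v j) (Suc s))"]]]
    by (simp add: matrix_diff_distrib)
qed

lemma mhasd_transpose:
  "mhasd x v (\<lambda>y. mre (M y)) (mlin V) \<Longrightarrow> mhasd x v (\<lambda>y. mre (transpose (M y))) (mlin (\<lambda>j. transpose (V j)))"
  by (simp add: mhasd_def mre_def mlin_def Finite_Cartesian_Product.transpose_def)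

text \<open>The Maurer-Cartan equation of the form \<open>dk k^-1\<close>: only \<open>k^-1\<close>
  contributes, with differential \<open>- k^-1 dk k^-1\<close>. As a transpose plays the role of the
  inverse, tangency of the vectors enters here.\<close>

lemma mhasd_Psi:
  fixes x :: "'n::finite spt"
  assumes h: "snd x \<in> SOT {1..r}" and v: "\<And>j. snd (v j) \<in> so_tangent {1..r} (snd x)" and s: "s \<le> r"
  shows "mhasd x v (\<lambda>y. Psi s y v) (Psi s x v ** Psi s x v)"
proof -
  let ?k = "hprod (snd x) s" and ?D = "mlin (\<lambda>j. dk (snd x) (snd (v j)) s)"
  have k: "?k \<in> SO" by (rule hprod_SO[OF h s])
  have T: "mlin (\<lambda>j. transpose (dk (snd x) (snd (v j)) s)) = - (mre (transpose ?k) ** ?D ** mre (transpose ?k))"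
  proof -
    have "transpose (dk (snd x) (snd (v j)) s) = - (transpose ?k ** dk (snd x) (snd (v j)) s ** transpose ?k)" for j
      by (rule SO_tangent_transpose(1)[OF k dk_tangent[OF h v s]])
    then show ?thesis by (simp add: mlin_uminus mlin_mult_left mlin_mult_right)
  qed
  have "mhasd x v (\<lambda>y. Psi s y v) (0 ** mre (transpose ?k) + mpar ?D ** mlin (\<lambda>j. transpose (dk (snd x) (snd (v j)) s)))"
    unfolding Psi_eq by (intro mhasd_mult mhasd_dk mhasd_transpose mhasd_hprod)
  also have "0 ** mre (transpose ?k) + mpar ?D ** mlin (\<lambda>j. transpose (dk (snd x) (snd (v j)) s)) =
      Psi s x v ** Psi s x v"
    unfolding T Psi_eq by (simp add: matrix_diff_distrib matrix_mul_assoc)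
  finally show ?thesis .
qed

lemma mhasd_scaleR_fst:
  assumes "mhasd x v G G'"
  shows "mhasd x v (\<lambda>y::'n::finite spt. fst y i *\<^sub>R G y) (smul (dtform v i) (G x) + fst x i *\<^sub>R G')"
  using mhasd_smul[OF hasd_functional[OF linear_fst_coord[of i]] assms]
  by (simp add: smul_of_real dtform_def)

lemma mpar_scaleR: "mpar (c *\<^sub>R A) = c *\<^sub>R mpar A"
  by (simp add: mpar_def vec_eq_iff)

text \<open>The Bianchi identity for the connection form \<open>- B\<close>.\<close>

lemma mhasd_curv:
  fixes \<psi> :: "nat \<Rightarrow> 'n::finite spt \<Rightarrow> grass^'n^'n"
  assumes d: "\<And>i. i \<le> r \<Longrightarrow> mhasd x v (\<psi> i) (\<psi> i x ** \<psi> i x)" and odd: "\<And>i. mpar (\<psi> i x) = - \<psi> i x"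
  defines "B \<equiv> \<Sum>i\<le>r. fst x i *\<^sub>R \<psi> i x" and "A \<equiv> \<lambda>y. curv r (fst y) (dtform v) (\<lambda>i. \<psi> i y)"
  shows "mhasd x v A (B ** A x - A x ** B)"
proof -
  let ?D = "\<Sum>i\<le>r. smul (dtform v i) (\<psi> i x) + fst x i *\<^sub>R (\<psi> i x ** \<psi> i x)"
  have oB: "mpar B = - B" by (simp add: B_def mpar_sum mpar_scaleR odd sum_negf)
  have 1: "mhasd x v (\<lambda>y. \<Sum>i\<le>r. smul (dtform v i) (\<psi> i y))
      (\<Sum>i\<le>r. smul 0 (\<psi> i x) + smul (par (dtform v i)) (\<psi> i x ** \<psi> i x))"
    by (intro mhasd_sum mhasd_smul hasd_const d) auto
  have 2: "mhasd x v (\<lambda>y. \<Sum>i\<le>r. fst y i *\<^sub>R (\<psi> i y ** \<psi> i y))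
      (\<Sum>i\<le>r. smul (dtform v i) (\<psi> i x ** \<psi> i x) +
        fst x i *\<^sub>R ((\<psi> i x ** \<psi> i x) ** \<psi> i x + mpar (\<psi> i x) ** (\<psi> i x ** \<psi> i x)))"
    by (intro mhasd_sum mhasd_scaleR_fst mhasd_mult d) auto
  have 3: "mhasd x v (\<lambda>y. \<Sum>i\<le>r. fst y i *\<^sub>R \<psi> i y) ?D"
    by (intro mhasd_sum mhasd_scaleR_fst d) auto
  have 4: "mhasd x v (\<lambda>y. (\<Sum>i\<le>r. fst y i *\<^sub>R \<psi> i y) ** (\<Sum>i\<le>r. fst y i *\<^sub>R \<psi> i y)) (?D ** B + mpar B ** ?D)"
    using mhasd_mult[OF 3 3] by (simp add: B_def)
  have Ax: "A x = - ?D + B ** B"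
    by (simp add: A_def curv_def B_def sum.distrib)
  have "mhasd x v A (- (\<Sum>i\<le>r. smul 0 (\<psi> i x) + smul (par (dtform v i)) (\<psi> i x ** \<psi> i x)) -
      (\<Sum>i\<le>r. smul (dtform v i) (\<psi> i x ** \<psi> i x) +
        fst x i *\<^sub>R ((\<psi> i x ** \<psi> i x) ** \<psi> i x + mpar (\<psi> i x) ** (\<psi> i x ** \<psi> i x))) +
      (?D ** B + mpar B ** ?D))"
    unfolding A_def curv_def by (intro mhasd_add mhasd_diff mhasd_uminus 1 2 4)
  \<comment> \<open>The differentials of \<open>\<Sum> dt_i \<psi>_i\<close> and
    \<open>\<Sum> t_i \<psi>_i^2\<close> cancel, the cubic terms because \<open>\<psi>_i\<close> is
    odd. What remains is the commutator of \<open>?D\<close> with \<open>B\<close>, and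
    \<open>A x\<close> differs from \<open>- ?D\<close> by \<open>B ** B\<close>, which commutes
    with \<open>B\<close>.\<close>
  also have "- (\<Sum>i\<le>r. smul 0 (\<psi> i x) + smul (par (dtform v i)) (\<psi> i x ** \<psi> i x)) -
      (\<Sum>i\<le>r. smul (dtform v i) (\<psi> i x ** \<psi> i x) +
        fst x i *\<^sub>R ((\<psi> i x ** \<psi> i x) ** \<psi> i x + mpar (\<psi> i x) ** (\<psi> i x ** \<psi> i x))) = 0"
    by (simp add: smul_simps odd matrix_diff_distrib matrix_mul_assoc dtform_def sum_negf)
  finally show ?thesis unfolding Ax by (simp add: oB matrix_diff_distrib matrix_mul_assoc)
qed

lemma mpar_Psi: "mpar (Psi i x v) = - Psi i x v"
  by (simp add: Psi_def)

lemma mpar_curv: "(\<And>i. mpar (\<psi> i) = - \<psi> i) \<Longrightarrow> mpar (curv r t (dtform v) \<psi>) = curv r t (dtform v) \<psi>"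
  by (simp add: curv_def mpar_sum mpar_smul mpar_mult mpar_scaleR matrix_diff_distrib smul_simps dtform_def
      scaleR_minus_right sum_negf)

text \<open>\<open>pfaffian_closed\<close> applies because \<open>psi\<close> is skew-symmetric on
  tangent vectors. All \<open>v j\<close> are tangent here, not only the first few, since
  \<open>hasd\<close> speaks of all coefficients at once.\<close>

lemma hasd_pf_base:
  fixes x :: "'n::finite spt"
  assumes e: "bij_betw e {1..2 * p} (UNIV :: 'n set)" and h: "snd x \<in> SOT {1..r}"
    and v: "\<And>j. snd (v j) \<in> so_tangent {1..r} (snd x)"
  shows "hasd x v (\<lambda>y. pfaffian p e (base_curv r y v)) 0"
proof (rule pfaffian_closed[OF e])
  let ?B = "\<Sum>i\<le>r. fst x i *\<^sub>R Psi i x v"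
  show "mhasd x v (\<lambda>y. base_curv r y v) (?B ** base_curv r x v - base_curv r x v ** ?B)"
    unfolding base_curv_def by (rule mhasd_curv) (auto intro!: mhasd_Psi[OF h v] mpar_Psi)
  show "mpar (base_curv r x v) = base_curv r x v" unfolding base_curv_def by (rule mpar_curv) (rule mpar_Psi)
  fix a b
  have "psi i (snd x) (snd (v j)) $ b $ a = - (psi i (snd x) (snd (v j)) $ a $ b)" if "i \<le> r" for i j
    using arg_cong[OF psi_skew[OF h v that, of j], of "\<lambda>M. M $ a $ b"] by (simp add: Finite_Cartesian_Product.transpose_def)
  then have "Psi i x v $ b $ a = - (Psi i x v $ a $ b)" if "i \<le> r" for i
    using that by (simp add: Psi_def mlin_def lin_uminus)
  then have "(\<Sum>i\<le>r. fst x i *\<^sub>R Psi i x v $ b $ a) = (\<Sum>i\<le>r. - (fst x i *\<^sub>R Psi i x v $ a $ b))"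
    by (intro sum.cong refl) simp
  then show "?B $ b $ a = - (?B $ a $ b)" by (simp add: sum_negf)
qed

section \<open>Coordinate frames and tangent fields for the group factors\<close>

definition unit_tuple :: "nat \<Rightarrow> 'n \<Rightarrow> 'n \<Rightarrow> 'n::finite tuple" where
  "unit_tuple j a b = (\<lambda>k. if k = j then (\<chi> c d. of_bool (c = a \<and> d = b)) else 0)"

definition entry_index :: "nat set \<Rightarrow> (nat \<times> 'n \<times> 'n::finite) set" where
  "entry_index J = J \<times> UNIV \<times> UNIV"

text \<open>Right multiplication by \<open>x^-1 v\<close>. Added to \<open>v\<close> at the argument
  \<open>y - x\<close>, it gives the left-invariant field with value \<open>v\<close> at
  \<open>x\<close>, which is affine in \<open>y\<close>.\<close>

definition right_field :: "nat set \<Rightarrow> 'n::finite tuple \<Rightarrow> 'n tuple \<Rightarrow> 'n tuple \<Rightarrow> 'n tuple" where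
  "right_field J x v z = (\<lambda>j. if j \<in> J then z j ** transpose (x j) ** v j else 0)"

lemma sum_unit_tuple_apply:
  assumes "finite J"
  shows "(\<Sum>(j, a, b)\<in>entry_index J. f j a b *\<^sub>R unit_tuple j a b) k $ c $ d = (if k \<in> J then f k c d else 0)"
proof -
  have "(\<Sum>(j, a, b)\<in>entry_index J. f j a b *\<^sub>R unit_tuple j a b) k $ c $ d =
      (\<Sum>i\<in>entry_index J. if i = (k, c, d) then f k c d else 0)"
    unfolding sum_fun_apply sum_component
    by (intro sum.cong refl) (auto simp: unit_tuple_def case_prod_beta)
  also have "\<dots> = (if k \<in> J then f k c d else 0)"
    using assms by (subst sum.delta) (auto simp: entry_index_def)
  finally show ?thesis .
qed

lemma sum_unit_tuple:
  assumes "finite J" "\<And>k. k \<notin> J \<Longrightarrow> h k = 0"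
  shows "(\<Sum>(j, a, b)\<in>entry_index J. h j $ a $ b *\<^sub>R unit_tuple j a b) = h"
proof
  fix k show "(\<Sum>(j, a, b)\<in>entry_index J. h j $ a $ b *\<^sub>R unit_tuple j a b) k = h k"
    using sum_unit_tuple_apply[OF assms(1), of "\<lambda>j a b. h j $ a $ b" k] assms(2)[of k]
    by (auto simp: vec_eq_iff)
qed

lemma tendsto_unit_tuple:
  fixes b :: "nat \<Rightarrow> (nat \<times> 'n \<times> 'n::finite) \<Rightarrow> real"
  assumes "finite J" "\<And>i. i \<in> entry_index J \<Longrightarrow> (\<lambda>n. b n i) \<longlonglongrightarrow> 0"
  shows "(\<lambda>n. (\<Sum>(j, c, d)\<in>entry_index J. b n (j, c, d) *\<^sub>R unit_tuple j c d)) \<longlonglongrightarrow> 0"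
  unfolding tendsto_fun_iff
proof (intro allI vec_tendstoI)
  fix k c d
  have "(\<lambda>n. if k \<in> J then b n (k, c, d) else 0) \<longlonglongrightarrow> 0"
    using assms(2)[of "(k, c, d)"] by (cases "k \<in> J") (auto simp: entry_index_def)
  then show "(\<lambda>n. (\<Sum>(j, c, d)\<in>entry_index J. b n (j, c, d) *\<^sub>R unit_tuple j c d) k $ c $ d) \<longlonglongrightarrow> (0::'n tuple) k $ c $ d"
    unfolding sum_unit_tuple_apply[OF assms(1), of "\<lambda>j c d. b n (j, c, d)" for n] by simp
qed

lemma right_field_linear: "linear (right_field J x v)"
  by (rule linearI) (auto simp: right_field_def fun_eq_iff matrix_diff_distrib matrix_scaleR_mult)

lemma right_field_tangent:
  assumes "y \<in> SOT J" "x \<in> SOT J" "v \<in> so_tangent J x"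
  shows "v + right_field J x v (y - x) \<in> so_tangent J y"
proof -
  have "(v + right_field J x v (y - x)) j = y j ** (transpose (x j) ** v j)" if "j \<in> J" for j
  proof -
    have "x j ** transpose (x j) = mat 1" by (rule SO_transpose(2)) (use assms(2) that in \<open>auto simp: SOT_def\<close>)
    then show ?thesis using that by (simp add: right_field_def matrix_diff_distrib matrix_mul_assoc)
  qed
  moreover have "transpose (y j) ** (y j ** A) + transpose (y j ** A) ** y j = A + transpose A" if "j \<in> J" for j A
  proof -
    have "transpose (y j) ** y j = mat 1" by (rule SO_transpose(1)) (use assms(1) that in \<open>auto simp: SOT_def\<close>)
    then show ?thesis by (simp add: matrix_transpose_mul matrix_mul_assoc) (metis matrix_mul_assoc matrix_mul_rid)
  qed
  moreover have "transpose (x j) ** v j + transpose (transpose (x j) ** v j) = 0" if "j \<in> J" for j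
    using assms(3) that by (auto simp: so_tangent_def matrix_transpose_mul split: if_splits)
  moreover have "(v + right_field J x v (y - x)) j = 0" if "j \<notin> J" for j
    using assms(3) that by (auto simp: so_tangent_def right_field_def)
  ultimately show ?thesis by (simp add: so_tangent_def del: plus_fun_apply)
qed

text \<open>The value is \<open>x\<close> times the commutator of \<open>x^-1 v\<close> and
  \<open>x^-1 w\<close>, and commutators of skew-symmetric matrices are skew-symmetric.\<close>

lemma right_field_bracket:
  assumes "x \<in> SOT J" "v \<in> so_tangent J x" "w \<in> so_tangent J x"
  shows "right_field J x w v - right_field J x v w \<in> so_tangent J x"
proof -
  have "transpose (x j) ** (v j ** transpose (x j) ** w j - w j ** transpose (x j) ** v j) +
      transpose (v j ** transpose (x j) ** w j - w j ** transpose (x j) ** v j) ** x j = 0" if j: "j \<in> J" for j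
  proof -
    let ?X = "transpose (x j)"
    have x: "x j \<in> SO" using assms(1) j by (auto simp: SOT_def)
    have t: "?X ** v j + transpose (v j) ** x j = 0" "?X ** w j + transpose (w j) ** x j = 0"
      using assms(2,3) j by (auto simp: so_tangent_def split: if_splits)
    have v: "transpose (v j) = - (?X ** v j ** ?X)" and w: "transpose (w j) = - (?X ** w j ** ?X)"
      using SO_tangent_transpose(1)[OF x] t by auto
    show ?thesis
      using SO_transpose(1)[OF x]
      by (simp add: matrix_transpose_mul transpose_linear matrix_diff_distrib v w matrix_mul_assoc[symmetric])
  qed
  then show ?thesis by (simp add: so_tangent_def right_field_def)
qed

lemma span_so_tangent:
  "finite J \<Longrightarrow> v \<in> so_tangent J h \<Longrightarrow> (\<Sum>(j, a, b)\<in>entry_index J. v j $ a $ b *\<^sub>R unit_tuple j a b) = v"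
  by (rule sum_unit_tuple) (auto simp: so_tangent_def)

lemma finite_entry_index: "finite J \<Longrightarrow> finite (entry_index J)"
  by (simp add: entry_index_def)

lemma cont_tuple_entry: "continuous_on UNIV (\<lambda>z::'n::finite tuple. z j $ a $ b)"
  by (intro continuous_on_component continuous_on_product_coordinates)

lemma cont_right_field: "continuous_on UNIV (\<lambda>z::'n::finite tuple. right_field J x v z j $ a $ b)"
proof (cases "j \<in> J")
  case True
  then show ?thesis
    by (auto simp: right_field_def matrix_matrix_mult_def intro!: continuous_intros cont_tuple_entry)
qed (simp add: right_field_def)

lemma spanned_SOT:
  assumes "finite J"
  shows "spanned_set (SOT J :: 'n::finite tuple set) (entry_index J) (\<lambda>(j, a, b) h. h j $ a $ b)
    (\<lambda>(j, a, b). unit_tuple j a b) (right_field J)"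
proof (rule spanned_set.intro)
  let ?I = "entry_index J :: (nat \<times> 'n \<times> 'n) set"
  have split: "(\<Sum>i\<in>?I. (case i of (j, a, b) \<Rightarrow> \<lambda>h. h j $ a $ b) (y :: 'n tuple) *\<^sub>R (case i of (j, a, b) \<Rightarrow> unit_tuple j a b)) =
      (\<Sum>(j, a, b)\<in>?I. y j $ a $ b *\<^sub>R unit_tuple j a b)" for y
    by (intro sum.cong) auto
  show "finite ?I" using assms by (rule finite_entry_index)
  show "linear ((case i of (j, a, b) \<Rightarrow> \<lambda>h::'n tuple. h j $ a $ b))" for i :: "nat \<times> 'n \<times> 'n"
    by (cases i) (auto intro!: linearI)
  show "continuous_on UNIV ((case i of (j, a, b) \<Rightarrow> \<lambda>h::'n tuple. h j $ a $ b))" for i :: "nat \<times> 'n \<times> 'n"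
    by (cases i) (simp add: cont_tuple_entry)
  show "(\<lambda>n. x + (\<Sum>i\<in>?I. b n i *\<^sub>R (case i of (j, a, b) \<Rightarrow> unit_tuple j a b))) \<longlonglongrightarrow> x"
    if "\<And>i. i \<in> ?I \<Longrightarrow> (\<lambda>n. b n i) \<longlonglongrightarrow> 0" for b :: "nat \<Rightarrow> nat \<times> 'n \<times> 'n \<Rightarrow> real" and x :: "'n tuple"
  proof -
    have "(\<Sum>i\<in>?I. b n i *\<^sub>R (case i of (j, a, b) \<Rightarrow> unit_tuple j a b)) =
        (\<Sum>(j, c, d)\<in>?I. b n (j, c, d) *\<^sub>R unit_tuple j c d)" for n by (intro sum.cong) auto
    then have l: "(\<lambda>n. \<Sum>i\<in>?I. b n i *\<^sub>R (case i of (j, a, b) \<Rightarrow> unit_tuple j a b)) \<longlonglongrightarrow> 0"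
      using tendsto_unit_tuple[OF assms that] by simp
    show ?thesis unfolding tendsto_fun_iff
    proof
      fix k
      have "(\<lambda>n. x k + (\<Sum>i\<in>?I. b n i *\<^sub>R (case i of (j, a, b) \<Rightarrow> unit_tuple j a b)) k) \<longlonglongrightarrow> x k + 0 k"
        by (intro tendsto_add tendsto_const l[unfolded tendsto_fun_iff, rule_format])
      then show "(\<lambda>n. (x + (\<Sum>i\<in>?I. b n i *\<^sub>R (case i of (j, a, b) \<Rightarrow> unit_tuple j a b))) k) \<longlonglongrightarrow> x k"
        by simp
    qed
  qed
  show "(\<Sum>i\<in>?I. (case i of (j, a, b) \<Rightarrow> \<lambda>h. h j $ a $ b) y *\<^sub>R (case i of (j, a, b) \<Rightarrow> unit_tuple j a b)) = y"
    if "y \<in> SOT J" for y :: "'n tuple"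
    unfolding split by (rule sum_unit_tuple[OF assms]) (use that in \<open>auto simp: SOT_def\<close>)
  show "(\<Sum>i\<in>?I. (case i of (j, a, b) \<Rightarrow> \<lambda>h. h j $ a $ b) v *\<^sub>R (case i of (j, a, b) \<Rightarrow> unit_tuple j a b)) = v"
    if "y \<in> SOT J" "v \<in> tangent_space (SOT J) y" for y v :: "'n tuple"
    unfolding split using that by (intro span_so_tangent[OF assms]) (simp add: tangent_space_SOT)
  show "linear (right_field J y v)" for y v :: "'n tuple" by (rule right_field_linear)
  show "continuous_on UNIV (\<lambda>z. (case i of (j, a, b) \<Rightarrow> \<lambda>h. h j $ a $ b) (right_field J y v z))"
    for i :: "nat \<times> 'n \<times> 'n" and y v :: "'n tuple"
    by (cases i) (simp add: cont_right_field)
  show "(\<Sum>i\<in>?I. (case i of (j, a, b) \<Rightarrow> \<lambda>h. h j $ a $ b) (right_field J y v z) *\<^sub>R (case i of (j, a, b) \<Rightarrow> unit_tuple j a b)) =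
      right_field J y v z" for y v z :: "'n tuple"
    unfolding split by (rule sum_unit_tuple[OF assms]) (auto simp: right_field_def)
qed (auto simp: tangent_space_SOT right_field_tangent right_field_bracket)

lemma unit_tuple_split: "k \<in> entry_index J \<Longrightarrow> finite J \<Longrightarrow>
  (\<Sum>(j, a, b)\<in>entry_index J. (case k of (j', a', b') \<Rightarrow> unit_tuple j' a' b') j $ a $ b *\<^sub>R unit_tuple j a b) =
    (case k of (j', a', b') \<Rightarrow> unit_tuple j' a' b')"
  by (rule sum_unit_tuple) (auto simp: entry_index_def unit_tuple_def)

lemma ext_deriv_SOT:
  fixes x :: "'n::finite tuple"
  assumes J: "finite J" and ext: "extends_on (SOT J) s \<omega> UNIV \<eta>" and x: "x \<in> SOT J"
    and v: "\<And>i. i \<le> s \<Longrightarrow> v i \<in> so_tangent J x"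
  shows "ext_deriv (SOT J) s \<omega> x v = flat_ext_deriv s \<eta> x v"
proof -
  interpret spanned_set "SOT J" "entry_index J" "\<lambda>(j, a, b) h. h j $ a $ b"
    "\<lambda>(j, a, b). unit_tuple j a b" "right_field J"
    by (rule spanned_SOT[OF J])
  show ?thesis
  proof (rule ext_deriv_eq[OF _ ext UNIV_I x])
    fix i :: "nat \<times> 'n \<times> 'n" assume i: "i \<in> entry_index J"
    show "(case i of (j, a, b) \<Rightarrow> unit_tuple j a b) \<in> coord_span"
      unfolding coord_span_def mem_Collect_eq
      by (rule trans[OF sum.cong[OF refl] unit_tuple_split[OF i J]]) auto
  qed (use v x in \<open>simp add: tangent_space_SOT\<close>)
qed

definition unit_spt :: "nat + (nat \<times> 'n \<times> 'n) \<Rightarrow> 'n::finite spt" where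
  "unit_spt i = (case i of Inl k \<Rightarrow> (\<lambda>j. of_bool (j = k), 0) | Inr (j, a, b) \<Rightarrow> (0, unit_tuple j a b))"

definition coord_spt :: "nat + (nat \<times> 'n \<times> 'n) \<Rightarrow> 'n::finite spt \<Rightarrow> real" where
  "coord_spt i x = (case i of Inl k \<Rightarrow> fst x k | Inr (j, a, b) \<Rightarrow> snd x j $ a $ b)"

lemma sum_unit_spt:
  assumes "finite J" "\<And>k. k \<notin> J \<Longrightarrow> snd x k = 0" "\<And>k. k > r \<Longrightarrow> fst x k = 0"
  shows "(\<Sum>i\<in>{..r} <+> entry_index J. coord_spt i x *\<^sub>R unit_spt i) = x"
proof -
  have "(\<Sum>i\<in>{..r} <+> entry_index J. coord_spt i x *\<^sub>R unit_spt i) =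
      (\<Sum>k\<le>r. (fst x k *\<^sub>R (\<lambda>j. of_bool (j = k)), 0)) + (\<Sum>(j, a, b)\<in>entry_index J. (0, snd x j $ a $ b *\<^sub>R unit_tuple j a b))"
    using assms(1) by (subst sum.Plus)
      (auto simp: coord_spt_def unit_spt_def finite_entry_index scaleR_Pair case_prod_beta intro!: arg_cong2[where f = "(+)"] sum.cong)
  also have "\<dots> = ((\<Sum>k\<le>r. fst x k *\<^sub>R (\<lambda>j. of_bool (j = k))), (\<Sum>(j, a, b)\<in>entry_index J. snd x j $ a $ b *\<^sub>R unit_tuple j a b))"
    by (simp add: prod_eq_iff fst_sum snd_sum case_prod_beta)
  also have "(\<Sum>(j, a, b)\<in>entry_index J. snd x j $ a $ b *\<^sub>R unit_tuple j a b) = snd x"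
    by (rule sum_unit_tuple[OF assms(1,2)])
  also have "(\<Sum>k\<le>r. fst x k *\<^sub>R (\<lambda>j. of_bool (j = k))) = fst x"
  proof
    fix j
    have "(\<Sum>k\<le>r. fst x k *\<^sub>R (\<lambda>j. of_bool (j = k) :: real)) j = (\<Sum>k\<le>r. if k = j then fst x j else 0)"
      unfolding sum_fun_apply by (intro sum.cong) auto
    then show "(\<Sum>k\<le>r. fst x k *\<^sub>R (\<lambda>j. of_bool (j = k))) j = fst x j" using assms(3)[of j] by (auto simp: not_le)
  qed
  finally show ?thesis by simp
qed

text \<open>In the direction of the simplex the fields are constant, since its tangent space is the
  same at all points.\<close>

lemma spanned_spt:
  assumes J: "finite J"
  shows "spanned_set (standard_simplex r \<times> SOT J :: 'n::finite spt set) ({..r} <+> entry_index J) coord_spt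
    unit_spt (\<lambda>x v z. (0, right_field J (snd x) (snd v) (snd z)))"
proof (rule spanned_set.intro)
  let ?I = "{..r} <+> entry_index J :: (nat + (nat \<times> 'n \<times> 'n)) set" and ?M = "standard_simplex r \<times> SOT J :: 'n spt set"
  let ?L = "\<lambda>x v z. (0, right_field J (snd x) (snd v) (snd z)) :: 'n spt"
  have T: "tangent_space ?M x = simplex_tangent r \<times> so_tangent J (snd x)" if "x \<in> ?M" for x
    using that tangent_space_simplex_SOT[of "fst x" r "snd x" J] by auto
  show "finite ?I" using J by (simp add: finite_entry_index)
  show "linear (coord_spt i :: 'n spt \<Rightarrow> real)" for i :: "nat + (nat \<times> 'n \<times> 'n)"
    unfolding coord_spt_def[abs_def] by (cases i) (auto simp: linear_fst_coord linear_snd_coord)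
  show cc: "continuous_on UNIV (coord_spt i :: 'n spt \<Rightarrow> real)" for i :: "nat + (nat \<times> 'n \<times> 'n)"
    unfolding coord_spt_def[abs_def] by (cases i) (auto simp: cont_fst_coord cont_snd_coord)
  show "(\<lambda>n. x + (\<Sum>i\<in>?I. b n i *\<^sub>R unit_spt i)) \<longlonglongrightarrow> x"
    if b: "\<And>i. i \<in> ?I \<Longrightarrow> (\<lambda>n. b n i) \<longlonglongrightarrow> 0" for b :: "nat \<Rightarrow> nat + (nat \<times> 'n \<times> 'n) \<Rightarrow> real" and x :: "'n spt"
  proof -
    have e: "(\<Sum>i\<in>?I. b n i *\<^sub>R unit_spt i) =
        ((\<Sum>k\<le>r. b n (Inl k) *\<^sub>R (\<lambda>j. of_bool (j = k))), (\<Sum>(j, c, d)\<in>entry_index J. b n (Inr (j, c, d)) *\<^sub>R unit_tuple j c d))" for n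
      using J by (subst sum.Plus) (auto simp: unit_spt_def finite_entry_index prod_eq_iff fst_sum snd_sum case_prod_beta)
    have 2: "(\<lambda>n. (\<Sum>(j, c, d)\<in>entry_index J. b n (Inr (j, c, d)) *\<^sub>R unit_tuple j c d :: 'n tuple)) \<longlonglongrightarrow> 0"
      using tendsto_unit_tuple[OF J, of "\<lambda>n i. b n (Inr i)"] b by auto
    have 1: "(\<lambda>n. (\<Sum>k\<le>r. b n (Inl k) *\<^sub>R (\<lambda>j. of_bool (j = k) :: real)) j) \<longlonglongrightarrow> 0" for j
      unfolding sum_fun_apply using b by (intro tendsto_null_sum) (auto intro!: tendsto_mult_left_zero)
    have "(\<lambda>n. (fst x + (\<Sum>k\<le>r. b n (Inl k) *\<^sub>R (\<lambda>j. of_bool (j = k))),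
        snd x + (\<Sum>(j, c, d)\<in>entry_index J. b n (Inr (j, c, d)) *\<^sub>R unit_tuple j c d))) \<longlonglongrightarrow> (fst x, snd x)"
    proof (intro tendsto_Pair)
      show "(\<lambda>n. fst x + (\<Sum>k\<le>r. b n (Inl k) *\<^sub>R (\<lambda>j. of_bool (j = k)))) \<longlonglongrightarrow> fst x"
        unfolding tendsto_fun_iff
      proof
        fix j show "(\<lambda>n. (fst x + (\<Sum>k\<le>r. b n (Inl k) *\<^sub>R (\<lambda>j. of_bool (j = k)))) j) \<longlonglongrightarrow> fst x j"
          using tendsto_add[OF tendsto_const[of "fst x j"] 1[of j]] by simp
      qed
      show "(\<lambda>n. snd x + (\<Sum>(j, c, d)\<in>entry_index J. b n (Inr (j, c, d)) *\<^sub>R unit_tuple j c d)) \<longlonglongrightarrow> snd x"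
        unfolding tendsto_fun_iff
      proof
        fix j show "(\<lambda>n. (snd x + (\<Sum>(j, c, d)\<in>entry_index J. b n (Inr (j, c, d)) *\<^sub>R unit_tuple j c d)) j) \<longlonglongrightarrow> snd x j"
          using tendsto_add[OF tendsto_const[of "snd x j"] 2[unfolded tendsto_fun_iff, rule_format, of j]] by simp
      qed
    qed
    then show ?thesis unfolding e by (simp add: plus_prod_def)
  qed
  show "(\<Sum>i\<in>?I. coord_spt i y *\<^sub>R unit_spt i) = y" if "y \<in> ?M" for y
    using that by (intro sum_unit_spt[OF J]) (auto simp: SOT_def standard_simplex_def)
  show "(\<Sum>i\<in>?I. coord_spt i v *\<^sub>R unit_spt i) = v" if "y \<in> ?M" "v \<in> tangent_space ?M y" for y v
    using that(2) unfolding T[OF that(1)]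
    by (intro sum_unit_spt[OF J]) (auto simp: so_tangent_def simplex_tangent_def)
  show "linear (?L y v)" for y v
    by (rule linearI) (auto simp: linear_add[OF right_field_linear] linear_scale[OF right_field_linear])
  show "continuous_on UNIV (\<lambda>z. coord_spt i (?L y v z))" for i y v
  proof (cases i)
    case (Inr i)
    obtain j a b where "i = (j, a, b)" by (cases i)
    then show ?thesis using Inr continuous_on_compose2[OF cont_right_field continuous_on_snd[OF continuous_on_id], of UNIV]
      by (simp add: coord_spt_def)
  qed (simp add: coord_spt_def)
  show "(\<Sum>i\<in>?I. coord_spt i (?L y v z) *\<^sub>R unit_spt i) = ?L y v z" for y v z
    by (rule sum_unit_spt[OF J]) (auto simp: right_field_def)
  show "v + ?L x v (y - x) \<in> tangent_space ?M y"
    if "y \<in> ?M" "x \<in> ?M" "v \<in> tangent_space ?M x" for x y v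
    using that(3) that(1,2) right_field_tangent[of "snd y" J "snd x" "snd v"]
    unfolding T[OF that(1)] T[OF that(2)] by (auto simp: mem_Times_iff)
  show "?L x w v - ?L x v w \<in> tangent_space ?M x"
    if "x \<in> ?M" "v \<in> tangent_space ?M x" "w \<in> tangent_space ?M x" for x v w
    using that right_field_bracket[of "snd x" J "snd v" "snd w"]
    unfolding T[OF that(1)] by (auto simp: mem_Times_iff subspace_0[OF subspace_simplex_tangent])
qed

lemma ext_deriv_spt:
  fixes x :: "'n::finite spt"
  assumes J: "finite J" and ext: "extends_on (standard_simplex r \<times> SOT J) s \<omega> UNIV \<eta>"
    and x: "x \<in> standard_simplex r \<times> SOT J"
    and v: "\<And>i. i \<le> s \<Longrightarrow> v i \<in> tangent_space (standard_simplex r \<times> SOT J) x"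
  shows "ext_deriv (standard_simplex r \<times> SOT J) s \<omega> x v = flat_ext_deriv s \<eta> x v"
proof -
  interpret spanned_set "standard_simplex r \<times> SOT J" "{..r} <+> entry_index J" coord_spt
    unit_spt "\<lambda>x v z. (0, right_field J (snd x) (snd v) (snd z))"
    by (rule spanned_spt[OF J])
  show ?thesis
  proof (rule ext_deriv_eq[OF _ ext UNIV_I x v])
    fix i :: "nat + (nat \<times> 'n \<times> 'n)" assume "i \<in> {..r} <+> entry_index J"
    then show "unit_spt i \<in> coord_span" unfolding coord_span_def mem_Collect_eq
      by (intro sum_unit_spt[OF J]) (auto simp: unit_spt_def entry_index_def unit_tuple_def)
  qed
qed

lemma alternating_cong: "alternating s a \<Longrightarrow> (\<And>i. i < s \<Longrightarrow> v i = w i) \<Longrightarrow> a v = a w"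
  by (simp add: alternating_def)

lemma flat_ext_deriv_cong:
  assumes F: "pform k F" and v: "\<And>i. i \<le> k \<Longrightarrow> v i = w i"
  shows "flat_ext_deriv k (\<lambda>y u. gc (F y u) {..<k}) x v = flat_ext_deriv k (\<lambda>y u. gc (F y u) {..<k}) x w"
  unfolding flat_ext_deriv_def
proof (rule sum.cong[OF refl])
  fix i assume i: "i \<in> {..k}"
  have "gc (F y (\<lambda>j. if j < i then v j else v (Suc j))) {..<k} = gc (F y (\<lambda>j. if j < i then w j else w (Suc j))) {..<k}" for y
    by (rule ten_cong[OF pform_ten[OF F]]) (use v in auto)
  then show "(-1) ^ i * dir_deriv (\<lambda>y. gc (F y (\<lambda>j. if j < i then v j else v (Suc j))) {..<k}) (v i) x =
      (-1) ^ i * dir_deriv (\<lambda>y. gc (F y (\<lambda>j. if j < i then w j else w (Suc j))) {..<k}) (w i) x"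
    using v[of i] i by simp
qed

lemma curv_cong: "(\<And>i. i \<le> r \<Longrightarrow> \<psi> i = \<psi>' i) \<Longrightarrow> curv r t dt \<psi> = curv r t dt \<psi>'"
  by (simp add: curv_def)

section \<open>The connection forms and the curvature on the total space\<close>

definition vertex_theta :: "nat \<Rightarrow> 'n::finite spt \<Rightarrow> (nat \<Rightarrow> 'n spt) \<Rightarrow> grass^'n^'n" where
  "vertex_theta i x v = mre (transpose (snd x i)) ** mlin (\<lambda>j. snd (v j) i)"

definition simplex_theta :: "nat \<Rightarrow> 'n::finite spt \<Rightarrow> (nat \<Rightarrow> 'n spt) \<Rightarrow> grass^'n^'n" where
  "simplex_theta r x v = (\<Sum>i\<le>r. fst x i *\<^sub>R vertex_theta i x v)"

lemma mpform_vertex_theta: "mpform 1 (vertex_theta i :: 'n::finite spt \<Rightarrow> _)"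
proof -
  have "mpform (0 + 1) (\<lambda>(x::'n spt) v. mre (transpose (snd x i)) ** mlin (\<lambda>j. snd (v j) i))"
    by (intro mpform_mult mpform_dh mpform_mre) (simp add: Finite_Cartesian_Product.transpose_def polyfun_snd)
  then show ?thesis unfolding vertex_theta_def[abs_def] by simp
qed

lemma mpform_simplex_theta: "mpform 1 (simplex_theta r :: 'n::finite spt \<Rightarrow> _)"
  unfolding simplex_theta_def[abs_def] by (intro mpform_sum mpform_scaleR mpform_vertex_theta polyfun_fst)

text \<open>The Maurer-Cartan equation of \<open>g^-1 dg\<close>. The sign is opposite to the one in
  \<open>mhasd_Psi\<close>, where the form is \<open>dk k^-1\<close>.\<close>

lemma mhasd_vertex_theta:
  fixes x :: "'n::finite spt"
  assumes x: "snd x \<in> SOT {..r}" and v: "\<And>j. snd (v j) \<in> so_tangent {..r} (snd x)" and i: "i \<le> r"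
  shows "mhasd x v (\<lambda>y. vertex_theta i y v) (- (vertex_theta i x v ** vertex_theta i x v))"
proof -
  let ?g = "snd x i" and ?D = "mlin (\<lambda>j. snd (v j) i)"
  have g: "?g \<in> SO" using x i by (auto simp: SOT_def)
  have T: "mlin (\<lambda>j. transpose (snd (v j) i)) = - (mre (transpose ?g) ** ?D ** mre (transpose ?g))"
  proof -
    have "transpose (snd (v j) i) = - (transpose ?g ** snd (v j) i ** transpose ?g)" for j
      by (rule SO_tangent_transpose(1)[OF g]) (use v[of j] i in \<open>auto simp: so_tangent_def split: if_splits\<close>)
    then show ?thesis by (simp add: mlin_uminus mlin_mult_left mlin_mult_right)
  qed
  have "mhasd x v (\<lambda>y. vertex_theta i y v) (mlin (\<lambda>j. transpose (snd (v j) i)) ** ?D + mpar (mre (transpose ?g)) ** 0)"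
    unfolding vertex_theta_def by (intro mhasd_mult mhasd_transpose mhasd_coord mhasd_const)
  then show ?thesis unfolding T vertex_theta_def by (simp add: matrix_diff_distrib matrix_mul_assoc)
qed

lemma entry_theta:
  fixes x :: "'n::finite spt"
  assumes "x \<in> standard_simplex r \<times> SOT {..r}"
  shows "entry (theta r) a b x v = gc (simplex_theta r x v $ a $ b) {..<1}"
proof -
  have "matrix_inv (snd x i) = transpose (snd x i)" if "i \<le> r" for i
    using assms that by (intro SO_matrix_inv) (auto simp: SOT_def)
  then have "theta r x v = (\<Sum>i\<le>r. fst x i *\<^sub>R (transpose (snd x i) ** snd (v 0) i))"
    unfolding theta_def theta_vertex_def by (intro sum.cong) auto
  moreover have "{..<1::nat} = {0}" by auto
  moreover have "vertex_theta i x v $ a $ b = lin (\<lambda>j. (transpose (snd x i) ** snd (v j) i) $ a $ b)" for i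
    unfolding vertex_theta_def mlin_mult_left by (simp add: mlin_def)
  ultimately show ?thesis
    by (simp add: entry_def simplex_theta_def)
qed

text \<open>For \<open>\<psi>_i = - \<theta>_i\<close> the expression \<open>curv\<close> is
  \<open>d\<theta> + \<theta> \<theta>\<close>, by the Maurer-Cartan equation.\<close>

lemma reps_entry_curvature:
  fixes x :: "'n::finite spt"
  assumes x: "x \<in> standard_simplex r \<times> SOT {..r}"
  defines "T \<equiv> simplex_tangent r \<times> so_tangent {..r} (snd x)"
  shows "reps x T 2 (entry (curvature r) a b) (\<lambda>v. curv r (fst x) (dtform v) (\<lambda>i. - vertex_theta i x v) $ a $ b)"
  unfolding reps_def
proof (intro conjI allI impI)
  let ?M = "standard_simplex r \<times> SOT {..r} :: 'n spt set"
  let ?F = "\<lambda>v. curv r (fst x) (dtform v) (\<lambda>i. - vertex_theta i x v) $ a $ b"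
  have "mpform 2 (\<lambda>(x::'n spt) v. curv r (fst x) (dtform v) (\<lambda>i. - vertex_theta i x v))"
    by (intro mpform_curv mpform_uminus mpform_vertex_theta)
  then have "pform 2 (\<lambda>(x::'n spt) v. curv r (fst x) (dtform v) (\<lambda>i. - vertex_theta i x v) $ a $ b)" by (simp add: mpform_def)
  from pform_ten[OF this, of x] have t: "ten 2 ?F" by simp
  then show "ten 2 ?F" .
  have tT: "tangent_space ?M x = T" using tangent_space_simplex_SOT[of "fst x" r "snd x"] x by (auto simp: T_def)
  have T0: "0 \<in> T" unfolding T_def zero_prod_def using subspace_0[OF subspace_simplex_tangent] zero_so_tangent by blast
  fix v :: "nat \<Rightarrow> 'n spt" assume v: "\<forall>i<2. v i \<in> T"
  \<comment> \<open>The vectors after the first two are replaced by 0, so that all of them are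
    tangent, as the computation with \<open>hasd\<close> requires.\<close>
  define w where "w i = (if i < 2 then v i else 0)" for i
  have wT: "w i \<in> T" for i using v T0 by (simp add: w_def)
  have wv: "w i = v i" if "i < 2" for i using that by (simp add: w_def)
  have pT: "pform 1 (\<lambda>(x::'n spt) v. simplex_theta r x v $ c $ d)" for c d using mpform_simplex_theta[where 'n = 'n, of r] by (simp add: mpform_def)
  have ext: "extends_on ?M 1 (entry (theta r) c d) UNIV (\<lambda>x v. gc (simplex_theta r x v $ c $ d) {..<1})" for c d
    by (rule pform_extends_on[OF pT entry_theta])
  let ?d = "\<Sum>i\<le>r. smul (dtform w i) (vertex_theta i x w) + fst x i *\<^sub>R - (vertex_theta i x w ** vertex_theta i x w)"
  have hd: "mhasd x w (\<lambda>y. simplex_theta r y w) ?d"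
    unfolding simplex_theta_def
    by (intro mhasd_sum mhasd_scaleR_fst mhasd_vertex_theta[of _ r]) (use x wT in \<open>auto simp: T_def mem_Times_iff\<close>)
  have "ext_deriv ?M 1 (entry (theta r) a b) x v = flat_ext_deriv 1 (\<lambda>y u. gc (simplex_theta r y u $ a $ b) {..<1}) x v"
    by (rule ext_deriv_spt[OF _ ext x]) (use v in \<open>auto simp: tT\<close>)
  also have "\<dots> = flat_ext_deriv 1 (\<lambda>y u. gc (simplex_theta r y u $ a $ b) {..<1}) x w"
    by (rule flat_ext_deriv_cong[OF pT]) (simp add: w_def)
  also have "\<dots> = gc (?d $ a $ b) {..<Suc 1}"
    by (rule hasd_flat[OF pT]) (use hd in \<open>simp add: mhasd_def\<close>)
  finally have 1: "ext_deriv ?M 1 (entry (theta r) a b) x v = gc (?d $ a $ b) {..<2}" by (simp add: numeral_2_eq_2)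
  have r1: "reps x T 1 (entry (theta r) c d) (\<lambda>v. simplex_theta r x v $ c $ d)" for c d
    unfolding reps_def using pform_ten[OF pT] entry_theta[OF x] by auto
  have "reps x T (1 + 1) (\<lambda>x v. \<Sum>c\<in>UNIV. wedge 1 1 (entry (theta r) a c) (entry (theta r) c b) x v)
      (\<lambda>v. \<Sum>c\<in>UNIV. simplex_theta r x v $ a $ c * simplex_theta r x v $ c $ b)"
    by (intro reps_sum reps_wedge r1)
  then have r2: "reps x T 2 (\<lambda>x v. \<Sum>c\<in>UNIV. wedge 1 1 (entry (theta r) a c) (entry (theta r) c b) x v)
      (\<lambda>v. (simplex_theta r x v ** simplex_theta r x v) $ a $ b)" by (simp add: matrix_mult_nth numeral_2_eq_2)
  have "(\<Sum>c\<in>UNIV. wedge 1 1 (entry (theta r) a c) (entry (theta r) c b) x v) = gc ((simplex_theta r x v ** simplex_theta r x v) $ a $ b) {..<2}"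
    using r2 v by (simp add: reps_def)
  also have "\<dots> = gc ((simplex_theta r x w ** simplex_theta r x w) $ a $ b) {..<2}"
    by (rule ten_cong[of 2]) (use r2 wv in \<open>auto simp: reps_def\<close>)
  finally have 2: "(\<Sum>c\<in>UNIV. wedge 1 1 (entry (theta r) a c) (entry (theta r) c b) x v) =
      gc ((simplex_theta r x w ** simplex_theta r x w) $ a $ b) {..<2}" .
  have "entry (curvature r) a b x v = gc ((?d + simplex_theta r x w ** simplex_theta r x w) $ a $ b) {..<2}"
    using 1 2 by (simp add: entry_def curvature_def mat_ext_deriv_def mat_wedge_def NGbar_eq)
  also have "?d + simplex_theta r x w ** simplex_theta r x w = curv r (fst x) (dtform w) (\<lambda>i. - vertex_theta i x w)"
    by (simp add: curv_def simplex_theta_def smul_simps matrix_diff_distrib sum_negf sum.distrib sum_subtractf)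
  also have "gc (\<dots> $ a $ b) {..<2} = gc (?F v) {..<2}"
    by (rule ten_cong[OF t]) (simp add: wv)
  finally show "entry (curvature r) a b x v = gc (?F v) {..<2}" .
qed

lemma reps_pf_form:
  fixes x :: "'n::finite spt"
  assumes x: "x \<in> standard_simplex r \<times> SOT {..r}"
  shows "reps x (simplex_tangent r \<times> so_tangent {..r} (snd x)) (2 * p) (pf_form p e (curvature r))
    (\<lambda>v. pfaffian p e (curv r (fst x) (dtform v) (\<lambda>i. - vertex_theta i x v)))"
proof -
  let ?T = "simplex_tangent r \<times> so_tangent {..r} (snd x)"
  have sl: "sum_list (map (\<lambda>k. 2) [1..<p + 1]) = 2 * p" by (simp add: sum_list_triv)
  have w: "reps x ?T (2 * p) (wedge_list (map (\<lambda>k. (2, entry (curvature r) (e (\<tau> (2 * k - 1))) (e (\<tau> (2 * k))))) [1..<p + 1]))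
      (\<lambda>v. prod_list (map (\<lambda>k. curv r (fst x) (dtform v) (\<lambda>i. - vertex_theta i x v) $ e (\<tau> (2 * k - 1)) $ e (\<tau> (2 * k))) [1..<p + 1]))" for \<tau>
    using reps_wedge_list[of "[1..<p + 1]" x ?T "\<lambda>k. 2"
        "\<lambda>k. entry (curvature r) (e (\<tau> (2 * k - 1))) (e (\<tau> (2 * k)))"
        "\<lambda>k v. curv r (fst x) (dtform v) (\<lambda>i. - vertex_theta i x v) $ e (\<tau> (2 * k - 1)) $ e (\<tau> (2 * k))"]
      reps_entry_curvature[OF x] unfolding sl by blast
  have "pf_form p e (curvature r) = (\<lambda>x v. (1 / (2 ^ (2 * p) * pi ^ p * fact p)) * (\<Sum>\<tau> | \<tau> permutes {1..2 * p}. of_int (sign \<tau>) *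
      wedge_list (map (\<lambda>k. (2, entry (curvature r) (e (\<tau> (2 * k - 1))) (e (\<tau> (2 * k))))) [1..<p + 1]) x v))"
    unfolding pf_form_def by (simp only: fun_eq_iff scaleR_fun_apply sum_fun_apply real_scaleR_def) simp
  then show ?thesis unfolding pfaffian_def
    by (simp only:) (intro reps_scaleR reps_sum w)
qed

text \<open>The differential of \<open>g_(j-1) g_j^-1\<close>: at points of SO the derivative of the
  inverse along a tangent vector is the transpose of that vector.\<close>

definition dgamma :: "nat \<Rightarrow> 'n::finite tuple \<Rightarrow> 'n tuple \<Rightarrow> 'n tuple" where
  "dgamma r g w = (\<lambda>j. if j \<in> {1..r} then w (j - 1) ** transpose (g j) + g (j - 1) ** transpose (w j) else 0)"

lemma gamma_SOT: "g \<in> SOT {..r} \<Longrightarrow> gamma r g = (\<lambda>j. if j \<in> {1..r} then g (j - 1) ** transpose (g j) else 0)"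
  by (auto simp: gamma_def fun_eq_iff SOT_def SO_matrix_inv)

text \<open>The Cayley transform bounds the inverse: \<open>(1 + sA)\<^sup>-\<^sup>1 = (C + 1) / 2\<close> with \<open>C\<close> orthogonal.\<close>

lemma matrix_inv_line:
  fixes g w :: "real^'n::finite^'n"
  assumes g: "g \<in> SO" and w: "transpose g ** w + transpose w ** g = 0"
  shows "((\<lambda>s. matrix_inv (g + s *\<^sub>R w)) \<longlongrightarrow> transpose g) (at 0)"
    "((\<lambda>s. (matrix_inv (g + s *\<^sub>R w) - transpose g) /\<^sub>R s) \<longlongrightarrow> transpose w) (at 0)"
proof -
  define A where "A = - (transpose g ** w)"
  have A: "transpose A = - A"
    using w by (simp add: A_def transpose_linear matrix_transpose_mul neg_eq_iff_add_eq_0 add.commute)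
  have inv: "matrix_inv (g + s *\<^sub>R w) = (1/2) *\<^sub>R (cayley A s + mat 1) ** transpose g" for s
  proof (rule matrix_inv_eqI)
    let ?N = "mat 1 - s *\<^sub>R A" and ?C = "cayley A s"
    have gw: "g + s *\<^sub>R w = g ** ?N"
      using SO_transpose(2)[OF g] by (simp add: A_def matrix_diff_distrib matrix_scaleR_mult matrix_mul_assoc)
    note i = matrix_inv_invertible[OF skew_invertible[OF A, of s]]
    have "?C + mat 1 = matrix_inv ?N ** ((mat 1 + s *\<^sub>R A) + ?N)"
      unfolding cayley_def matrix_diff_distrib(8) i(2) ..
    also have "(mat 1 + s *\<^sub>R A) + ?N = 2 *\<^sub>R mat 1" by (simp only: scaleR_2) simp
    also have "matrix_inv ?N ** (2 *\<^sub>R mat 1) = 2 *\<^sub>R matrix_inv ?N"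
      by (simp only: matrix_scaleR_mult matrix_mul_rid)
    finally have c: "(1/2) *\<^sub>R (?C + mat 1) = matrix_inv ?N" by simp
    show "(g + s *\<^sub>R w) ** ((1/2) *\<^sub>R (?C + mat 1) ** transpose g) = mat 1"
      unfolding gw c using i(1) SO_transpose(2)[OF g] by (metis matrix_mul_assoc matrix_mul_lid)
    show "(1/2) *\<^sub>R (?C + mat 1) ** transpose g ** (g + s *\<^sub>R w) = mat 1"
      unfolding gw c using i(2) SO_transpose(1)[OF g] by (metis matrix_mul_assoc matrix_mul_lid)
  qed
  have v: "((\<lambda>s. (cayley A s - mat 1) /\<^sub>R s) \<longlongrightarrow> 2 *\<^sub>R A) (at 0)" by (rule cayley_velocity[OF A])
  have "((\<lambda>s. s *\<^sub>R ((cayley A s - mat 1) /\<^sub>R s) + mat 1) \<longlongrightarrow> 0 *\<^sub>R (2 *\<^sub>R A) + mat 1) (at 0)"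
    by (intro tendsto_intros v)
  moreover have "\<forall>\<^sub>F s in at 0. s *\<^sub>R ((cayley A s - mat 1) /\<^sub>R s) + mat 1 = cayley A s"
    using eventually_neq_at_within[of "0::real" 0 UNIV] by eventually_elim simp
  ultimately have c: "(cayley A \<longlongrightarrow> mat 1) (at 0)" by (simp add: tendsto_cong)
  have "((\<lambda>s. (1/2) *\<^sub>R (cayley A s + mat 1) ** transpose g) \<longlongrightarrow> (1/2) *\<^sub>R (mat 1 + mat 1) ** transpose g) (at 0)"
    by (intro tendsto_matrix_mult tendsto_intros c)
  moreover have "(1/2) *\<^sub>R (mat 1 + mat 1) = (mat 1 :: real^'n^'n)" by (simp add: scaleR_2[symmetric] del: scaleR_2)
  ultimately show "((\<lambda>s. matrix_inv (g + s *\<^sub>R w)) \<longlongrightarrow> transpose g) (at 0)" unfolding inv by simp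
  have "((\<lambda>s. (1/2) *\<^sub>R ((cayley A s - mat 1) /\<^sub>R s) ** transpose g) \<longlongrightarrow> (1/2) *\<^sub>R (2 *\<^sub>R A) ** transpose g) (at 0)"
    by (intro tendsto_matrix_mult tendsto_intros v)
  moreover have "(matrix_inv (g + s *\<^sub>R w) - transpose g) /\<^sub>R s = (1/2) *\<^sub>R ((cayley A s - mat 1) /\<^sub>R s) ** transpose g" for s
  proof -
    have "(1/2) *\<^sub>R (cayley A s + mat 1) - mat 1 = (1/2) *\<^sub>R (cayley A s - mat 1)"
    proof -
      have "(mat 1 :: real^'n^'n) = (1/2) *\<^sub>R (mat 1 + mat 1)" by (simp add: scaleR_2[symmetric] del: scaleR_2)
      then have "(1/2) *\<^sub>R (cayley A s + mat 1) - mat 1 = (1/2) *\<^sub>R (cayley A s + mat 1) - (1/2) *\<^sub>R (mat 1 + mat 1)" by simp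
      then show ?thesis unfolding scaleR_diff_right[symmetric] by simp
    qed
    moreover have "matrix_inv (g + s *\<^sub>R w) - transpose g = ((1/2) *\<^sub>R (cayley A s + mat 1) - mat 1) ** transpose g"
      unfolding inv by (simp add: matrix_diff_distrib)
    ultimately show ?thesis by (simp add: matrix_scaleR_mult)
  qed
  moreover have "(1/2) *\<^sub>R (2 *\<^sub>R A) ** transpose g = transpose w"
    using SO_tangent_transpose(1)[OF g w] by (simp add: A_def matrix_diff_distrib)
  ultimately show "((\<lambda>s. (matrix_inv (g + s *\<^sub>R w) - transpose g) /\<^sub>R s) \<longlongrightarrow> transpose w) (at 0)" by simp
qed

text \<open>The line \<open>g + s w\<close> leaves SO, so \<open>matrix_inv\<close> is evaluated off
  the group, where it is not the transpose; \<open>matrix_inv_line\<close> supplies its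
  limits.\<close>

lemma pushforward_gamma:
  fixes g :: "'n::finite tuple"
  assumes g: "g \<in> SOT {..r}" and w: "w \<in> so_tangent {..r} g"
  shows "pushforward (\<lambda>(t, g). (t, gamma r g)) (t, g) (a, w) = (a, dgamma r g w)"
  unfolding pushforward_def
proof (rule tendsto_Lim)
  have l: "((\<lambda>s. (gamma r (g + s *\<^sub>R w) - gamma r g) /\<^sub>R s) \<longlongrightarrow> dgamma r g w) (at 0)"
    unfolding tendsto_fun_iff
  proof
    fix j
    show "((\<lambda>s. ((gamma r (g + s *\<^sub>R w) - gamma r g) /\<^sub>R s) j) \<longlongrightarrow> dgamma r g w j) (at 0)"
    proof (cases "j \<in> {1..r}")
      case True
      have gj: "g j \<in> SO" and wj: "transpose (g j) ** w j + transpose (w j) ** g j = 0"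
        using g w True by (auto simp: SOT_def so_tangent_def split: if_splits)
      let ?I = "\<lambda>s. matrix_inv (g j + s *\<^sub>R w j)"
      have "((\<lambda>s. w (j - 1) ** ?I s + g (j - 1) ** ((?I s - transpose (g j)) /\<^sub>R s)) \<longlongrightarrow>
          w (j - 1) ** transpose (g j) + g (j - 1) ** transpose (w j)) (at 0)"
        by (intro tendsto_add tendsto_matrix_mult tendsto_const matrix_inv_line gj wj)
      moreover have "\<forall>\<^sub>F s in at 0. w (j - 1) ** ?I s + g (j - 1) ** ((?I s - transpose (g j)) /\<^sub>R s) =
          ((gamma r (g + s *\<^sub>R w) - gamma r g) /\<^sub>R s) j"
        using eventually_neq_at_within[of "0::real" 0 UNIV]
      proof eventually_elim
        case (elim s)
        have "((g (j - 1) + s *\<^sub>R w (j - 1)) ** ?I s - g (j - 1) ** transpose (g j)) /\<^sub>R s =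
            w (j - 1) ** ?I s + g (j - 1) ** ((?I s - transpose (g j)) /\<^sub>R s)"
          using elim by (simp add: matrix_diff_distrib matrix_scaleR_mult algebra_simps)
        then show ?case using True by (simp add: gamma_def SO_matrix_inv[OF gj])
      qed
      ultimately show ?thesis using True by (simp add: dgamma_def tendsto_cong)
    next
      case False
      then show ?thesis by (auto simp: gamma_def dgamma_def)
    qed
  qed
  have "((\<lambda>s. (a, (gamma r (g + s *\<^sub>R w) - gamma r g) /\<^sub>R s)) \<longlongrightarrow> (a, dgamma r g w)) (at 0)"
    by (intro tendsto_Pair tendsto_const l)
  moreover have "\<forall>\<^sub>F s in at 0. (a, (gamma r (g + s *\<^sub>R w) - gamma r g) /\<^sub>R s) =
      ((case (t, g) + s *\<^sub>R (a, w) of (t, g) \<Rightarrow> (t, gamma r g)) - (case (t, g) of (t, g) \<Rightarrow> (t, gamma r g))) /\<^sub>R s"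
    using eventually_neq_at_within[of "0::real" 0 UNIV] by eventually_elim simp
  ultimately show "((\<lambda>s. ((case (t, g) + s *\<^sub>R (a, w) of (t, g) \<Rightarrow> (t, gamma r g)) -
      (case (t, g) of (t, g) \<Rightarrow> (t, gamma r g))) /\<^sub>R s) \<longlongrightarrow> (a, dgamma r g w)) (at 0)"
    using Lim_transform_eventually by fast
qed simp

lemma hprod_gamma:
  assumes g: "g \<in> SOT {..r}"
  shows "s \<le> r \<Longrightarrow> hprod (gamma r g) s = g 0 ** transpose (g s)"
proof (induction s)
  case 0
  then show ?case using g SO_transpose(2)[of "g 0"] by (auto simp: SOT_def)
next
  case (Suc s)
  have "transpose (g s) ** g s = mat 1" using g Suc.prems by (intro SO_transpose) (auto simp: SOT_def)
  then have "g 0 ** transpose (g s) ** (g s ** transpose (g (Suc s))) = g 0 ** transpose (g (Suc s))"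
    by (metis matrix_mul_assoc matrix_mul_rid)
  then show ?case using Suc by (simp add: gamma_SOT[OF g])
qed

lemma dk_gamma:
  assumes g: "g \<in> SOT {..r}" and w: "w \<in> so_tangent {..r} g"
  shows "s \<le> r \<Longrightarrow> dk (gamma r g) (dgamma r g w) s = w 0 ** transpose (g s) + g 0 ** transpose (w s)"
proof (induction s)
  case 0
  have "g 0 \<in> SO" "transpose (g 0) ** w 0 + transpose (w 0) ** g 0 = 0"
    using g w by (auto simp: SOT_def so_tangent_def split: if_splits)
  then show ?case using SO_tangent_transpose(2) by (metis dk.simps(1))
next
  case (Suc s)
  have s: "transpose (g s) ** w s + transpose (w s) ** g s = 0"
    using w Suc.prems by (auto simp: so_tangent_def split: if_splits)
  have gs: "transpose (g s) ** g s = mat 1" using g Suc.prems by (intro SO_transpose) (auto simp: SOT_def)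
  let ?G = "transpose (g (Suc s))" and ?W = "transpose (w (Suc s))"
  have "dk (gamma r g) (dgamma r g w) (Suc s) =
      (w 0 ** transpose (g s) + g 0 ** transpose (w s)) ** (g s ** ?G) +
      g 0 ** transpose (g s) ** (w s ** ?G + g s ** ?W)"
    using Suc hprod_gamma[OF g, of s] by (simp add: gamma_SOT[OF g] dgamma_def)
  also have "\<dots> = w 0 ** (transpose (g s) ** g s) ** ?G +
      g 0 ** (transpose (g s) ** w s + transpose (w s) ** g s) ** ?G + g 0 ** (transpose (g s) ** g s) ** ?W"
    by (simp add: matrix_diff_distrib matrix_mul_assoc algebra_simps)
  finally show ?case by (simp add: s gs matrix_diff_distrib)
qed

text \<open>Since \<open>k_s = g_0 g_s^-1\<close>, the form \<open>dk_s k_s^-1\<close> is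
  \<open>dg_0 g_0^-1\<close> minus the conjugate of \<open>\<theta>_s\<close> by \<open>g_0\<close>.
  This links the forms on the base with the connection forms.\<close>

lemma psi_gamma:
  assumes g: "g \<in> SOT {..r}" and w: "w \<in> so_tangent {..r} g" and s: "s \<le> r"
  shows "psi s (gamma r g) (dgamma r g w) =
    g 0 ** (transpose (g 0) ** w 0 - transpose (g s) ** w s) ** transpose (g 0)"
proof -
  have gs: "g s \<in> SO" and g0: "g 0 \<in> SO" using g s by (auto simp: SOT_def)
  have ws: "transpose (g s) ** w s + transpose (w s) ** g s = 0"
    using w s by (auto simp: so_tangent_def split: if_splits)
  then have "transpose (w s) ** g s = - (transpose (g s) ** w s)" by (simp add: eq_neg_iff_add_eq_0 add.commute)
  then have 1: "g 0 ** (transpose (w s) ** g s) ** transpose (g 0) = - (g 0 ** (transpose (g s) ** w s) ** transpose (g 0))"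
    by (simp add: matrix_diff_distrib)
  have "psi s (gamma r g) (dgamma r g w) =
      w 0 ** (transpose (g s) ** g s) ** transpose (g 0) + g 0 ** (transpose (w s) ** g s) ** transpose (g 0)"
    unfolding psi_def dk_gamma[OF g w s] hprod_gamma[OF g s]
    by (simp add: matrix_transpose_mul matrix_diff_distrib matrix_mul_assoc)
  then show ?thesis
    unfolding 1 using SO_transpose(1)[OF gs] SO_transpose(2)[OF g0]
    by (simp add: matrix_diff_distrib matrix_mul_assoc)
qed

lemma pf_base_cong: "(\<And>i. i < 2 * p \<Longrightarrow> v i = w i) \<Longrightarrow> pf_base p e r x v = pf_base p e r x w"
  unfolding pf_base_def by (rule ten_cong[OF pform_ten[OF pform_pf_base]])

text \<open>Under \<open>gamma\<close> each \<open>\<psi>_s\<close> becomes the conjugate of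
  \<open>\<theta>_0 - \<theta>_s\<close> by \<open>g_0\<close>. Neither the conjugation nor the
  common summand \<open>\<theta>_0\<close> changes the Pfaffian, and with
  \<open>- \<theta>_s\<close> alone the matrix is the curvature.\<close>

lemma pf_base_gamma:
  fixes g :: "'n::finite tuple"
  assumes e: "bij_betw e {1..2 * p} (UNIV :: 'n set)" and t: "t \<in> standard_simplex r" and g: "g \<in> SOT {..r}"
    and v: "\<And>i. i < 2 * p \<Longrightarrow> v i \<in> simplex_tangent r \<times> so_tangent {..r} g"
  shows "pf_base p e r (t, gamma r g) (\<lambda>i. (fst (v i), dgamma r g (snd (v i)))) = pf_form p e (curvature r) (t, g) v"
proof -
  define w where "w i = (if i < 2 * p then v i else 0)" for i
  have w: "w i \<in> simplex_tangent r \<times> so_tangent {..r} g" for i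
    using v subspace_0[OF subspace_simplex_tangent] zero_so_tangent by (auto simp: w_def zero_prod_def)
  have ws: "snd (w j) \<in> so_tangent {..r} g" for j using w[of j] by auto
  let ?x = "(t, g)" and ?g = "g 0"
  have g0: "?g \<in> SO" using g by (auto simp: SOT_def)
  let ?w = "\<lambda>i. (fst (w i), dgamma r g (snd (w i)))"
  have P: "Psi s (t, gamma r g) ?w = mre ?g ** (- vertex_theta s ?x w + vertex_theta 0 ?x w) ** mre (transpose ?g)" if "s \<le> r" for s
    using psi_gamma[OF g ws that]
    by (simp add: Psi_def vertex_theta_def mlin_mult_left mlin_mult_right flip: mlin_diff)
  have dt: "dtform ?w = dtform w" by (simp add: dtform_def fun_eq_iff)
  have s1: "(\<Sum>i\<le>r. t i) = 1" using t by (simp add: standard_simplex_def)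
  have "(\<Sum>i\<le>r. fst (w j) i) = 0" for j using w[of j] by (auto simp: simplex_tangent_def mem_Times_iff)
  then have s0: "(\<Sum>i\<le>r. dtform w i) = 0" by (simp add: dtform_def lin_sum[symmetric])
  have "base_curv r (t, gamma r g) ?w = curv r t (dtform w) (\<lambda>s. mre ?g ** (- vertex_theta s ?x w + vertex_theta 0 ?x w) ** mre (transpose ?g))"
    unfolding base_curv_def dt fst_conv by (rule curv_cong) (rule P)
  also have "\<dots> = mre ?g ** curv r t (dtform w) (\<lambda>s. - vertex_theta s ?x w) ** mre (transpose ?g)"
    unfolding curv_conj[OF SO_transpose(1)[OF g0]] curv_shift[OF s1 s0] ..
  finally have "pfaffian p e (base_curv r (t, gamma r g) ?w) = pfaffian p e (curv r t (dtform w) (\<lambda>s. - vertex_theta s ?x w))"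
    by (simp add: pfaffian_conj[OF e g0])
  moreover have "reps ?x (simplex_tangent r \<times> so_tangent {..r} (snd ?x)) (2 * p) (pf_form p e (curvature r))
      (\<lambda>v. pfaffian p e (curv r (fst ?x) (dtform v) (\<lambda>i. - vertex_theta i ?x v)))"
    by (rule reps_pf_form) (use t g in auto)
  ultimately have "pf_form p e (curvature r) ?x v = gc (pfaffian p e (curv r t (dtform v) (\<lambda>i. - vertex_theta i ?x v))) {..<2 * p}"
    and ten: "ten (2 * p) (\<lambda>v. pfaffian p e (curv r t (dtform v) (\<lambda>i. - vertex_theta i ?x v)))"
    and "pf_base p e r (t, gamma r g) ?w = gc (pfaffian p e (curv r t (dtform w) (\<lambda>s. - vertex_theta s ?x w))) {..<2 * p}"
    using v by (auto simp: reps_def pf_base_def)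
  moreover have "gc (pfaffian p e (curv r t (dtform w) (\<lambda>s. - vertex_theta s ?x w))) {..<2 * p} =
      gc (pfaffian p e (curv r t (dtform v) (\<lambda>s. - vertex_theta s ?x v))) {..<2 * p}"
    by (rule ten_cong[OF ten]) (simp add: w_def)
  moreover have "pf_base p e r (t, gamma r g) ?w = pf_base p e r (t, gamma r g) (\<lambda>i. (fst (v i), dgamma r g (snd (v i))))"
    by (rule pf_base_cong) (simp add: w_def)
  ultimately show ?thesis by simp
qed

text \<open>The section of \<open>gamma\<close> that sends \<open>h\<close> to the tuple of the
  inverses of its partial products, starting with the identity. Through it and
  \<open>gamma_dsection\<close> every tangent vector of NG(r) is lifted to the total space.\<close>

definition gamma_section :: "nat \<Rightarrow> 'n::finite tuple \<Rightarrow> 'n tuple" where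
  "gamma_section r h = (\<lambda>s. if s \<le> r then transpose (hprod h s) else 0)"

definition gamma_dsection :: "nat \<Rightarrow> 'n::finite tuple \<Rightarrow> 'n tuple \<Rightarrow> 'n tuple" where
  "gamma_dsection r h u = (\<lambda>s. if s \<le> r then transpose (dk h u s) else 0)"

lemma gamma_section_SOT: "h \<in> SOT {1..r} \<Longrightarrow> gamma_section r h \<in> SOT {..r}"
  using hprod_SO SO_transpose_in by (auto simp: SOT_def gamma_section_def intro!: SO_transpose_in hprod_SO[unfolded SOT_def])

lemma gamma_dsection_tangent:
  assumes h: "h \<in> SOT {1..r}" and u: "u \<in> so_tangent {1..r} h"
  shows "gamma_dsection r h u \<in> so_tangent {..r} (gamma_section r h)"
proof -
  have "hprod h s ** transpose (dk h u s) + dk h u s ** transpose (hprod h s) = 0" if "s \<le> r" for s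
    using SO_tangent_transpose(2)[OF hprod_SO[OF h that] dk_tangent[OF h u that]] by (simp add: add.commute)
  then show ?thesis by (simp add: so_tangent_def gamma_section_def gamma_dsection_def)
qed

lemma gamma_of_section:
  assumes h: "h \<in> SOT {1..r}" shows "gamma r (gamma_section r h) = h"
proof
  fix j
  show "gamma r (gamma_section r h) j = h j"
  proof (cases "j \<in> {1..r}")
    case True
    then obtain s where s: "j = Suc s" "s < r" by (cases j) auto
    have "transpose (hprod h s) ** hprod h s = mat 1" using SO_transpose(1)[OF hprod_SO[OF h]] s by auto
    then show ?thesis using s unfolding gamma_SOT[OF gamma_section_SOT[OF h]] by (simp add: gamma_section_def matrix_mul_assoc)
  next
    case False
    then show ?thesis using h by (auto simp: gamma_def SOT_def)
  qed
qed

lemma dgamma_of_section: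
  assumes h: "h \<in> SOT {1..r}" and u: "u \<in> so_tangent {1..r} h"
  shows "dgamma r (gamma_section r h) (gamma_dsection r h u) = u"
proof
  fix j
  show "dgamma r (gamma_section r h) (gamma_dsection r h u) j = u j"
  proof (cases "j \<in> {1..r}")
    case True
    then obtain s where s: "j = Suc s" "s < r" by (cases j) auto
    let ?k = "hprod h s" and ?d = "dk h u s"
    have k: "transpose ?k ** ?k = mat 1" using SO_transpose(1)[OF hprod_SO[OF h]] s by auto
    have d: "transpose ?k ** ?d + transpose ?d ** ?k = 0" using dk_tangent[OF h u] s by auto
    have "dgamma r (gamma_section r h) (gamma_dsection r h u) j = transpose ?d ** (?k ** h (Suc s)) + transpose ?k ** (?d ** h (Suc s) + ?k ** u (Suc s))"
      using s by (simp add: dgamma_def gamma_section_def gamma_dsection_def)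
    also have "\<dots> = (transpose ?k ** ?d + transpose ?d ** ?k) ** h (Suc s) + (transpose ?k ** ?k) ** u (Suc s)"
      by (simp add: matrix_diff_distrib matrix_mul_assoc algebra_simps)
    finally show ?thesis by (simp add: d k s matrix_diff_distrib)
  next
    case False
    then show ?thesis using u by (auto simp: dgamma_def so_tangent_def)
  qed
qed

text \<open>\<open>pf_base\<close> shows that a form with the required properties exists. The chosen
  form is known only through its pullback, and evaluating this pullback at the section recovers it
  on tangent vectors.\<close>

lemma descended_pf_eq:
  fixes h :: "'n::finite tuple"
  assumes e: "bij_betw e {1..2 * p} (UNIV :: 'n set)" and t: "t \<in> standard_simplex r" and h: "h \<in> SOT {1..r}"
    and v: "\<And>i. i < 2 * p \<Longrightarrow> v i \<in> simplex_tangent r \<times> so_tangent {1..r} h"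
  shows "descended_pf p e r (t, h) v = pf_base p e r (t, h) v"
proof -
  let ?\<gamma> = "\<lambda>(t, g). (t, gamma r g)"
  let ?P = "\<lambda>\<beta>. smooth_form (standard_simplex r \<times> NG r) (2 * p) \<beta> \<and>
     form_eq (standard_simplex r \<times> NGbar r) (2 * p) (pullback ?\<gamma> \<beta>) (pf_form p e (curvature r))"
  have T: "tangent_space (standard_simplex r \<times> SOT {..r}) (t, g) = simplex_tangent r \<times> so_tangent {..r} g"
    if "t \<in> standard_simplex r" "g \<in> SOT {..r}" for t and g :: "'n tuple"
    by (rule tangent_space_simplex_SOT[OF that])
  have push: "pushforward ?\<gamma> (t, g) u = (fst u, dgamma r g (snd u))"
    if "g \<in> SOT {..r}" "u \<in> simplex_tangent r \<times> so_tangent {..r} g" for t g u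
    using pushforward_gamma[OF that(1), of "snd u" t "fst u"] that(2) by (simp add: mem_Times_iff)
  have "?P (pf_base p e r)"
  proof
    show "smooth_form (standard_simplex r \<times> NG r) (2 * p) (pf_base p e r)"
      by (rule pform_smooth_form[OF pform_pf_base]) (simp add: pf_base_def)
    show "form_eq (standard_simplex r \<times> NGbar r) (2 * p) (pullback ?\<gamma> (pf_base p e r)) (pf_form p e (curvature r))"
      unfolding form_eq_def NGbar_eq
    proof (intro ballI allI impI)
      fix x :: "'n spt" and v assume x: "x \<in> standard_simplex r \<times> SOT {..r}"
        and v: "\<forall>i<2 * p. v i \<in> tangent_space (standard_simplex r \<times> SOT {..r}) x"
      obtain t g where tg: "x = (t, g)" "t \<in> standard_simplex r" "g \<in> SOT {..r}" using x by auto
      have v': "v i \<in> simplex_tangent r \<times> so_tangent {..r} g" if "i < 2 * p" for i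
        using v that unfolding tg(1) T[OF tg(2,3)] by blast
      have "pullback ?\<gamma> (pf_base p e r) x v = pf_base p e r (t, gamma r g) (\<lambda>i. (fst (v i), dgamma r g (snd (v i))))"
        unfolding pullback_def tg(1) prod.case by (rule pf_base_cong) (rule push[OF tg(3) v'])
      then show "pullback ?\<gamma> (pf_base p e r) x v = pf_form p e (curvature r) x v"
        unfolding tg(1) using pf_base_gamma[OF e tg(2,3) v'] by simp
    qed
  qed
  then have D: "?P (descended_pf p e r)" unfolding descended_pf_def by (rule someI[of ?P])
  let ?v = "\<lambda>i. if i < 2 * p then (fst (v i), gamma_dsection r h (snd (v i))) else 0"
  let ?g = "gamma_section r h"
  have g: "?g \<in> SOT {..r}" by (rule gamma_section_SOT[OF h])
  have vT: "?v i \<in> simplex_tangent r \<times> so_tangent {..r} ?g" if "i < 2 * p" for i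
    using v[OF that] gamma_dsection_tangent[OF h] that by (auto simp: mem_Times_iff)
  have A1: "pullback ?\<gamma> (descended_pf p e r) (t, ?g) ?v = pf_form p e (curvature r) (t, ?g) ?v"
    using D vT T[OF t g] t g unfolding form_eq_def NGbar_eq by auto
  have A2: "pullback ?\<gamma> (pf_base p e r) (t, ?g) ?v = pf_form p e (curvature r) (t, ?g) ?v"
    using \<open>?P (pf_base p e r)\<close> vT T[OF t g] t g unfolding form_eq_def NGbar_eq by auto
  have A3: "pushforward ?\<gamma> (t, ?g) (?v i) = v i" if "i < 2 * p" for i
    using push[OF g vT[OF that], of t] dgamma_of_section[OF h] v[OF that] that by (simp add: mem_Times_iff)
  \<comment> \<open>The chosen form might depend on entries beyond the first \<open>2 * p\<close>.
    On tangent vectors it agrees with a local extension, which is alternating and therefore ignores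
    them.\<close>
  have A4: "descended_pf p e r (t, h) v = descended_pf p e r (t, h) w" if "\<And>i. i < 2 * p \<Longrightarrow> v i = w i" for w
  proof -
    have "(t, h) \<in> standard_simplex r \<times> NG r" using t h by (simp add: NG_eq)
    then obtain U \<eta> where U: "(t, h) \<in> U" "extends_on (standard_simplex r \<times> NG r) (2 * p) (descended_pf p e r) U \<eta>"
      using D unfolding smooth_form_def by blast
    have TT: "tangent_space (standard_simplex r \<times> NG r) (t, h) = simplex_tangent r \<times> so_tangent {1..r} h"
      unfolding NG_eq by (rule tangent_space_simplex_SOT[OF t h])
    have "(t, h) \<in> standard_simplex r \<times> NG r \<inter> U" using U t h by (simp add: NG_eq)
    then have D': "\<eta> (t, h) u = descended_pf p e r (t, h) u"
      if "\<forall>i<2 * p. u i \<in> simplex_tangent r \<times> so_tangent {1..r} h" for u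
      using U(2) that unfolding extends_on_def TT[symmetric] by blast
    have vT: "\<forall>i<2 * p. v i \<in> simplex_tangent r \<times> so_tangent {1..r} h" using v by blast
    then have wT: "\<forall>i<2 * p. w i \<in> simplex_tangent r \<times> so_tangent {1..r} h" using that by metis
    have "\<eta> (t, h) v = descended_pf p e r (t, h) v" "\<eta> (t, h) w = descended_pf p e r (t, h) w"
      by (rule D'[OF vT], rule D'[OF wT])
    moreover have "alternating (2 * p) (\<eta> (t, h))" using U unfolding extends_on_def by blast
    then have "\<eta> (t, h) v = \<eta> (t, h) w" by (rule alternating_cong) (rule that)
    ultimately show ?thesis by simp
  qed
  have "descended_pf p e r (t, h) v = pullback ?\<gamma> (descended_pf p e r) (t, ?g) ?v"
    unfolding pullback_def prod.case gamma_of_section[OF h] by (rule A4, rule A3[symmetric])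
  also have "\<dots> = pullback ?\<gamma> (pf_base p e r) (t, ?g) ?v" unfolding A1 A2 ..
  also have "\<dots> = pf_base p e r (t, h) v"
    unfolding pullback_def prod.case gamma_of_section[OF h] by (rule pf_base_cong, rule A3)
  finally show ?thesis .
qed

definition euler_rep :: "nat \<Rightarrow> (nat \<Rightarrow> 'n) \<Rightarrow> 'n::finite cochain" where
  "euler_rep p e r = fibre_integral r (pf_base p e r)"

lemma euler_cocycle_eq:
  fixes h :: "'n::finite tuple"
  assumes e: "bij_betw e {1..2 * p} (UNIV :: 'n set)" and h: "h \<in> SOT {1..r}"
    and w: "\<And>i. i < 2 * p - r \<Longrightarrow> w i \<in> so_tangent {1..r} h"
  shows "euler_cocycle p e r h w = euler_rep p e r h w"
  unfolding euler_cocycle_def euler_rep_def fibre_integral_def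
  by (rule simplex_integral_cong, rule descended_pf_eq[OF e _ h])
    (use w in \<open>auto simp: zero_so_tangent subspace_0[OF subspace_simplex_tangent] intro!: simplex_vec_tangent\<close>)

section \<open>The expansion into words\<close>

lemma prod_list_sum_lists:
  fixes F :: "'k \<Rightarrow> 'c \<Rightarrow> 'a::semiring_1"
  assumes "finite C"
  shows "prod_list (map (\<lambda>k. \<Sum>c\<in>C. F k c) ks) = (\<Sum>W | set W \<subseteq> C \<and> length W = length ks. prod_list (map2 F ks W))"
proof (induction ks)
  case Nil
  have "{W :: 'c list. set W \<subseteq> C \<and> W = []} = {[]}" by auto
  then show ?case by simp
next
  case (Cons k ks)
  let ?A = "{W. set W \<subseteq> C \<and> length W = length ks}"
  have inj: "inj_on (\<lambda>(xs, n). n # xs) (?A \<times> C)" by (auto simp: inj_on_def)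
  have "(\<Sum>W | set W \<subseteq> C \<and> length W = length (k # ks). prod_list (map2 F (k # ks) W)) =
      (\<Sum>(W, c)\<in>?A \<times> C. F k c * prod_list (map2 F ks W))"
    unfolding length_Cons lists_length_Suc_eq by (subst sum.reindex[OF inj]) (auto simp: o_def case_prod_beta)
  also have "\<dots> = (\<Sum>W\<in>?A. \<Sum>c\<in>C. F k c * prod_list (map2 F ks W))" by (rule sum.cartesian_product[symmetric])
  also have "\<dots> = (\<Sum>c\<in>C. \<Sum>W\<in>?A. F k c * prod_list (map2 F ks W))" by (rule sum.swap)
  finally show ?case using Cons by (simp add: sum_product)
qed

lemma map2_nth: "length W = p \<Longrightarrow> map2 F [1..<p + 1] W = map (\<lambda>k. F k (W ! (k - 1))) [1..<p + 1]"
  by (rule nth_equalityI) (auto simp del: upt_Suc)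

definition phis :: "letter list \<Rightarrow> nat list" where
  "phis W = concat (map (\<lambda>L. case L of Phi s \<Rightarrow> [s] | R i j \<Rightarrow> []) W)"

lemma phis_simps [simp]: "phis [] = []" "phis (Phi s # W) = s # phis W" "phis (R i j # W) = phis W"
  by (simp_all add: phis_def)

definition is_Phi :: "letter \<Rightarrow> bool" where "is_Phi L = (case L of Phi s \<Rightarrow> True | R i j \<Rightarrow> False)"

lemma is_Phi_simps [simp]: "is_Phi (Phi s)" "\<not> is_Phi (R i j)" by (simp_all add: is_Phi_def)

lemma filter_is_Phi: "filter is_Phi W = map Phi (phis W)"
proof (induction W)
  case (Cons L W) then show ?case by (cases L) auto
qed simp

lemma length_phis: "length (phis W) + length (filter (\<lambda>L. \<not> is_Phi L) W) = length W"
proof (induction W)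
  case (Cons L W) then show ?case by (cases L) auto
qed simp

lemma triangle_Suc: "Suc m * m div 2 = m + m * (m - 1) div 2"
proof -
  have "Suc m * m = 2 * m + m * (m - 1)" by (cases m) auto
  then show ?thesis by (metis div_mult_self4 mult.commute zero_neq_numeral)
qed

lemma par_word_prod:
  assumes "\<And>s. par (c (Phi s)) = - c (Phi s)" "\<And>i j. par (c (R i j)) = c (R i j)"
  shows "par (prod_list (map c W)) = (-1) ^ length (phis W) *\<^sub>R prod_list (map c W)"
proof (induction W)
  case (Cons L W) then show ?case by (cases L) (auto simp: assms)
qed simp

text \<open>The coefficients are moved to the front. Every odd \<open>y\<close> has to pass the odd
  coefficients of the later letters, so m odd letters cause m(m-1)/2 sign changes. This is the
  origin of the triangular exponent in \<open>T_coeff\<close>.\<close>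

lemma word_prod_split:
  assumes c: "\<And>s. par (c (Phi s)) = - c (Phi s)" "\<And>i j. par (c (R i j)) = c (R i j)"
    and y: "\<And>k s. par (y k (Phi s)) = - y k (Phi s)" "\<And>k i j. par (y k (R i j)) = y k (R i j)"
  shows "length ks = length W \<Longrightarrow> prod_list (map2 (\<lambda>k L. c L * y k L) ks W) =
    (-1) ^ (length (phis W) * (length (phis W) - 1) div 2) *\<^sub>R (prod_list (map c W) * prod_list (map2 y ks W))"
proof (induction ks W rule: list_induct2)
  case (Cons k ks L W)
  let ?C = "prod_list (map c W)" and ?Y = "prod_list (map2 y ks W)" and ?m = "length (phis W)"
  have eq: "prod_list (map2 (\<lambda>k L. c L * y k L) (k # ks) (L # W)) =
      (-1) ^ (?m * (?m - 1) div 2) *\<^sub>R (c L * (y k L * ?C) * ?Y)"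
    using Cons by (simp add: mult.assoc)
  show ?case
  proof (cases L)
    case (Phi s)
    have "y k L * ?C = (-1) ^ ?m *\<^sub>R (?C * y k L)"
      using odd_commute[of "y k L" ?C] par_word_prod[of c W] c y(1) by (simp add: Phi)
    then have "prod_list (map2 (\<lambda>k L. c L * y k L) (k # ks) (L # W)) =
        (-1) ^ (?m + ?m * (?m - 1) div 2) *\<^sub>R (c L * ?C * (y k L * ?Y))"
      unfolding eq by (simp add: power_add mult.assoc mult.commute)
    then show ?thesis using triangle_Suc[of ?m] by (simp add: Phi)
  next
    case (R i j)
    have "y k L * ?C = ?C * y k L" using even_commute[of "y k L" ?C] y(2) by (simp add: R)
    then show ?thesis unfolding eq by (simp add: R mult.assoc)
  qed
qed simp

definition R_pairs :: "nat \<Rightarrow> (nat \<times> nat) set" where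
  "R_pairs r = {(i, j). 1 \<le> i \<and> i < j \<and> j \<le> r + 1}"

lemma finite_R_pairs [simp]: "finite (R_pairs r)"
  by (rule finite_subset[of _ "{..r + 1} \<times> {..r + 1}"]) (auto simp: R_pairs_def)

definition letters :: "nat \<Rightarrow> letter set" where
  "letters r = Phi ` {1..r} \<union> (\<lambda>(i, j). R i j) ` R_pairs r"

lemma finite_letters [simp]: "finite (letters r)"
  by (simp add: letters_def)

lemma sum_letters:
  "(\<Sum>L\<in>letters r. f L) = (\<Sum>s=1..r. f (Phi s)) + (\<Sum>(i, j)\<in>R_pairs r. f (R i j))"
proof -
  have "(\<Sum>L\<in>letters r. f L) = (\<Sum>L\<in>Phi ` {1..r}. f L) + (\<Sum>L\<in>(\<lambda>(i, j). R i j) ` R_pairs r. f L)"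
    unfolding letters_def by (rule sum.union_disjoint) auto
  also have "(\<Sum>L\<in>Phi ` {1..r}. f L) = (\<Sum>s=1..r. f (Phi s))"
    by (subst sum.reindex) (auto simp: inj_on_def)
  also have "(\<Sum>L\<in>(\<lambda>(i, j). R i j) ` R_pairs r. f L) = (\<Sum>(i, j)\<in>R_pairs r. f (R i j))"
    by (subst sum.reindex) (auto simp: inj_on_def case_prod_beta)
  finally show ?thesis .
qed

text \<open>The form \<open>dt_s + ... + dt_r\<close>: on
  \<open>\<partial>/\<partial>t_(j+1)\<close>, which stands at place \<open>j\<close>, it has the
  value 1 if \<open>s \<le> j + 1\<close>. It is the coefficient of \<open>\<phi>_s\<close> in
  \<open>\<Sum> dt_i \<psi>_i\<close>, as \<open>\<psi>_i\<close> is the sum of the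
  \<open>\<phi>_s\<close> with \<open>s \<le> i\<close>.\<close>

definition dtau :: "nat \<Rightarrow> nat \<Rightarrow> grass" where
  "dtau r s = lin (\<lambda>j. of_bool (s \<le> Suc j \<and> j < r))"

definition tweight :: "nat \<Rightarrow> (nat \<Rightarrow> real) \<Rightarrow> letter list \<Rightarrow> real" where
  "tweight r t W = (\<Prod>(i, j)\<in>R_pairs r. (t (i - 1) * t (j - 1)) ^ count_list W (R i j))"

definition letter_coeff :: "nat \<Rightarrow> (nat \<Rightarrow> real) \<Rightarrow> letter \<Rightarrow> grass" where
  "letter_coeff r t L = (case L of Phi s \<Rightarrow> - dtau r s | R i j \<Rightarrow> of_real (- (t (i - 1) * t (j - 1))))"

lemma letter_coeff_simps [simp]: "letter_coeff r t (Phi s) = - dtau r s"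
  "letter_coeff r t (R i j) = of_real (- (t (i - 1) * t (j - 1)))"
  by (simp_all add: letter_coeff_def)

lemma tweight_Cons:
  "tweight r t (Phi s # W) = tweight r t W"
  "(i, j) \<in> R_pairs r \<Longrightarrow> tweight r t (R i j # W) = (t (i - 1) * t (j - 1)) * tweight r t W"
proof -
  assume ij: "(i, j) \<in> R_pairs r"
  have "tweight r t (R i j # W) = (\<Prod>x\<in>R_pairs r. (if x = (i, j) then t (i - 1) * t (j - 1) else 1) *
      (case x of (i, j) \<Rightarrow> (t (i - 1) * t (j - 1)) ^ count_list W (R i j)))"
    unfolding tweight_def
  proof (rule prod.cong[OF refl])
    fix x assume "x \<in> R_pairs r"
    show "(case x of (i', j') \<Rightarrow> (t (i' - 1) * t (j' - 1)) ^ count_list (R i j # W) (R i' j')) =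
        (if x = (i, j) then t (i - 1) * t (j - 1) else 1) *
        (case x of (i, j) \<Rightarrow> (t (i - 1) * t (j - 1)) ^ count_list W (R i j))"
      by (cases x, cases "x = (i, j)") auto
  qed
  then show "tweight r t (R i j # W) = (t (i - 1) * t (j - 1)) * tweight r t W"
    unfolding prod.distrib using ij by (simp add: tweight_def)
qed (simp add: tweight_def)

text \<open>Every letter enters the curvature with a minus sign. For words of length p this is the
  factor \<open>(-1)^p\<close> of \<open>T_coeff\<close>.\<close>

lemma prod_letter_coeff:
  "set W \<subseteq> letters r \<Longrightarrow> prod_list (map (letter_coeff r t) W) =
    ((-1) ^ length W * tweight r t W) *\<^sub>R prod_list (map (dtau r) (phis W))"
proof (induction W)
  case Nil
  then show ?case by (simp add: tweight_def case_prod_beta)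
next
  case (Cons L W)
  show ?case
  proof (cases L)
    case (Phi s)
    then show ?thesis using Cons by (simp add: tweight_Cons)
  next
    case (R i j)
    then have "(i, j) \<in> R_pairs r" using Cons.prems by (auto simp: letters_def)
    then show ?thesis using Cons R
      by (simp add: tweight_Cons of_real_def mult.assoc mult.left_commute del: of_real_mult of_real_minus)
  qed
qed

lemma lin_anticommute: "lin a * lin b = - (lin b * lin a)"
  using odd_commute[of "lin a" "lin b"] by simp

lemma lin_square: "lin a * lin a = 0"
proof -
  have "2 *\<^sub>R (lin a * lin a) = 0" using lin_anticommute[of a a] by (simp add: scaleR_2 eq_neg_iff_add_eq_0)
  then show ?thesis by simp
qed

text \<open>Two equal factors can be brought next to each other at the cost of a sign, and the
  square of a 1-form is 0.\<close>

lemma prod_lin_repeat: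
  assumes "\<not> distinct xs"
  shows "prod_list (map (\<lambda>s. lin (c s)) xs) = 0"
proof -
  obtain us vs ws y where xs: "xs = us @ [y] @ vs @ [y] @ ws" using assms not_distinct_decomp by blast
  have "prod_list (map (\<lambda>s. lin (c s)) vs) * lin (c y) = (-1) ^ length vs *\<^sub>R (lin (c y) * prod_list (map (\<lambda>s. lin (c s)) vs))" for vs
  proof (induction vs)
    case (Cons v vs)
    have "prod_list (map (\<lambda>s. lin (c s)) (v # vs)) * lin (c y) = lin (c v) * (prod_list (map (\<lambda>s. lin (c s)) vs) * lin (c y))"
      by (simp add: mult.assoc)
    also have "\<dots> = (-1) ^ length vs *\<^sub>R ((lin (c v) * lin (c y)) * prod_list (map (\<lambda>s. lin (c s)) vs))"
      unfolding Cons by (simp add: mult.assoc)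
    also have "lin (c v) * lin (c y) = - (lin (c y) * lin (c v))" by (rule lin_anticommute)
    finally show ?case by (simp add: mult.assoc)
  qed simp
  then have z: "lin (c y) * (prod_list (map (\<lambda>s. lin (c s)) vs) * lin (c y)) = 0"
    by (simp add: lin_square flip: mult.assoc)
  have "prod_list (map (\<lambda>s. lin (c s)) xs) = prod_list (map (\<lambda>s. lin (c s)) us) *
      (lin (c y) * (prod_list (map (\<lambda>s. lin (c s)) vs) * lin (c y))) * prod_list (map (\<lambda>s. lin (c s)) ws)"
    by (simp add: xs mult.assoc)
  then show ?thesis by (simp add: z)
qed

text \<open>The determinant of a triangular matrix with ones on the diagonal: only the identity
  permutation satisfies \<open>m \<le> \<pi> m\<close> for all \<open>m\<close>.\<close>

lemma gc_prod_dtau_id: "gc (prod_list (map (dtau r) [1..<r + 1])) {..<r} = 1"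
proof -
  have "prod_list (map (dtau r) [1..<r + 1]) = prod_list (map (\<lambda>m. lin (\<lambda>j. of_bool (m \<le> j \<and> j < r))) [0..<r])"
    by (rule arg_cong[of _ _ prod_list], rule nth_equalityI) (auto simp: dtau_def simp del: upt_Suc)
  then have "gc (prod_list (map (dtau r) [1..<r + 1])) {..<r} =
      (\<Sum>\<pi> | \<pi> permutes {..<r}. of_int (sign \<pi>) * (\<Prod>m<r. of_bool (m \<le> \<pi> m \<and> \<pi> m < r)))"
    by (simp only: gc_prod_lin detsum_def)
  also have "\<dots> = (\<Sum>\<pi> | \<pi> permutes {..<r}. if \<pi> = id then 1 else 0)"
  proof (rule sum.cong[OF refl])
    fix \<pi> assume "\<pi> \<in> {\<pi>. \<pi> permutes {..<r}}"
    then have p: "\<pi> permutes {..<r}" by simp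
    show "of_int (sign \<pi>) * (\<Prod>m<r. of_bool (m \<le> \<pi> m \<and> \<pi> m < r)) = (if \<pi> = id then 1 else (0::real))"
    proof (cases "\<pi> = id")
      case False
      then obtain m where "m < r" "\<not> m \<le> \<pi> m"
        using permutes_natset_ge[OF p] by (metis lessThan_iff)
      then have "(\<Prod>m<r. of_bool (m \<le> \<pi> m \<and> \<pi> m < r)) = (0::real)" by (intro prod_zero) auto
      then show ?thesis using False by simp
    qed (simp add: sign_id)
  qed
  also have "\<dots> = 1" by (subst sum.delta) (auto simp: finite_permutations permutes_id)
  finally show ?thesis .
qed

text \<open>An auxiliary generator \<open>\<xi>\<^sub>r\<close> in front makes the product start at index \<open>0\<close>.\<close>

lemma gc_prod_dtau_perm:
  assumes "\<sigma> permutes {1..r}"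
  shows "gc (prod_list (map (dtau r) (map \<sigma> [1..<r + 1]))) {..<r} = of_int (sign \<sigma>)"
proof -
  define g where "g s = (if s = 0 then xi r else dtau r s)" for s
  have gl: "\<exists>c. g s = lin c" for s by (auto simp: g_def dtau_def xi_def)
  have anti: "g a * g b = - (g b * g a)" for a b using gl[of a] gl[of b] lin_anticommute by metis
  have s: "\<sigma> permutes {..<r + 1}" by (rule permutes_subset[OF assms]) auto
  have s0: "\<sigma> 0 = 0" by (rule permutes_not_in[OF assms]) simp
  have up: "[0..<r + 1] = 0 # [1..<r + 1]" by (simp add: upt_conv_Cons del: upt_Suc)
  have gs: "map g (map \<pi> [1..<r + 1]) = map (dtau r) (map \<pi> [1..<r + 1])" if "\<pi> permutes {1..r}" for \<pi>
  proof -
    have "\<pi> s \<noteq> 0" if "s \<in> {1..r}" for s using permutes_in_image[OF \<open>\<pi> permutes {1..r}\<close>, of s] that by auto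
    then have "g (\<pi> s) = dtau r (\<pi> s)" if "s \<in> {1..r}" for s using that by (simp only: g_def if_False)
    then show ?thesis by (auto simp del: upt_Suc)
  qed
  have "prod_list (map (g \<circ> \<sigma>) [0..<r + 1]) = of_int (sign \<sigma>) *\<^sub>R prod_list (map g [0..<r + 1])"
    by (rule prod_list_permute[OF s]) (rule anti)
  then have "xi r * prod_list (map g (map \<sigma> [1..<r + 1])) = of_int (sign \<sigma>) *\<^sub>R (xi r * prod_list (map g (map id [1..<r + 1])))"
    unfolding up by (simp add: s0 g_def[of 0] del: upt_Suc)
  then have eq: "xi r * prod_list (map (dtau r) (map \<sigma> [1..<r + 1])) =
      of_int (sign \<sigma>) *\<^sub>R (xi r * prod_list (map (dtau r) [1..<r + 1]))"
    unfolding gs[OF assms] gs[OF permutes_id] by simp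
  have "(-1) ^ r * gc a {..<r} = gc (xi r * a) {..<Suc r}" for a
  proof -
    have "{s \<in> {..<Suc r}. s < r} = {..<r}" "{..<Suc r} - {r} = {..<r}" by auto
    then show ?thesis by (simp add: gc_xi_mult)
  qed
  then have "(-1) ^ r * gc (prod_list (map (dtau r) (map \<sigma> [1..<r + 1]))) {..<r} =
      of_int (sign \<sigma>) * ((-1) ^ r * gc (prod_list (map (dtau r) [1..<r + 1])) {..<r})"
    using arg_cong[OF eq, of "\<lambda>a. gc a {..<Suc r}"] by simp
  then show ?thesis unfolding gc_prod_dtau_id by simp
qed

text \<open>A list of the wrong length gives 0 for reasons of degree, and a repeated index gives 0
  as well; what is left are the rearrangements of 1, ..., r. Writing the sign as a sum over
  \<open>\<sigma>\<close> produces the sum over the symmetric group in \<open>mu\<close>.\<close>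

lemma gc_prod_dtau:
  assumes "set S \<subseteq> {1..r}"
  shows "gc (prod_list (map (dtau r) S)) {..<r} =
    (\<Sum>\<sigma> | \<sigma> permutes {1..r}. of_int (sign \<sigma>) * of_bool (S = map \<sigma> [1..<r + 1]))"
proof (cases "\<exists>\<sigma>. \<sigma> permutes {1..r} \<and> S = map \<sigma> [1..<r + 1]")
  case True
  then obtain \<sigma> where s: "\<sigma> permutes {1..r}" "S = map \<sigma> [1..<r + 1]" by blast
  have "\<sigma>' = \<sigma>" if "\<sigma>' permutes {1..r}" "S = map \<sigma>' [1..<r + 1]" for \<sigma>'
  proof
    fix k
    have "\<sigma> k = \<sigma>' k" if "k \<in> {1..r}"
      using that s(2) \<open>S = map \<sigma>' [1..<r + 1]\<close> by (auto simp del: upt_Suc)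
    then show "\<sigma>' k = \<sigma> k"
      using s(1) \<open>\<sigma>' permutes {1..r}\<close> by (cases "k \<in> {1..r}") (auto simp: permutes_not_in)
  qed
  then have "(\<Sum>\<sigma> | \<sigma> permutes {1..r}. of_int (sign \<sigma>) * of_bool (S = map \<sigma> [1..<r + 1])) =
      (\<Sum>\<sigma>' | \<sigma>' permutes {1..r}. if \<sigma>' = \<sigma> then of_int (sign \<sigma>) else (0::real))"
    using s(2) by (intro sum.cong) auto
  also have "\<dots> = of_int (sign \<sigma>)" using s(1) by (subst sum.delta) (auto simp: finite_permutations)
  finally show ?thesis unfolding s(2) using gc_prod_dtau_perm[OF s(1)] by simp
next
  case False
  have "gc (prod_list (map (dtau r) S)) {..<r} = 0"
  proof (cases "length S = r \<and> distinct S")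
    case True
    define \<sigma> where "\<sigma> k = (if k \<in> {1..r} then S ! (k - 1) else k)" for k
    have S: "S = map \<sigma> [1..<r + 1]"
      using True by (intro nth_equalityI) (auto simp: \<sigma>_def simp del: upt_Suc)
    have "\<sigma> ` {1..r} = set S" by (subst S) (auto simp del: upt_Suc)
    moreover have "set S = {1..r}"
      by (rule card_subset_eq) (use assms True distinct_card[of S] in auto)
    moreover have "inj_on \<sigma> {1..r}"
      using True by (intro eq_card_imp_inj_on) (use calculation in auto)
    ultimately have "\<sigma> permutes {1..r}"
      by (intro bij_imp_permutes) (auto simp: bij_betw_def \<sigma>_def)
    then show ?thesis using False S by blast
  next
    case rep: False
    show ?thesis
    proof (cases "distinct S")
      case True
      then have "length S \<noteq> r" using rep by simp
      moreover have "homog (length S) (prod_list (map (dtau r) S))"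
        using homog_prod_lin[of "map (\<lambda>s j. of_bool (s \<le> Suc j \<and> j < r)) S"] by (simp add: dtau_def[abs_def] o_def)
      ultimately show ?thesis by (simp add: homog_def)
    next
      case False
      then show ?thesis using prod_lin_repeat[of S] by (simp add: dtau_def[abs_def])
    qed
  qed
  moreover have "(\<Sum>\<sigma> | \<sigma> permutes {1..r}. of_int (sign \<sigma>) * of_bool (S = map \<sigma> [1..<r + 1])) = (0::real)"
    using False by (intro sum.neutral) auto
  ultimately show ?thesis by simp
qed

text \<open>\<open>phi\<close> reads the vector at place 0, so it is applied to the constant
  sequence to obtain its value on \<open>v j\<close>.\<close>

definition letter_mat :: "'n::finite tuple \<Rightarrow> (nat \<Rightarrow> 'n tuple) \<Rightarrow> letter \<Rightarrow> grass^'n^'n" where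
  "letter_mat h v L = (case L of Phi s \<Rightarrow> mlin (\<lambda>j. phi s h (\<lambda>_. v j))
    | R i j \<Rightarrow> (\<Sum>s=i..<j. mlin (\<lambda>m. phi s h (\<lambda>_. v m))) ** (\<Sum>s=i..<j. mlin (\<lambda>m. phi s h (\<lambda>_. v m))))"

lemma letter_mat_par:
  "par (letter_mat h v (Phi s) $ a $ b) = - letter_mat h v (Phi s) $ a $ b"
  "par (letter_mat h v (R i j) $ a $ b) = letter_mat h v (R i j) $ a $ b"
proof -
  show "par (letter_mat h v (Phi s) $ a $ b) = - letter_mat h v (Phi s) $ a $ b"
    by (simp add: letter_mat_def mlin_def)
  have "mpar (letter_mat h v (R i j)) = letter_mat h v (R i j)"
    by (simp add: letter_mat_def mpar_mult mpar_sum sum_negf matrix_diff_distrib)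
  then show "par (letter_mat h v (R i j) $ a $ b) = letter_mat h v (R i j) $ a $ b"
    by (simp add: mpar_def vec_eq_iff)
qed

lemma entry_mat_wedge:
  "entry (mat_wedge k l A B) a b x v = (\<Sum>c\<in>UNIV. wedge k l (entry A a c) (entry B c b) x v)"
  by (simp add: entry_def[of "mat_wedge k l A B"] mat_wedge_def)

lemma reps_letter:
  "reps h UNIV (letter_degree L) (entry (letter_form L) a b) (\<lambda>v. letter_mat h v L $ a $ b)"
proof -
  have P: "reps h UNIV 1 (entry (phi s) a b) (\<lambda>v. mlin (\<lambda>j. phi s h (\<lambda>_. v j)) $ a $ b)" for s a b
  proof -
    have "{..<1::nat} = {0}" by auto
    moreover have "phi s h v = phi s h (\<lambda>_. v 0)" for v by (simp add: phi_def)
    ultimately have "entry (phi s) a b h v = gc (lin (\<lambda>j. phi s h (\<lambda>_. v j) $ a $ b)) {..<1}" for v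
      by (simp add: entry_def)
    moreover have "ten 1 (\<lambda>v. lin (\<lambda>j. phi s h (\<lambda>_. v j) $ a $ b))" by (rule ten_lin)
    ultimately show ?thesis unfolding reps_def mlin_def vec_lambda_beta by blast
  qed
  show ?thesis
  proof (cases L)
    case (Phi s)
    then show ?thesis using P by (simp add: letter_mat_def)
  next
    case (R i j)
    let ?S = "\<lambda>v. \<Sum>s=i..<j. mlin (\<lambda>m. phi s h (\<lambda>_. v m))"
    have S: "reps h UNIV 1 (entry (\<Sum>s=i..<j. phi s) a b) (\<lambda>v. ?S v $ a $ b)" for a b
    proof -
      have "entry (\<Sum>s=i..<j. phi s) a b = (\<lambda>x v. \<Sum>s=i..<j. entry (phi s) a b x v)"
        by (simp add: fun_eq_iff entry_def sum_fun_apply)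
      then show ?thesis by (simp only: sum_component) (rule reps_sum[OF P])
    qed
    have "reps h UNIV (1 + 1) (\<lambda>x v. \<Sum>c\<in>UNIV. wedge 1 1 (entry (\<Sum>s=i..<j. phi s) a c) (entry (\<Sum>s=i..<j. phi s) c b) x v)
        (\<lambda>v. \<Sum>c\<in>UNIV. ?S v $ a $ c * ?S v $ c $ b)"
      by (intro reps_sum reps_wedge S)
    moreover have "entry (letter_form L) a b =
        (\<lambda>x v. \<Sum>c\<in>UNIV. wedge 1 1 (entry (\<Sum>s=i..<j. phi s) a c) (entry (\<Sum>s=i..<j. phi s) c b) x v)"
      by (intro ext) (simp only: R letter_form.simps R_form_def entry_mat_wedge)
    moreover have "letter_mat h v L $ a $ b = (\<Sum>c\<in>UNIV. ?S v $ a $ c * ?S v $ c $ b)" for v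
      by (simp add: R letter_mat_def matrix_mult_nth)
    ultimately show ?thesis by (simp add: R numeral_2_eq_2)
  qed
qed

lemma reps_word:
  assumes "length W = p"
  shows "reps h UNIV (length (phis W) + 2 * (p - length (phis W)))
    (wedge_list (map (\<lambda>k. (letter_degree (W ! (k - 1)), entry (letter_form (W ! (k - 1))) (a k) (b k))) [1..<p + 1]))
    (\<lambda>v. prod_list (map2 (\<lambda>k L. letter_mat h v L $ a k $ b k) [1..<p + 1] W))"
proof -
  have "map (\<lambda>k. letter_degree (W ! (k - 1))) [1..<p + 1] = map letter_degree W"
    using assms by (intro nth_equalityI) (auto simp del: upt_Suc)
  moreover have "sum_list (map letter_degree W) = length (phis W) + 2 * (length W - length (phis W))"
  proof (induction W)
    case (Cons L W)
    moreover have "length (phis W) \<le> length W" using length_phis[of W] by simp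
    ultimately show ?case by (cases L) auto
  qed simp
  ultimately have "sum_list (map (\<lambda>k. letter_degree (W ! (k - 1))) [1..<p + 1]) = length (phis W) + 2 * (p - length (phis W))"
    using assms by simp
  moreover have "reps h UNIV (sum_list (map (\<lambda>k. letter_degree (W ! (k - 1))) [1..<p + 1]))
    (wedge_list (map (\<lambda>k. (letter_degree (W ! (k - 1)), entry (letter_form (W ! (k - 1))) (a k) (b k))) [1..<p + 1]))
    (\<lambda>v. prod_list (map (\<lambda>k. letter_mat h v (W ! (k - 1)) $ a k $ b k) [1..<p + 1]))"
    by (rule reps_wedge_list) (rule reps_letter)
  ultimately show ?thesis unfolding map2_nth[OF assms] by (simp only:)
qed

definition fibre_vec :: "nat \<Rightarrow> (nat \<Rightarrow> 'n::finite tuple) \<Rightarrow> nat \<Rightarrow> 'n spt" where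
  "fibre_vec r w i = (if i < r then (simplex_vec (Suc i), 0) else (0, w (i - r)))"

lemma psi_sum_phi:
  assumes "h \<in> SOT {1..r}"
  shows "s \<le> r \<Longrightarrow> psi s h u = (\<Sum>m=1..s. phi m h (\<lambda>_. u))"
proof (induction s)
  case 0
  then show ?case by (simp add: psi_def matrix_diff_distrib)
next
  case (Suc s)
  have "h (Suc s) ** transpose (h (Suc s)) = mat 1"
    by (rule SO_transpose(2)) (use assms Suc.prems in \<open>auto simp: SOT_def\<close>)
  then have "dk h u s ** (h (Suc s) ** transpose (h (Suc s))) ** transpose (hprod h s) = psi s h u"
    by (simp add: psi_def)
  then have "psi (Suc s) h u = psi s h u + hprod h s ** u (Suc s) ** transpose (hprod h (Suc s))"
    by (simp add: psi_def matrix_diff_distrib matrix_transpose_mul matrix_mul_assoc)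
  then show ?case using Suc hprod_inv_eq[OF assms Suc.prems] by (simp add: phi_def del: hprod.simps hprod_inv.simps)
qed

text \<open>The forms \<open>dt_i\<close> see only the first \<open>r\<close> vectors and the forms
  on the group only the others. Interchanging the sums in \<open>\<Sum> dt_i \<psi>_i\<close>
  collects \<open>dtau r s\<close> at \<open>\<phi>_s\<close>, and \<open>curv_pairs\<close> gives
  the squares. The pairs of vertices are shifted by one because the indices of \<open>R\<close>
  start at 1.\<close>

lemma base_curv_fibre:
  fixes h :: "'n::finite tuple"
  assumes h: "h \<in> SOT {1..r}" and t: "(\<Sum>i\<le>r. t i) = 1"
  shows "base_curv r (t, h) (fibre_vec r w) $ a $ b =
    (\<Sum>L\<in>letters r. letter_coeff r t L * letter_mat h (\<lambda>j. if j < r then 0 else w (j - r)) L $ a $ b)"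
proof -
  let ?v = "\<lambda>j. if j < r then 0 else w (j - r)" and ?V = "fibre_vec r w"
  define X where "X m = mlin (\<lambda>j. phi m h (\<lambda>_. ?v j))" for m
  have sV: "snd (?V j) = ?v j" for j by (simp add: fibre_vec_def)
  have Psi: "Psi s (t, h) ?V = (\<Sum>m=1..s. X m)" if "s \<le> r" for s
    unfolding X_def Psi_def snd_conv sV psi_sum_phi[OF h that] by (simp add: mlin_sum)
  have dtau: "(\<Sum>i | i \<in> {..r} \<and> m \<le> i. dtform ?V i) = dtau r m" if "m \<in> {1..r}" for m
  proof -
    have "(\<Sum>i | i \<in> {..r} \<and> m \<le> i. fst (?V j) i) = of_bool (m \<le> Suc j \<and> j < r)" for j
    proof (cases "j < r")
      case True
      have "(\<Sum>i | i \<in> {..r} \<and> m \<le> i. fst (?V j) i) = (\<Sum>i | i \<in> {..r} \<and> m \<le> i. if i = Suc j then 1 else 0)"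
        using that True by (intro sum.cong) (auto simp: fibre_vec_def simplex_vec_def)
      then show ?thesis using True by simp
    qed (simp add: fibre_vec_def)
    then show ?thesis by (simp add: dtform_def dtau_def flip: lin_sum)
  qed
  have "(\<Sum>i\<le>r. smul (dtform ?V i) (Psi i (t, h) ?V)) = (\<Sum>i\<in>{..r}. \<Sum>m | m \<in> {1..r} \<and> m \<le> i. smul (dtform ?V i) (X m))"
  proof (rule sum.cong[OF refl])
    fix i assume "i \<in> {..r}"
    then have "{m. m \<in> {1..r} \<and> m \<le> i} = {1..i}" by auto
    then show "smul (dtform ?V i) (Psi i (t, h) ?V) = (\<Sum>m | m \<in> {1..r} \<and> m \<le> i. smul (dtform ?V i) (X m))"
      using Psi[of i] \<open>i \<in> {..r}\<close> by (simp only: smul_sum atMost_iff)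
  qed
  also have "\<dots> = (\<Sum>m\<in>{1..r}. \<Sum>i | i \<in> {..r} \<and> m \<le> i. smul (dtform ?V i) (X m))"
    by (rule sum.swap_restrict) auto
  also have "\<dots> = (\<Sum>m=1..r. smul (dtau r m) (X m))"
    by (intro sum.cong refl) (simp only: smul_sum(1)[symmetric] dtau)
  finally have 1: "(\<Sum>i\<le>r. smul (dtform ?V i) (Psi i (t, h) ?V)) = (\<Sum>m=1..r. smul (dtau r m) (X m))" .
  have bij: "bij_betw (\<lambda>(i, j). (Suc i, Suc j)) {(i, j). i < j \<and> j \<le> r} (R_pairs r)"
    by (rule bij_betw_byWitness[of _ "\<lambda>(i, j). (i - 1, j - 1)"]) (auto simp: R_pairs_def)
  have D: "Psi i (t, h) ?V - Psi j (t, h) ?V = - (\<Sum>m=Suc i..<Suc j. X m)" if "i < j" "j \<le> r" for i j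
  proof -
    have "(\<Sum>m=1..j. X m) = (\<Sum>m=1..i. X m) + (\<Sum>m=Suc i..j. X m)"
    proof -
      have "{1..j} = {1..i} \<union> {Suc i..j}" using that by auto
      then show ?thesis by (simp add: sum.union_disjoint)
    qed
    then show ?thesis using that Psi[of i] Psi[of j] by (simp add: atLeastLessThanSuc_atLeastAtMost)
  qed
  have 2: "(\<Sum>(i, j)\<in>{(i, j). i < j \<and> j \<le> r}. (t i * t j) *\<^sub>R
      ((Psi i (t, h) ?V - Psi j (t, h) ?V) ** (Psi i (t, h) ?V - Psi j (t, h) ?V))) =
      (\<Sum>(i, j)\<in>R_pairs r. (t (i - 1) * t (j - 1)) *\<^sub>R ((\<Sum>m=i..<j. X m) ** (\<Sum>m=i..<j. X m)))"
    unfolding sum.reindex_bij_betw[OF bij, symmetric]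
  proof (rule sum.cong[OF refl])
    fix x :: "nat \<times> nat" assume x: "x \<in> {(i, j). i < j \<and> j \<le> r}"
    obtain i j where ij: "x = (i, j)" by (cases x)
    have "i < j" "j \<le> r" using x ij by auto
    from D[OF this] show "(case x of (i, j) \<Rightarrow> (t i * t j) *\<^sub>R
        ((Psi i (t, h) ?V - Psi j (t, h) ?V) ** (Psi i (t, h) ?V - Psi j (t, h) ?V))) =
      (case case x of (i, j) \<Rightarrow> (Suc i, Suc j) of (i, j) \<Rightarrow>
        (t (i - 1) * t (j - 1)) *\<^sub>R ((\<Sum>m=i..<j. X m) ** (\<Sum>m=i..<j. X m)))"
      by (simp only: ij prod.case matrix_diff_distrib(3,4) minus_minus diff_Suc_1)
  qed
  have "base_curv r (t, h) ?V = - (\<Sum>m=1..r. smul (dtau r m) (X m)) -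
      (\<Sum>(i, j)\<in>R_pairs r. (t (i - 1) * t (j - 1)) *\<^sub>R ((\<Sum>m=i..<j. X m) ** (\<Sum>m=i..<j. X m)))"
    unfolding base_curv_def fst_conv curv_pairs[OF t] 1 2 ..
  then show ?thesis
    unfolding sum_letters
    by (simp add: letter_coeff_def letter_mat_def X_def[symmetric] smul_def sum_negf case_prod_beta of_real_def)
qed

definition word_set :: "nat \<Rightarrow> nat \<Rightarrow> (nat \<Rightarrow> nat) \<Rightarrow> letter list set" where
  "word_set p r \<sigma> = {W. set W \<subseteq> letters r \<and> length W = p \<and> phis W = map \<sigma> [1..<r + 1]}"

lemma finite_word_set [simp]: "finite (word_set p r \<sigma>)"
  by (rule finite_subset[OF _ finite_lists_length_eq[OF finite_letters, of r p]]) (auto simp: word_set_def)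

text \<open>The group vectors occupy the places \<open>r\<close>, ..., \<open>2p - 1\<close>.
  Relabelling these places from 0 brings back the form on NG(r), whose degree \<open>2p - r\<close>
  comes from \<open>r\<close> odd and \<open>p - r\<close> even letters.\<close>

lemma word_form_shift:
  assumes W: "W \<in> word_set p r \<sigma>"
  shows "gc (prod_list (map2 (\<lambda>k L. letter_mat h (\<lambda>j. if j < r then 0 else w (j - r)) L $ a k $ b k) [1..<p + 1] W)) {r..<2 * p} =
    wedge_list (map (\<lambda>k. (letter_degree (W ! (k - 1)), entry (letter_form (W ! (k - 1))) (a k) (b k))) [1..<p + 1]) h w"
proof -
  have l: "length W = p" "length (phis W) = r" using W by (auto simp: word_set_def)
  have "r \<le> p" using length_phis[of W] l by simp
  let ?F = "\<lambda>v. prod_list (map2 (\<lambda>k L. letter_mat h v L $ a k $ b k) [1..<p + 1] W)"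
  have d: "r + 2 * (p - r) = 2 * p - r" using \<open>r \<le> p\<close> by simp
  have R: "reps h UNIV (2 * p - r) (wedge_list (map (\<lambda>k. (letter_degree (W ! (k - 1)), entry (letter_form (W ! (k - 1))) (a k) (b k))) [1..<p + 1])) ?F"
    using reps_word[OF l(1), of h a b] unfolding l d .
  have im: "(\<lambda>j. j + r) ` {..<2 * p - r} = {r..<2 * p}"
    using \<open>r \<le> p\<close> image_add_atLeastLessThan'[of r 0 "2 * p - r"] by (simp add: lessThan_atLeast0)
  have t: "ten (2 * p - r) ?F" using R by (simp add: reps_def)
  have "gc (?F (\<lambda>j. if j < r then 0 else w (j - r))) ((\<lambda>j. j + r) ` {..<2 * p - r}) = gc (?F w) {..<2 * p - r}"
    by (subst ten_gc_image[OF t]) (auto simp: strict_mono_def)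
  then show ?thesis using R unfolding im by (simp add: reps_def)
qed

definition euler_const :: "nat \<Rightarrow> real" where "euler_const p = 1 / (2 ^ (2 * p) * pi ^ p * fact p)"

text \<open>Each entry of the curvature is a sum over letters, so a product of p entries is a sum
  over words of length p. After the coefficients are moved to the front, the top coefficient factors
  into a part in the simplex directions and a part on the group; the first is nonzero only if the
  odd letters carry a permutation of 1, ..., r.\<close>

lemma pf_base_fibre:
  fixes h :: "'n::finite tuple"
  assumes h: "h \<in> SOT {1..r}" and t: "(\<Sum>i\<le>r. t i) = 1" and r: "r \<le> 2 * p"
  shows "pf_base p e r (t, h) (fibre_vec r w) =
    (\<Sum>\<sigma> | \<sigma> permutes {1..r}. \<Sum>\<tau> | \<tau> permutes {1..2 * p}. \<Sum>W\<in>word_set p r \<sigma>.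
      (of_int (sign \<tau>) * of_int (sign \<sigma>) * ((-1) ^ (p + r * (r - 1) div 2) * euler_const p)) * tweight r t W *
      wedge_list (map (\<lambda>k. (letter_degree (W ! (k - 1)),
        entry (letter_form (W ! (k - 1))) (e (\<tau> (2 * k - 1))) (e (\<tau> (2 * k))))) [1..<p + 1]) h w)"
proof -
  let ?v = "\<lambda>j. if j < r then 0 else w (j - r)"
  let ?y = "\<lambda>\<tau> k L. letter_mat h ?v L $ e (\<tau> (2 * k - 1)) $ e (\<tau> (2 * k))"
  let ?c = "letter_coeff r t" and ?ks = "[1..<p + 1]" and ?LW = "{W. set W \<subseteq> letters r \<and> length W = p}"
  let ?w = "\<lambda>\<tau> W. wedge_list (map (\<lambda>k. (letter_degree (W ! (k - 1)),
        entry (letter_form (W ! (k - 1))) (e (\<tau> (2 * k - 1))) (e (\<tau> (2 * k))))) ?ks) h w"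
  let ?K = "\<lambda>\<tau> \<sigma>. of_int (sign \<tau>) * of_int (sign \<sigma>) * ((-1) ^ (p + r * (r - 1) div 2) * euler_const p)"
  have cpar: "par (?c (Phi s)) = - ?c (Phi s)" "par (?c (R i j)) = ?c (R i j)" for s i j
    by (simp_all add: letter_coeff_def dtau_def flip: of_real_minus of_real_mult)
  have fin: "finite ?LW" by (rule finite_lists_length_eq[OF finite_letters])
  have word: "gc (prod_list (map2 (\<lambda>k L. ?c L * ?y \<tau> k L) ?ks W)) {..<2 * p} =
      (\<Sum>\<sigma> | \<sigma> permutes {1..r}. of_bool (W \<in> word_set p r \<sigma>) *
        (of_int (sign \<sigma>) * (-1) ^ (p + r * (r - 1) div 2) * tweight r t W * ?w \<tau> W))" if W: "W \<in> ?LW" for \<tau> W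
  proof -
    have len: "length ?ks = length W" using W by (simp del: upt_Suc)
    let ?m = "length (phis W)" and ?Y = "prod_list (map2 (?y \<tau>) ?ks W)"
    have sup: "suppin {..<r} (prod_list (map (dtau r) (phis W)))"
      by (intro suppin_prod_list) (auto simp: dtau_def intro!: suppin_lin)
    have sl: "suppin {r..} (mlin (\<lambda>j. phi s h (\<lambda>_. ?v j)) $ a $ b)" for s a b
      unfolding mlin_def by (simp, rule suppin_lin) (simp add: phi_def matrix_diff_distrib)
    have sy: "suppin {r..} (letter_mat h ?v L $ a $ b)" for L a b
    proof (cases L)
      case (R i j)
      then show ?thesis
        by (simp add: letter_mat_def matrix_mult_nth) (intro suppin_sum suppin_mult sl)
    qed (simp add: letter_mat_def sl)
    have sY: "suppin {r..} ?Y" by (rule suppin_prod_list) (auto simp: sy simp del: upt_Suc)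
    have ph: "set (phis W) \<subseteq> {1..r}"
    proof -
      have "Phi ` set (phis W) = set (filter is_Phi W)" unfolding filter_is_Phi by simp
      then have "Phi ` set (phis W) \<subseteq> letters r" using W by auto
      then show ?thesis by (auto simp: letters_def)
    qed
    have "prod_list (map2 (\<lambda>k L. ?c L * ?y \<tau> k L) ?ks W) =
        (-1) ^ (?m * (?m - 1) div 2) *\<^sub>R (prod_list (map ?c W) * ?Y)"
      by (rule word_prod_split[OF cpar letter_mat_par len])
    also have "prod_list (map ?c W) = ((-1) ^ p * tweight r t W) *\<^sub>R prod_list (map (dtau r) (phis W))"
      using prod_letter_coeff[of W r t] W by simp
    finally have eq: "prod_list (map2 (\<lambda>k L. ?c L * ?y \<tau> k L) ?ks W) =
        ((-1) ^ (?m * (?m - 1) div 2) * ((-1) ^ p * tweight r t W)) *\<^sub>R (prod_list (map (dtau r) (phis W)) * ?Y)"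
      by (simp only: scaleR_scaleR mult_scaleR_left)
    have "gc (prod_list (map2 (\<lambda>k L. ?c L * ?y \<tau> k L) ?ks W)) {..<2 * p} =
        (-1) ^ (?m * (?m - 1) div 2) * ((-1) ^ p * tweight r t W * (gc (prod_list (map (dtau r) (phis W))) {..<r} * gc ?Y {r..<2 * p}))"
      unfolding eq by (simp only: gc_simps gc_mult_split[OF sup sY r] mult.assoc)
    also have "\<dots> = (\<Sum>\<sigma> | \<sigma> permutes {1..r}. of_bool (phis W = map \<sigma> [1..<r + 1]) *
        (of_int (sign \<sigma>) * ((-1) ^ (?m * (?m - 1) div 2) * ((-1) ^ p * tweight r t W * gc ?Y {r..<2 * p}))))"
      unfolding gc_prod_dtau[OF ph] by (simp add: sum_distrib_left sum_distrib_right mult_ac del: upt_Suc)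
    also have "\<dots> = (\<Sum>\<sigma> | \<sigma> permutes {1..r}. of_bool (W \<in> word_set p r \<sigma>) *
        (of_int (sign \<sigma>) * (-1) ^ (p + r * (r - 1) div 2) * tweight r t W * ?w \<tau> W))"
    proof (rule sum.cong[OF refl])
      fix \<sigma>
      show "of_bool (phis W = map \<sigma> [1..<r + 1]) *
        (of_int (sign \<sigma>) * ((-1) ^ (?m * (?m - 1) div 2) * ((-1) ^ p * tweight r t W * gc ?Y {r..<2 * p}))) =
        of_bool (W \<in> word_set p r \<sigma>) *
        (of_int (sign \<sigma>) * (-1) ^ (p + r * (r - 1) div 2) * tweight r t W * ?w \<tau> W)"
      proof (cases "phis W = map \<sigma> [1..<r + 1]")
        case True
        then have ws: "W \<in> word_set p r \<sigma>" and m: "?m = r" using W by (auto simp: word_set_def simp del: upt_Suc)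
        have g: "gc ?Y {r..<2 * p} = ?w \<tau> W"
          by (rule word_form_shift[OF ws, of h w "\<lambda>k. e (\<tau> (2 * k - 1))" "\<lambda>k. e (\<tau> (2 * k))"])
        show ?thesis unfolding g m using True ws by (simp add: power_add mult_ac del: upt_Suc)
      next
        case False
        then have "W \<notin> word_set p r \<sigma>" by (simp add: word_set_def del: upt_Suc)
        then show ?thesis using False by (simp del: upt_Suc)
      qed
    qed
    finally show ?thesis .
  qed
  have "pf_base p e r (t, h) (fibre_vec r w) = euler_const p * (\<Sum>\<tau> | \<tau> permutes {1..2 * p}. of_int (sign \<tau>) *
      gc (prod_list (map (\<lambda>k. \<Sum>L\<in>letters r. ?c L * ?y \<tau> k L) ?ks)) {..<2 * p})"
    unfolding pf_base_def pfaffian_def base_curv_fibre[OF h t] by (simp add: euler_const_def del: upt_Suc)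
  also have "\<dots> = euler_const p * (\<Sum>\<tau> | \<tau> permutes {1..2 * p}. of_int (sign \<tau>) * (\<Sum>W\<in>?LW.
      \<Sum>\<sigma> | \<sigma> permutes {1..r}. of_bool (W \<in> word_set p r \<sigma>) *
        (of_int (sign \<sigma>) * (-1) ^ (p + r * (r - 1) div 2) * tweight r t W * ?w \<tau> W)))"
  proof -
    have "gc (prod_list (map (\<lambda>k. \<Sum>L\<in>letters r. ?c L * ?y \<tau> k L) ?ks)) {..<2 * p} = (\<Sum>W\<in>?LW.
      \<Sum>\<sigma> | \<sigma> permutes {1..r}. of_bool (W \<in> word_set p r \<sigma>) *
        (of_int (sign \<sigma>) * (-1) ^ (p + r * (r - 1) div 2) * tweight r t W * ?w \<tau> W))" for \<tau>
      unfolding prod_list_sum_lists[OF finite_letters] gc_sum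
      by (rule sum.cong) (use word in \<open>simp_all del: upt_Suc\<close>)
    then show ?thesis by presburger
  qed
  also have "\<dots> = (\<Sum>\<tau> | \<tau> permutes {1..2 * p}. \<Sum>W\<in>?LW. \<Sum>\<sigma> | \<sigma> permutes {1..r}.
      of_bool (W \<in> word_set p r \<sigma>) * (?K \<tau> \<sigma> * tweight r t W * ?w \<tau> W))"
    by (simp add: sum_distrib_left mult_ac del: upt_Suc)
  also have "\<dots> = (\<Sum>\<tau> | \<tau> permutes {1..2 * p}. \<Sum>\<sigma> | \<sigma> permutes {1..r}. \<Sum>W\<in>?LW.
      of_bool (W \<in> word_set p r \<sigma>) * (?K \<tau> \<sigma> * tweight r t W * ?w \<tau> W))"
    by (intro sum.cong refl sum.swap)
  also have "\<dots> = (\<Sum>\<sigma> | \<sigma> permutes {1..r}. \<Sum>\<tau> | \<tau> permutes {1..2 * p}. \<Sum>W\<in>?LW.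
      of_bool (W \<in> word_set p r \<sigma>) * (?K \<tau> \<sigma> * tweight r t W * ?w \<tau> W))"
    by (rule sum.swap)
  also have "\<dots> = (\<Sum>\<sigma> | \<sigma> permutes {1..r}. \<Sum>\<tau> | \<tau> permutes {1..2 * p}. \<Sum>W\<in>word_set p r \<sigma>.
      ?K \<tau> \<sigma> * tweight r t W * ?w \<tau> W)"
    by (intro sum.cong refl sum.mono_neutral_cong_right fin) (auto simp: word_set_def)
  finally show ?thesis .
qed

lemma simplex_integral_sum:
  assumes "finite I" "\<And>i. i \<in> I \<Longrightarrow> simplex_integrable r (f i)"
  shows "simplex_integrable r (\<lambda>t. \<Sum>i\<in>I. f i t) \<and>
    simplex_integral r (\<lambda>t. \<Sum>i\<in>I. f i t) = (\<Sum>i\<in>I. simplex_integral r (f i))"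
  using assms by (induction I) (simp_all add: simplex_integral_add)

lemma tweight_integrable: "simplex_integrable r (\<lambda>t. tweight r t W)"
proof -
  \<comment> \<open>The real argument \<open>h\<close> is a dummy that \<open>sep\<close> asks
    for.\<close>
  have t: "sep r (\<lambda>t (h::real). t i)" if "i \<le> r" for i
    using sep.base[OF polyfun.const, of r 1 "\<lambda>j. if j = i then 1 else 0"] by (simp add: bary_mono_single[OF that])
  have one: "sep r (\<lambda>t (h::real). 1)"
    using sep.base[OF polyfun.const, of r 1 "\<lambda>j. 0"] by (simp add: bary_mono_one)
  have pw: "sep r (\<lambda>t (h::real). f t ^ n)" if "sep r (\<lambda>t (h::real). f t)" for f n
    by (induction n) (auto intro: one sep_mult that)
  have "sep r (\<lambda>t (h::real). \<Prod>x\<in>P. (t (fst x - 1) * t (snd x - 1)) ^ count_list W (R (fst x) (snd x)))"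
    if "finite P" "P \<subseteq> R_pairs r" for P
    using that
  proof (induction P)
    case (insert x P)
    then have "fst x - 1 \<le> r" "snd x - 1 \<le> r" by (auto simp: R_pairs_def)
    then show ?case using insert by (auto intro!: sep_mult pw t)
  qed (simp add: one)
  from sep_integrable[OF this[OF finite_R_pairs subset_refl]] show ?thesis
    by (simp add: tweight_def case_prod_beta)
qed

lemma euler_rep_expand:
  fixes h :: "'n::finite tuple"
  assumes h: "h \<in> SOT {1..r}" and r: "r \<le> 2 * p"
  shows "euler_rep p e r h w =
    (\<Sum>\<sigma> | \<sigma> permutes {1..r}. \<Sum>\<tau> | \<tau> permutes {1..2 * p}. \<Sum>W\<in>word_set p r \<sigma>.
      (of_int (sign \<tau>) * of_int (sign \<sigma>) * ((-1) ^ (p + r * (r - 1) div 2) * euler_const p)) *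
      simplex_integral r (\<lambda>t. tweight r t W) *
      wedge_list (map (\<lambda>k. (letter_degree (W ! (k - 1)),
        entry (letter_form (W ! (k - 1))) (e (\<tau> (2 * k - 1))) (e (\<tau> (2 * k))))) [1..<p + 1]) h w)"
proof -
  let ?w = "\<lambda>\<tau> W. wedge_list (map (\<lambda>k. (letter_degree (W ! (k - 1)),
        entry (letter_form (W ! (k - 1))) (e (\<tau> (2 * k - 1))) (e (\<tau> (2 * k))))) [1..<p + 1]) h w"
  let ?K = "\<lambda>\<tau> \<sigma>. of_int (sign \<tau>) * of_int (sign \<sigma>) * ((-1) ^ (p + r * (r - 1) div 2) * euler_const p)"
  have fv: "(\<lambda>i. if i < r then (simplex_vec (Suc i), 0) else (0, w (i - r))) = fibre_vec r w"
    by (simp add: fun_eq_iff fibre_vec_def)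
  have i0: "simplex_integrable r (\<lambda>t. ?K \<tau> \<sigma> * tweight r t W * ?w \<tau> W) \<and>
      simplex_integral r (\<lambda>t. ?K \<tau> \<sigma> * tweight r t W * ?w \<tau> W) =
      ?K \<tau> \<sigma> * simplex_integral r (\<lambda>t. tweight r t W) * ?w \<tau> W" for \<tau> \<sigma> W
    using simplex_integrable_scale[OF tweight_integrable, of r "?K \<tau> \<sigma> * ?w \<tau> W" W]
      simplex_integral_scale[of r "?K \<tau> \<sigma> * ?w \<tau> W" "\<lambda>t. tweight r t W"]
    by (simp only: mult.assoc mult.commute[of "?w \<tau> W"])
  have "euler_rep p e r h w = simplex_integral r (\<lambda>t. \<Sum>\<sigma> | \<sigma> permutes {1..r}. \<Sum>\<tau> | \<tau> permutes {1..2 * p}.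
      \<Sum>W\<in>word_set p r \<sigma>. ?K \<tau> \<sigma> * tweight r t W * ?w \<tau> W)"
    unfolding euler_rep_def fibre_integral_def fv
    by (rule simplex_integral_cong) (rule pf_base_fibre[OF h _ r], simp add: standard_simplex_def)
  also have "\<dots> = (\<Sum>\<sigma> | \<sigma> permutes {1..r}. \<Sum>\<tau> | \<tau> permutes {1..2 * p}. \<Sum>W\<in>word_set p r \<sigma>.
      ?K \<tau> \<sigma> * simplex_integral r (\<lambda>t. tweight r t W) * ?w \<tau> W)"
  proof -
    have 1: "simplex_integrable r (\<lambda>t. \<Sum>W\<in>word_set p r \<sigma>. ?K \<tau> \<sigma> * tweight r t W * ?w \<tau> W) \<and>
      simplex_integral r (\<lambda>t. \<Sum>W\<in>word_set p r \<sigma>. ?K \<tau> \<sigma> * tweight r t W * ?w \<tau> W) =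
      (\<Sum>W\<in>word_set p r \<sigma>. simplex_integral r (\<lambda>t. ?K \<tau> \<sigma> * tweight r t W * ?w \<tau> W))" for \<sigma> \<tau>
      by (rule simplex_integral_sum) (simp, use i0 in blast)
    have 2: "simplex_integrable r (\<lambda>t. \<Sum>\<tau> | \<tau> permutes {1..2 * p}. \<Sum>W\<in>word_set p r \<sigma>. ?K \<tau> \<sigma> * tweight r t W * ?w \<tau> W) \<and>
      simplex_integral r (\<lambda>t. \<Sum>\<tau> | \<tau> permutes {1..2 * p}. \<Sum>W\<in>word_set p r \<sigma>. ?K \<tau> \<sigma> * tweight r t W * ?w \<tau> W) =
      (\<Sum>\<tau> | \<tau> permutes {1..2 * p}. simplex_integral r (\<lambda>t. \<Sum>W\<in>word_set p r \<sigma>. ?K \<tau> \<sigma> * tweight r t W * ?w \<tau> W))" for \<sigma>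
      by (rule simplex_integral_sum) (simp add: finite_permutations, use 1 in blast)
    have 3: "simplex_integral r (\<lambda>t. \<Sum>\<sigma> | \<sigma> permutes {1..r}. \<Sum>\<tau> | \<tau> permutes {1..2 * p}. \<Sum>W\<in>word_set p r \<sigma>. ?K \<tau> \<sigma> * tweight r t W * ?w \<tau> W) =
      (\<Sum>\<sigma> | \<sigma> permutes {1..r}. simplex_integral r (\<lambda>t. \<Sum>\<tau> | \<tau> permutes {1..2 * p}. \<Sum>W\<in>word_set p r \<sigma>. ?K \<tau> \<sigma> * tweight r t W * ?w \<tau> W))"
      by (rule conjunct2[OF simplex_integral_sum]) (simp add: finite_permutations, use 2 in blast)
    show ?thesis unfolding 3 conjunct2[OF 2] conjunct2[OF 1] conjunct2[OF i0] ..
  qed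
  finally show ?thesis .
qed

text \<open>Filtering by \<open>is_Phi\<close> recovers the two lists from a shuffle, and conversely
  every list is a shuffle of its two filtered parts. Words of length \<open>p\<close> with
  \<open>p - q\<close> odd letters have exactly \<open>q\<close> even ones.\<close>

lemma words_eq:
  assumes s: "\<sigma> permutes {1..p - q}" and q: "q \<le> p"
  shows "words p q \<sigma> = word_set p (p - q) \<sigma>"
  unfolding word_set_def
proof (rule subset_antisym; rule subsetI)
  have RI: "R_indices p q = R_pairs (p - q)" by (simp add: R_indices_def R_pairs_def)
  let ?xs = "map (\<lambda>s. Phi (\<sigma> s)) [1..<p - q + 1]"
  fix W
  {
    assume "W \<in> words p q \<sigma>"
    then obtain Rs where Rs: "length Rs = q" "set Rs \<subseteq> (\<lambda>(i, j). R i j) ` R_pairs (p - q)" and W: "W \<in> shuffles ?xs Rs"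
      unfolding words_def RI by blast
    have "filter is_Phi W \<in> shuffles (filter is_Phi ?xs) (filter is_Phi Rs)"
      unfolding filter_shuffles[symmetric] using W by (rule imageI)
    moreover have "filter is_Phi ?xs = ?xs" by (rule filter_True) auto
    moreover have "filter is_Phi Rs = []" by (rule filter_False) (use Rs in auto)
    ultimately have "map Phi (phis W) = map Phi (map \<sigma> [1..<p - q + 1])" unfolding filter_is_Phi by (simp del: upt_Suc)
    then have "phis W = map \<sigma> [1..<p - q + 1]" by (simp only: inj_map_eq_map[OF injI[of Phi, OF letter.inject(1)[THEN iffD1]]])
    moreover have "length W = p" using length_shuffles[OF W] Rs q by (simp del: upt_Suc)
    moreover have "\<sigma> s \<in> {1..p - q}" if "s \<in> {1..p - q}" for s
      using permutes_in_image[OF s] that by blast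
    then have "set W \<subseteq> letters (p - q)"
      using set_shuffles[OF W] Rs(2) unfolding letters_def by (auto simp del: upt_Suc)
    ultimately show "W \<in> {W. set W \<subseteq> letters (p - q) \<and> length W = p \<and> phis W = map \<sigma> [1..<p - q + 1]}" by blast
  next
    assume "W \<in> {W. set W \<subseteq> letters (p - q) \<and> length W = p \<and> phis W = map \<sigma> [1..<p - q + 1]}"
    then have W: "set W \<subseteq> letters (p - q)" "length W = p" "phis W = map \<sigma> [1..<p - q + 1]" by auto
    let ?Rs = "filter (\<lambda>L. \<not> is_Phi L) W"
    have xs: "filter is_Phi W = ?xs" unfolding filter_is_Phi W(3) by (simp del: upt_Suc)
    have "W \<in> shuffles ?xs ?Rs" unfolding xs[symmetric] by (rule partition_in_shuffles)
    moreover have "length ?Rs = q" using length_phis[of W] W q by (simp del: upt_Suc)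
    moreover have "set ?Rs \<subseteq> (\<lambda>(i, j). R i j) ` R_pairs (p - q)" using W(1) by (auto simp: letters_def)
    ultimately show "W \<in> words p q \<sigma>" unfolding words_def RI by blast
  }
qed

lemma mu_eq_euler_rep:
  fixes h :: "'n::finite tuple"
  assumes "q < p" "h \<in> SOT {1..p - q}"
  shows "mu p e q h w = euler_rep p e (p - q) h w"
proof -
  have T: "T_coeff p q \<tau> \<sigma> W = (of_int (sign \<tau>) * of_int (sign \<sigma>) * ((-1) ^ (p + (p - q) * (p - q - 1) div 2) * euler_const p)) *
      simplex_integral (p - q) (\<lambda>t. tweight (p - q) t W)" for \<tau> \<sigma> W
    by (simp add: T_coeff_def euler_const_def tweight_def R_indices_def R_pairs_def)
  have "mu p e q h w = (\<Sum>\<sigma> | \<sigma> permutes {1..p - q}. \<Sum>\<tau> | \<tau> permutes {1..2 * p}. \<Sum>W\<in>words p q \<sigma>. T_coeff p q \<tau> \<sigma> W *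
      wedge_list (map (\<lambda>k. (letter_degree (W ! (k - 1)),
        entry (letter_form (W ! (k - 1))) (e (\<tau> (2 * k - 1))) (e (\<tau> (2 * k))))) [1..<p + 1]) h w)"
    unfolding mu_def sum_fun_apply scaleR_fun_apply real_scaleR_def ..
  also have "\<dots> = euler_rep p e (p - q) h w"
    unfolding euler_rep_expand[OF assms(2) trans_le_add1[OF diff_le_self, of p q p, folded mult_2]] T
    by (intro sum.cong refl) (use assms(1) in \<open>auto simp: words_eq\<close>)
  finally show ?thesis .
qed

text \<open>There are no words: for \<open>r > p\<close> a word of length \<open>p\<close> is too
  short for \<open>r\<close> odd letters, and for \<open>r = 0\<close> there are no letters at
  all.\<close>

lemma euler_rep_zero:
  fixes h :: "'n::finite tuple"
  assumes "h \<in> SOT {1..r}" "r \<le> 2 * p" "p \<ge> 1" "r = 0 \<or> p < r"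
  shows "euler_rep p e r h w = 0"
proof -
  have "word_set p r \<sigma> = {}" for \<sigma>
  proof (rule ccontr)
    assume "word_set p r \<sigma> \<noteq> {}"
    then obtain W where W: "set W \<subseteq> letters r" "length W = p" "phis W = map \<sigma> [1..<r + 1]" by (auto simp: word_set_def)
    have "length (phis W) = r" using W(3) by (simp del: upt_Suc)
    then have "r = 0" using length_phis[of W] W(2) assms(4) by auto
    moreover have "letters 0 = {}" by (auto simp: letters_def R_pairs_def)
    ultimately have "W = []" using W(1) by simp
    then show False using W(2) assms(3) by simp
  qed
  then show ?thesis unfolding euler_rep_expand[OF assms(1,2)] by simp
qed

section \<open>Faces and the cocycle condition\<close>

lemma simplex_support: "t \<in> standard_simplex r \<Longrightarrow> i > r \<Longrightarrow> t i = 0"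
  by (simp add: standard_simplex_def)

lemma polyfun_simplex_integral:
  fixes F :: "(nat \<Rightarrow> real) \<times> 'b::{real_vector,t2_space} \<Rightarrow> real"
  assumes "polyfun F"
  shows "simplex_integrable r (\<lambda>t. F (t, h))" "polyfun (\<lambda>h. simplex_integral r (\<lambda>t. F (t, h)))"
    "dir_deriv (\<lambda>h. simplex_integral r (\<lambda>t. F (t, h))) w h = simplex_integral r (\<lambda>t. dir_deriv F (0, w) (t, h))"
proof -
  obtain f where f: "sep r f" "\<And>t h. \<forall>i>r. t i = 0 \<Longrightarrow> F (t, h) = f t h"
    using sep_of_polyfun[OF assms] by blast
  have Ff: "F (simplex_chart r u, h) = f (simplex_chart r u) h" for u h
    by (rule f(2)) (simp add: simplex_chart_sums)
  have I: "simplex_integral r (\<lambda>t. F (t, h)) = simplex_integral r (\<lambda>t. f t h)" for h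
    by (rule simplex_integral_cong, rule f(2)) (simp add: simplex_support)
  show "simplex_integrable r (\<lambda>t. F (t, h))"
    using sep_integrable[OF f(1), of h] by (simp add: simplex_integrable_def Ff)
  show "polyfun (\<lambda>h. simplex_integral r (\<lambda>t. F (t, h)))"
    unfolding I by (rule sep_integral_poly[OF f(1)])
  obtain f' where f': "\<And>t h. ((\<lambda>s. f t (h + s *\<^sub>R w)) has_field_derivative f' t h) (at 0)"
    "\<And>h. ((\<lambda>s. simplex_integral r (\<lambda>t. f t (h + s *\<^sub>R w))) has_field_derivative simplex_integral r (\<lambda>t. f' t h)) (at 0)"
    using sep_deriv[OF f(1)] by blast
  have "dir_deriv (\<lambda>h. simplex_integral r (\<lambda>t. F (t, h))) w h = simplex_integral r (\<lambda>t. f' t h)"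
    unfolding dir_deriv_def I by (rule DERIV_imp_deriv[OF f'(2)])
  also have "\<dots> = simplex_integral r (\<lambda>t. dir_deriv F (0, w) (t, h))"
  proof (rule simplex_integral_cong)
    fix t assume "t \<in> standard_simplex r"
    then have "F (t, y) = f t y" for y by (intro f(2)) (simp add: simplex_support)
    then show "f' t h = dir_deriv F (0, w) (t, h)"
      using DERIV_imp_deriv[OF f'(1), of t h] by (simp add: dir_deriv_def)
  qed
  finally show "dir_deriv (\<lambda>h. simplex_integral r (\<lambda>t. F (t, h))) w h = simplex_integral r (\<lambda>t. dir_deriv F (0, w) (t, h))" .
qed

lemma polyfun_stokes:
  fixes F :: "(nat \<Rightarrow> real) \<times> 'b::{real_vector,t2_space} \<Rightarrow> real"
  assumes F: "polyfun F" and s: "s \<in> {1..Suc r}"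
  shows "simplex_integral (Suc r) (\<lambda>t. dir_deriv F (simplex_vec s, 0) (t, h)) =
    simplex_integral r (\<lambda>t. F (coface 0 t, h)) - simplex_integral r (\<lambda>t. F (coface s t, h))"
    "i \<le> Suc r \<Longrightarrow> simplex_integrable r (\<lambda>t. F (coface i t, h))"
proof -
  obtain f where f: "sep (Suc r) f" "\<And>t h. \<forall>i>Suc r. t i = 0 \<Longrightarrow> F (t, h) = f t h"
    using sep_of_polyfun[OF F] by blast
  obtain f' where f': "\<And>t h. ((\<lambda>x. f (t + x *\<^sub>R simplex_vec s) h) has_field_derivative f' t h) (at 0)"
    "\<And>h i. i \<le> Suc r \<Longrightarrow> simplex_integrable r (\<lambda>t. f (coface i t) h)"
    "\<And>h. simplex_integral (Suc r) (\<lambda>t. f' t h) =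
      simplex_integral r (\<lambda>t. f (coface 0 t) h) - simplex_integral r (\<lambda>t. f (coface s t) h)"
    using sep_stokes[OF s f(1)] by blast
  have cf: "F (coface i t, h) = f (coface i t) h" if "\<forall>k>r. t k = 0" "i \<le> Suc r" for i t
    by (rule f(2)) (use that in \<open>auto simp: coface_def\<close>)
  have "simplex_integral (Suc r) (\<lambda>t. dir_deriv F (simplex_vec s, 0) (t, h)) = simplex_integral (Suc r) (\<lambda>t. f' t h)"
  proof (rule simplex_integral_cong)
    fix t assume t: "t \<in> standard_simplex (Suc r)"
    have "F (t + x *\<^sub>R simplex_vec s, h) = f (t + x *\<^sub>R simplex_vec s) h" for x
      by (rule f(2)) (use t s in \<open>auto simp: simplex_support simplex_vec_def\<close>)
    then show "dir_deriv F (simplex_vec s, 0) (t, h) = f' t h"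
      using DERIV_imp_deriv[OF f'(1), of t h] by (simp add: dir_deriv_def)
  qed
  also have "\<dots> = simplex_integral r (\<lambda>t. f (coface 0 t) h) - simplex_integral r (\<lambda>t. f (coface s t) h)" by (rule f'(3))
  finally have eq: "simplex_integral (Suc r) (\<lambda>t. dir_deriv F (simplex_vec s, 0) (t, h)) =
    simplex_integral r (\<lambda>t. f (coface 0 t) h) - simplex_integral r (\<lambda>t. f (coface s t) h)" .
  have I: "simplex_integral r (\<lambda>t. f (coface i t) h) = simplex_integral r (\<lambda>t. F (coface i t, h))" if "i \<le> Suc r" for i
    by (rule simplex_integral_cong, rule cf[symmetric]) (use that in \<open>auto simp: simplex_support\<close>)
  show "simplex_integral (Suc r) (\<lambda>t. dir_deriv F (simplex_vec s, 0) (t, h)) =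
    simplex_integral r (\<lambda>t. F (coface 0 t, h)) - simplex_integral r (\<lambda>t. F (coface s t, h))"
    unfolding eq using I[of 0] I[of s] s by simp
  show "simplex_integrable r (\<lambda>t. F (coface i t, h))" if "i \<le> Suc r"
    using f'(2)[OF that, of h] cf[OF _ that] by (simp add: simplex_integrable_def simplex_chart_sums)
qed

section \<open>The fibre integral as a form with polynomial coefficients\<close>

lemma polyfun_pf_base: "polyfun (\<lambda>x. pf_base p e r x v)"
  unfolding pf_base_def by (rule polyfun_gc_pform[OF pform_pf_base])

lemma pf_base_alternating: "alternating (2 * p) (pf_base p e r x)"
  unfolding pf_base_def by (rule pform_alternating[OF pform_pf_base])

lemma euler_rep_eq: "euler_rep p e r h w = simplex_integral r (\<lambda>t. pf_base p e r (t, h) (fibre_vec r w))"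
  by (simp add: euler_rep_def fibre_integral_def fibre_vec_def[abs_def])

lemma polyfun_euler_rep: "polyfun (\<lambda>h. euler_rep p e r h w)"
  unfolding euler_rep_eq by (rule polyfun_simplex_integral(2)[OF polyfun_pf_base])

lemma fibre_vec_upd: "fibre_vec r (w(i := u)) = (fibre_vec r w)(i + r := (0, u))"
  by (auto simp: fibre_vec_def fun_eq_iff)

lemma euler_rep_alternating:
  assumes "r \<le> 2 * p"
  shows "alternating (2 * p - r) (euler_rep p e r h)"
  unfolding alternating_def
proof (intro conjI allI impI)
  fix v w :: "nat \<Rightarrow> 'a tuple" assume vw: "\<forall>i<2 * p - r. v i = w i"
  have "pf_base p e r (t, h) (fibre_vec r v) = pf_base p e r (t, h) (fibre_vec r w)" for t
    by (rule pf_base_cong) (use vw in \<open>auto simp: fibre_vec_def\<close>)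
  then show "euler_rep p e r h v = euler_rep p e r h w" by (simp add: euler_rep_eq)
next
  fix v :: "nat \<Rightarrow> 'a tuple" and i assume i: "i < 2 * p - r"
  have lin: "linear (\<lambda>z. pf_base p e r (t, h) ((fibre_vec r v)(i + r := z)))" for t
    using pf_base_alternating[of p e r "(t, h)"] i unfolding alternating_def by auto
  have z: "(0, a + b) = (0, a) + ((0, b) :: 'a spt)" "(0, c *\<^sub>R a) = c *\<^sub>R ((0, a) :: 'a spt)" for a b and c :: real
    by simp_all
  note int = polyfun_simplex_integral(1)[OF polyfun_pf_base]
  show "linear (\<lambda>u. euler_rep p e r h (v(i := u)))"
    unfolding euler_rep_eq fibre_vec_upd
  proof (rule linearI, goal_cases)
    case (1 a b)
    show ?case unfolding z(1) linear_add[OF lin] by (rule conjunct2[OF simplex_integral_add[OF int int]])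
  next
    case (2 c a)
    show ?case unfolding z(2) linear_scale[OF lin] by (simp add: simplex_integral_scale)
  qed
next
  fix v :: "nat \<Rightarrow> 'a tuple" and i j
  assume i: "i < 2 * p - r" "j < 2 * p - r" "i \<noteq> j \<and> v i = v j"
  have "pf_base p e r (t, h) (fibre_vec r v) = 0" for t
  proof -
    have "i + r < 2 * p" "j + r < 2 * p" "i + r \<noteq> j + r" "fibre_vec r v (i + r) = fibre_vec r v (j + r)"
      using i by (auto simp: fibre_vec_def)
    then show ?thesis using pf_base_alternating[of p e r "(t, h)"] unfolding alternating_def by blast
  qed
  then show "euler_rep p e r h v = 0" by (simp add: euler_rep_eq)
qed

lemma euler_rep_extends:
  fixes c :: "'n::finite tuple form"
  assumes "r \<le> 2 * p" "\<And>h w. h \<in> SOT {1..r} \<Longrightarrow> (\<And>i. i < 2 * p - r \<Longrightarrow> w i \<in> so_tangent {1..r} h) \<Longrightarrow> c h w = euler_rep p e r h w"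
  shows "extends_on (SOT {1..r}) (2 * p - r) c UNIV (euler_rep p e r)"
  unfolding extends_on_def
proof (intro conjI ballI allI impI)
  fix y :: "'n tuple" and v assume y: "y \<in> SOT {1..r} \<inter> UNIV" "\<forall>i<2 * p - r. v i \<in> tangent_space (SOT {1..r}) y"
  then have "c y v = euler_rep p e r y v" using assms(2)[of y v] tangent_space_SOT[of y "{1..r}"] by auto
  then show "euler_rep p e r y v = c y v" ..
qed (auto intro: euler_rep_alternating[OF assms(1)] polyfun_smooth polyfun_euler_rep)

section \<open>Face operators and their differentials\<close>

definition dface :: "nat \<Rightarrow> nat \<Rightarrow> 'n::finite tuple \<Rightarrow> 'n tuple \<Rightarrow> 'n tuple" where
  "dface q i h z = (\<lambda>j. if j \<in> {1..<q} then
     (if j < i then z j else if j = i then z j ** h (Suc j) + h j ** z (Suc j) else z (Suc j)) else 0)"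

lemma pushforward_face: "pushforward (face q i) h z = dface q i h z"
  unfolding pushforward_def
proof (rule tendsto_Lim)
  show "((\<lambda>s. (face q i (h + s *\<^sub>R z) - face q i h) /\<^sub>R s) \<longlongrightarrow> dface q i h z) (at 0)"
    unfolding tendsto_fun_iff
  proof
    fix j
    have P: "((\<lambda>s. z j ** h (Suc j) + h j ** z (Suc j) + s *\<^sub>R (z j ** z (Suc j))) \<longlongrightarrow>
        z j ** h (Suc j) + h j ** z (Suc j) + 0 *\<^sub>R (z j ** z (Suc j))) (at 0)"
      by (intro tendsto_intros)
    define D where "D s = (if j \<in> {1..<q} then (if j < i then z j else if j = i then
        z j ** h (Suc j) + h j ** z (Suc j) + s *\<^sub>R (z j ** z (Suc j)) else z (Suc j)) else 0)" for s :: real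
    have "(D \<longlongrightarrow> dface q i h z j) (at 0)"
      using P by (auto simp: D_def[abs_def] dface_def)
    moreover have "\<forall>\<^sub>F s in at 0. D s = ((face q i (h + s *\<^sub>R z) - face q i h) /\<^sub>R s) j"
      using eventually_neq_at_within[of "0::real" 0 UNIV]
    proof eventually_elim
      case (elim s)
      have "((h j + s *\<^sub>R z j) ** (h (Suc j) + s *\<^sub>R z (Suc j)) - h j ** h (Suc j)) =
          s *\<^sub>R (z j ** h (Suc j) + h j ** z (Suc j) + s *\<^sub>R (z j ** z (Suc j)))"
        by (simp add: matrix_diff_distrib matrix_scaleR_mult scaleR_add_right)
      then show ?case using elim by (auto simp: D_def face_def)
    qed
    ultimately show "((\<lambda>s. ((face q i (h + s *\<^sub>R z) - face q i h) /\<^sub>R s) j) \<longlongrightarrow> dface q i h z j) (at 0)"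
      using Lim_transform_eventually by fast
  qed
qed simp

lemma face_SOT:
  assumes "h \<in> SOT {1..Suc r}" shows "face (Suc r) i h \<in> SOT {1..r}"
proof -
  have "h j \<in> SO" if "1 \<le> j" "j \<le> Suc r" for j using assms that by (auto simp: SOT_def)
  then show ?thesis by (auto simp: SOT_def face_def intro!: SO_mult)
qed

lemma dface_tangent:
  assumes h: "h \<in> SOT {1..Suc r}" and z: "z \<in> so_tangent {1..Suc r} h"
  shows "dface (Suc r) i h z \<in> so_tangent {1..r} (face (Suc r) i h)"
proof -
  have t: "transpose (h j) ** z j + transpose (z j) ** h j = 0" if "1 \<le> j" "j \<le> Suc r" for j
    using z that by (auto simp: so_tangent_def split: if_splits)
  have m: "transpose (h j ** h (Suc j)) ** (z j ** h (Suc j) + h j ** z (Suc j)) +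
      transpose (z j ** h (Suc j) + h j ** z (Suc j)) ** (h j ** h (Suc j)) = 0" if j: "1 \<le> j" "j \<le> r" for j
  proof -
    let ?a = "h j" and ?b = "h (Suc j)" and ?x = "z j" and ?y = "z (Suc j)"
    have a: "transpose ?a ** ?a = mat 1" using h j by (intro SO_transpose) (auto simp: SOT_def)
    have "transpose (?a ** ?b) ** (?x ** ?b + ?a ** ?y) + transpose (?x ** ?b + ?a ** ?y) ** (?a ** ?b) =
        transpose ?b ** (transpose ?a ** ?x + transpose ?x ** ?a) ** ?b +
        (transpose ?b ** (transpose ?a ** ?a) ** ?y + transpose ?y ** (transpose ?a ** ?a) ** ?b)"
      by (simp add: matrix_transpose_mul transpose_linear matrix_diff_distrib matrix_mul_assoc algebra_simps)
    then show ?thesis using t[of j] t[of "Suc j"] j by (simp add: a matrix_diff_distrib)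
  qed
  have "if j \<in> {1..r} then transpose (face (Suc r) i h j) ** dface (Suc r) i h z j +
      transpose (dface (Suc r) i h z j) ** face (Suc r) i h j = 0 else dface (Suc r) i h z j = 0" for j
  proof (cases "j \<in> {1..r}")
    case True
    then have j: "1 \<le> j" "j \<le> r" "j \<in> {1..<Suc r}" by auto
    consider "j < i" | "j = i" | "i < j" by linarith
    then show ?thesis
    proof cases
      case 1
      then show ?thesis using j t[of j] by (simp add: face_def dface_def)
    next
      case 2
      then show ?thesis using j m[of j] by (simp add: face_def dface_def)
    next
      case 3
      then show ?thesis using j t[of "Suc j"] by (simp add: face_def dface_def)
    qed
  next
    case False
    then show ?thesis by (auto simp: dface_def)
  qed
  then show ?thesis unfolding so_tangent_def by blast
qed

text \<open>For \<open>s \<ge> 1\<close> the face operator multiplies two neighbours or drops the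
  last entry, so the partial products of the face are those of \<open>h\<close> with the one of
  index \<open>s\<close> left out.\<close>

lemma hprod_face:
  assumes "s \<ge> 1"
  shows "i \<le> r \<Longrightarrow> hprod (face (Suc r) s h) i = hprod h (skip s i)"
proof (induction i)
  case 0
  then show ?case using assms by (simp add: skip_def)
next
  case (Suc i)
  then have i: "Suc i \<in> {1..<Suc r}" by auto
  have f: "face (Suc r) s h (Suc i) = (if Suc i < s then h (Suc i) else if Suc i = s then h (Suc i) ** h (Suc (Suc i)) else h (Suc (Suc i)))"
    using i by (simp add: face_def)
  consider "Suc i < s" | "Suc i = s" | "s < Suc i" by linarith
  then show ?case
  proof cases
    case 1
    then show ?thesis using Suc by (simp add: f skip_def)
  next
    case 2
    then have s: "s = Suc i" by simp
    show ?thesis using Suc f unfolding s by (simp add: skip_def matrix_mul_assoc)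
  next
    case 3
    then show ?thesis using Suc by (simp add: f skip_def)
  qed
qed

lemma dk_face:
  assumes "s \<ge> 1"
  shows "i \<le> r \<Longrightarrow> dk (face (Suc r) s h) (dface (Suc r) s h z) i = dk h z (skip s i)"
proof (induction i)
  case 0
  then show ?case using assms by (simp add: skip_def)
next
  case (Suc i)
  then have i: "Suc i \<in> {1..<Suc r}" by auto
  have f: "face (Suc r) s h (Suc i) = (if Suc i < s then h (Suc i) else if Suc i = s then h (Suc i) ** h (Suc (Suc i)) else h (Suc (Suc i)))"
    using i by (simp add: face_def)
  have d: "dface (Suc r) s h z (Suc i) = (if Suc i < s then z (Suc i) else if Suc i = s then
      z (Suc i) ** h (Suc (Suc i)) + h (Suc i) ** z (Suc (Suc i)) else z (Suc (Suc i)))"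
    using i by (simp add: dface_def)
  have k: "hprod (face (Suc r) s h) i = hprod h (skip s i)" using Suc.prems hprod_face[OF assms, of i r h] by simp
  consider "Suc i < s" | "Suc i = s" | "s < Suc i" by linarith
  then show ?case
  proof cases
    case 1
    then show ?thesis using Suc by (simp add: k f d skip_def)
  next
    case 2
    then have s: "s = Suc i" by simp
    show ?thesis using Suc f d k unfolding s
      by (simp add: skip_def matrix_mul_assoc matrix_diff_distrib add.assoc)
  next
    case 3
    then show ?thesis using Suc by (simp add: k f d skip_def)
  qed
qed

lemma psi_face:
  "s \<ge> 1 \<Longrightarrow> i \<le> r \<Longrightarrow> psi i (face (Suc r) s h) (dface (Suc r) s h z) = psi (skip s i) h z"
  by (simp add: psi_def hprod_face dk_face)

lemma psi_zero [simp]: "psi 0 h z = 0"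
  by (simp add: psi_def matrix_diff_distrib)

text \<open>Dropping the first entry turns the partial products into \<open>h_1^-1 k_(i+1)\<close>.
  The forms then change by a common shift and a conjugation, neither of which the Pfaffian
  sees.\<close>

lemma psi_face_0:
  assumes h: "h \<in> SOT {1..Suc r}"
  shows "i \<le> r \<Longrightarrow> psi i (face (Suc r) 0 h) (dface (Suc r) 0 h z) =
    transpose (h 1) ** (psi (Suc i) h z - psi 1 h z) ** h 1"
proof -
  let ?f = "face (Suc r) 0 h" and ?z = "dface (Suc r) 0 h z"
  have h1: "h 1 \<in> SO" using h by (auto simp: SOT_def)
  have k: "hprod ?f i = transpose (h 1) ** hprod h (Suc i)" if "i \<le> r" for i
    using that
  proof (induction i)
    case 0
    then show ?case using SO_transpose(1)[OF h1] by simp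
  next
    case (Suc i)
    then have "?f (Suc i) = h (Suc (Suc i))" by (simp add: face_def)
    then show ?case using Suc by (simp add: matrix_mul_assoc)
  qed
  have dk: "dk ?f ?z i = transpose (h 1) ** (dk h z (Suc i) - z 1 ** transpose (h 1) ** hprod h (Suc i))" if "i \<le> r" for i
    using that
  proof (induction i)
    case 0
    have "z 1 ** transpose (h 1) ** h 1 = z 1" using SO_transpose(1)[OF h1] by (simp flip: matrix_mul_assoc)
    then show ?case by (simp add: matrix_diff_distrib)
  next
    case (Suc i)
    then have f: "?f (Suc i) = h (Suc (Suc i))" "?z (Suc i) = z (Suc (Suc i))" by (simp_all add: face_def dface_def)
    have "dk ?f ?z (Suc i) = transpose (h 1) ** (dk h z (Suc i) - z 1 ** transpose (h 1) ** hprod h (Suc i)) ** h (Suc (Suc i)) +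
        transpose (h 1) ** hprod h (Suc i) ** z (Suc (Suc i))"
      using Suc k[of i] by (simp only: dk.simps(2)[of ?f ?z i] f)
    then show ?case
      unfolding dk.simps(2)[of h z "Suc i"] hprod.simps(2)[of h "Suc i"]
      by (simp add: matrix_diff_distrib matrix_mul_assoc algebra_simps del: hprod.simps dk.simps)
  qed
  assume i: "i \<le> r"
  have kk: "hprod h (Suc i) ** transpose (hprod h (Suc i)) = mat 1"
    by (rule SO_transpose(2)[OF hprod_SO[OF h]]) (use i in simp)
  have p1: "psi 1 h z = z 1 ** transpose (h 1)" by (simp add: psi_def matrix_diff_distrib)
  have "psi i ?f ?z = transpose (h 1) ** (dk h z (Suc i) ** transpose (hprod h (Suc i)) -
      z 1 ** transpose (h 1) ** (hprod h (Suc i) ** transpose (hprod h (Suc i)))) ** h 1"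
    unfolding psi_def k[OF i] dk[OF i]
    by (simp add: matrix_transpose_mul matrix_diff_distrib matrix_mul_assoc del: hprod.simps dk.simps)
  also have "\<dots> = transpose (h 1) ** (psi (Suc i) h z - psi 1 h z) ** h 1"
    unfolding kk p1 psi_def[of "Suc i"] by simp
  finally show "psi i ?f ?z = transpose (h 1) ** (psi (Suc i) h z - psi 1 h z) ** h 1" .
qed

lemma strict_mono_skip: "strict_mono (skip s)"
  by (auto simp: strict_mono_def skip_def)

lemma skip_image: "j \<le> n \<Longrightarrow> skip j ` {..<n} = {..<Suc n} - {j}"
proof (rule subset_antisym; rule subsetI)
  fix x assume "j \<le> n" "x \<in> {..<Suc n} - {j}"
  then show "x \<in> skip j ` {..<n}"
    by (intro image_eqI[of _ _ "if x < j then x else x - 1"]) (auto simp: skip_def)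
qed (auto simp: skip_def split: if_splits)

text \<open>The index \<open>s\<close> drops out: its coordinate is 0 on the face, and the product
  of \<open>dt s\<close> and \<open>\<psi> s\<close> vanishes. In the applications it does so
  through the first factor for \<open>s \<ge> 1\<close> and through the second for
  \<open>s = 0\<close>.\<close>

lemma curv_skip:
  assumes s: "s \<le> Suc r" and z: "smul (dt s) (\<psi> s) = 0"
  shows "curv (Suc r) (coface s t) dt \<psi> = curv r t (\<lambda>i. dt (skip s i)) (\<lambda>i. \<psi> (skip s i))"
proof -
  have S: "(\<Sum>i\<le>Suc r. g i) = g s + (\<Sum>i\<le>r. g (skip s i))" for g :: "nat \<Rightarrow> grass^'n^'n"
  proof -
    have "(\<Sum>i\<le>Suc r. g i) = g s + (\<Sum>i\<in>{..Suc r} - {s}. g i)" using s by (intro sum.remove) auto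
    then show ?thesis unfolding sum.reindex_bij_betw[OF skip_bij[OF s], symmetric] .
  qed
  show ?thesis unfolding curv_def S z by simp
qed

lemma gc_sum_xi_mult:
  assumes "m \<le> Suc n"
  shows "gc ((\<Sum>j<m. xi j) * X) {..<Suc n} = (\<Sum>j<m. (-1) ^ j * gc X ({..<Suc n} - {j}))"
  unfolding sum_distrib_right gc_sum
proof (rule sum.cong[OF refl])
  fix j assume j: "j \<in> {..<m}"
  then have "{s \<in> {..<Suc n}. s < j} = {..<j}" using assms by auto
  then show "gc (xi j * X) {..<Suc n} = (-1) ^ j * gc X ({..<Suc n} - {j})"
    using j assms by (simp add: gc_xi_mult)
qed

text \<open>Under multiplication by \<open>\<eta>\<close> one may compute modulo
  \<open>\<eta>\<close>, because its square is 0 and the even factors \<open>x k\<close> can be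
  moved past it.\<close>

lemma eta_prod_cong:
  fixes \<eta> :: grass
  assumes "\<eta> * \<eta> = 0" "\<And>k. par (x k) = x k"
  shows "\<eta> * prod_list (map (\<lambda>k. x k + \<eta> * z k) ks) = \<eta> * prod_list (map x ks)"
proof (induction ks)
  case (Cons k ks)
  let ?P = "prod_list (map (\<lambda>k. x k + \<eta> * z k) ks)" and ?Q = "prod_list (map x ks)"
  have c: "x k * a = a * x k" for a by (rule even_commute[OF assms(2)])
  have "\<eta> * ((x k + \<eta> * z k) * ?P) = \<eta> * x k * ?P + \<eta> * \<eta> * z k * ?P" by (simp add: algebra_simps)
  also have "\<dots> = x k * (\<eta> * ?P)" by (simp add: assms(1) c mult.assoc)
  also have "\<dots> = x k * \<eta> * ?Q" unfolding Cons by (simp add: mult.assoc)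
  also have "\<dots> = \<eta> * (x k * ?Q)" unfolding c[of \<eta>] by (simp add: mult.assoc)
  finally show ?case by simp
qed simp

lemma eta_pfaffian_cong:
  assumes "\<eta> * \<eta> = 0" "mpar A = A"
  shows "\<eta> * pfaffian p e (A + smul \<eta> Z) = \<eta> * pfaffian p e A"
proof -
  have ev: "par (A $ a $ b) = A $ a $ b" for a b using assms(2) by (simp add: mpar_def vec_eq_iff)
  have "\<eta> * prod_list (map (\<lambda>k. (A + smul \<eta> Z) $ a k $ b k) ks) = \<eta> * prod_list (map (\<lambda>k. A $ a k $ b k) ks)"
    for a b :: "nat \<Rightarrow> 'a" and ks
    using eta_prod_cong[OF assms(1), of "\<lambda>k. A $ a k $ b k" "\<lambda>k. Z $ a k $ b k" ks] ev by (simp add: smul_def)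
  then show ?thesis
    unfolding pfaffian_def by (simp only: mult_scaleR_right sum_distrib_left)
qed

lemma pf_base_skip:
  "j \<le> 2 * p \<Longrightarrow> pf_base p e r x (\<lambda>i. v (skip j i)) = gc (pfaffian p e (base_curv r x v)) ({..<Suc (2 * p)} - {j})"
  using ten_gc_image[OF pform_ten[OF pform_pf_base] strict_mono_skip, of p e r x v j]
  by (simp add: pf_base_def skip_image)

lemma pf_base_zero: "i < 2 * p \<Longrightarrow> v i = 0 \<Longrightarrow> pf_base p e r x v = 0"
proof -
  assume i: "i < 2 * p" "v i = 0"
  then have "linear (\<lambda>u. pf_base p e r x (v(i := u)))" using pf_base_alternating[of p e r x] unfolding alternating_def by blast
  from linear_0[OF this] show ?thesis using i(2) by (metis fun_upd_triv)
qed

lemma dface_zero [simp]: "dface q i h 0 = 0"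
  by (simp add: dface_def fun_eq_iff matrix_diff_distrib)

lemma curv_cong_all:
  "(\<And>i. i \<le> r \<Longrightarrow> dt i = dt' i) \<Longrightarrow> (\<And>i. i \<le> r \<Longrightarrow> \<psi> i = \<psi>' i) \<Longrightarrow> curv r t dt \<psi> = curv r t dt' \<psi>'"
  by (simp add: curv_def)

text \<open>The omitted place \<open>s - 1\<close> is that of
  \<open>\<partial>/\<partial>t_s\<close>, the direction transversal to the face
  \<open>t s = 0\<close>. The remaining fields are those of the face after renumbering its
  vertices.\<close>

lemma pf_base_face:
  fixes h :: "'n::finite tuple"
  assumes s: "s \<in> {1..Suc r}"
  shows "pf_base p e (Suc r) (coface s t, h) (\<lambda>i. fibre_vec (Suc r) w (skip (s - 1) i)) =
    pf_base p e r (t, face (Suc r) s h) (fibre_vec r (\<lambda>j. dface (Suc r) s h (w j)))"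
proof -
  let ?u = "\<lambda>i. fibre_vec (Suc r) w (skip (s - 1) i)" and ?f = "face (Suc r) s h"
  let ?w = "\<lambda>j. dface (Suc r) s h (w j)"
  have u: "?u j = (if j < r then (simplex_vec (Suc (skip (s - 1) j)), 0) else (0, w (j - r)))" for j
    using s by (auto simp: fibre_vec_def skip_def)
  have "fst (?u j) s = 0" for j
    unfolding u using s by (auto simp: simplex_vec_def skip_def)
  then have z: "dtform ?u s = 0" by (simp add: dtform_def)
  have dt: "dtform ?u (skip s i) = dtform (fibre_vec r ?w) i" for i
  proof -
    have "fst (?u j) (skip s i) = fst (fibre_vec r ?w j) i" for j
      unfolding u using s by (auto simp: simplex_vec_def skip_def fibre_vec_def)
    then show ?thesis by (simp add: dtform_def)
  qed
  have P: "Psi (skip s i) (coface s t, h) ?u = Psi i (t, ?f) (fibre_vec r ?w)" if "i \<le> r" for i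
  proof -
    have "psi (skip s i) h (snd (?u j)) = psi i ?f (snd (fibre_vec r ?w j))" for j
    proof (cases "j < r")
      case True
      have "psi i ?f (dface (Suc r) s h 0) = psi (skip s i) h 0" by (rule psi_face) (use s that in auto)
      then show ?thesis unfolding u using True by (simp add: fibre_vec_def)
    next
      case False
      have "psi i ?f (dface (Suc r) s h (w (j - r))) = psi (skip s i) h (w (j - r))"
        by (rule psi_face) (use s that in auto)
      then show ?thesis unfolding u using False by (simp add: fibre_vec_def)
    qed
    then show ?thesis by (simp add: Psi_def)
  qed
  have "base_curv (Suc r) (coface s t, h) ?u =
      curv r t (\<lambda>i. dtform ?u (skip s i)) (\<lambda>i. Psi (skip s i) (coface s t, h) ?u)"
    unfolding base_curv_def fst_conv by (rule curv_skip) (use s in simp, simp only: z smul_simps)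
  also have "\<dots> = base_curv r (t, ?f) (fibre_vec r ?w)"
    unfolding base_curv_def fst_conv by (rule curv_cong_all[OF dt P])
  finally show ?thesis by (simp add: pf_base_def)
qed

text \<open>On the face \<open>t\<^sub>0 = 0\<close> all the fields \<open>\<partial>/\<partial>t\<^sub>j\<close> survive; the alternating sum over the omitted
  one is the coefficient of a product with \<open>\<eta> = dt\<^sub>1 + \<dots> + dt\<^bsub>r+1\<^esub>\<close>, which
  vanishes on that face.\<close>

lemma pf_base_face_0:
  fixes h :: "'n::finite tuple"
  assumes e: "bij_betw e {1..2 * p} (UNIV :: 'n set)" and p: "p \<ge> 1" and r: "r \<le> 2 * p"
    and h: "h \<in> SOT {1..Suc r}" and t: "(\<Sum>i\<le>r. t i) = 1"
  shows "(\<Sum>j<Suc r. (-1) ^ j * pf_base p e (Suc r) (coface 0 t, h) (\<lambda>i. fibre_vec (Suc r) w (skip j i))) =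
    pf_base p e r (t, face (Suc r) 0 h) (fibre_vec r (\<lambda>j. dface (Suc r) 0 h (w j)))"
proof -
  let ?v = "fibre_vec (Suc r) w" and ?f = "face (Suc r) 0 h" and ?x = "(coface 0 t, h)"
  let ?w = "\<lambda>j. dface (Suc r) 0 h (w j)" and ?h = "h 1"
  define \<eta> where "\<eta> = (\<Sum>j<Suc r. xi j)"
  \<comment> \<open>The vectors of the face with a zero in front: in the alternating sum over
    omitted arguments only the term that omits place 0 survives.\<close>
  define v' where "v' j = (if j = 0 then 0 else fibre_vec r ?w (j - 1))" for j
  define \<phi> where "\<phi> i = Psi (Suc i) ?x ?v" for i
  have \<eta>_lin: "\<eta> = lin (\<lambda>j. \<Sum>i<Suc r. of_bool (j = i))" by (simp only: \<eta>_def xi_def lin_sum)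
  have \<eta>2: "\<eta> * \<eta> = 0" unfolding \<eta>_lin by (rule lin_square)
  have h1: "?h \<in> SO" using h by (auto simp: SOT_def)
  have sk0: "skip 0 i = Suc i" for i by (simp add: skip_def)
  have dv: "dtform ?v (Suc i) = xi i" if "i \<le> r" for i
  proof -
    have "fst (?v j) (Suc i) = of_bool (j = i)" for j
      using that by (auto simp: fibre_vec_def simplex_vec_def)
    then show ?thesis by (simp add: dtform_def xi_def)
  qed
  have dv': "dtform v' i = (if i = 0 then xi 0 - \<eta> else xi i)" if "i \<le> r" for i
  proof (cases "i = 0")
    case True
    have c: "fst (v' j) 0 = of_bool (j = 0) - (\<Sum>i<Suc r. of_bool (j = i))" for j
    proof -
      have "(\<Sum>i<Suc r. of_bool (j = i)) = (of_bool (j < Suc r) :: real)"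
        by (subst sum.cong[OF refl, of _ _ "\<lambda>i. if i = j then 1 else 0"]) auto
      then show ?thesis by (auto simp: v'_def fibre_vec_def simplex_vec_def zero_prod_def)
    qed
    have "lin (\<lambda>j. of_bool (j = 0) - (\<Sum>i<Suc r. of_bool (j = i))) = xi 0 - \<eta>"
      using lin_add[of "\<lambda>j. of_bool (j = 0)" "\<lambda>j. - (\<Sum>i<Suc r. of_bool (j = i))"]
      unfolding lin_uminus \<eta>_lin[symmetric] xi_def[symmetric] by (simp only: diff_conv_add_uminus)
    then show ?thesis using True by (simp only: dtform_def c) simp
  next
    case False
    have "fst (v' j) i = of_bool (j = i)" for j
      using that False by (auto simp: v'_def fibre_vec_def simplex_vec_def zero_prod_def)
    then show ?thesis using False by (simp add: dtform_def xi_def)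
  qed
  have s0: "(\<Sum>i\<le>r. dtform v' i) = 0"
  proof -
    have "(\<Sum>i\<le>r. dtform v' i) = (\<Sum>i\<le>r. xi i - (if i = 0 then \<eta> else 0))"
      by (intro sum.cong refl) (simp add: dv')
    then show ?thesis by (simp add: sum_subtractf \<eta>_def lessThan_Suc_atMost)
  qed
  have Psi0: "Psi 0 ?x ?v = 0" by (simp add: Psi_def)
  have A: "base_curv (Suc r) ?x ?v = curv r t (\<lambda>i. xi i) \<phi>"
  proof -
    have "base_curv (Suc r) ?x ?v = curv r t (\<lambda>i. dtform ?v (skip 0 i)) (\<lambda>i. Psi (skip 0 i) ?x ?v)"
      unfolding base_curv_def fst_conv by (rule curv_skip) (auto simp: Psi0 smul_simps)
    also have "\<dots> = curv r t (\<lambda>i. xi i) \<phi>"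
      unfolding sk0 by (rule curv_cong_all) (auto simp: dv \<phi>_def)
    finally show ?thesis .
  qed
  \<comment> \<open>For the vectors of the face \<open>dt_0\<close> equals
    \<open>xi 0 - \<eta>\<close>, so the two matrices differ by a multiple of \<open>\<eta>\<close>
    and multiplication by \<open>\<eta>\<close> removes the difference.\<close>
  have B: "curv r t (\<lambda>i. xi i) \<phi> = curv r t (dtform v') \<phi> + smul \<eta> (- \<phi> 0)"
  proof -
    have "(\<Sum>i\<le>r. smul (xi i) (\<phi> i)) = (\<Sum>i\<le>r. smul (dtform v' i) (\<phi> i) + (if i = 0 then smul \<eta> (\<phi> 0) else 0))"
    proof (rule sum.cong[OF refl])
      fix i assume "i \<in> {..r}"
      then have "xi i = dtform v' i + (if i = 0 then \<eta> else 0)" by (simp add: dv')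
      then show "smul (xi i) (\<phi> i) = smul (dtform v' i) (\<phi> i) + (if i = 0 then smul \<eta> (\<phi> 0) else 0)"
        by (auto simp: smul_simps)
    qed
    also have "\<dots> = (\<Sum>i\<le>r. smul (dtform v' i) (\<phi> i)) + smul \<eta> (\<phi> 0)"
      unfolding sum.distrib by simp
    finally show ?thesis by (simp add: curv_def smul_simps)
  qed
  have \<phi>: "\<phi> i = mre ?h ** Psi i (t, ?f) v' ** mre (transpose ?h) + \<phi> 0" if "i \<le> r" for i
  proof -
    have sv: "snd (v' j) = dface (Suc r) 0 h (snd (?v j))" for j
      by (auto simp: v'_def fibre_vec_def)
    have "psi (Suc i) h z = ?h ** psi i ?f (dface (Suc r) 0 h z) ** transpose ?h + psi (Suc 0) h z" for z
    proof -
      have "?h ** (transpose ?h ** (psi (Suc i) h z - psi 1 h z) ** ?h) ** transpose ?h = psi (Suc i) h z - psi 1 h z"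
        using SO_transpose(2)[OF h1] by (simp add: matrix_mul_assoc) (simp flip: matrix_mul_assoc)
      then show ?thesis unfolding psi_face_0[OF h that] by simp
    qed
    then have "\<phi> i = mlin (\<lambda>j. ?h ** psi i ?f (snd (v' j)) ** transpose ?h + psi (Suc 0) h (snd (?v j)))"
      unfolding \<phi>_def Psi_def snd_conv sv by presburger
    then show ?thesis
      by (simp add: mlin_add Psi_def[of i] \<phi>_def[of 0] Psi_def[of "Suc 0"] mlin_mult_left mlin_mult_right)
  qed
  have C: "pfaffian p e (curv r t (dtform v') \<phi>) = pfaffian p e (base_curv r (t, ?f) v')"
  proof -
    have "curv r t (dtform v') \<phi> = curv r t (dtform v') (\<lambda>i. mre ?h ** Psi i (t, ?f) v' ** mre (transpose ?h) + \<phi> 0)"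
      by (rule curv_cong) (rule \<phi>)
    also have "\<dots> = mre ?h ** base_curv r (t, ?f) v' ** mre (transpose ?h)"
      unfolding curv_shift[OF t s0] curv_conj[OF SO_transpose(1)[OF h1]] base_curv_def fst_conv ..
    finally show ?thesis by (simp only: pfaffian_conj[OF e h1])
  qed
  have ev: "mpar (curv r t (dtform v') \<phi>) = curv r t (dtform v') \<phi>"
    unfolding \<phi>_def by (rule mpar_curv) (rule mpar_Psi)
  have "(\<Sum>j<Suc r. (-1) ^ j * pf_base p e (Suc r) ?x (\<lambda>i. ?v (skip j i))) =
      gc (\<eta> * pfaffian p e (base_curv (Suc r) ?x ?v)) {..<Suc (2 * p)}"
    unfolding \<eta>_def by (subst gc_sum_xi_mult) (use r in \<open>auto simp: pf_base_skip intro!: sum.cong\<close>)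
  also have "\<eta> * pfaffian p e (base_curv (Suc r) ?x ?v) = \<eta> * pfaffian p e (base_curv r (t, ?f) v')"
    unfolding A B eta_pfaffian_cong[OF \<eta>2 ev] C ..
  also have "gc (\<eta> * pfaffian p e (base_curv r (t, ?f) v')) {..<Suc (2 * p)} =
      (\<Sum>j<Suc r. (-1) ^ j * pf_base p e r (t, ?f) (\<lambda>i. v' (skip j i)))"
    unfolding \<eta>_def by (subst gc_sum_xi_mult) (use r in \<open>auto simp: pf_base_skip intro!: sum.cong\<close>)
  also have "\<dots> = (\<Sum>j<Suc r. if j = 0 then pf_base p e r (t, ?f) (fibre_vec r ?w) else 0)"
  proof (rule sum.cong[OF refl])
    fix j
    show "(-1) ^ j * pf_base p e r (t, ?f) (\<lambda>i. v' (skip j i)) = (if j = 0 then pf_base p e r (t, ?f) (fibre_vec r ?w) else 0)"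
    proof (cases "j = 0")
      case True
      then show ?thesis by (simp add: sk0 v'_def)
    next
      case False
      have "pf_base p e r (t, ?f) (\<lambda>i. v' (skip j i)) = 0"
        by (rule pf_base_zero[of 0]) (use p False in \<open>auto simp: skip_def v'_def\<close>)
      then show ?thesis using False by simp
    qed
  qed
  finally show ?thesis by simp
qed

text \<open>The integral over the simplex of the vanishing exterior derivative of the Pfaffian form,
  sorted by the direction of differentiation. The places below \<open>r\<close> are directions of
  the simplex and yield boundary terms, the others yield the exterior derivative on NG(r).\<close>

lemma integral_closed:
  fixes h :: "'n::finite tuple"
  assumes e: "bij_betw e {1..2 * p} (UNIV :: 'n set)" and h: "h \<in> SOT {1..r}"
    and w: "\<And>j. w j \<in> so_tangent {1..r} h"
  shows "(\<Sum>j\<le>2 * p. (-1) ^ j * simplex_integral r (\<lambda>t.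
    dir_deriv (\<lambda>y. pf_base p e r y (\<lambda>i. fibre_vec r w (skip j i))) (fibre_vec r w j) (t, h))) = 0"
proof -
  let ?v = "fibre_vec r w"
  let ?D = "\<lambda>j t. (-1) ^ j * dir_deriv (\<lambda>y. pf_base p e r y (\<lambda>i. ?v (skip j i))) (?v j) (t, h)"
  have sk: "(\<lambda>i. if i < j then ?v i else ?v (Suc i)) = (\<lambda>i. ?v (skip j i))" for j
    by (auto simp: skip_def)
  have zero: "(\<Sum>j\<le>2 * p. ?D j t) = 0" for t
  proof -
    have "snd (?v j) \<in> so_tangent {1..r} (snd (t, h))" for j
      using w zero_so_tangent by (auto simp: fibre_vec_def)
    then have "hasd (t, h) ?v (\<lambda>y. pfaffian p e (base_curv r y ?v)) 0" using h by (intro hasd_pf_base[OF e]) auto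
    from hasd_gc[OF pform_pf_base this] show ?thesis unfolding sk pf_base_def[symmetric] by simp
  qed
  have int: "simplex_integrable r (?D j)" for j
    by (rule simplex_integrable_scale[OF polyfun_simplex_integral(1)[OF polyfun_dir_deriv[OF polyfun_pf_base]]])
  have "(\<Sum>j\<le>2 * p. simplex_integral r (?D j)) = simplex_integral r (\<lambda>t. \<Sum>j\<le>2 * p. ?D j t)"
    by (rule conjunct2[OF simplex_integral_sum, symmetric]) (auto intro: int)
  then show ?thesis unfolding zero simplex_integral_scale by simp
qed

text \<open>Place \<open>r + i\<close> holds \<open>w i\<close>. Its sign \<open>(-1)^(r+i)\<close>
  splits into the sign of the exterior derivative on NG(r) and the factor \<open>(-1)^r\<close> of
  \<open>d''\<close>; differentiation under the integral sign does the rest.\<close>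

lemma integral_tail:
  assumes "r \<le> 2 * p"
  shows "(\<Sum>j\<in>{r..2 * p}. (-1) ^ j * simplex_integral r (\<lambda>t.
    dir_deriv (\<lambda>y. pf_base p e r y (\<lambda>i. fibre_vec r w (skip j i))) (fibre_vec r w j) (t, h))) =
    (-1) ^ r * flat_ext_deriv (2 * p - r) (euler_rep p e r) h w"
proof -
  have bij: "bij_betw (\<lambda>i. r + i) {..2 * p - r} {r..2 * p}"
    by (rule bij_betw_byWitness[of _ "\<lambda>j. j - r"]) (use assms in auto)
  have "simplex_integral r (\<lambda>t. dir_deriv (\<lambda>y. pf_base p e r y (\<lambda>k. fibre_vec r w (skip (r + i) k))) (fibre_vec r w (r + i)) (t, h)) =
      dir_deriv (\<lambda>y. euler_rep p e r y (\<lambda>j. if j < i then w j else w (Suc j))) (w i) h" for i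
  proof -
    have "fibre_vec r w (skip (r + i) k) = fibre_vec r (\<lambda>j. if j < i then w j else w (Suc j)) k" for k
      by (auto simp: fibre_vec_def skip_def Suc_diff_le)
    moreover have "fibre_vec r w (r + i) = (0, w i)" by (simp add: fibre_vec_def)
    ultimately show ?thesis unfolding euler_rep_eq by (simp only: polyfun_simplex_integral(3)[OF polyfun_pf_base])
  qed
  then show ?thesis
    unfolding sum.reindex_bij_betw[OF bij, symmetric] flat_ext_deriv_def
    by (simp add: power_add sum_distrib_left mult.assoc)
qed

lemma euler_rep_closed_0:
  fixes h :: "'n::finite tuple"
  assumes "bij_betw e {1..2 * p} (UNIV :: 'n set)" "h \<in> SOT {1..0}" "\<And>j. w j \<in> so_tangent {1..0} h"
  shows "flat_ext_deriv (2 * p) (euler_rep p e 0) h w = 0"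
  using integral_closed[OF assms] integral_tail[of 0 p e w h] by (simp add: atLeast0AtMost)

text \<open>Stokes' theorem in the direction of \<open>t_(j+1)\<close> yields the face
  \<open>j + 1\<close> with its sign in \<open>d'\<close>, together with a term on the face
  \<open>t_0 = 0\<close>. These terms add up over \<open>j\<close> to the face 0 by
  \<open>pf_base_face_0\<close>. For \<open>r = 2p\<close> no group direction is left and
  \<open>d''\<close> does not occur.\<close>

lemma euler_rep_closed_Suc:
  fixes h :: "'n::finite tuple"
  assumes e: "bij_betw e {1..2 * p} (UNIV :: 'n set)" and p: "p \<ge> 1" and r: "r \<le> 2 * p"
    and h: "h \<in> SOT {1..Suc r}" and w: "\<And>j. w j \<in> so_tangent {1..Suc r} h"
  shows "(\<Sum>i\<le>Suc r. (-1) ^ i * euler_rep p e r (face (Suc r) i h) (\<lambda>j. dface (Suc r) i h (w j))) +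
    (if Suc r \<le> 2 * p then (-1) ^ Suc r * flat_ext_deriv (2 * p - Suc r) (euler_rep p e (Suc r)) h w else 0) = 0"
proof -
  let ?v = "fibre_vec (Suc r) w"
  let ?F = "\<lambda>j y. pf_base p e (Suc r) y (\<lambda>i. ?v (skip j i))"
  let ?D = "\<lambda>j. (-1) ^ j * simplex_integral (Suc r) (\<lambda>t. dir_deriv (?F j) (?v j) (t, h))"
  let ?E = "\<lambda>i. euler_rep p e r (face (Suc r) i h) (\<lambda>j. dface (Suc r) i h (w j))"
  let ?I = "\<lambda>j i. simplex_integral r (\<lambda>t. ?F j (coface i t, h))"
  have D: "?D j = (-1) ^ j * ?I j 0 + (-1) ^ Suc j * ?E (Suc j)" if "j < Suc r" for j
  proof -
    have "?v j = (simplex_vec (Suc j), 0)" using that by (simp add: fibre_vec_def)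
    then have "simplex_integral (Suc r) (\<lambda>t. dir_deriv (?F j) (?v j) (t, h)) = ?I j 0 - ?I j (Suc j)"
      using polyfun_stokes(1)[OF polyfun_pf_base, of "Suc j" r p e "Suc r" "\<lambda>i. ?v (skip j i)" h] that by simp
    also have "?I j (Suc j) = ?E (Suc j)"
      using pf_base_face[of "Suc j" r p e _ h w] that by (simp add: euler_rep_eq)
    finally have S: "simplex_integral (Suc r) (\<lambda>t. dir_deriv (?F j) (?v j) (t, h)) = ?I j 0 - ?E (Suc j)" .
    show ?thesis unfolding S by (simp add: algebra_simps)
  qed
  have E0: "(\<Sum>j<Suc r. (-1) ^ j * ?I j 0) = ?E 0"
  proof -
    have "simplex_integrable r (\<lambda>t. (-1) ^ j * ?F j (coface 0 t, h))" for j
      by (rule simplex_integrable_scale[OF polyfun_stokes(2)[OF polyfun_pf_base, of 1]]) auto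
    then have "(\<Sum>j<Suc r. simplex_integral r (\<lambda>t. (-1) ^ j * ?F j (coface 0 t, h))) =
        simplex_integral r (\<lambda>t. \<Sum>j<Suc r. (-1) ^ j * ?F j (coface 0 t, h))"
      by (intro conjunct2[OF simplex_integral_sum, symmetric]) auto
    also have "\<dots> = ?E 0"
      unfolding euler_rep_eq by (rule simplex_integral_cong) (rule pf_base_face_0[OF e p r h], simp add: standard_simplex_def)
    finally show ?thesis unfolding simplex_integral_scale .
  qed
  have "(\<Sum>j<Suc r. ?D j) = (\<Sum>j<Suc r. (-1) ^ j * ?I j 0) + (\<Sum>j<Suc r. (-1) ^ Suc j * ?E (Suc j))"
    unfolding sum.distrib[symmetric] by (rule sum.cong) (auto simp: D simp del: power_Suc)
  also have "\<dots> = (\<Sum>i\<le>Suc r. (-1) ^ i * ?E i)"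
    unfolding E0 sum.atMost_Suc_shift by (simp only: lessThan_Suc_atMost power_0 mult_1)
  finally have head: "(\<Sum>j<Suc r. ?D j) = (\<Sum>i\<le>Suc r. (-1) ^ i * ?E i)" .
  have all: "(\<Sum>j\<le>2 * p. ?D j) = 0" by (rule integral_closed[OF e h w])
  show ?thesis
  proof (cases "Suc r \<le> 2 * p")
    case True
    have "{..2 * p} = {..<Suc r} \<union> {Suc r..2 * p}" "{..<Suc r} \<inter> {Suc r..2 * p} = {}" using True by auto
    then have "(\<Sum>j\<le>2 * p. ?D j) = (\<Sum>j<Suc r. ?D j) + (\<Sum>j\<in>{Suc r..2 * p}. ?D j)"
      by (simp only: sum.union_disjoint finite_lessThan finite_atLeastAtMost)
    then show ?thesis using True all head integral_tail[OF True, of e w h] by simp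
  next
    case False
    then have "r = 2 * p" using r by simp
    then have "{..2 * p} = {..<Suc r}" by auto
    then show ?thesis using all head False by simp
  qed
qed

text \<open>Equality as families of forms. Being a cocycle and the cohomology class depend on a
  cochain only through these values.\<close>

definition on_tangents_eq :: "nat \<Rightarrow> 'n::finite cochain \<Rightarrow> 'n cochain \<Rightarrow> bool" where
  "on_tangents_eq n c c' \<longleftrightarrow> (\<forall>r\<le>n. \<forall>h\<in>SOT {1..r}. \<forall>w. (\<forall>i<n - r. w i \<in> so_tangent {1..r} h) \<longrightarrow> c r h w = c' r h w)"

lemma on_tangents_eqD:
  "on_tangents_eq n c c' \<Longrightarrow> r \<le> n \<Longrightarrow> h \<in> SOT {1..r} \<Longrightarrow> (\<And>i. i < n - r \<Longrightarrow> w i \<in> so_tangent {1..r} h) \<Longrightarrow>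
    c r h w = c' r h w"
  by (simp add: on_tangents_eq_def)

lemma d'_apply: "d' r \<omega> h w = (\<Sum>i\<le>Suc r. (-1) ^ i * \<omega> (face (Suc r) i h) (\<lambda>j. dface (Suc r) i h (w j)))"
  by (simp only: d'_def sum_fun_apply scaleR_fun_apply real_scaleR_def pullback_def pushforward_face Suc_eq_plus1)

lemma cochain_extends:
  fixes c :: "'n::finite cochain"
  assumes "on_tangents_eq (2 * p) c (euler_rep p e)" "r \<le> 2 * p"
  shows "extends_on (NG r) (2 * p - r) (c r) UNIV (euler_rep p e r)"
  unfolding NG_eq by (rule euler_rep_extends[OF assms(2)]) (rule on_tangents_eqD[OF assms])

lemma total_cocycle_euler_rep:
  fixes c :: "'n::finite cochain"
  assumes e: "bij_betw e {1..2 * p} (UNIV :: 'n set)" and p: "p \<ge> 1"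
    and c: "on_tangents_eq (2 * p) c (euler_rep p e)"
  shows "total_cocycle (2 * p) c"
  unfolding total_cocycle_def
proof (intro conjI allI impI)
  show "total_cochain (2 * p) c"
    unfolding total_cochain_def smooth_form_def using cochain_extends[OF c] by blast
  fix r assume r: "r \<le> 2 * p + 1"
  show "form_eq (NG r) (2 * p + 1 - r) (total_d (2 * p) c r) 0"
    unfolding form_eq_def
  proof (intro ballI allI impI)
    fix h :: "'n tuple" and w assume "h \<in> NG r" and "\<forall>i<2 * p + 1 - r. w i \<in> tangent_space (NG r) h"
    then have h: "h \<in> SOT {1..r}" and w: "\<And>i. i < 2 * p + 1 - r \<Longrightarrow> w i \<in> so_tangent {1..r} h"
      by (auto simp: NG_eq tangent_space_SOT)
    define w' where "w' i = (if i < 2 * p + 1 - r then w i else 0)" for i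
    have w': "w' i \<in> so_tangent {1..r} h" for i using w zero_so_tangent[of "{1..r}" h] by (simp add: w'_def)
    have d: "d'' r (2 * p - r) (c r) h w = (-1) ^ r * flat_ext_deriv (2 * p - r) (euler_rep p e r) h w'" if "r \<le> 2 * p"
    proof -
      have "ext_deriv (SOT {1..r}) (2 * p - r) (c r) h w = flat_ext_deriv (2 * p - r) (euler_rep p e r) h w"
        by (rule ext_deriv_SOT[OF _ cochain_extends[OF c that, unfolded NG_eq] h]) (use w that in auto)
      also have "\<dots> = flat_ext_deriv (2 * p - r) (euler_rep p e r) h w'"
        unfolding flat_ext_deriv_def
      proof (rule sum.cong[OF refl])
        fix i assume i: "i \<in> {..2 * p - r}"
        have "euler_rep p e r y (\<lambda>j. if j < i then w j else w (Suc j)) = euler_rep p e r y (\<lambda>j. if j < i then w' j else w' (Suc j))" for y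
          by (rule alternating_cong[OF euler_rep_alternating[OF that]]) (use that in \<open>auto simp: w'_def\<close>)
        moreover have "w i = w' i" using i that by (auto simp: w'_def)
        ultimately show "(-1) ^ i * dir_deriv (\<lambda>y. euler_rep p e r y (\<lambda>j. if j < i then w j else w (Suc j))) (w i) h =
            (-1) ^ i * dir_deriv (\<lambda>y. euler_rep p e r y (\<lambda>j. if j < i then w' j else w' (Suc j))) (w' i) h" by simp
      qed
      finally show ?thesis by (simp add: d''_def NG_eq)
    qed
    show "total_d (2 * p) c r h w = 0 h w"
    proof (cases r)
      case 0
      have "flat_ext_deriv (2 * p) (euler_rep p e 0) h w' = 0"
        by (rule euler_rep_closed_0[OF e]) (use h w' 0 in auto)
      then show ?thesis using d 0 by (simp add: total_d_def)
    next
      case (Suc k)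
      have k: "k \<le> 2 * p" using r Suc by simp
      have "d' k (c k) h w = (\<Sum>i\<le>Suc k. (-1) ^ i * euler_rep p e k (face (Suc k) i h) (\<lambda>j. dface (Suc k) i h (w' j)))"
        unfolding d'_apply
      proof (rule sum.cong[OF refl])
        fix i
        have t: "dface (Suc k) i h (w j) \<in> so_tangent {1..k} (face (Suc k) i h)" if "j < 2 * p - k" for j
          using dface_tangent[OF h[unfolded Suc] w[unfolded Suc]] that by simp
        have "c k (face (Suc k) i h) (\<lambda>j. dface (Suc k) i h (w j)) = euler_rep p e k (face (Suc k) i h) (\<lambda>j. dface (Suc k) i h (w j))"
          by (rule on_tangents_eqD[OF c k face_SOT[OF h[unfolded Suc]] t])
        also have "\<dots> = euler_rep p e k (face (Suc k) i h) (\<lambda>j. dface (Suc k) i h (w' j))"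
          by (rule alternating_cong[OF euler_rep_alternating[OF k]]) (simp add: w'_def Suc)
        finally show "(-1) ^ i * c k (face (Suc k) i h) (\<lambda>j. dface (Suc k) i h (w j)) =
            (-1) ^ i * euler_rep p e k (face (Suc k) i h) (\<lambda>j. dface (Suc k) i h (w' j))" by simp
      qed
      then show ?thesis
        using euler_rep_closed_Suc[OF e p k h[unfolded Suc] w'[unfolded Suc]] d Suc
        by (auto simp: total_d_def)
    qed
  qed
qed

lemma extends_on_zero: "extends_on M s 0 UNIV (0 :: 'a::{real_vector,t2_space} form)"
  using pform_extends_on[OF pform.zero[of s], where M = M and \<omega> = 0] by (simp add: zero_fun_def)

lemma smooth_form_zero: "smooth_form M s 0"
  unfolding smooth_form_def using extends_on_zero by blast

lemma same_class_of_euler_rep: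
  fixes c c' :: "'n::finite cochain"
  assumes e: "bij_betw e {1..2 * p} (UNIV :: 'n set)" and p: "p \<ge> 1"
    and c: "on_tangents_eq (2 * p) c (euler_rep p e)" and c': "on_tangents_eq (2 * p) c' (euler_rep p e)"
  shows "same_class (2 * p) c c'"
  unfolding same_class_def
\<comment> \<open>The two cochains agree as forms, so the cochain 0 serves as the primitive of their
  difference.\<close>
proof (intro conjI exI[of _ 0] allI impI)
  show "total_cocycle (2 * p) c" "total_cocycle (2 * p) c'"
    by (rule total_cocycle_euler_rep[OF e p c], rule total_cocycle_euler_rep[OF e p c'])
  show "total_cochain (2 * p - 1) (0 :: 'n cochain)"
    by (simp add: total_cochain_def smooth_form_zero)
  fix r assume r: "r \<le> 2 * p"
  show "form_eq (NG r) (2 * p - r) (c r - c' r) (total_d (2 * p - 1) 0 r)"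
    unfolding form_eq_def
  proof (intro ballI allI impI)
    fix h :: "'n tuple" and w assume "h \<in> NG r" and "\<forall>i<2 * p - r. w i \<in> tangent_space (NG r) h"
    then have h: "h \<in> SOT {1..r}" and w: "\<And>i. i < 2 * p - r \<Longrightarrow> w i \<in> so_tangent {1..r} h"
      by (auto simp: NG_eq tangent_space_SOT)
    have "d' k 0 h w = 0" for k by (simp add: d'_apply)
    moreover have "d'' r (2 * p - 1 - r) 0 h w = 0" if "r \<le> 2 * p - 1"
    proof -
      have "ext_deriv (SOT {1..r}) (2 * p - 1 - r) 0 h w = flat_ext_deriv (2 * p - 1 - r) 0 h w"
        by (rule ext_deriv_SOT[OF _ extends_on_zero h]) (use w that p in auto)
      then show ?thesis by (simp add: d''_def NG_eq flat_ext_deriv_def dir_deriv_def)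
    qed
    ultimately have "total_d (2 * p - 1) 0 r h w = 0" by (simp add: total_d_def)
    moreover have "c r h w = euler_rep p e r h w" "c' r h w = euler_rep p e r h w"
      by (rule on_tangents_eqD[OF c r h w], assumption, rule on_tangents_eqD[OF c' r h w])
    ultimately show "(c r - c' r) h w = total_d (2 * p - 1) 0 r h w" by simp
  qed
qed

theorem theorem3p3:
  fixes p :: nat and e :: "nat \<Rightarrow> 'n::finite" and c :: "'n cochain"
  assumes "p \<ge> 1"
    and "bij_betw e {1..2 * p} (UNIV :: 'n set)"
    and "c = (\<Sum>q<p. in_component (p - q) (mu p e q))"
  shows "(\<forall>q<p. smooth_form (NG (p - q)) (p + q) (mu p e q)) \<and>
    total_cocycle (2 * p) c \<and>
    represents_euler_class p e c \<and>
    (\<forall>q<p. c (p - q) = mu p e q)"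
proof -
  have c: "c r = (\<Sum>q<p. if r = p - q then mu p e q else 0)" for r
    unfolding assms(3) sum_fun_apply in_component_def ..
  have cmu: "c (p - q) = mu p e q" if "q < p" for q
  proof -
    have "c (p - q) = (\<Sum>q'<p. if q' = q then mu p e q else 0)"
      unfolding c by (rule sum.cong) (use that in auto)
    then show ?thesis using that by simp
  qed
  have cz: "c r = 0" if "r = 0 \<or> p < r" for r
    unfolding c by (rule sum.neutral) (use that in auto)
  \<comment> \<open>All components of total degree \<open>2 * p\<close> have to be compared. Outside
    1, ..., \<open>p\<close> the left side is 0 by definition and the right side is 0 for want of
    words.\<close>
  have cE: "c r h w = euler_rep p e r h w" if "r \<le> 2 * p" "h \<in> SOT {1..r}" for r h w
  proof (cases "r = 0 \<or> p < r")
    case True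
    then show ?thesis using cz[OF True] euler_rep_zero[OF that(2,1) assms(1) True] by simp
  next
    case False
    then have "p - r < p" "p - (p - r) = r" by auto
    then show ?thesis using cmu[of "p - r"] mu_eq_euler_rep[of "p - r" p h e w] that by simp
  qed
  then have C: "on_tangents_eq (2 * p) c (euler_rep p e)" by (simp add: on_tangents_eq_def)
  have "on_tangents_eq (2 * p) (euler_cocycle p e) (euler_rep p e)"
    unfolding on_tangents_eq_def using euler_cocycle_eq[OF assms(2)] by blast
  then have "represents_euler_class p e c"
    unfolding represents_euler_class_def by (rule same_class_of_euler_rep[OF assms(2,1) C])
  moreover have "smooth_form (NG (p - q)) (p + q) (mu p e q)" if "q < p" for q
  proof -
    have "2 * p - (p - q) = p + q" "p - q \<le> 2 * p" using that by auto
    then show ?thesis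
      using cochain_extends[OF C, of "p - q"] unfolding smooth_form_def cmu[OF that] by auto
  qed
  ultimately show ?thesis using total_cocycle_euler_rep[OF assms(2,1) C] cmu by blast
qed

end
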